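(* Consider the high-dimensional linear model with unlabeled data described in the context: $p/n\to\kappa\in(0,\infty)$, $\theta^\top\Sigma_Z\theta\to v_Z^2$, $\limsup_n\xi^\top\Sigma_Z\xi<\infty$, $\sigma^2$ constant, $\beta=h/\sqrt n$ with $h>0$ constant, where $\xi$ and $\mathrm{Var}(X\mid Z)$ are unknown to the test but $\mathrm{Var}(X\mid Z)$ is fixed to be $1$, and where there are $m$ additional unlabeled data points $(X_i,Z_i)_{i=n+1}^{n+m}$, $n_*=n+m$, $n/n_*\to\kappa_*$ and $\kappa\kappa_*<1$. Then the asymptotic power of the conditional CRT with statistic $T_{\mathrm{MC}}=n^{-1}\mathbf Y^\top\mathbf X$ is lower-bounded (the $\liminf$ of its power is lower-bounded) by that of a $z$-test with standardized effect size $$\frac{h\sqrt{1-\kappa\kappa_*}}{\sqrt{\sigma^2+v_Z^2\,\frac{1}{1-\kappa\kappa_*}}}$$ and upper-bounded (the $\limsup$ of its power is upper-bounded) by that of a $z$-test with standardized effect size $$\frac{h\sqrt{1-\kappa\kappa_*}}{\sqrt{\sigma^2+v_Z^2\max\left(0,\ \frac{1-\frac{(1+\sqrt{1/\kappa})^2}{(1-\sqrt{\kappa\kappa_*})^2}\,\kappa\kappa_*}{1-\kappa\kappa_*}\right)}} .$$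
   Context: **Model.** For each $n$ let $p=p_n$, $m=m_n$, $n_*=n+m$, and let $\theta,\xi\in\mathbb R^{p-1}$ and the positive definite covariance matrix $\Sigma_Z$ be deterministic (they may depend on $n$), $\sigma^2>0$. The pairs $(X_i,Z_i)$, $i=1,\dots,n_*$, are i.i.d. with $Z_i\sim\mathcal N(0,\Sigma_Z)$ in $\mathbb R^{p-1}$ and $X_i\mid Z_i\sim\mathcal N(Z_i^\top\xi,1)$. Let $\mathbf X_*\in\mathbb R^{n_*}$ and $\mathbf Z_*\in\mathbb R^{n_*\times(p-1)}$ collect all $n_*$ samples, and $\mathbf X,\mathbf Z$ their first $n$ rows (the labeled samples). The response is $\mathbf Y=\mathbf X\beta+\mathbf Z\theta+\varepsilon\in\mathbb R^n$ with $\varepsilon\sim\mathcal N(0,\sigma^2I_n)$ independent of $(\mathbf X_*,\mathbf Z_* )$. As $n\to\infty$: $p/n\to\kappa\in(0,\infty)$, $m/p$ converges to a positive constant, $n/n_*\to\kappa_*$, $\theta^\top\Sigma_Z\theta\to v_Z^2$, $\limsup\xi^\top\Sigma_Z\xi<\infty$, and $\sigma^2$ and $\sqrt n\beta=h>0$ stay constant. **Conditional CRT.** It assumes only that $X\mid Z$ follows a Gaussian linear model with unknown coefficient and unknown variance, and conditions on the sufficient statistic based on all labeled and unlabeled samples. Let $H=\mathbf Z_*(\mathbf Z_*^\top\mathbf Z_* )^{-1}\mathbf Z_*^\top$, and condition on $\mathcal S=(\mathbf Z_*,\mathbf Y,H\mathbf X_*,\|(I_{n_*}-H)\mathbf X_*\|)$.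 Given $\mathcal S$, let $\tilde{\mathbf X}_*=H\mathbf X_*+\|(I_{n_*}-H)\mathbf X_*\|\,\tilde V$, where $\tilde V$ is uniformly distributed on the unit sphere of the range of $I_{n_*}-H$; this is the conditional law of $\mathbf X_*$ given $\mathcal S$ under the null $X\perp Y\mid Z$. Let $\tilde{\mathbf X}$ be the first $n$ coordinates of $\tilde{\mathbf X}_*$. The level-$\alpha$ one-sided conditional CRT with $T_{\mathrm{MC}}$ rejects when $n^{-1}\mathbf Y^\top\mathbf X$ is at least the $(1-\alpha)$-quantile of the conditional law of $n^{-1}\mathbf Y^\top\tilde{\mathbf X}$ given $\mathcal S$; the two-sided version uses $|T_{\mathrm{MC}}|$ in place of $T_{\mathrm{MC}}$. **$z$-test power.** Power is the unconditional rejection probability under $\beta=h/\sqrt n$. The power of a $z$-test with standardized effect size $\mu$ at level $\alpha\in(0,1)$ is $\Phi(\mu-z_{1-\alpha})$ (for comparison with the one-sided CRT) and $\Phi(\mu-z_{1-\alpha/2})+\Phi(-\mu-z_{1-\alpha/2})$ (for comparison with the two-sided CRT), where $\Phi$ is the CDF of $\mathcal N(0,1)$ and $\Phi(z_a)=a$.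
   Formalization: Only the one-sided conditional CRT is treated; the two-sided comparison with |T_MC| is left out because it is false: for p=n, n/n_*→0.81, θ=ξ=0, σ=1, h=5, α=0.05 its power tends to about 0.70, above the bound 0.59. *)

theory Defs
  imports
    "HOL-Probability.Probability"
    "Jordan_Normal_Form.Gauss_Jordan_Elimination"
    "Jordan_Normal_Form.Determinant"
begin

text \<open>
  All dimensions vary with the sample size, so deterministic vectors and matrices are
  \<^typ>\<open>real Matrix.vec\<close> and \<^typ>\<open>real Matrix.mat\<close>, while measures on real \<open>k\<close>-space live on
  \<open>\<Pi>\<^sub>M i\<in>{..<k}. borel\<close>. Indices start at 0. HOL-Analysis uses some of the same names,
  whence the qualified names below.
\<close>

section \<open>Linear algebra\<close>

definition vnorm :: "real Matrix.vec \<Rightarrow> real" where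
  "vnorm v = sqrt (scalar_prod v v)"

definition quad_form :: "real Matrix.mat \<Rightarrow> real Matrix.vec \<Rightarrow> real" where
  "quad_form A v = scalar_prod v (A *\<^sub>v v)"

definition pos_def_mat :: "nat \<Rightarrow> real Matrix.mat \<Rightarrow> bool" where
  "pos_def_mat d A \<longleftrightarrow> A \<in> carrier_mat d d \<and> transpose_mat A = A \<and>
     (\<forall>v \<in> carrier_vec d. v \<noteq> 0\<^sub>v d \<longrightarrow> quad_form A v > 0)"

text \<open>A singular matrix is given inverse 0; this keeps the dependence on the matrix measurable.\<close>

definition inv_mat :: "real Matrix.mat \<Rightarrow> real Matrix.mat" where
  "inv_mat A = (case mat_inverse A of Some B \<Rightarrow> B | None \<Rightarrow> 0\<^sub>m (dim_row A) (dim_row A))"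

definition hat_mat :: "real Matrix.mat \<Rightarrow> real Matrix.mat" where
  "hat_mat Z = Z * inv_mat (transpose_mat Z * Z) * transpose_mat Z"

definition resid_mat :: "real Matrix.mat \<Rightarrow> real Matrix.mat" where
  "resid_mat Z = 1\<^sub>m (dim_row Z) - hat_mat Z"

definition mat_range :: "real Matrix.mat \<Rightarrow> real Matrix.vec set" where
  "mat_range A = {A *\<^sub>v u | u. u \<in> carrier_vec (dim_col A)}"


section \<open>Distributions\<close>

definition mvn_density :: "nat \<Rightarrow> real Matrix.mat \<Rightarrow> (nat \<Rightarrow> real) \<Rightarrow> real" where
  "mvn_density d \<Sigma> z =
     exp (- quad_form (inv_mat \<Sigma>) (Matrix.vec d z) / 2) / sqrt ((2 * pi) ^ d * Determinant.det \<Sigma>)"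

definition quantile :: "real measure \<Rightarrow> real \<Rightarrow> real" where
  "quantile \<mu> u = Inf {t. cdf \<mu> t \<ge> u}"

text \<open>
  The uniform distribution on the unit sphere of a subspace \<open>W\<close> of real \<open>N\<close>-space is the unique
  probability measure carried by that sphere which is invariant under all orthogonal maps that
  preserve \<open>W\<close>. It exists whenever \<open>W\<close> is not the zero space.
\<close>

definition is_uniform_sphere :: "nat \<Rightarrow> real Matrix.vec set \<Rightarrow> (nat \<Rightarrow> real) measure \<Rightarrow> bool" where
  "is_uniform_sphere N W \<nu> \<longleftrightarrow>
     prob_space \<nu> \<and> sets \<nu> = sets (\<Pi>\<^sub>M i\<in>{..<N}. borel) \<and>
     (AE v in \<nu>. Matrix.vec N v \<in> W \<and> vnorm (Matrix.vec N v) = 1) \<and>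
     (\<forall>Q \<in> carrier_mat N N. transpose_mat Q * Q = 1\<^sub>m N \<and> (\<forall>w\<in>W. Q *\<^sub>v w \<in> W) \<longrightarrow>
        distr \<nu> (\<Pi>\<^sub>M i\<in>{..<N}. borel)
          (\<lambda>v. \<lambda>i\<in>{..<N}. vec_index (Q *\<^sub>v Matrix.vec N v) i) = \<nu>)"

definition uniform_sphere :: "nat \<Rightarrow> real Matrix.vec set \<Rightarrow> (nat \<Rightarrow> real) measure" where
  "uniform_sphere N W = (SOME \<nu>. is_uniform_sphere N W \<nu>)"


section \<open>The conditional randomization test\<close>

definition T_MC :: "real Matrix.vec \<Rightarrow> real Matrix.vec \<Rightarrow> real" where
  "T_MC y x = scalar_prod y x / dim_vec y"

text \<open>
  The conditional law of the resampled statistic is a function of the conditioning variables only: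
  the full covariate matrix \<open>Z\<close>, the response \<open>y\<close> (its dimension is the number of labeled samples),
  the projected vector \<open>b\<close> and the residual norm \<open>r\<close>.
\<close>

definition resampled_T_law ::
  "real Matrix.mat \<Rightarrow> real Matrix.vec \<Rightarrow> real Matrix.vec \<Rightarrow> real \<Rightarrow> real measure" where
  "resampled_T_law Z y b r =
     distr (uniform_sphere (dim_row Z) (mat_range (resid_mat Z))) borel
       (\<lambda>v. T_MC y (vec_first (b + r \<cdot>\<^sub>v Matrix.vec (dim_row Z) v) (dim_vec y)))"

text \<open>
  The one-sided test. The statistic and its conditional law share the location determined by
  \<open>b = hat_mat Z *\<^sub>v x\<close>, so it cancels here. It would not cancel for the absolute value of the
  statistic, whose test is not asymptotically a two-sided z-test.
\<close>

definition ccrt_rejects ::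
  "real \<Rightarrow> real Matrix.mat \<Rightarrow> real Matrix.vec \<Rightarrow> real Matrix.vec \<Rightarrow> bool" where
  "ccrt_rejects \<alpha> Z x y \<longleftrightarrow>
     T_MC y (vec_first x (dim_vec y)) \<ge>
       quantile (resampled_T_law Z y (hat_mat Z *\<^sub>v x) (vnorm (resid_mat Z *\<^sub>v x))) (1 - \<alpha>)"


section \<open>The Gaussian linear model with unlabeled data\<close>

text \<open>
  \<open>n\<close> labeled and \<open>m\<close> unlabeled samples, \<open>d = p - 1\<close> covariates besides \<open>X\<close>; \<open>\<sigma>\<close> is the standard
  deviation of the noise. The joint density of a pair \<open>(Z\<^sub>i, X\<^sub>i)\<close> is written as the marginal density
  of \<open>Z\<^sub>i\<close> times the conditional density of \<open>X\<^sub>i\<close> given \<open>Z\<^sub>i\<close>.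
\<close>

locale unlabeled_linear_model = prob_space M for M :: "'a measure" +
  fixes n m d :: nat
    and \<Sigma> :: "real Matrix.mat" and \<theta> \<xi> :: "real Matrix.vec" and \<beta> \<sigma> :: real
    and X :: "nat \<Rightarrow> 'a \<Rightarrow> real" and Z :: "nat \<Rightarrow> 'a \<Rightarrow> nat \<Rightarrow> real"
    and \<epsilon> :: "nat \<Rightarrow> 'a \<Rightarrow> real" and Y :: "nat \<Rightarrow> 'a \<Rightarrow> real"
  assumes cov: "pos_def_mat d \<Sigma>"
    and coef: "\<theta> \<in> carrier_vec d" "\<xi> \<in> carrier_vec d"
    and sigma_pos: "\<sigma> > 0"
    and indep_samples:
      "indep_vars (\<lambda>_. (\<Pi>\<^sub>M j\<in>{..<d}. borel) \<Otimes>\<^sub>M borel) (\<lambda>i \<omega>. (Z i \<omega>, X i \<omega>)) {..<n + m}"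
    and sample_law: "\<And>i. i < n + m \<Longrightarrow>
      distributed M ((\<Pi>\<^sub>M j\<in>{..<d}. lborel) \<Otimes>\<^sub>M lborel) (\<lambda>\<omega>. (Z i \<omega>, X i \<omega>))
        (\<lambda>(z, x). ennreal (mvn_density d \<Sigma> z *
                           normal_density (scalar_prod (Matrix.vec d z) \<xi>) 1 x))"
    and indep_noise: "indep_vars (\<lambda>_. borel) \<epsilon> {..<n}"
    and noise_law: "\<And>i. i < n \<Longrightarrow>
      distributed M lborel (\<epsilon> i) (\<lambda>e. ennreal (normal_density 0 \<sigma> e))"
    and noise_indep_samples:
      "indep_set
         {(\<lambda>\<omega>. \<lambda>i\<in>{..<n}. \<epsilon> i \<omega>) -` A \<inter> space M | A. A \<in> sets (\<Pi>\<^sub>M i\<in>{..<n}. borel)}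
         {(\<lambda>\<omega>. \<lambda>i\<in>{..<n + m}. (Z i \<omega>, X i \<omega>)) -` B \<inter> space M | B.
            B \<in> sets (\<Pi>\<^sub>M i\<in>{..<n + m}. (\<Pi>\<^sub>M j\<in>{..<d}. borel) \<Otimes>\<^sub>M borel)}"
    and response: "\<And>i \<omega>. i < n \<Longrightarrow> \<omega> \<in> space M \<Longrightarrow>
      Y i \<omega> = X i \<omega> * \<beta> + scalar_prod (Matrix.vec d (Z i \<omega>)) \<theta> + \<epsilon> i \<omega>"

definition ccrt_power ::
  "'a measure \<Rightarrow> nat \<Rightarrow> nat \<Rightarrow> nat \<Rightarrow> (nat \<Rightarrow> 'a \<Rightarrow> real) \<Rightarrow> (nat \<Rightarrow> 'a \<Rightarrow> nat \<Rightarrow> real) \<Rightarrow>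
   (nat \<Rightarrow> 'a \<Rightarrow> real) \<Rightarrow> real \<Rightarrow> real" where
  "ccrt_power M n m d X Z Y \<alpha> =
     measure M {\<omega> \<in> space M. ccrt_rejects \<alpha>
       (Matrix.mat (n + m) d (\<lambda>(i, j). Z i \<omega> j))
       (Matrix.vec (n + m) (\<lambda>i. X i \<omega>))
       (Matrix.vec n (\<lambda>i. Y i \<omega>))}"


section \<open>The z-test\<close>

definition Phi :: "real \<Rightarrow> real" where
  "Phi = cdf std_normal_distribution"

definition z_quantile :: "real \<Rightarrow> real" where
  "z_quantile a = (THE z. Phi z = a)"

definition z_test_power :: "real \<Rightarrow> real \<Rightarrow> real" where
  "z_test_power \<alpha> \<mu> = Phi (\<mu> - z_quantile (1 - \<alpha>))"

end

theory Submission
  imports Defs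
begin

text \<open>
  Let \<open>P\<close> be the residual projection of the full covariate matrix and extend \<open>Y\<close> by zeros to all samples.
  Given the sufficient statistic, the test compares the direction of \<open>P X\<close> with a uniform point of the
  unit sphere of the range of \<open>P\<close>: it rejects iff \<open>\<langle>P Y, X\<rangle> / (|P Y| |P X|)\<close> reaches a quantile of a
  spherical coordinate, and \<open>sqrt (N - d)\<close> times that quantile converges to the normal quantile.
  Since \<open>P\<close> annihilates \<open>Z \<xi>\<close>, \<open>X\<close> may be replaced by its residual \<open>\<eta>\<close>. Whitening the rows of \<open>Z\<close> and
  rotating them so that \<open>Z (\<theta> + \<beta> \<xi>)\<close> becomes a multiple \<open>\<tau> w\<close> of a single column makes all data standard
  normal, and \<open>Y\<close> becomes the truncation of \<open>\<beta> \<eta> + \<tau> w + \<sigma> e\<close> to the first \<open>n\<close> coordinates.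

  The diagonal of \<open>P\<close> is exchangeable with a fixed sum, so the trace of its labeled block is
  \<open>n (1 - \<kappa> \<kappa>\<^sub>s)\<close> up to \<open>o(n)\<close>. Splitting \<open>w\<close> off the projection gives
  \<open>|P J w|\<^sup>2 / n \<longlonglongrightarrow> (1 - \<kappa> \<kappa>\<^sub>s) (1 - \<kappa>\<^sub>s)\<close> for the truncation \<open>J\<close>. Hence the power has the limit
  \<open>\<Phi> (\<mu> - z)\<close> with \<open>\<mu> = h sqrt (1 - \<kappa> \<kappa>\<^sub>s) / sqrt (\<sigma>\<^sup>2 + v\<^sup>2 (1 - \<kappa>\<^sub>s))\<close>, and both bounds follow
  because \<open>1 - \<kappa>\<^sub>s\<close> lies between the two factors of \<open>v\<^sup>2\<close>.
\<close>

section \<open>Orthogonal projections\<close>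

text \<open>The obstacle is that the signal direction w is itself a column of the design, so the
  projection P is not independent of it: P annihilates w but not its truncation J w. Let R be the
  residual projection of the other columns, which is independent of w. Then |P J w|^2 = |R J w|^2 -
  <R J w, w>^2 / |R w|^2, and with \<rho> = 1 - \<kappa> \<kappa>s the three forms on the right are
  close to n \<rho>, n \<rho> and N \<rho>. This is the origin of the factor 1 - n / N, hence of 1 -
  \<kappa>s. Limits of this kind are second-moment bounds: all columns but one are held fixed, and
  the squared Frobenius norm of a projection equals its trace. Normality enters exactly: the inner
  product of P u with the independent \<eta>, divided by |P u|, is standard normal, where u is the
  response without its \<beta> \<eta> part. The sphere is reached through Gaussian vectors too, by a
  Fubini argument, so that the rejection event becomes an inequality between a Gaussian probability
  and 1 - \<alpha>, measurable in the data.\<close>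

lemma inv_mat_nonsingular:
  assumes A: "A \<in> carrier_mat n n" and det: "Determinant.det A \<noteq> 0"
  shows "A * inv_mat A = 1\<^sub>m n" "inv_mat A * A = 1\<^sub>m n" "inv_mat A \<in> carrier_mat n n"
proof -
  have "A \<in> Units (ring_mat TYPE(real) n n)" using det_non_zero_imp_unit[OF A det] .
  then obtain B where "mat_inverse A = Some B"
    using mat_inverse(1)[OF A, where b = n] by (cases "mat_inverse A") auto
  then show "A * inv_mat A = 1\<^sub>m n" "inv_mat A * A = 1\<^sub>m n" "inv_mat A \<in> carrier_mat n n"
    using mat_inverse(2)[OF A] by (auto simp: inv_mat_def)
qed

lemma inv_mat_singular:
  assumes A: "A \<in> carrier_mat n n" and det: "Determinant.det A = 0"
  shows "inv_mat A = 0\<^sub>m n n"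
proof (cases "mat_inverse A")
  case None
  then show ?thesis using A by (simp add: inv_mat_def)
next
  case (Some B)
  then have "A * B = 1\<^sub>m n" "B \<in> carrier_mat n n" using mat_inverse(2)[OF A] by auto
  then have "Determinant.det A * Determinant.det B = 1" using det_mult[OF A, of B] by simp
  with det show ?thesis by simp
qed

lemma inv_mat_carrier:
  assumes A: "A \<in> carrier_mat n n" shows "inv_mat A \<in> carrier_mat n n"
  using inv_mat_nonsingular(3)[OF A] inv_mat_singular[OF A] by (cases "Determinant.det A = 0") auto

text \<open>Cramer's rule, completed by the default value. It exhibits the entries of the inverse as
  measurable functions of the entries of \<open>A\<close>.\<close>

lemma inv_mat_index:
  assumes A: "A \<in> carrier_mat n n" and ij: "i < n" "j < n"
  shows "inv_mat A $$ (i, j) =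
    (if Determinant.det A = 0 then 0 else adj_mat A $$ (i, j) / Determinant.det A)"
proof (cases "Determinant.det A = 0")
  case True
  then show ?thesis using inv_mat_singular[OF A] ij by simp
next
  case False
  note inv = inv_mat_nonsingular[OF A False]
  note adj = adj_mat[OF A]
  have "adj_mat A = (inv_mat A * A) * adj_mat A" using inv adj by simp
  also have "\<dots> = inv_mat A * (A * adj_mat A)" by (rule assoc_mult_mat[OF inv(3) A adj(1)])
  also have "\<dots> = Determinant.det A \<cdot>\<^sub>m inv_mat A"
    unfolding adj(2) by (subst mult_smult_distrib[OF inv(3)]) (use inv in auto)
  finally have "adj_mat A $$ (i, j) = Determinant.det A * inv_mat A $$ (i, j)"
    using ij inv by simp
  then show ?thesis using False by simp
qed

lemma inv_mat_unique:
  assumes A: "A \<in> carrier_mat n n" and B: "B \<in> carrier_mat n n" and AB: "A * B = 1\<^sub>m n"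
  shows "inv_mat A = B"
proof -
  have "Determinant.det A * Determinant.det B = 1" using det_mult[OF A B] AB by simp
  then have det: "Determinant.det A \<noteq> 0" by auto
  note inv = inv_mat_nonsingular[OF A det]
  have "inv_mat A = inv_mat A * (A * B)" using AB inv by simp
  also have "\<dots> = (inv_mat A * A) * B" by (rule assoc_mult_mat[OF inv(3) A B, symmetric])
  also have "\<dots> = B" using inv B by simp
  finally show ?thesis .
qed

lemma inv_mat_symmetric:
  assumes A: "A \<in> carrier_mat n n" and sym: "transpose_mat A = A"
  shows "transpose_mat (inv_mat A) = inv_mat A"
proof (cases "Determinant.det A = 0")
  case True
  then show ?thesis using inv_mat_singular[OF A] by (auto intro!: eq_matI)
next
  case False
  note inv = inv_mat_nonsingular[OF A False]
  have "A * transpose_mat (inv_mat A) = transpose_mat (inv_mat A * A)"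
    using transpose_mult[OF inv(3) A] sym by simp
  then have "A * transpose_mat (inv_mat A) = 1\<^sub>m n" using inv by simp
  from inv_mat_unique[OF A _ this] inv show ?thesis by simp
qed

text \<open>The default inverse 0 makes the identity true for singular matrices as well; it is what
  makes \<open>hat_mat\<close> idempotent whatever the rank of the design.\<close>

lemma inv_mat_reflexive_inverse:
  assumes A: "A \<in> carrier_mat n n" shows "inv_mat A * A * inv_mat A = inv_mat A"
proof (cases "Determinant.det A = 0")
  case True
  then show ?thesis using inv_mat_singular[OF A] A by simp
next
  case False
  then show ?thesis using inv_mat_nonsingular[OF A False] by simp
qed

section \<open>Hat and residual matrices as orthogonal projections\<close>

definition orth_proj :: "nat \<Rightarrow> real Matrix.mat \<Rightarrow> bool" where
  "orth_proj N P \<longleftrightarrow> P \<in> carrier_mat N N \<and> transpose_mat P = P \<and> P * P = P"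

lemma one_minus_idem:
  assumes H: "H \<in> carrier_mat N N" and HH: "H * H = (H :: real Matrix.mat)"
  shows "(1\<^sub>m N - H) * (1\<^sub>m N - H) = 1\<^sub>m N - H"
proof -
  have "(1\<^sub>m N - H) * (1\<^sub>m N - H) = 1\<^sub>m N * (1\<^sub>m N - H) - H * (1\<^sub>m N - H)"
    by (rule minus_mult_distrib_mat) (use H in auto)
  also have "H * (1\<^sub>m N - H) = H * 1\<^sub>m N - H * H"
    by (rule mult_minus_distrib_mat) (use H in auto)
  also have "\<dots> = 0\<^sub>m N N" using H HH by simp
  finally have "(1\<^sub>m N - H) * (1\<^sub>m N - H) = 1\<^sub>m N * (1\<^sub>m N - H) - 0\<^sub>m N N" .
  moreover have "1\<^sub>m N * (1\<^sub>m N - H) - 0\<^sub>m N N = 1\<^sub>m N - H"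
    using H by (subst left_mult_one_mat[of _ N N]) (auto intro!: eq_matI)
  ultimately show ?thesis by simp
qed

context
  fixes Z :: "real Matrix.mat" and N d :: nat
  assumes Z: "Z \<in> carrier_mat N d"
begin

private definition "G = transpose_mat Z * Z"

private lemma G: "G \<in> carrier_mat d d" "transpose_mat G = G"
proof -
  show "G \<in> carrier_mat d d" using Z by (simp add: G_def)
  have "transpose_mat (transpose_mat Z * Z) = transpose_mat Z * transpose_mat (transpose_mat Z)"
    by (rule transpose_mult) (use Z in auto)
  then show "transpose_mat G = G" by (simp add: G_def)
qed

private lemma hat_eq: "hat_mat Z = Z * (inv_mat G * transpose_mat Z)"
  unfolding hat_mat_def G_def
  by (rule assoc_mult_mat) (use Z inv_mat_carrier[OF G(1)] in \<open>auto simp: G_def\<close>)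

lemma hat_mat_carrier: "hat_mat Z \<in> carrier_mat N N"
  unfolding hat_eq using Z inv_mat_carrier[OF G(1)] by auto

lemma hat_mat_symmetric: "transpose_mat (hat_mat Z) = hat_mat Z"
proof -
  note I = inv_mat_carrier[OF G(1)]
  have "transpose_mat (Z * (inv_mat G * transpose_mat Z))
      = transpose_mat (inv_mat G * transpose_mat Z) * transpose_mat Z"
    by (rule transpose_mult) (use Z I in auto)
  also have "transpose_mat (inv_mat G * transpose_mat Z) = Z * inv_mat G"
    using transpose_mult[OF I, of "transpose_mat Z" N] Z inv_mat_symmetric[OF G] by simp
  also have "Z * inv_mat G * transpose_mat Z = Z * (inv_mat G * transpose_mat Z)"
    by (rule assoc_mult_mat) (use Z I in auto)
  finally show ?thesis by (simp add: hat_eq)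
qed

lemma hat_mat_idem: "hat_mat Z * hat_mat Z = hat_mat Z"
proof -
  note I = inv_mat_carrier[OF G(1)]
  let ?K = "inv_mat G * transpose_mat Z"
  have K: "?K \<in> carrier_mat d N" using Z I by auto
  have ZK: "Z * ?K \<in> carrier_mat N N" using Z K by auto
  have "?K * (Z * ?K) = ?K * Z * ?K" by (rule assoc_mult_mat[symmetric, OF K Z K])
  also have "?K * Z = inv_mat G * G"
    unfolding G_def by (rule assoc_mult_mat) (use Z I in \<open>auto simp: G_def\<close>)
  also have "inv_mat G * G * ?K = inv_mat G * G * inv_mat G * transpose_mat Z"
    by (rule assoc_mult_mat[symmetric]) (use Z I G in auto)
  also have "\<dots> = ?K" using inv_mat_reflexive_inverse[OF G(1)] by simp
  finally have *: "?K * (Z * ?K) = ?K" .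
  have "Z * ?K * (Z * ?K) = Z * (?K * (Z * ?K))" by (rule assoc_mult_mat[OF Z K ZK])
  then show ?thesis unfolding hat_eq * .
qed

lemma resid_mat_proj: "orth_proj N (resid_mat Z)"
proof -
  have "dim_row Z = N" using Z by auto
  moreover have "transpose_mat (1\<^sub>m N - hat_mat Z) = 1\<^sub>m N - hat_mat Z"
    using transpose_minus[of "1\<^sub>m N" N N "hat_mat Z"] hat_mat_carrier hat_mat_symmetric by simp
  ultimately show ?thesis
    unfolding orth_proj_def resid_mat_def
    using hat_mat_carrier one_minus_idem[OF hat_mat_carrier hat_mat_idem] by auto
qed

lemma resid_hat: "resid_mat Z + hat_mat Z = 1\<^sub>m N"
  unfolding resid_mat_def using Z hat_mat_carrier by (intro eq_matI) auto

text \<open>The complement of the residual projection factors through \<open>Z\<close>. Together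
  with \<open>resid_mat_mult\<close> this pins the projection down, see
  \<open>orth_proj_unique\<close>.\<close>

lemma one_minus_resid: "\<exists>B \<in> carrier_mat d N. 1\<^sub>m N - resid_mat Z = Z * B"
proof (rule bexI)
  show "1\<^sub>m N - resid_mat Z = Z * (inv_mat G * transpose_mat Z)"
    unfolding hat_eq[symmetric] resid_mat_def using Z hat_mat_carrier by (intro eq_matI) auto
qed (use Z inv_mat_carrier[OF G(1)] in auto)

lemma resid_mat_mult:
  assumes det: "Determinant.det (transpose_mat Z * Z) \<noteq> 0"
  shows "resid_mat Z * Z = 0\<^sub>m N d"
proof -
  note I = inv_mat_nonsingular[OF G(1), folded G_def, OF det[folded G_def]]
  have *: "inv_mat G * transpose_mat Z * Z = 1\<^sub>m d"
    using assoc_mult_mat[OF I(3), of "transpose_mat Z" N Z d] Z I(2) by (auto simp: G_def)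
  have "hat_mat Z * Z = Z * (inv_mat G * transpose_mat Z * Z)"
    unfolding hat_eq by (rule assoc_mult_mat) (use Z I in auto)
  then have "hat_mat Z * Z = Z" using * Z by simp
  moreover have "resid_mat Z * Z = 1\<^sub>m N * Z - hat_mat Z * Z"
    unfolding resid_mat_def
    using minus_mult_distrib_mat[OF one_carrier_mat hat_mat_carrier Z] Z by simp
  ultimately show ?thesis using Z by simp
qed

text \<open>Cyclicity of the trace: the hat matrix is \<open>Z * K\<close> with \<open>K * Z\<close>
  the identity of size \<open>d\<close>, so its trace is \<open>d\<close>.\<close>

lemma resid_mat_diag_sum:
  assumes det: "Determinant.det (transpose_mat Z * Z) \<noteq> 0"
  shows "(\<Sum>i<N. resid_mat Z $$ (i, i)) = real N - real d"
proof -
  note I = inv_mat_nonsingular[OF G(1), folded G_def, OF det[folded G_def]]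
  define K where "K = inv_mat G * transpose_mat Z"
  have K: "K \<in> carrier_mat d N" using Z I by (auto simp: K_def)
  have KZ: "K * Z = 1\<^sub>m d"
    using assoc_mult_mat[OF I(3), of "transpose_mat Z" N Z d] Z I(2) by (auto simp: G_def K_def)
  have "(\<Sum>i<N. hat_mat Z $$ (i, i)) = (\<Sum>i<N. \<Sum>k<d. Z $$ (i, k) * K $$ (k, i))"
    unfolding hat_eq K_def[symmetric] using Z K by (intro sum.cong refl)
      (auto simp: scalar_prod_def lessThan_atLeast0)
  also have "\<dots> = (\<Sum>k<d. \<Sum>i<N. K $$ (k, i) * Z $$ (i, k))"
    by (subst sum.swap) (simp add: mult.commute)
  also have "\<dots> = (\<Sum>k<d. (K * Z) $$ (k, k))"
    using Z K by (intro sum.cong refl) (auto simp: scalar_prod_def lessThan_atLeast0)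
  also have "\<dots> = real d" unfolding KZ by simp
  finally have "(\<Sum>i<N. hat_mat Z $$ (i, i)) = real d" .
  moreover have "(\<Sum>i<N. resid_mat Z $$ (i, i)) = (\<Sum>i<N. 1 - hat_mat Z $$ (i, i))"
    unfolding resid_mat_def using Z hat_mat_carrier by (intro sum.cong refl) auto
  ultimately show ?thesis by (simp add: sum_subtractf)
qed

end

text \<open>An orthogonal projection is determined by its kernel, here the column space of \<open>Z\<close>.\<close>

lemma orth_proj_unique:
  assumes P: "orth_proj N P" and Q: "orth_proj N Q" and Z: "Z \<in> carrier_mat N d"
    and PZ: "P * Z = 0\<^sub>m N d" and QZ: "Q * Z = 0\<^sub>m N d"
    and B: "B \<in> carrier_mat d N" "1\<^sub>m N - P = Z * B"
    and C: "C \<in> carrier_mat d N" "1\<^sub>m N - Q = Z * C"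
  shows "P = Q"
proof -
  \<comment> \<open>P' (1 - Q') = P' Z C' = 0. Used in both orders this gives P = P Q and Q = Q P,
    and a transposition links the two.\<close>
  have key: "P' = P' * Q'"
    if "orth_proj N P'" "orth_proj N Q'" "P' * Z = 0\<^sub>m N d" "C' \<in> carrier_mat d N" "1\<^sub>m N - Q' = Z * C'"
    for P' Q' C'
  proof -
    have P': "P' \<in> carrier_mat N N" and Q': "Q' \<in> carrier_mat N N" using that by (auto simp: orth_proj_def)
    have "P' * (1\<^sub>m N - Q') = (P' * Z) * C'"
      unfolding that(5) by (rule assoc_mult_mat[OF P' Z that(4), symmetric])
    then have "P' * (1\<^sub>m N - Q') = 0\<^sub>m N N" using that by simp
    moreover have "P' * (1\<^sub>m N - Q') = P' - P' * Q'"
      using mult_minus_distrib_mat[OF P' one_carrier_mat Q'] P' by simp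
    ultimately have "P' - P' * Q' = 0\<^sub>m N N" by simp
    then have "(P' - P' * Q') $$ (i, j) = 0" if "i < N" "j < N" for i j using that by simp
    then show ?thesis using P' Q' by (intro eq_matI) (auto simp del: index_mult_mat(1))
  qed
  have "P = P * Q" by (rule key[OF P Q PZ C])
  also have "\<dots> = transpose_mat (Q * P)"
    using P Q transpose_mult[of Q N N P N] by (simp add: orth_proj_def)
  also have "Q * P = Q" using key[OF Q P QZ B] by simp
  also have "transpose_mat Q = Q" using Q by (simp add: orth_proj_def)
  finally show ?thesis .
qed

lemma resid_mat_unique:
  assumes Z: "Z \<in> carrier_mat N d" and det: "Determinant.det (transpose_mat Z * Z) \<noteq> 0"
    and P: "orth_proj N P" "P * Z = 0\<^sub>m N d" and B: "B \<in> carrier_mat d N" "1\<^sub>m N - P = Z * B"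
  shows "resid_mat Z = P"
proof -
  obtain C where C: "C \<in> carrier_mat d N" "1\<^sub>m N - resid_mat Z = Z * C"
    using one_minus_resid[OF Z] by auto
  show ?thesis
    by (rule orth_proj_unique[OF resid_mat_proj[OF Z] P(1) Z resid_mat_mult[OF Z det] P(2) C B])
qed

text \<open>\<open>Z\<close> and its Gram matrix have the same kernel, because <v, Z^T Z v> = |Z
  v|^2.\<close>

lemma gram_det_nonzero_iff:
  assumes Z: "Z \<in> carrier_mat N d"
  shows "Determinant.det (transpose_mat Z * Z) \<noteq> 0 \<longleftrightarrow>
    (\<forall>v \<in> carrier_vec d. Z *\<^sub>v v = 0\<^sub>v N \<longrightarrow> v = (0\<^sub>v d :: real Matrix.vec))"
proof -
  have G: "transpose_mat Z * Z \<in> carrier_mat d d" using Z by auto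
  have "transpose_mat Z * Z *\<^sub>v v = 0\<^sub>v d \<longleftrightarrow> Z *\<^sub>v v = 0\<^sub>v N" if v: "v \<in> carrier_vec d" for v
  proof
    have eq: "transpose_mat Z * Z *\<^sub>v v = transpose_mat Z *\<^sub>v (Z *\<^sub>v v)"
      by (rule assoc_mult_mat_vec) (use Z v in auto)
    show "transpose_mat Z * Z *\<^sub>v v = 0\<^sub>v d" if "Z *\<^sub>v v = 0\<^sub>v N"
      unfolding eq that using Z by auto
    assume "transpose_mat Z * Z *\<^sub>v v = 0\<^sub>v d"
    then have 0: "transpose_mat Z *\<^sub>v (Z *\<^sub>v v) = 0\<^sub>v d" using eq by simp
    have Zv: "Z *\<^sub>v v \<in> carrier_vec N" using Z v by auto
    have "scalar_prod (Z *\<^sub>v v) (Z *\<^sub>v v) = scalar_prod (transpose_mat Z *\<^sub>v (Z *\<^sub>v v)) v"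
      using transpose_vec_mult_scalar[OF Z v Zv] by simp
    also have "\<dots> = 0" unfolding 0 using v by simp
    finally have "(\<Sum>i<N. (vec_index (Z *\<^sub>v v) i)\<^sup>2) = 0"
      using Zv carrier_matD[OF Z] by (simp add: scalar_prod_def power2_eq_square lessThan_atLeast0 del: index_mult_mat_vec)
    then have "\<forall>i<N. vec_index (Z *\<^sub>v v) i = 0"
      using sum_nonneg_eq_0_iff[of "{..<N}" "\<lambda>i. (vec_index (Z *\<^sub>v v) i)\<^sup>2"] by simp
    then show "Z *\<^sub>v v = 0\<^sub>v N" using Z by (intro eq_vecI) auto
  qed
  then show ?thesis using det_0_iff_vec_prod_zero[OF G] by auto
qed

text \<open>The residual projection depends only on the column space. This undoes the whitening,
  with \<open>B\<close> the transposed square root of the covariance matrix.\<close>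

lemma resid_mat_basis_change:
  assumes W: "W \<in> carrier_mat N d" and B: "B \<in> carrier_mat d d" and B': "B' \<in> carrier_mat d d"
    and BB': "B * B' = 1\<^sub>m d"
    and det: "Determinant.det (transpose_mat W * W) \<noteq> 0"
  shows "Determinant.det (transpose_mat (W * B) * (W * B)) \<noteq> 0" "resid_mat (W * B) = resid_mat W"
proof -
  have WB: "W * B \<in> carrier_mat N d" using W B by auto
  have B'B: "B' * B = 1\<^sub>m d" by (rule mat_mult_left_right_inverse[OF B B' BB'])
  show det': "Determinant.det (transpose_mat (W * B) * (W * B)) \<noteq> 0"
    unfolding gram_det_nonzero_iff[OF WB]
  proof (intro ballI impI)
    fix v assume v: "v \<in> carrier_vec d" and "W * B *\<^sub>v v = 0\<^sub>v N"
    then have "W *\<^sub>v (B *\<^sub>v v) = 0\<^sub>v N" using assoc_mult_mat_vec[OF W B v] by simp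
    then have *: "B *\<^sub>v v = 0\<^sub>v d"
      using det[unfolded gram_det_nonzero_iff[OF W]] B v by auto
    have "v = (B' * B) *\<^sub>v v" using B'B v by simp
    also have "\<dots> = B' *\<^sub>v (B *\<^sub>v v)" by (rule assoc_mult_mat_vec[OF B' B v])
    also have "\<dots> = 0\<^sub>v d" unfolding * using B' by auto
    finally show "v = 0\<^sub>v d" .
  qed
  obtain C where C: "C \<in> carrier_mat d N" "1\<^sub>m N - resid_mat W = W * C"
    using one_minus_resid[OF W] by auto
  have R: "resid_mat W \<in> carrier_mat N N" using resid_mat_proj[OF W] by (auto simp: orth_proj_def)
  show "resid_mat (W * B) = resid_mat W"
  proof (rule resid_mat_unique[OF WB det' resid_mat_proj[OF W]])
    show "resid_mat W * (W * B) = 0\<^sub>m N d"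
      using assoc_mult_mat[OF R W B] resid_mat_mult[OF W det] B by simp
    show "B' * C \<in> carrier_mat d N" using B' C by auto
    have "W * B * (B' * C) = W * (B * (B' * C))" by (rule assoc_mult_mat) (use W B B' C in auto)
    also have "B * (B' * C) = B * B' * C" by (rule assoc_mult_mat[symmetric]) (use B B' C in auto)
    finally show "1\<^sub>m N - resid_mat W = W * B * (B' * C)" using C BB' by simp
  qed
qed

text \<open>The form <f, P g> on coordinate functions, which are the points of the product measures
  used later. For a projection it is the inner product of P f and P g (\<open>bil_eq_inner\<close>),
  so \<open>bil N P f f\<close> is |P f|^2.\<close>

definition bil :: "nat \<Rightarrow> real Matrix.mat \<Rightarrow> (nat \<Rightarrow> real) \<Rightarrow> (nat \<Rightarrow> real) \<Rightarrow> real" where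
  "bil N P f g = (\<Sum>i<N. \<Sum>j<N. P $$ (i, j) * f i * g j)"

definition pvec :: "nat \<Rightarrow> real Matrix.mat \<Rightarrow> (nat \<Rightarrow> real) \<Rightarrow> nat \<Rightarrow> real" where
  "pvec N P f i = (\<Sum>j<N. P $$ (i, j) * f j)"

lemma bil_eq_pvec: "bil N P f g = (\<Sum>i<N. f i * pvec N P g i)"
  unfolding bil_def pvec_def by (simp add: sum_distrib_left mult_ac)

lemma bil_add_left: "bil N P (\<lambda>i. f i + f' i) g = bil N P f g + bil N P f' g"
  unfolding bil_def by (simp add: algebra_simps sum.distrib)

lemma bil_add_right: "bil N P g (\<lambda>i. f i + f' i) = bil N P g f + bil N P g f'"
  unfolding bil_def by (simp add: algebra_simps sum.distrib)

lemma bil_scale_left: "bil N P (\<lambda>i. c * f i) g = c * bil N P f g"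
  unfolding bil_def by (simp add: sum_distrib_left mult_ac)

lemma bil_scale_right: "bil N P g (\<lambda>i. c * f i) = c * bil N P g f"
  unfolding bil_def by (simp add: sum_distrib_left mult_ac)

lemma bil_cong:
  assumes "\<And>i. i < N \<Longrightarrow> f i = f' i" "\<And>i. i < N \<Longrightarrow> g i = g' i"
  shows "bil N P f g = bil N P f' g'"
  unfolding bil_def using assms by (intro sum.cong refl) auto

lemma mat_vec_index:
  assumes "P \<in> carrier_mat N N" "i < N"
  shows "vec_index (P *\<^sub>v Matrix.vec N f) i = pvec N P f i"
  using assms by (simp add: scalar_prod_def pvec_def lessThan_atLeast0)

context
  fixes N :: nat and P :: "real Matrix.mat"
  assumes P: "orth_proj N P"
begin

lemma orth_proj_carrier: "P \<in> carrier_mat N N"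
  using P by (simp add: orth_proj_def)

lemma orth_proj_sym: "i < N \<Longrightarrow> j < N \<Longrightarrow> P $$ (i, j) = P $$ (j, i)"
  using P unfolding orth_proj_def by (metis carrier_matD index_transpose_mat(1))

lemma orth_proj_idem: "i < N \<Longrightarrow> j < N \<Longrightarrow> (\<Sum>k<N. P $$ (i, k) * P $$ (k, j)) = P $$ (i, j)"
proof -
  assume ij: "i < N" "j < N"
  have "(P * P) $$ (i, j) = (\<Sum>k<N. P $$ (i, k) * P $$ (k, j))"
    using orth_proj_carrier ij by (simp add: scalar_prod_def lessThan_atLeast0)
  then show ?thesis using P by (simp add: orth_proj_def)
qed

lemma bil_sym: "bil N P f g = bil N P g f"
proof -
  have "bil N P f g = (\<Sum>i<N. \<Sum>j<N. P $$ (j, i) * f i * g j)"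
    unfolding bil_def by (intro sum.cong refl) (simp add: orth_proj_sym)
  also have "\<dots> = bil N P g f" unfolding bil_def by (subst sum.swap) (simp add: mult_ac)
  finally show ?thesis .
qed

lemma pvec_pvec: "i < N \<Longrightarrow> pvec N P (pvec N P f) i = pvec N P f i"
proof -
  assume i: "i < N"
  have "pvec N P (pvec N P f) i = (\<Sum>k<N. \<Sum>j<N. P $$ (i, k) * P $$ (k, j) * f j)"
    unfolding pvec_def by (simp add: sum_distrib_left mult_ac)
  also have "\<dots> = (\<Sum>j<N. (\<Sum>k<N. P $$ (i, k) * P $$ (k, j)) * f j)"
    by (subst sum.swap) (simp add: sum_distrib_right)
  also have "\<dots> = pvec N P f i" using i by (simp add: orth_proj_idem pvec_def)
  finally show ?thesis .
qed

lemma bil_pvec_right: "bil N P f (pvec N P g) = bil N P f g"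
  unfolding bil_eq_pvec by (simp add: pvec_pvec)

lemma bil_pvec_left: "bil N P (pvec N P f) g = bil N P f g"
  by (metis bil_pvec_right bil_sym)

lemma bil_eq_inner: "bil N P f g = (\<Sum>i<N. pvec N P f i * pvec N P g i)"
  using bil_pvec_left[of f g] by (simp add: bil_eq_pvec)

lemma bil_nonneg: "0 \<le> bil N P f f"
  unfolding bil_eq_inner by (intro sum_nonneg) simp

lemma bil_le: "bil N P f f \<le> (\<Sum>i<N. (f i)\<^sup>2)"
proof -
  have "0 \<le> (\<Sum>i<N. (f i - pvec N P f i)\<^sup>2)" by (intro sum_nonneg) simp
  also have "\<dots> = (\<Sum>i<N. (f i)\<^sup>2) - 2 * bil N P f f + (\<Sum>i<N. pvec N P f i * pvec N P f i)"
    unfolding bil_eq_pvec by (simp add: power2_eq_square algebra_simps sum.distrib sum_subtractf sum_distrib_left)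
  finally show ?thesis unfolding bil_eq_inner[symmetric] by simp
qed

lemma pvec_zero: "bil N P f f = 0 \<Longrightarrow> i < N \<Longrightarrow> pvec N P f i = 0"
  unfolding bil_eq_inner using sum_nonneg_eq_0_iff[of "{..<N}" "\<lambda>i. pvec N P f i * pvec N P f i"] by auto

lemma bil_zero: "bil N P f f = 0 \<Longrightarrow> bil N P f g = 0"
  unfolding bil_eq_inner[of f g] by (simp add: pvec_zero)

text \<open>Symmetry and idempotence. The variance bounds for quadratic forms rest on it: the
  squared Frobenius norm of a projection is its trace and hence at most the dimension.\<close>

lemma orth_proj_frob: "i < N \<Longrightarrow> (\<Sum>k<N. (P $$ (i, k))\<^sup>2) = P $$ (i, i)"
proof -
  assume i: "i < N"
  have "(\<Sum>k<N. (P $$ (i, k))\<^sup>2) = (\<Sum>k<N. P $$ (i, k) * P $$ (k, i))"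
    using i by (intro sum.cong refl) (metis lessThan_iff orth_proj_sym power2_eq_square)
  then show ?thesis using orth_proj_idem[OF i i] by simp
qed

lemma orth_proj_diag: "i < N \<Longrightarrow> 0 \<le> P $$ (i, i)" "i < N \<Longrightarrow> P $$ (i, i) \<le> 1"
proof -
  assume i: "i < N"
  show *: "0 \<le> P $$ (i, i)"
    unfolding orth_proj_frob[OF i, symmetric] by (intro sum_nonneg) simp
  have "(P $$ (i, i))\<^sup>2 \<le> (\<Sum>k<N. (P $$ (i, k))\<^sup>2)" using i by (intro member_le_sum) auto
  then have "(P $$ (i, i))\<^sup>2 \<le> P $$ (i, i)" unfolding orth_proj_frob[OF i] .
  then show "P $$ (i, i) \<le> 1"
    using * by (cases "P $$ (i, i) = 0") (auto simp: power2_eq_square)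
qed

lemma orth_proj_frob_le: "(\<Sum>i<N. \<Sum>j<N. (P $$ (i, j))\<^sup>2) \<le> real N"
proof -
  have "(\<Sum>i<N. \<Sum>j<N. (P $$ (i, j))\<^sup>2) \<le> (\<Sum>i<N. 1)"
    by (intro sum_mono) (simp only: lessThan_iff orth_proj_frob orth_proj_diag)
  then show ?thesis by simp
qed

end

text \<open>A rank-one downdate. With R the residual projection of the columns other than column 0,
  and a = R w the part of column 0 outside their span, adding column 0 to the design removes the
  direction a: P = R - a a^T / |a|^2. The point is that R, unlike P, does not involve
  \<open>w\<close>.\<close>

lemma bil_resid_unique:
  assumes W: "W \<in> carrier_mat N (Suc k)"
    and det: "Determinant.det (transpose_mat W * W) \<noteq> 0"
  defines "V \<equiv> Matrix.mat N k (\<lambda>(i, j). W $$ (i, Suc j))"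
    and "w \<equiv> \<lambda>i. W $$ (i, 0)"
  shows "Determinant.det (transpose_mat V * V) \<noteq> 0"
    and "bil N (resid_mat V) w w > 0"
    and "bil N (resid_mat W) f g = bil N (resid_mat V) f g
      - bil N (resid_mat V) f w * bil N (resid_mat V) g w / bil N (resid_mat V) w w"
proof -
  have V: "V \<in> carrier_mat N k" by (simp add: V_def)
  note ker = det[unfolded gram_det_nonzero_iff[OF W], rule_format]
  show detV: "Determinant.det (transpose_mat V * V) \<noteq> 0"
    unfolding gram_det_nonzero_iff[OF V]
  proof (intro ballI impI)
    fix v assume v: "v \<in> carrier_vec k" and 0: "V *\<^sub>v v = 0\<^sub>v N"
    \<comment> \<open>A kernel vector of \<open>V\<close>, padded by a zero in front, is a kernel
      vector of \<open>W\<close>.\<close>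
    let ?u = "Matrix.vec (Suc k) (\<lambda>j. case j of 0 \<Rightarrow> 0 | Suc j \<Rightarrow> vec_index v j)"
    have "W *\<^sub>v ?u = 0\<^sub>v N"
    proof (rule eq_vecI)
      fix i assume "i < dim_vec (0\<^sub>v N)"
      then have i: "i < N" by simp
      have "vec_index (W *\<^sub>v ?u) i = (\<Sum>j<Suc k. W $$ (i, j) * (case j of 0 \<Rightarrow> 0 | Suc j \<Rightarrow> vec_index v j))"
        using W i by (simp add: scalar_prod_def lessThan_atLeast0)
      also have "\<dots> = (\<Sum>j<k. W $$ (i, Suc j) * vec_index v j)"
        by (simp add: sum.lessThan_Suc_shift del: sum.lessThan_Suc)
      also have "\<dots> = vec_index (V *\<^sub>v v) i"
        using v i by (simp add: scalar_prod_def lessThan_atLeast0 V_def)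
      finally show "vec_index (W *\<^sub>v ?u) i = vec_index (0\<^sub>v N) i" using 0 by simp
    qed (use W in auto)
    then have u: "?u = 0\<^sub>v (Suc k)" by (intro ker) auto
    show "v = 0\<^sub>v k"
    proof (rule eq_vecI)
      fix j assume "j < dim_vec (0\<^sub>v k)"
      then have j: "j < k" by simp
      have "vec_index ?u (Suc j) = vec_index (0\<^sub>v (Suc k)) (Suc j)" unfolding u ..
      then show "vec_index v j = vec_index (0\<^sub>v k) j" using j by simp
    qed (use v in auto)
  qed
  let ?R = "resid_mat V"
  have R: "orth_proj N ?R" by (rule resid_mat_proj[OF V])
  note Rc = orth_proj_carrier[OF R]
  obtain C where C: "C \<in> carrier_mat k N" "1\<^sub>m N - ?R = V * C" using one_minus_resid[OF V] by auto
  define a where "a = pvec N ?R w"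
  define q where "q = bil N ?R w w"
  have VC: "(if i = j then 1 else 0) - ?R $$ (i, j) = (\<Sum>l<k. V $$ (i, l) * C $$ (l, j))"
    if "i < N" "j < N" for i j
  proof -
    have "(1\<^sub>m N - ?R) $$ (i, j) = (V * C) $$ (i, j)" using C by simp
    then show ?thesis using that V C(1) Rc by (simp add: scalar_prod_def lessThan_atLeast0)
  qed
  have RV: "(\<Sum>j<N. ?R $$ (i, j) * V $$ (j, l)) = 0" if "i < N" "l < k" for i l
  proof -
    have "(?R * V) $$ (i, l) = 0" using resid_mat_mult[OF V detV] that by simp
    then show ?thesis using that V Rc by (simp add: scalar_prod_def lessThan_atLeast0)
  qed
  have wa: "w i - a i = (\<Sum>l<k. V $$ (i, l) * pvec N C w l)" if i: "i < N" for i
  proof -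
    have "(\<Sum>j<N. ((if i = j then 1 else 0) - ?R $$ (i, j)) * w j) = w i - a i"
      using i by (simp add: a_def pvec_def left_diff_distrib sum_subtractf if_distrib[of "\<lambda>c. c * _"] cong: if_cong)
    moreover have "(\<Sum>j<N. ((if i = j then 1 else 0) - ?R $$ (i, j)) * w j)
        = (\<Sum>j<N. \<Sum>l<k. V $$ (i, l) * C $$ (l, j) * w j)"
      using i by (intro sum.cong refl) (simp add: VC sum_distrib_right)
    moreover have "\<dots> = (\<Sum>l<k. V $$ (i, l) * pvec N C w l)"
      by (subst sum.swap) (simp add: pvec_def sum_distrib_left mult_ac)
    ultimately show ?thesis by simp
  qed
  show q: "q > 0" unfolding q_def
  proof (rule ccontr)
    assume "\<not> bil N ?R w w > 0"
    then have "bil N ?R w w = 0" using bil_nonneg[OF R, of w] by linarith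
    then have a0: "a i = 0" if "i < N" for i using pvec_zero[OF R _ that] by (simp add: a_def)
    \<comment> \<open>If a vanished, \<open>w\<close> would equal V (C w), and (1, - C w) would be a
      kernel vector of \<open>W\<close>.\<close>
    let ?u = "Matrix.vec (Suc k) (\<lambda>j. case j of 0 \<Rightarrow> 1 | Suc j \<Rightarrow> - pvec N C w j)"
    have "W *\<^sub>v ?u = 0\<^sub>v N"
    proof (rule eq_vecI)
      fix i assume "i < dim_vec (0\<^sub>v N)"
      then have i: "i < N" by simp
      have "vec_index (W *\<^sub>v ?u) i = (\<Sum>j<Suc k. W $$ (i, j) * (case j of 0 \<Rightarrow> 1 | Suc j \<Rightarrow> - pvec N C w j))"
        using W i by (simp add: scalar_prod_def lessThan_atLeast0)
      also have "\<dots> = w i - (\<Sum>j<k. V $$ (i, j) * pvec N C w j)"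
        using i by (simp add: sum.lessThan_Suc_shift sum_negf w_def V_def del: sum.lessThan_Suc)
      also have "\<dots> = 0" using wa[OF i] a0[OF i] by simp
      finally show "vec_index (W *\<^sub>v ?u) i = vec_index (0\<^sub>v N) i" using i by simp
    qed (use W in auto)
    then have "?u = 0\<^sub>v (Suc k)" by (intro ker) auto
    then have "vec_index ?u 0 = vec_index (0\<^sub>v (Suc k)) 0" by simp
    then show False by simp
  qed
  have aw: "(\<Sum>i<N. a i * w i) = q" unfolding q_def a_def bil_eq_pvec by (simp add: mult.commute)
  have aa: "(\<Sum>i<N. a i * a i) = q" unfolding q_def a_def bil_eq_inner[OF R] ..
  have Ra: "(\<Sum>j<N. ?R $$ (i, j) * a j) = a i" if "i < N" for i
    using pvec_pvec[OF R that, of w] by (simp add: a_def pvec_def)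
  have aV: "(\<Sum>j<N. a j * V $$ (j, l)) = 0" if l: "l < k" for l
  proof -
    have "(\<Sum>j<N. a j * V $$ (j, l)) = bil N ?R (\<lambda>j. V $$ (j, l)) w"
      unfolding a_def bil_eq_pvec by (simp add: mult.commute)
    also have "\<dots> = bil N ?R w (\<lambda>j. V $$ (j, l))" by (rule bil_sym[OF R])
    also have "\<dots> = 0" unfolding bil_eq_pvec pvec_def using l by (simp add: RV)
    finally show ?thesis .
  qed
  \<comment> \<open>The candidate for the projection of \<open>W\<close>, to be identified by
    \<open>resid_mat_unique\<close>; \<open>B\<close> below is the factorisation witness that this
    requires.\<close>
  define P where "P = Matrix.mat N N (\<lambda>(i, j). ?R $$ (i, j) - a i * a j / q)"
  have Pc: "P \<in> carrier_mat N N" by (simp add: P_def)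
  have Pproj: "orth_proj N P"
    unfolding orth_proj_def
  proof (intro conjI Pc eq_matI)
    fix i j assume "i < dim_row P" "j < dim_col P"
    then have ij: "i < N" "j < N" by (auto simp: P_def)
    show "transpose_mat P $$ (i, j) = P $$ (i, j)"
      using ij orth_proj_sym[OF R, of i j] by (simp add: P_def)
    have aR: "(\<Sum>k<N. a k * ?R $$ (k, j)) = a j"
    proof -
      have "(\<Sum>k<N. a k * ?R $$ (k, j)) = (\<Sum>k<N. ?R $$ (j, k) * a k)"
        by (intro sum.cong refl) (use orth_proj_sym[OF R ij(2)] in \<open>auto simp: mult.commute\<close>)
      then show ?thesis using Ra[OF ij(2)] by simp
    qed
    have "(P * P) $$ (i, j) = (\<Sum>k<N. (?R $$ (i, k) - a i * a k / q) * (?R $$ (k, j) - a k * a j / q))"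
      using ij by (simp add: P_def scalar_prod_def lessThan_atLeast0)
    also have "\<dots> = (\<Sum>k<N. ?R $$ (i, k) * ?R $$ (k, j)) - (\<Sum>k<N. ?R $$ (i, k) * a k) * a j / q
        - a i * (\<Sum>k<N. a k * ?R $$ (k, j)) / q + a i * a j / q * ((\<Sum>k<N. a k * a k) / q)"
      by (simp add: algebra_simps sum.distrib sum_subtractf sum_distrib_left sum_divide_distrib)
    also have "\<dots> = P $$ (i, j)"
      unfolding aR aa using q ij by (simp add: Ra orth_proj_idem[OF R] P_def)
    finally show "(P * P) $$ (i, j) = P $$ (i, j)" .
  qed (auto simp: P_def)
  have PW: "P * W = 0\<^sub>m N (Suc k)"
  proof (rule eq_matI)
    fix i j assume "i < dim_row (0\<^sub>m N (Suc k))" "j < dim_col (0\<^sub>m N (Suc k))"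
    then have ij: "i < N" "j < Suc k" by auto
    have eq: "(P * W) $$ (i, j) = (\<Sum>l<N. (?R $$ (i, l) - a i * a l / q) * W $$ (l, j))"
      using ij W by (simp add: P_def scalar_prod_def lessThan_atLeast0)
    also have "\<dots> = (\<Sum>l<N. ?R $$ (i, l) * W $$ (l, j)) - a i / q * (\<Sum>l<N. a l * W $$ (l, j))"
      by (simp add: algebra_simps sum_subtractf sum_distrib_left)
    also have "\<dots> = 0"
    proof (cases j)
      case 0
      have "(\<Sum>l<N. a l * W $$ (l, 0)) = q" using aw by (simp add: w_def)
      moreover have "(\<Sum>l<N. ?R $$ (i, l) * W $$ (l, 0)) = a i" by (simp add: a_def pvec_def w_def)
      ultimately show ?thesis using 0 q by simp
    next
      case (Suc j')
      have "(\<Sum>l<N. f l * W $$ (l, j)) = (\<Sum>l<N. f l * V $$ (l, j'))" for f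
        using Suc ij by (intro sum.cong refl) (simp add: V_def)
      then show ?thesis using RV[of i j'] aV[of j'] Suc ij by simp
    qed
    finally show "(P * W) $$ (i, j) = 0\<^sub>m N (Suc k) $$ (i, j)" using ij by simp
  qed (use W Pc in auto)
  \<comment> \<open>1 - P = (1 - R) + a a^T / q, where 1 - R = V C and a = w - V (C w). Collecting
    the coefficients of \<open>w\<close> and of the columns of \<open>V\<close> gives the rows of
    \<open>B\<close>.\<close>
  define B where "B = Matrix.mat (Suc k) N (\<lambda>(l, j). case l of 0 \<Rightarrow> a j / q
     | Suc l \<Rightarrow> C $$ (l, j) - pvec N C w l * a j / q)"
  have "1\<^sub>m N - P = W * B"
  proof (rule eq_matI)
    fix i j assume "i < dim_row (W * B)" "j < dim_col (W * B)"
    then have ij: "i < N" "j < N" using W by (auto simp: B_def)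
    have "(W * B) $$ (i, j) = (\<Sum>l<Suc k. W $$ (i, l) * B $$ (l, j))"
      using ij W by (simp add: B_def scalar_prod_def lessThan_atLeast0)
    also have "\<dots> = w i * (a j / q) + (\<Sum>l<k. V $$ (i, l) * (C $$ (l, j) - pvec N C w l * a j / q))"
      using ij by (simp add: sum.lessThan_Suc_shift B_def w_def V_def del: sum.lessThan_Suc)
    also have "(\<Sum>l<k. V $$ (i, l) * (C $$ (l, j) - pvec N C w l * a j / q))
        = (\<Sum>l<k. V $$ (i, l) * C $$ (l, j)) - (\<Sum>l<k. V $$ (i, l) * pvec N C w l) * (a j / q)"
      by (simp add: algebra_simps sum_subtractf sum_distrib_left sum_distrib_right sum_divide_distrib)
    also have "w i * (a j / q) + ((\<Sum>l<k. V $$ (i, l) * C $$ (l, j)) - (\<Sum>l<k. V $$ (i, l) * pvec N C w l) * (a j / q))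
        = (if i = j then 1 else 0) - ?R $$ (i, j) + a i * a j / q"
      unfolding VC[OF ij, symmetric] wa[OF ij(1), symmetric] by (simp add: algebra_simps)
    finally show "(1\<^sub>m N - P) $$ (i, j) = (W * B) $$ (i, j)" using ij by (simp add: P_def)
  qed (use W in \<open>auto simp: P_def B_def\<close>)
  then have WP: "resid_mat W = P"
    by (intro resid_mat_unique[OF W det Pproj PW, of B]) (auto simp: B_def)
  have "bil N P f g = bil N ?R f g - (\<Sum>i<N. f i * a i) * (\<Sum>i<N. g i * a i) / q"
  proof -
    have "bil N P f g = (\<Sum>i<N. \<Sum>j<N. ?R $$ (i, j) * f i * g j) - (\<Sum>i<N. \<Sum>j<N. (f i * a i) * (g j * a j)) / q"
      unfolding bil_def P_def by (simp add: algebra_simps sum_subtractf sum_divide_distrib)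
    then show ?thesis unfolding bil_def sum_product .
  qed
  then show "bil N (resid_mat W) f g = bil N ?R f g - bil N ?R f w * bil N ?R g w / bil N ?R w w"
    unfolding WP q_def a_def bil_eq_pvec .
qed

lemma hat_mat_index:
  assumes Z: "Z \<in> carrier_mat N d" and ij: "i < N" "j < N"
  shows "hat_mat Z $$ (i, j) =
    (\<Sum>k<d. \<Sum>l<d. Z $$ (i, k) * inv_mat (transpose_mat Z * Z) $$ (k, l) * Z $$ (j, l))"
proof -
  define I where "I = inv_mat (transpose_mat Z * Z)"
  have I: "I \<in> carrier_mat d d" unfolding I_def by (rule inv_mat_carrier) (use Z in auto)
  have ZI: "Z * I \<in> carrier_mat N d" using Z I by auto
  have "hat_mat Z $$ (i, j) = (\<Sum>l<d. (Z * I) $$ (i, l) * Z $$ (j, l))"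
    unfolding hat_mat_def I_def[symmetric] using Z ZI ij
    by (simp add: scalar_prod_def lessThan_atLeast0 del: index_mult_mat(1) assoc_mult_mat)
      (subst index_mult_mat(1), auto simp: scalar_prod_def simp del: index_mult_mat(1))
  also have "\<dots> = (\<Sum>l<d. \<Sum>k<d. Z $$ (i, k) * I $$ (k, l) * Z $$ (j, l))"
    using Z I ij by (simp add: scalar_prod_def lessThan_atLeast0 sum_distrib_right)
  also have "\<dots> = (\<Sum>k<d. \<Sum>l<d. Z $$ (i, k) * I $$ (k, l) * Z $$ (j, l))" by (rule sum.swap)
  finally show ?thesis by (simp add: I_def)
qed

lemma resid_mat_index:
  assumes Z: "Z \<in> carrier_mat N d" and ij: "i < N" "j < N"
  shows "resid_mat Z $$ (i, j) = (if i = j then 1 else 0) -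
    (\<Sum>k<d. \<Sum>l<d. Z $$ (i, k) * inv_mat (transpose_mat Z * Z) $$ (k, l) * Z $$ (j, l))"
  unfolding hat_mat_index[OF assms, symmetric] resid_mat_def
  using Z hat_mat_carrier[OF Z] ij by simp

text \<open>A permutation of the rows leaves the Gram matrix unchanged and therefore only conjugates
  the projection. This is the source of the exchangeability of its diagonal.\<close>

lemma resid_mat_permute_rows:
  assumes \<pi>: "bij_betw \<pi> {..<N} {..<N}" and ij: "i < N" "j < N"
  shows "resid_mat (Matrix.mat N d (\<lambda>(i, j). F (\<pi> i) j)) $$ (i, j)
       = resid_mat (Matrix.mat N d (\<lambda>(i, j). F i j)) $$ (\<pi> i, \<pi> j)"
proof -
  let ?Z = "\<lambda>F. Matrix.mat N d (\<lambda>(i, j). F i j) :: real Matrix.mat"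
  have \<pi>ij: "\<pi> i < N" "\<pi> j < N" using \<pi> ij by (auto dest: bij_betwE)
  have inj: "(\<pi> i = \<pi> j) = (i = j)" using \<pi> ij by (auto simp: bij_betw_def inj_on_def)
  have "transpose_mat (?Z (\<lambda>i. F (\<pi> i))) * ?Z (\<lambda>i. F (\<pi> i)) = transpose_mat (?Z F) * ?Z F"
  proof (rule eq_matI)
    fix k l assume "k < dim_row (transpose_mat (?Z F) * ?Z F)" "l < dim_col (transpose_mat (?Z F) * ?Z F)"
    then show "(transpose_mat (?Z (\<lambda>i. F (\<pi> i))) * ?Z (\<lambda>i. F (\<pi> i))) $$ (k, l) = (transpose_mat (?Z F) * ?Z F) $$ (k, l)"
      using sum.reindex_bij_betw[OF \<pi>, of "\<lambda>i. F i k * F i l"]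
      by (simp add: scalar_prod_def lessThan_atLeast0)
  qed auto
  then show ?thesis
    using ij \<pi>ij inj by (simp add: resid_mat_index[where N = N and d = d])
qed

section \<open>Square roots of positive definite matrices\<close>

text \<open>Reflection in the hyperplane orthogonal to \<open>v\<close>. For \<open>v\<close> = 0
  the quotient is 0 and the matrix is the identity, so that \<open>householder_maps\<close> also
  covers equal vectors.\<close>

definition householder :: "nat \<Rightarrow> (nat \<Rightarrow> real) \<Rightarrow> real Matrix.mat" where
  "householder N v = Matrix.mat N N (\<lambda>(i, j). (if i = j then 1 else 0) - 2 / (\<Sum>k<N. (v k)\<^sup>2) * v i * v j)"

lemma householder_carrier: "householder N v \<in> carrier_mat N N"
  by (simp add: householder_def)

lemma householder_sym: "transpose_mat (householder N v) = householder N v"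
  by (rule eq_matI) (auto simp: householder_def)

lemma householder_pvec:
  "i < N \<Longrightarrow> pvec N (householder N v) x i = x i - 2 / (\<Sum>k<N. (v k)\<^sup>2) * (\<Sum>k<N. v k * x k) * v i"
proof -
  assume i: "i < N"
  let ?c = "2 / (\<Sum>k<N. (v k)\<^sup>2)"
  have "pvec N (householder N v) x i = (\<Sum>j<N. (if i = j then x j else 0) - ?c * v i * (v j * x j))"
    unfolding pvec_def using i by (intro sum.cong refl) (simp add: householder_def algebra_simps)
  also have "\<dots> = x i - ?c * v i * (\<Sum>j<N. v j * x j)"
    unfolding sum_subtractf sum_distrib_left using i by simp
  finally show ?thesis by simp
qed

text \<open>For |x| = |y| one has |x - y|^2 = 2 <x - y, x>, so the reflection subtracts exactly x -
  y from x.\<close>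

lemma householder_maps:
  assumes "(\<Sum>k<N. (x k)\<^sup>2) = (\<Sum>k<N. (y k)\<^sup>2)" "i < N"
  shows "pvec N (householder N (\<lambda>k. x k - y k)) x i = y i"
proof -
  let ?v = "\<lambda>k. x k - y k"
  let ?n = "\<Sum>k<N. (?v k)\<^sup>2"
  have n: "?n = 2 * (\<Sum>k<N. ?v k * x k)"
    using assms(1) by (simp add: power2_eq_square algebra_simps sum.distrib sum_subtractf sum_distrib_left)
  show ?thesis
  proof (cases "?n = 0")
    case True
    then have "\<forall>k\<in>{..<N}. (?v k)\<^sup>2 = 0" by (subst (asm) sum_nonneg_eq_0_iff) auto
    then have "x i = y i" using assms(2) by auto
    then show ?thesis using assms(2) True by (simp add: householder_pvec)
  next
    case False
    then have "2 / ?n * (\<Sum>k<N. ?v k * x k) = 1" using n by simp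
    then show ?thesis using assms(2) by (simp add: householder_pvec del: times_divide_eq_left)
  qed
qed

lemma householder_square: "householder N v * householder N v = 1\<^sub>m N"
proof (rule eq_matI)
  fix i j assume "i < dim_row (1\<^sub>m N :: real Matrix.mat)" "j < dim_col (1\<^sub>m N :: real Matrix.mat)"
  then have ij: "i < N" "j < N" by auto
  let ?n = "\<Sum>k<N. (v k)\<^sup>2"
  have "(householder N v * householder N v) $$ (i, j) = pvec N (householder N v) (\<lambda>k. householder N v $$ (k, j)) i"
    using ij by (simp add: pvec_def scalar_prod_def lessThan_atLeast0 householder_def)
  also have "\<dots> = householder N v $$ (i, j) - 2 / ?n * (\<Sum>k<N. v k * householder N v $$ (k, j)) * v i"
    by (rule householder_pvec[OF ij(1)])
  also have "(\<Sum>k<N. v k * householder N v $$ (k, j)) = v j - 2 / ?n * ?n * v j"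
    using ij by (simp add: householder_def right_diff_distrib sum_subtractf sum_distrib_left sum_distrib_right
        sum_divide_distrib power2_eq_square mult_ac if_distrib[of "\<lambda>c. c * _"] if_distrib[of "\<lambda>c. _ * c"] cong: if_cong)
  finally show "(householder N v * householder N v) $$ (i, j) = 1\<^sub>m N $$ (i, j)"
    using ij by (cases "?n = 0") (auto simp: householder_def algebra_simps)
qed (auto simp: householder_def)

text \<open>Induction by Schur complements: the pivot \<open>S 0 0\<close> supplies the leading row
  and column of the factor, and the induction hypothesis factors the complement
  \<open>S'\<close>.\<close>

lemma cholesky:
  fixes S :: "nat \<Rightarrow> nat \<Rightarrow> real"
  assumes "\<And>i j. i < d \<Longrightarrow> j < d \<Longrightarrow> S i j = S j i"
    and "\<And>v. \<exists>i<d. v i \<noteq> 0 \<Longrightarrow> (\<Sum>i<d. \<Sum>j<d. S i j * v i * v j) > 0"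
  shows "\<exists>A. \<forall>i<d. \<forall>j<d. (\<Sum>k<d. A i k * A j k) = S i j"
  using assms
proof (induction d arbitrary: S)
  case 0
  then show ?case by simp
next
  case (Suc d)
  define a where "a = S 0 0"
  have split: "(\<Sum>i<Suc d. \<Sum>j<Suc d. S i j * v i * v j) = a * v 0 * v 0
     + 2 * v 0 * (\<Sum>j<d. S (Suc j) 0 * v (Suc j)) + (\<Sum>i<d. \<Sum>j<d. S (Suc i) (Suc j) * v (Suc i) * v (Suc j))" for v
  proof -
    have "(\<Sum>j<d. S 0 (Suc j) * v 0 * v (Suc j)) = (\<Sum>j<d. S (Suc j) 0 * v 0 * v (Suc j))"
      by (intro sum.cong refl) (simp add: Suc.prems(1)[of 0])
    then show ?thesis
      by (simp add: sum.lessThan_Suc_shift a_def sum.distrib sum_distrib_left sum_distrib_right mult_ac del: sum.lessThan_Suc)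
  qed
  have a: "a > 0"
    using Suc.prems(2)[of "\<lambda>i. if i = 0 then 1 else 0"] unfolding split by auto
  define S' where "S' = (\<lambda>i j. S (Suc i) (Suc j) - S (Suc i) 0 * S (Suc j) 0 / a)"
  have "\<exists>A. \<forall>i<d. \<forall>j<d. (\<Sum>k<d. A i k * A j k) = S' i j"
  proof (rule Suc.IH)
    show "S' i j = S' j i" if "i < d" "j < d" for i j
      using Suc.prems(1)[of "Suc i" "Suc j"] that by (simp add: S'_def)
    fix v :: "nat \<Rightarrow> real" assume ex: "\<exists>i<d. v i \<noteq> 0"
    define t where "t = (\<Sum>j<d. S (Suc j) 0 * v j)"
    \<comment> \<open>The entry \<open>- t / a\<close> minimises the form over the leading
      coordinate. The minimum is the form of \<open>S'\<close> at \<open>v\<close>, which is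
      therefore positive.\<close>
    let ?u = "\<lambda>i. case i of 0 \<Rightarrow> - t / a | Suc i \<Rightarrow> v i"
    have "0 < (\<Sum>i<Suc d. \<Sum>j<Suc d. S i j * ?u i * ?u j)"
    proof (rule Suc.prems(2))
      obtain i where "i < d" "v i \<noteq> 0" using ex by auto
      then show "\<exists>i<Suc d. ?u i \<noteq> 0" by (intro exI[of _ "Suc i"]) simp
    qed
    also have "\<dots> = (\<Sum>i<d. \<Sum>j<d. S (Suc i) (Suc j) * v i * v j) - t * t / a"
      unfolding split nat.case t_def[symmetric] using a by (simp add: field_simps)
    also have "t * t / a = (\<Sum>i<d. \<Sum>j<d. S (Suc i) 0 * v i * (S (Suc j) 0 * v j)) / a"
      unfolding t_def sum_product ..
    finally show "0 < (\<Sum>i<d. \<Sum>j<d. S' i j * v i * v j)"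
      by (simp add: S'_def algebra_simps sum_subtractf sum_divide_distrib)
  qed
  then obtain A where A: "\<And>i j. i < d \<Longrightarrow> j < d \<Longrightarrow> (\<Sum>k<d. A i k * A j k) = S' i j" by auto
  let ?B = "\<lambda>i k. case i of 0 \<Rightarrow> (case k of 0 \<Rightarrow> sqrt a | Suc k \<Rightarrow> 0)
      | Suc i \<Rightarrow> (case k of 0 \<Rightarrow> S (Suc i) 0 / sqrt a | Suc k \<Rightarrow> A i k)"
  have "(\<Sum>k<Suc d. ?B i k * ?B j k) = S i j" if ij: "i < Suc d" "j < Suc d" for i j
  proof -
    have eq: "(\<Sum>k<Suc d. ?B i k * ?B j k) = ?B i 0 * ?B j 0 + (\<Sum>k<d. ?B i (Suc k) * ?B j (Suc k))"
      by (simp add: sum.lessThan_Suc_shift del: sum.lessThan_Suc)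
    show ?thesis
    proof (cases i)
      case 0
      then show ?thesis unfolding eq using a ij Suc.prems(1)[of 0 j]
        by (cases j) (auto simp: a_def)
    next
      case (Suc i')
      show ?thesis
      proof (cases j)
        case 0
        then show ?thesis unfolding eq using Suc a by (auto simp: a_def)
      next
        case (Suc j')
        then show ?thesis unfolding eq using \<open>i = Suc i'\<close> a ij A[of i' j'] by (simp add: S'_def)
      qed
    qed
  qed
  then show ?case by (intro exI[of _ ?B]) blast
qed

lemma quad_form_sum:
  assumes "A \<in> carrier_mat d d" "v \<in> carrier_vec d"
  shows "quad_form A v = (\<Sum>i<d. \<Sum>j<d. A $$ (i, j) * vec_index v i * vec_index v j)"
  using assms by (simp add: quad_form_def scalar_prod_def lessThan_atLeast0 sum_distrib_left mult_ac)

text \<open>The square root is chosen so that the given direction is read off the first coordinate.\<close>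

lemma aligned_square_root:
  assumes S: "pos_def_mat d S" and t: "t \<in> carrier_vec d" and d: "d > 0"
  obtains A where "A \<in> carrier_mat d d" "A * transpose_mat A = S" "Determinant.det A \<noteq> 0"
    "transpose_mat A *\<^sub>v t = Matrix.vec d (\<lambda>i. if i = 0 then sqrt (quad_form S t) else 0)"
proof -
  have Sc: "S \<in> carrier_mat d d" "transpose_mat S = S"
    and pos: "\<And>v. v \<in> carrier_vec d \<Longrightarrow> v \<noteq> 0\<^sub>v d \<Longrightarrow> quad_form S v > 0"
    using S by (auto simp: pos_def_mat_def)
  have "\<exists>A. \<forall>i<d. \<forall>j<d. (\<Sum>k<d. A i k * A j k) = S $$ (i, j)"
  proof (rule cholesky)
    show "S $$ (i, j) = S $$ (j, i)" if "i < d" "j < d" for i j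
      using Sc that by (metis carrier_matD index_transpose_mat(1))
    fix v :: "nat \<Rightarrow> real" assume "\<exists>i<d. v i \<noteq> 0"
    then obtain i where i: "i < d" "v i \<noteq> 0" by auto
    then have "vec_index (Matrix.vec d v) i \<noteq> vec_index (0\<^sub>v d) i" by simp
    then have "Matrix.vec d v \<noteq> 0\<^sub>v d" by metis
    from pos[OF _ this] show "0 < (\<Sum>i<d. \<Sum>j<d. S $$ (i, j) * v i * v j)"
      by (simp add: quad_form_sum[OF Sc(1)])
  qed
  then obtain a where a: "\<And>i j. i < d \<Longrightarrow> j < d \<Longrightarrow> (\<Sum>k<d. a i k * a j k) = S $$ (i, j)" by auto
  define A0 where "A0 = Matrix.mat d d (\<lambda>(i, k). a i k)"
  have A0: "A0 \<in> carrier_mat d d" by (simp add: A0_def)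
  have A0S: "A0 * transpose_mat A0 = S"
    using Sc a by (intro eq_matI) (auto simp: A0_def scalar_prod_def lessThan_atLeast0)
  define y where "y = (\<lambda>i. vec_index (transpose_mat A0 *\<^sub>v t) i)"
  let ?e = "\<lambda>i. if i = 0 then sqrt (quad_form S t) else 0 :: real"
  have yc: "transpose_mat A0 *\<^sub>v t \<in> carrier_vec d" using A0 t by auto
  have "quad_form S t = scalar_prod t (A0 *\<^sub>v (transpose_mat A0 *\<^sub>v t))"
    unfolding quad_form_def A0S[symmetric] using assoc_mult_mat_vec[OF A0, of "transpose_mat A0" d t] A0 t by simp
  also have "\<dots> = scalar_prod (transpose_mat A0 *\<^sub>v t) (transpose_mat A0 *\<^sub>v t)"
    using transpose_vec_mult_scalar[OF A0 yc t] by simp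
  finally have qy: "quad_form S t = (\<Sum>i<d. (y i)\<^sup>2)"
    using yc A0 by (simp add: scalar_prod_def y_def lessThan_atLeast0 power2_eq_square del: index_mult_mat_vec)
  have "0 \<le> quad_form S t" unfolding qy by (intro sum_nonneg) simp
  then have norm: "(\<Sum>i<d. (y i)\<^sup>2) = (\<Sum>i<d. (?e i)\<^sup>2)"
    using d qy by (simp add: if_distrib[of "\<lambda>c. c\<^sup>2"] cong: if_cong)
  \<comment> \<open>\<open>Q\<close> reflects A0^T t onto its length times the leading unit vector.
    Since \<open>Q\<close> is orthogonal, \<open>A0 * Q\<close> is still a square root of
    \<open>S\<close>.\<close>
  define Q where "Q = householder d (\<lambda>k. y k - ?e k)"
  have Q: "Q \<in> carrier_mat d d" "transpose_mat Q = Q" "Q * Q = 1\<^sub>m d"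
    unfolding Q_def by (rule householder_carrier householder_sym householder_square)+
  show ?thesis
  proof (rule that)
    show A: "A0 * Q \<in> carrier_mat d d" using A0 Q by auto
    have AT: "transpose_mat (A0 * Q) = Q * transpose_mat A0"
      using transpose_mult[OF A0 Q(1)] Q(2) by simp
    have "A0 * Q * (Q * transpose_mat A0) = A0 * (Q * (Q * transpose_mat A0))"
      by (rule assoc_mult_mat) (use A0 Q in auto)
    also have "Q * (Q * transpose_mat A0) = Q * Q * transpose_mat A0"
      by (rule assoc_mult_mat[symmetric]) (use A0 Q in auto)
    finally show eq: "A0 * Q * transpose_mat (A0 * Q) = S" using AT Q A0 A0S by simp
    have "Determinant.det S \<noteq> 0"
    proof
      assume "Determinant.det S = 0"
      then obtain v where v: "v \<in> carrier_vec d" "v \<noteq> 0\<^sub>v d" "S *\<^sub>v v = 0\<^sub>v d"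
        using det_0_iff_vec_prod_zero[OF Sc(1)] by auto
      then show False using pos[OF v(1,2)] by (simp add: quad_form_def)
    qed
    then show "Determinant.det (A0 * Q) \<noteq> 0"
      unfolding eq[symmetric] using det_mult[OF A, of "transpose_mat (A0 * Q)"] A by auto
    show "transpose_mat (A0 * Q) *\<^sub>v t = Matrix.vec d ?e"
    proof (rule eq_vecI)
      fix i assume "i < dim_vec (Matrix.vec d ?e)"
      then have i: "i < d" by simp
      have "transpose_mat (A0 * Q) *\<^sub>v t = Q *\<^sub>v Matrix.vec d y"
      proof -
        have "Matrix.vec d y = transpose_mat A0 *\<^sub>v t" 
        proof -
          have "Matrix.vec d (vec_index v) = v" if "v \<in> carrier_vec d" for v :: "real Matrix.vec"
            using that by (intro eq_vecI) auto
          from this[OF yc] show ?thesis by (simp add: y_def)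
        qed
        then show ?thesis unfolding AT using assoc_mult_mat_vec[OF Q(1), of "transpose_mat A0" d t] A0 t by simp
      qed
      then have "vec_index (transpose_mat (A0 * Q) *\<^sub>v t) i = pvec d Q y i"
        using mat_vec_index[OF Q(1) i] by simp
      also have "\<dots> = ?e i" unfolding Q_def by (rule householder_maps[OF norm i])
      finally show "vec_index (transpose_mat (A0 * Q) *\<^sub>v t) i = vec_index (Matrix.vec d ?e) i" using i by simp
    qed (use A in auto)
  qed
qed

section \<open>Gaussian vectors and arrays\<close>

text \<open>The index set is arbitrary, so that vectors, indexed by \<open>{..<N}\<close>, and
  arrays, indexed by pairs, are instances of one definition.\<close>

definition gauss :: "'i set \<Rightarrow> ('i \<Rightarrow> real) measure" where
  "gauss I = PiM I (\<lambda>_. std_normal_distribution)"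

lemma prob_space_std_normal: "prob_space std_normal_distribution"
  by (rule prob_space_normal_density) simp

interpretation std_normal: prob_space std_normal_distribution
  by (rule prob_space_std_normal)

interpretation std_normal_prod: product_prob_space "\<lambda>_. std_normal_distribution" UNIV
  by unfold_locales

interpretation gauss: prob_space "gauss I" for I :: "'i set"
  unfolding gauss_def by (intro prob_space_PiM prob_space_std_normal)

lemma sets_gauss[measurable_cong]: "sets (gauss I) = sets (PiM I (\<lambda>_. borel))"
  unfolding gauss_def by (intro sets_PiM_cong) auto

lemma space_gauss: "space (gauss I) = (\<Pi>\<^sub>E i\<in>I. UNIV)"
  by (simp add: gauss_def space_PiM)

lemma gauss_coordinate: "i \<in> I \<Longrightarrow> distr (gauss I) borel (\<lambda>x. x i) = std_normal_distribution"
proof -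
  assume i: "i \<in> I"
  have "distr (gauss I) borel (\<lambda>x. x i) = distr (gauss I) std_normal_distribution (\<lambda>x. x i)"
    by (intro distr_cong) auto
  also have "\<dots> = std_normal_distribution"
    unfolding gauss_def by (rule distr_PiM_component[OF prob_space_std_normal i])
  finally show ?thesis .
qed

section \<open>Moments of Gaussian vectors and second-moment concentration\<close>

definition normal_moment :: "nat \<Rightarrow> real" where
  "normal_moment k = (\<integral>x. x ^ k \<partial>std_normal_distribution)"

lemma normal_moment_integrable: "integrable std_normal_distribution (\<lambda>x. x ^ k)"
  by (subst integrable_real_density) (auto intro: integrable_std_normal_moment)

lemma normal_moment_eq: "normal_moment k = (\<integral>x. std_normal_density x * x ^ k \<partial>lborel)"
  unfolding normal_moment_def by (subst integral_real_density) auto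

lemma normal_moment_even: "normal_moment (2 * k) = fact (2 * k) / (2 ^ k * fact k)"
  unfolding normal_moment_eq by (rule integral_std_normal_moment_even)

lemma normal_moment_odd: "odd k \<Longrightarrow> normal_moment k = 0"
  unfolding normal_moment_eq using integral_std_normal_moment_odd[of "k div 2"]
  by (metis odd_two_times_div_two_succ)

lemma normal_moment_simps: "normal_moment 0 = 1" "normal_moment 2 = 1" "normal_moment 4 = 3"
  using normal_moment_even[of 0] normal_moment_even[of 1] normal_moment_even[of 2]
  by (simp_all add: fact_numeral)

lemma normal_moment_4: "normal_moment (Suc (Suc (Suc (Suc 0)))) = 3"
  using normal_moment_simps(3) by (simp add: eval_nat_numeral)

lemma gauss_moment:
  assumes "finite I"
  shows "has_bochner_integral (gauss I) (\<lambda>x. \<Prod>i\<in>I. x i ^ k i) (\<Prod>i\<in>I. normal_moment (k i))"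
  unfolding has_bochner_integral_iff gauss_def normal_moment_def
  using std_normal_prod.product_integrable_prod[OF assms, of "\<lambda>i x. x ^ k i"]
    std_normal_prod.product_integral_prod[OF assms, of "\<lambda>i x. x ^ k i"] normal_moment_integrable
  by auto

definition delta :: "'i \<Rightarrow> 'i \<Rightarrow> real" where
  "delta i j = (if i = j then 1 else 0)"

lemma gauss_isserlis4:
  assumes I: "finite I" "i \<in> I" "j \<in> I" "k \<in> I" "l \<in> I"
  shows "has_bochner_integral (gauss I) (\<lambda>x. x i * x j * (x k * x l))
    (delta i j * delta k l + delta i k * delta j l + delta i l * delta j k)"
proof -
  define e :: "'a \<Rightarrow> 'a \<Rightarrow> nat" where "e = (\<lambda>i a. if a = i then 1 else 0)"
  \<comment> \<open>\<open>c a\<close> counts the occurrences of \<open>a\<close> among the four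
    indices, which turns the product into one monomial.\<close>
  define c where "c = (\<lambda>a. (e i a + e j a) + (e k a + e l a))"
  have pow: "(\<Prod>a\<in>I. x a ^ e i a) = x i" if "i \<in> I" for i and x :: "'a \<Rightarrow> real"
    unfolding e_def using that I by (simp add: if_distrib[of "\<lambda>n. _ ^ n"] cong: if_cong)
  have mono: "(\<lambda>x. x i * x j * (x k * x l)) = (\<lambda>x::'a \<Rightarrow> real. \<Prod>a\<in>I. x a ^ c a)"
    unfolding c_def power_add prod.distrib using I by (simp add: pow)
  have val: "(\<Prod>a\<in>I. normal_moment (c a)) = delta i j * delta k l + delta i k * delta j l + delta i l * delta j k"
  proof -
    have odd0: "(\<Prod>a\<in>I. normal_moment (c a)) = 0" if "a \<in> I" "odd (c a)" for a
      using that I(1) normal_moment_odd by (intro prod_zero) auto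
    have even1: "(\<Prod>a\<in>I. normal_moment (c a)) = 1" if "\<And>a. a \<in> I \<Longrightarrow> c a = 0 \<or> c a = 2"
      using that by (intro prod.neutral ballI) (metis normal_moment_simps(1,2))
    \<comment> \<open>Unless some index occurs an odd number of times, the indices match in pairs;
      only four equal indices produce the fourth moment 3.\<close>
    consider (all) "i = j" "j = k" "k = l" | (ij) "i = j" "k = l" "i \<noteq> k" | (ik) "i = k" "j = l" "i \<noteq> j"
      | (il) "i = l" "j = k" "i \<noteq> j"
      | (odd) a where "a \<in> I" "odd (c a)" "\<not> (i = j \<and> k = l)" "\<not> (i = k \<and> j = l)" "\<not> (i = l \<and> j = k)"
    proof -
      have "(i = j \<and> k = l) \<or> (i = k \<and> j = l) \<or> (i = l \<and> j = k) \<or>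
        (odd (c i) \<or> odd (c j) \<or> odd (c k) \<or> odd (c l))"
        unfolding c_def e_def by auto
      then show ?thesis using that I by metis
    qed
    then show ?thesis
    proof cases
      case all
      then have "(\<Prod>a\<in>I. normal_moment (c a)) = (\<Prod>a\<in>I. if a = i then 3 else 1)"
        by (intro prod.cong refl) (auto simp: c_def e_def normal_moment_simps normal_moment_4)
      also have "\<dots> = 3" using I by simp
      finally show ?thesis using all by (simp add: delta_def)
    next
      case ij
      then have "(\<Prod>a\<in>I. normal_moment (c a)) = 1" by (intro even1) (auto simp: c_def e_def)
      then show ?thesis using ij by (simp add: delta_def)
    next
      case ik
      then have "(\<Prod>a\<in>I. normal_moment (c a)) = 1" by (intro even1) (auto simp: c_def e_def)
      then show ?thesis using ik by (simp add: delta_def)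
    next
      case il
      then have "(\<Prod>a\<in>I. normal_moment (c a)) = 1" by (intro even1) (auto simp: c_def e_def)
      then show ?thesis using il by (simp add: delta_def)
    next
      case odd
      then have "(\<Prod>a\<in>I. normal_moment (c a)) = 0" by (intro odd0)
      then show ?thesis using odd by (auto simp: delta_def)
    qed
  qed
  show ?thesis unfolding mono val[symmetric] by (rule gauss_moment[OF I(1)])
qed

lemma gauss_isserlis2:
  assumes I: "finite I" "i \<in> I" "j \<in> I"
  shows "has_bochner_integral (gauss I) (\<lambda>x. x i * x j) (delta i j)"
proof -
  define e :: "'a \<Rightarrow> 'a \<Rightarrow> nat" where "e = (\<lambda>i a. if a = i then 1 else 0)"
  define c where "c = (\<lambda>a. e i a + e j a)"
  have pow: "(\<Prod>a\<in>I. x a ^ e i a) = x i" if "i \<in> I" for i and x :: "'a \<Rightarrow> real"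
    unfolding e_def using that I by (simp add: if_distrib[of "\<lambda>n. _ ^ n"] cong: if_cong)
  have mono: "(\<lambda>x. x i * x j) = (\<lambda>x::'a \<Rightarrow> real. \<Prod>a\<in>I. x a ^ c a)"
    unfolding c_def power_add prod.distrib using I by (simp add: pow)
  have val: "(\<Prod>a\<in>I. normal_moment (c a)) = delta i j"
  proof (cases "i = j")
    case True
    then have "(\<Prod>a\<in>I. normal_moment (c a)) = 1"
      by (intro prod.neutral) (auto simp: c_def e_def normal_moment_simps numeral_2_eq_2[symmetric])
    then show ?thesis using True by (simp add: delta_def)
  next
    case False
    then have "odd (c i)" by (simp add: c_def e_def)
    then have "(\<Prod>a\<in>I. normal_moment (c a)) = 0"
      using I normal_moment_odd by (intro prod_zero) auto
    then show ?thesis using False by (simp add: delta_def)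
  qed
  show ?thesis unfolding mono val[symmetric] by (rule gauss_moment[OF I(1)])
qed

lemma chebyshev_measure:
  assumes "prob_space M" and f: "has_bochner_integral M (\<lambda>x. (f x)\<^sup>2) v" and v: "v \<le> b" and \<delta>: "(\<delta>::real) > 0"
  shows "measure M {x \<in> space M. \<bar>f x\<bar> \<ge> \<delta>} \<le> b / \<delta>\<^sup>2"
proof -
  have "{x \<in> space M. \<bar>f x\<bar> \<ge> \<delta>} = {x \<in> space M. (f x)\<^sup>2 \<ge> \<delta>\<^sup>2}"
    using \<delta> by (metis abs_le_square_iff abs_of_pos)
  also have "measure M \<dots> \<le> (\<integral>x. (f x)\<^sup>2 \<partial>M) / \<delta>\<^sup>2"
    using f \<delta> by (intro integral_Markov_inequality_measure[where A = "space M"]) (auto simp: has_bochner_integral_iff)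
  also have "\<dots> \<le> b / \<delta>\<^sup>2" using f v \<delta> by (intro divide_right_mono) (auto simp: has_bochner_integral_iff)
  finally show ?thesis .
qed

text \<open>The square is expanded and Isserlis' formula applied to the centred products.
  \<open>B\<close> may be asymmetric, as truncations of different lengths on the two sides will make
  it; this is why two sums appear.\<close>

lemma gauss_quadratic_variance:
  assumes I: "finite I"
  shows "has_bochner_integral (gauss I) (\<lambda>x. ((\<Sum>i\<in>I. \<Sum>j\<in>I. B i j * x i * x j) - (\<Sum>i\<in>I. B i i))\<^sup>2)
    ((\<Sum>i\<in>I. \<Sum>j\<in>I. (B i j)\<^sup>2) + (\<Sum>i\<in>I. \<Sum>j\<in>I. B i j * B j i))"
proof -
  have tr: "(\<Sum>i\<in>I. B i i) = (\<Sum>i\<in>I. \<Sum>j\<in>I. B i j * delta i j)"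
    using I by (intro sum.cong refl) (simp add: delta_def if_distrib[of "\<lambda>c. _ * c"] cong: if_cong)
  have sq: "((\<Sum>i\<in>I. \<Sum>j\<in>I. B i j * x i * x j) - (\<Sum>i\<in>I. B i i))\<^sup>2
    = (\<Sum>i\<in>I. \<Sum>j\<in>I. \<Sum>k\<in>I. \<Sum>l\<in>I. B i j * B k l * ((x i * x j - delta i j) * (x k * x l - delta k l)))" for x
  proof -
    have "(\<Sum>i\<in>I. \<Sum>j\<in>I. B i j * x i * x j) - (\<Sum>i\<in>I. B i i) = (\<Sum>i\<in>I. \<Sum>j\<in>I. B i j * (x i * x j - delta i j))"
      unfolding tr by (simp add: sum_subtractf[symmetric] algebra_simps)
    then have "((\<Sum>i\<in>I. \<Sum>j\<in>I. B i j * x i * x j) - (\<Sum>i\<in>I. B i i))\<^sup>2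
      = (\<Sum>i\<in>I. \<Sum>j\<in>I. (B i j * (x i * x j - delta i j)) * (\<Sum>k\<in>I. \<Sum>l\<in>I. B k l * (x k * x l - delta k l)))"
      unfolding power2_eq_square by (simp only: sum_distrib_right)
    also have "\<dots> = (\<Sum>i\<in>I. \<Sum>j\<in>I. \<Sum>k\<in>I. \<Sum>l\<in>I. (B i j * (x i * x j - delta i j)) * (B k l * (x k * x l - delta k l)))"
      by (simp only: sum_distrib_left)
    finally show ?thesis by (simp add: mult_ac)
  qed
  have cov: "has_bochner_integral (gauss I) (\<lambda>x. (x i * x j - delta i j) * (x k * x l - delta k l))
      (delta i k * delta j l + delta i l * delta j k)"
    if "i \<in> I" "j \<in> I" "k \<in> I" "l \<in> I" for i j k l
  proof -
    have "has_bochner_integral (gauss I)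
      (\<lambda>x. x i * x j * (x k * x l) - delta k l * (x i * x j) - delta i j * (x k * x l) + delta i j * delta k l)
      ((delta i j * delta k l + delta i k * delta j l + delta i l * delta j k) - delta k l * delta i j
        - delta i j * delta k l + delta i j * delta k l)"
      using that I gauss.prob_space
      by (intro has_bochner_integral_add has_bochner_integral_diff has_bochner_integral_mult_right
          gauss_isserlis4 gauss_isserlis2)
        (auto simp: has_bochner_integral_iff)
    then show ?thesis by (simp add: algebra_simps)
  qed
  have "has_bochner_integral (gauss I)
     (\<lambda>x. \<Sum>i\<in>I. \<Sum>j\<in>I. \<Sum>k\<in>I. \<Sum>l\<in>I. B i j * B k l * ((x i * x j - delta i j) * (x k * x l - delta k l)))
     (\<Sum>i\<in>I. \<Sum>j\<in>I. \<Sum>k\<in>I. \<Sum>l\<in>I. B i j * B k l * (delta i k * delta j l + delta i l * delta j k))"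
    by (intro has_bochner_integral_sum has_bochner_integral_mult_right cov)
  moreover have "(\<Sum>i\<in>I. \<Sum>j\<in>I. \<Sum>k\<in>I. \<Sum>l\<in>I. B i j * B k l * (delta i k * delta j l + delta i l * delta j k))
     = (\<Sum>i\<in>I. \<Sum>j\<in>I. (B i j)\<^sup>2) + (\<Sum>i\<in>I. \<Sum>j\<in>I. B i j * B j i)"
  proof -
    have "(\<Sum>k\<in>I. \<Sum>l\<in>I. B i j * B k l * (delta i k * delta j l + delta i l * delta j k)) = (B i j)\<^sup>2 + B i j * B j i"
      if "i \<in> I" "j \<in> I" for i j
    proof -
      have "(\<Sum>k\<in>I. \<Sum>l\<in>I. B i j * B k l * (delta i k * delta j l)) =
          (\<Sum>k\<in>I. if k = i then (\<Sum>l\<in>I. if l = j then B i j * B k l else 0) else 0)"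
        by (intro sum.cong refl) (auto simp: delta_def intro!: sum.cong)
      moreover have "(\<Sum>k\<in>I. \<Sum>l\<in>I. B i j * B k l * (delta i l * delta j k)) =
          (\<Sum>k\<in>I. if k = j then (\<Sum>l\<in>I. if l = i then B i j * B k l else 0) else 0)"
        by (intro sum.cong refl) (auto simp: delta_def intro!: sum.cong)
      ultimately show ?thesis
        using that I by (simp add: distrib_left sum.distrib power2_eq_square)
    qed
    then show ?thesis by (simp add: sum.distrib)
  qed
  ultimately show ?thesis unfolding sq by simp
qed

lemma gauss_quadratic_concentration:
  assumes I: "finite I" and b: "(\<Sum>i\<in>I. \<Sum>j\<in>I. (B i j)\<^sup>2) \<le> b" and \<delta>: "\<delta> > 0"
  shows "measure (gauss I) {x \<in> space (gauss I).
    \<bar>(\<Sum>i\<in>I. \<Sum>j\<in>I. B i j * x i * x j) - (\<Sum>i\<in>I. B i i)\<bar> \<ge> \<delta>} \<le> 2 * b / \<delta>\<^sup>2"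
proof (rule chebyshev_measure[OF gauss.prob_space_axioms gauss_quadratic_variance[OF I] _ \<delta>])
  \<comment> \<open>The mixed sum is at most the squared Frobenius norm, by the inequality between
    arithmetic and geometric mean.\<close>
  have "B i j * B j i \<le> ((B i j)\<^sup>2 + (B j i)\<^sup>2) / 2" for i j
    using sum_squares_bound[of "B i j" "B j i"] by simp
  then have "(\<Sum>i\<in>I. \<Sum>j\<in>I. B i j * B j i) \<le> (\<Sum>i\<in>I. \<Sum>j\<in>I. ((B i j)\<^sup>2 + (B j i)\<^sup>2) / 2)"
    by (intro sum_mono) auto
  also have "\<dots> = (\<Sum>i\<in>I. \<Sum>j\<in>I. (B i j)\<^sup>2)"
    using sum.swap[of "\<lambda>i j. (B i j)\<^sup>2" I I]
    by (simp add: sum_divide_distrib[symmetric] sum.distrib)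
  finally show "(\<Sum>i\<in>I. \<Sum>j\<in>I. (B i j)\<^sup>2) + (\<Sum>i\<in>I. \<Sum>j\<in>I. B i j * B j i) \<le> 2 * b" using b by simp
qed

lemma gauss_linear_concentration:
  assumes I: "finite I" and b: "(\<Sum>i\<in>I. (c i)\<^sup>2) \<le> b" and \<delta>: "\<delta> > 0"
  shows "measure (gauss I) {x \<in> space (gauss I). \<bar>\<Sum>i\<in>I. c i * x i\<bar> \<ge> \<delta>} \<le> b / \<delta>\<^sup>2"
proof (rule chebyshev_measure[OF gauss.prob_space_axioms _ b \<delta>])
  have "has_bochner_integral (gauss I) (\<lambda>x. \<Sum>i\<in>I. \<Sum>j\<in>I. c i * c j * (x i * x j)) (\<Sum>i\<in>I. \<Sum>j\<in>I. c i * c j * delta i j)"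
    using I by (intro has_bochner_integral_sum has_bochner_integral_mult_right gauss_isserlis2)
  moreover have "(\<Sum>i\<in>I. \<Sum>j\<in>I. c i * c j * delta i j) = (\<Sum>i\<in>I. (c i)\<^sup>2)"
    using I by (intro sum.cong refl) (simp add: delta_def power2_eq_square if_distrib[of "\<lambda>c. _ * c"] cong: if_cong)
  moreover have "(\<Sum>i\<in>I. \<Sum>j\<in>I. c i * c j * (x i * x j)) = (\<Sum>i\<in>I. c i * x i)\<^sup>2" for x
    by (simp add: power2_eq_square sum_product mult_ac)
  ultimately show "has_bochner_integral (gauss I) (\<lambda>x. (\<Sum>i\<in>I. c i * x i)\<^sup>2) (\<Sum>i\<in>I. (c i)\<^sup>2)" by simp
qed

lemma gauss_indep_coordinates:
  assumes "I \<noteq> {}"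
  shows "gauss.indep_vars I (\<lambda>_. borel) (\<lambda>i x. x i) I"
proof (subst gauss.indep_vars_iff_distr_eq_PiM'[OF assms])
  have "distr (gauss I) (\<Pi>\<^sub>M i\<in>I. borel) (\<lambda>x. \<lambda>i\<in>I. x i) = distr (gauss I) (gauss I) (\<lambda>x. x)"
    by (intro distr_cong) (auto simp: sets_gauss space_gauss PiE_restrict)
  also have "\<dots> = (\<Pi>\<^sub>M i\<in>I. distr (gauss I) borel (\<lambda>x. x i))"
  proof -
    have "(\<Pi>\<^sub>M i\<in>I. distr (gauss I) borel (\<lambda>x. x i)) = gauss I"
      unfolding gauss_def[of I] by (intro PiM_cong refl) (simp add: gauss_coordinate[unfolded gauss_def])
    then show ?thesis by (simp add: distr_id)
  qed
  finally show "distr (gauss I) (\<Pi>\<^sub>M i\<in>I. borel) (\<lambda>x. \<lambda>i\<in>I. x i) = (\<Pi>\<^sub>M i\<in>I. distr (gauss I) borel (\<lambda>x. x i))" .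
qed measurable

lemma gauss_linear_law:
  assumes I: "finite I" and c: "(\<Sum>i\<in>I. (c i)\<^sup>2) = 1"
  shows "distr (gauss I) borel (\<lambda>x. \<Sum>i\<in>I. c i * x i) = std_normal_distribution"
proof -
  \<comment> \<open>\<open>sum_indep_normal\<close> asks for positive standard deviations, so the
    zero coefficients are dropped.\<close>
  define J where "J = {i\<in>I. c i \<noteq> 0}"
  have J: "finite J" "J \<subseteq> I" using I by (auto simp: J_def)
  have sumJ: "(\<Sum>i\<in>I. c i * f i) = (\<Sum>i\<in>J. c i * f i)" for f :: "'a \<Rightarrow> real"
    unfolding J_def using I by (intro sum.mono_neutral_right) auto
  have c1: "(\<Sum>i\<in>J. (c i)\<^sup>2) = 1" using c sumJ[of c] by (simp add: power2_eq_square)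
  then have "J \<noteq> {}" by auto
  then have "I \<noteq> {}" using J by auto
  have ind: "gauss.indep_vars I (\<lambda>_. borel) (\<lambda>i x. c i * x i) J"
    using gauss.indep_vars_compose2[OF gauss.indep_vars_subset[OF gauss_indep_coordinates[OF \<open>I \<noteq> {}\<close>] J(2)],
        of "\<lambda>i x. c i * x"] by simp
  have "distributed (gauss I) lborel (\<lambda>x. \<Sum>i\<in>J. c i * x i)
      (normal_density (\<Sum>i\<in>J. 0) (sqrt (\<Sum>i\<in>J. \<bar>c i\<bar>\<^sup>2)))"
  proof (rule gauss.sum_indep_normal[OF J(1) \<open>J \<noteq> {}\<close> ind])
    fix i assume i: "i \<in> J"
    show "0 < \<bar>c i\<bar>" using i by (simp add: J_def)
    have "distr (gauss I) lborel (\<lambda>x. x i) = distr (gauss I) borel (\<lambda>x. x i)" by (intro distr_cong) auto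
    then have "distributed (gauss I) lborel (\<lambda>x. x i) std_normal_density"
      unfolding distributed_def using gauss_coordinate[of i I] i J(2) by auto
    from gauss.normal_density_affine[OF this, of "c i" 0] i
    show "distributed (gauss I) lborel (\<lambda>x. c i * x i) (normal_density 0 \<bar>c i\<bar>)"
      by (simp add: J_def)
  qed
  then have "distr (gauss I) lborel (\<lambda>x. \<Sum>i\<in>I. c i * x i) = std_normal_distribution"
    using c1 by (simp add: sumJ distributed_def)
  moreover have "distr (gauss I) lborel (\<lambda>x. \<Sum>i\<in>I. c i * x i) = distr (gauss I) borel (\<lambda>x. \<Sum>i\<in>I. c i * x i)"
    by (intro distr_cong) auto
  ultimately show ?thesis by simp
qed

section \<open>Gaussian arrays and the resampling of one column\<close>

definition arr :: "nat \<Rightarrow> nat \<Rightarrow> (nat \<times> nat \<Rightarrow> real) measure" where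
  "arr N D = gauss ({..<N} \<times> {..<D})"

text \<open>Overwrites column \<open>k\<close>. With a fresh independent column the law of the array
  is unchanged (\<open>distr_upd\<close>), so integrating over the new column alone amounts to
  conditioning on all the others.\<close>

definition upd :: "nat \<Rightarrow> nat \<Rightarrow> nat \<Rightarrow> (nat \<times> nat \<Rightarrow> real) \<Rightarrow> (nat \<Rightarrow> real) \<Rightarrow> nat \<times> nat \<Rightarrow> real" where
  "upd N D k x y = (\<lambda>p\<in>{..<N} \<times> {..<D}. if snd p = k then y (fst p) else x p)"

interpretation arr: prob_space "arr N D" for N D
  unfolding arr_def by (rule gauss.prob_space_axioms)

lemma sets_arr[measurable_cong]: "sets (arr N D) = sets (PiM ({..<N} \<times> {..<D}) (\<lambda>_. borel))"
  by (simp add: arr_def sets_gauss)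

lemma measurable_upd[measurable]:
  assumes "k < D"
  shows "(\<lambda>(x, y). upd N D k x y) \<in> arr N D \<Otimes>\<^sub>M gauss {..<N} \<rightarrow>\<^sub>M arr N D"
proof -
  have 1: "(\<lambda>z. fst z p) \<in> borel_measurable (arr N D \<Otimes>\<^sub>M gauss {..<N})" if "p \<in> {..<N} \<times> {..<D}" for p
    using that by measurable
  have 2: "(\<lambda>z. snd z i) \<in> borel_measurable (arr N D \<Otimes>\<^sub>M gauss {..<N})" if "i \<in> {..<N}" for i
    using that by measurable
  have "(\<lambda>z. \<lambda>p\<in>{..<N} \<times> {..<D}. if snd p = k then snd z (fst p) else fst z p)
      \<in> arr N D \<Otimes>\<^sub>M gauss {..<N} \<rightarrow>\<^sub>M PiM ({..<N} \<times> {..<D}) (\<lambda>_. borel)"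
    by (rule measurable_restrict) (auto intro: 1 2 split: if_splits)
  then show ?thesis
    unfolding upd_def split_beta' by (simp cong: measurable_cong_sets add: sets_arr measurable_cong_sets[OF refl sets_arr])
qed

lemma distr_upd:
  assumes k: "k < D"
  shows "distr (arr N D \<Otimes>\<^sub>M gauss {..<N}) (arr N D) (\<lambda>(x, y). upd N D k x y) = arr N D"
proof -
  let ?I = "{..<N} \<times> {..<D}"
  let ?S = "std_normal_distribution"
  note measurable_upd[OF k, measurable]
  have "distr (arr N D \<Otimes>\<^sub>M gauss {..<N}) (arr N D) (\<lambda>(x, y). upd N D k x y) = PiM ?I (\<lambda>_. ?S)"
  proof (rule std_normal_prod.PiM_eqI)
    show "sets (distr (arr N D \<Otimes>\<^sub>M gauss {..<N}) (arr N D) (\<lambda>(x, y). upd N D k x y)) = sets (PiM ?I (\<lambda>_. ?S))"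
      by (simp add: arr_def gauss_def)
    fix A assume A: "\<And>p. p \<in> ?I \<Longrightarrow> A p \<in> sets ?S"
    have box: "Pi\<^sub>E ?I A \<in> sets (arr N D)"
      unfolding arr_def gauss_def by (rule sets_PiM_I_finite) (use A in auto)
    \<comment> \<open>Column \<open>k\<close> of the old array is overwritten and hence
      unconstrained.\<close>
    let ?A = "\<lambda>p. if snd p = k then UNIV else A p"
    have "(\<lambda>(x, y). upd N D k x y) -` Pi\<^sub>E ?I A \<inter> space (arr N D \<Otimes>\<^sub>M gauss {..<N})
        = Pi\<^sub>E ?I ?A \<times> Pi\<^sub>E {..<N} (\<lambda>i. A (i, k))" (is "?L = ?R")
    proof (intro equalityI subsetI)
      fix z assume "z \<in> ?L"
      then obtain x y where z: "z = (x, y)" "upd N D k x y \<in> Pi\<^sub>E ?I A" "x \<in> extensional ?I" "y \<in> extensional {..<N}"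
        by (auto simp: space_pair_measure arr_def space_gauss PiE_def)
      have "y i \<in> A (i, k)" if "i < N" for i
        using PiE_mem[OF z(2), of "(i, k)"] that k by (simp add: upd_def)
      moreover have "x p \<in> A p" if "p \<in> ?I" "snd p \<noteq> k" for p
        using PiE_mem[OF z(2), of p] that by (simp add: upd_def)
      ultimately show "z \<in> ?R" using z by (auto simp: PiE_def)
    next
      fix z assume "z \<in> ?R"
      then obtain x y where z: "z = (x, y)" "x \<in> Pi\<^sub>E ?I ?A" "y \<in> Pi\<^sub>E {..<N} (\<lambda>i. A (i, k))" by auto
      have "upd N D k x y \<in> Pi\<^sub>E ?I A"
      proof (rule PiE_I)
        fix p assume p: "p \<in> ?I"
        then show "upd N D k x y p \<in> A p"
          using PiE_mem[OF z(2) p] PiE_mem[OF z(3), of "fst p"] by (cases p) (auto simp: upd_def split: if_splits)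
      qed (auto simp: upd_def)
      then show "z \<in> ?L" using z by (auto simp: space_pair_measure arr_def space_gauss PiE_def)
    qed
    then have "emeasure (distr (arr N D \<Otimes>\<^sub>M gauss {..<N}) (arr N D) (\<lambda>(x, y). upd N D k x y)) (Pi\<^sub>E ?I A)
        = emeasure (arr N D \<Otimes>\<^sub>M gauss {..<N}) (Pi\<^sub>E ?I ?A \<times> Pi\<^sub>E {..<N} (\<lambda>i. A (i, k)))"
      using box by (simp add: emeasure_distr)
    also have "\<dots> = emeasure (arr N D) (Pi\<^sub>E ?I ?A) * emeasure (gauss {..<N}) (Pi\<^sub>E {..<N} (\<lambda>i. A (i, k)))"
      unfolding arr_def gauss_def using A k
      by (intro std_normal_prod.emeasure_pair_measure_Times gauss.emeasure_pair_measure_Times[unfolded gauss_def] sets_PiM_I_finite) auto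
    also have "emeasure (arr N D) (Pi\<^sub>E ?I ?A) = (\<Prod>p\<in>?I. emeasure ?S (?A p))"
      unfolding arr_def gauss_def using A by (intro std_normal_prod.emeasure_PiM) auto
    also have "\<dots> = (\<Prod>i<N. \<Prod>j<D. if j = k then 1 else emeasure ?S (A (i, j)))"
      unfolding prod.cartesian_product
      using std_normal.emeasure_space_1 by (intro prod.cong refl) (auto simp: space_density)
    also have "emeasure (gauss {..<N}) (Pi\<^sub>E {..<N} (\<lambda>i. A (i, k))) = (\<Prod>i<N. emeasure ?S (A (i, k)))"
      unfolding gauss_def using A k by (intro std_normal_prod.emeasure_PiM) auto
    also have "(\<Prod>i<N. \<Prod>j<D. if j = k then 1 else emeasure ?S (A (i, j))) * (\<Prod>i<N. emeasure ?S (A (i, k)))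
        = (\<Prod>i<N. \<Prod>j<D. emeasure ?S (A (i, j)))"
      unfolding prod.distrib[symmetric]
    proof (intro prod.cong refl)
      fix i
      have "(\<Prod>j<D. if j = k then 1 else emeasure ?S (A (i, j))) = (\<Prod>j\<in>{..<D} - {k}. emeasure ?S (A (i, j)))"
        by (intro prod.mono_neutral_cong_right) auto
      then show "(\<Prod>j<D. if j = k then 1 else emeasure ?S (A (i, j))) * emeasure ?S (A (i, k))
          = (\<Prod>j<D. emeasure ?S (A (i, j)))"
        using k prod.remove[of "{..<D}" k "\<lambda>j. emeasure ?S (A (i, j))"] by (simp add: mult.commute)
    qed
    also have "\<dots> = (\<Prod>p\<in>?I. emeasure ?S (A p))" unfolding prod.cartesian_product by simp
    finally show "emeasure (distr (arr N D \<Otimes>\<^sub>M gauss {..<N}) (arr N D) (\<lambda>(x, y). upd N D k x y)) (Pi\<^sub>E ?I A)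
        = (\<Prod>p\<in>?I. emeasure ?S (A p))" .
  qed auto
  then show ?thesis by (simp add: arr_def gauss_def)
qed

text \<open>Fubini for the resampled column: the inner measure is the conditional probability of
  \<open>E\<close> given the other columns. A bound on it that is uniform in \<open>x\<close> is a
  bound on the probability of \<open>E\<close>.\<close>

lemma emeasure_arr_column:
  assumes k: "k < D" and E: "E \<in> sets (arr N D)"
  shows "emeasure (arr N D) E =
    (\<integral>\<^sup>+x. emeasure (gauss {..<N}) {y \<in> space (gauss {..<N}). upd N D k x y \<in> E} \<partial>arr N D)"
    and "x \<in> space (arr N D) \<Longrightarrow> {y \<in> space (gauss {..<N}). upd N D k x y \<in> E} \<in> sets (gauss {..<N})"
proof -
  note measurable_upd[OF k, measurable] E[measurable]
  let ?E = "{z \<in> space (arr N D \<Otimes>\<^sub>M gauss {..<N}). (case z of (x, y) \<Rightarrow> upd N D k x y) \<in> E}"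
  have E': "?E \<in> sets (arr N D \<Otimes>\<^sub>M gauss {..<N})" by measurable
  have eq: "Pair x -` ?E = {y \<in> space (gauss {..<N}). upd N D k x y \<in> E}" if "x \<in> space (arr N D)" for x
    using that by (auto simp: space_pair_measure)
  have "emeasure (arr N D) E = emeasure (distr (arr N D \<Otimes>\<^sub>M gauss {..<N}) (arr N D) (\<lambda>(x, y). upd N D k x y)) E"
    by (simp add: distr_upd[OF k])
  also have "\<dots> = emeasure (arr N D \<Otimes>\<^sub>M gauss {..<N}) ?E"
    by (subst emeasure_distr) (auto intro!: arg_cong2[where f = emeasure])
  also have "\<dots> = (\<integral>\<^sup>+x. emeasure (gauss {..<N}) (Pair x -` ?E) \<partial>arr N D)"
    by (rule gauss.emeasure_pair_measure_alt[OF E'])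
  also have "\<dots> = (\<integral>\<^sup>+x. emeasure (gauss {..<N}) {y \<in> space (gauss {..<N}). upd N D k x y \<in> E} \<partial>arr N D)"
    by (intro nn_integral_cong) (simp only: eq)
  finally show "emeasure (arr N D) E =
    (\<integral>\<^sup>+x. emeasure (gauss {..<N}) {y \<in> space (gauss {..<N}). upd N D k x y \<in> E} \<partial>arr N D)" .
  show "{y \<in> space (gauss {..<N}). upd N D k x y \<in> E} \<in> sets (gauss {..<N})" if "x \<in> space (arr N D)"
    using sets_Pair1[OF E', of x] eq[OF that] by simp
qed

lemma measure_arr_column_le:
  assumes k: "k < D" and E: "E \<in> sets (arr N D)" and b: "0 \<le> b"
    and le: "\<And>x. x \<in> space (arr N D) \<Longrightarrow>
      measure (gauss {..<N}) {y \<in> space (gauss {..<N}). upd N D k x y \<in> E} \<le> b"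
  shows "measure (arr N D) E \<le> b"
proof -
  have "emeasure (arr N D) E \<le> (\<integral>\<^sup>+x. ennreal b \<partial>arr N D)"
    unfolding emeasure_arr_column(1)[OF k E]
    by (intro nn_integral_mono) (use le in \<open>simp add: gauss.emeasure_eq_measure ennreal_leI\<close>)
  also have "\<dots> = ennreal b" by (simp add: arr.emeasure_space_1)
  finally show ?thesis using b by (simp add: arr.emeasure_eq_measure)
qed

lemma measure_arr_column_eq:
  assumes k: "k < D" and E: "E \<in> sets (arr N D)"
    and eq: "AE x in arr N D. measure (gauss {..<N}) {y \<in> space (gauss {..<N}). upd N D k x y \<in> E} = b"
  shows "measure (arr N D) E = b"
proof -
  have "emeasure (arr N D) E = (\<integral>\<^sup>+x. ennreal b \<partial>arr N D)"
    unfolding emeasure_arr_column(1)[OF k E]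
    by (intro nn_integral_cong_AE) (use eq in \<open>auto simp: gauss.emeasure_eq_measure\<close>)
  also have "\<dots> = ennreal b" by (simp add: arr.emeasure_space_1)
  finally have *: "ennreal (measure (arr N D) E) = ennreal b" by (simp add: arr.emeasure_eq_measure)
  \<comment> \<open>\<open>ennreal\<close> forgets the value of a negative number, so the sign of
    \<open>b\<close> must be known before the two sides can be compared as reals.\<close>
  have "0 \<le> b"
  proof (rule ccontr)
    assume "\<not> 0 \<le> b"
    then have "AE x in arr N D. False" 
      by (intro eventually_mono[OF eq]) (metis measure_nonneg)
    then show False using arr.AE_False by blast
  qed
  with * show ?thesis by simp
qed

lemma distr_arr_permute_rows:
  assumes \<pi>: "bij_betw \<pi> {..<N} {..<N}"
  shows "distr (arr N D) (arr N D) (\<lambda>x. \<lambda>p\<in>{..<N} \<times> {..<D}. x (\<pi> (fst p), snd p)) = arr N D"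
proof -
  have "inj_on (\<lambda>p. (\<pi> (fst p), snd p)) ({..<N} \<times> {..<D})"
    using \<pi> by (auto simp: bij_betw_def inj_on_def)
  moreover have "(\<lambda>p. (\<pi> (fst p), snd p)) \<in> {..<N} \<times> {..<D} \<rightarrow> {..<N} \<times> {..<D}"
    using \<pi> by (auto dest: bij_betwE)
  ultimately show ?thesis
    unfolding arr_def gauss_def by (intro distr_PiM_reindex prob_space_std_normal)
qed

section \<open>Orthogonal invariance\<close>

definition leb :: "nat \<Rightarrow> (nat \<Rightarrow> real) measure" where
  "leb N = PiM {..<N} (\<lambda>_. lborel)"

definition lin :: "nat \<Rightarrow> real Matrix.mat \<Rightarrow> (nat \<Rightarrow> real) \<Rightarrow> nat \<Rightarrow> real" where
  "lin N A x = (\<lambda>i\<in>{..<N}. pvec N A x i)"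

definition phi :: "nat \<Rightarrow> (nat \<Rightarrow> real) \<Rightarrow> ennreal" where
  "phi N x = (\<Prod>i<N. ennreal (std_normal_density (x i)))"

interpretation lborel_prod: product_sigma_finite "\<lambda>_. lborel :: real measure"
  by (simp add: product_sigma_finite_def sigma_finite_lborel)

lemma sigma_finite_leb: "sigma_finite_measure (leb N)"
  unfolding leb_def by (rule lborel_prod.sigma_finite) simp

interpretation leb: sigma_finite_measure "leb N" for N
  by (rule sigma_finite_leb)

interpretation leb_pair: pair_sigma_finite "leb N" "leb N" for N
  by (simp add: pair_sigma_finite_def sigma_finite_leb)

lemma sets_leb[measurable_cong]: "sets (leb N) = sets (PiM {..<N} (\<lambda>_. borel))"
  unfolding leb_def by (intro sets_PiM_cong) auto

lemma measurable_pvec[measurable]: "(\<lambda>x. pvec N A x i) \<in> borel_measurable (PiM {..<N} (\<lambda>_. borel))"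
  unfolding pvec_def by measurable

lemma measurable_lin[measurable]: "lin N A \<in> PiM {..<N} (\<lambda>_. borel) \<rightarrow>\<^sub>M PiM {..<N} (\<lambda>_. borel)"
  unfolding lin_def[abs_def] by measurable

lemma measurable_phi[measurable]: "phi N \<in> borel_measurable (PiM {..<N} (\<lambda>_. borel))"
  unfolding phi_def[abs_def] by measurable

lemma gauss_eq_density: "gauss {..<N} = density (leb N) (phi N)"
proof -
  have "density (leb N) (phi N) = PiM {..<N} (\<lambda>_. std_normal_distribution)"
  proof (rule std_normal_prod.PiM_eqI)
    show "sets (density (leb N) (phi N)) = sets (PiM {..<N} (\<lambda>_. std_normal_distribution))"
      by (simp add: sets_leb cong: sets_PiM_cong)
    fix A :: "nat \<Rightarrow> real set" assume A: "\<And>i. i \<in> {..<N} \<Longrightarrow> A i \<in> sets std_normal_distribution"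
    have box: "Pi\<^sub>E {..<N} A \<in> sets (leb N)"
      unfolding leb_def using A by (intro sets_PiM_I_finite) auto
    have "emeasure (density (leb N) (phi N)) (Pi\<^sub>E {..<N} A)
        = (\<integral>\<^sup>+x. phi N x * indicator (Pi\<^sub>E {..<N} A) x \<partial>leb N)"
      by (rule emeasure_density[OF _ box]) measurable
    also have "\<dots> = (\<integral>\<^sup>+x. (\<Prod>i<N. ennreal (std_normal_density (x i)) * indicator (A i) (x i)) \<partial>leb N)"
    proof (rule nn_integral_cong)
      fix x assume x: "x \<in> space (leb N)"
      have "indicator (Pi\<^sub>E {..<N} A) x = (\<Prod>i<N. indicator (A i) (x i) :: ennreal)"
      proof (cases "x \<in> Pi\<^sub>E {..<N} A")
        case True
        then show ?thesis by (auto simp: PiE_iff)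
      next
        case False
        then obtain i where "i < N" "x i \<notin> A i"
          using x by (auto simp: leb_def space_PiM PiE_iff)
        then have "(\<Prod>i<N. indicator (A i) (x i) :: ennreal) = 0"
            by (intro prod_zero) (auto intro!: bexI[of _ i])
        then show ?thesis using False by simp
      qed
      then show "phi N x * indicator (Pi\<^sub>E {..<N} A) x
          = (\<Prod>i<N. ennreal (std_normal_density (x i)) * indicator (A i) (x i))"
        by (simp add: phi_def prod.distrib)
    qed
    also have "\<dots> = (\<Prod>i<N. \<integral>\<^sup>+x. ennreal (std_normal_density x) * indicator (A i) x \<partial>lborel)"
      unfolding leb_def using A by (intro lborel_prod.product_nn_integral_prod) auto
    also have "\<dots> = (\<Prod>i\<in>{..<N}. emeasure std_normal_distribution (A i))"
      by (rule prod.cong[OF refl]) (use A in \<open>simp add: emeasure_density\<close>)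
    finally show "emeasure (density (leb N) (phi N)) (Pi\<^sub>E {..<N} A)
        = (\<Prod>i\<in>{..<N}. emeasure std_normal_distribution (A i))" .
  qed simp
  then show ?thesis by (simp add: gauss_def)
qed

lemma leb_translate: "distr (leb N) (leb N) (\<lambda>x. \<lambda>i\<in>{..<N}. x i + t i) = leb N"
proof -
  have "distr (leb N) (leb N) (\<lambda>x. \<lambda>i\<in>{..<N}. x i + t i) = PiM {..<N} (\<lambda>_. lborel)"
  proof (rule lborel_prod.PiM_eqI)
    fix A :: "nat \<Rightarrow> real set" assume A: "\<And>i. i \<in> {..<N} \<Longrightarrow> A i \<in> sets lborel"
    have box: "Pi\<^sub>E {..<N} A \<in> sets (leb N)"
      unfolding leb_def using A by (intro sets_PiM_I_finite) auto
    have A': "(\<lambda>u. u + t i) -` A i \<in> sets lborel" if "i \<in> {..<N}" for i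
      using measurable_sets[of "\<lambda>u. u + t i" borel borel "A i"] A[OF that] by simp
    have "emeasure (distr (leb N) (leb N) (\<lambda>x. \<lambda>i\<in>{..<N}. x i + t i)) (Pi\<^sub>E {..<N} A)
        = emeasure (leb N) ((\<lambda>x. \<lambda>i\<in>{..<N}. x i + t i) -` Pi\<^sub>E {..<N} A \<inter> space (leb N))"
      by (rule emeasure_distr[OF _ box]) measurable
    also have "(\<lambda>x. \<lambda>i\<in>{..<N}. x i + t i) -` Pi\<^sub>E {..<N} A \<inter> space (leb N)
        = Pi\<^sub>E {..<N} (\<lambda>i. (\<lambda>u. u + t i) -` A i)"
      by (auto simp: leb_def space_PiM PiE_iff)
    also have "emeasure (leb N) \<dots> = (\<Prod>i<N. emeasure lborel ((\<lambda>u. u + t i) -` A i))"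
      unfolding leb_def using A' by (intro lborel_prod.emeasure_PiM) auto
    also have "\<dots> = (\<Prod>i\<in>{..<N}. emeasure lborel (A i))"
    proof (intro prod.cong refl)
      fix i assume i: "i \<in> {..<N}"
      have "emeasure lborel (A i) = emeasure (distr lborel borel ((+) (t i))) (A i)"
        by (simp add: lborel_distr_plus)
      also have "\<dots> = emeasure lborel ((+) (t i) -` A i)"
        using A[OF i] by (subst emeasure_distr) auto
      finally show "emeasure lborel ((\<lambda>u. u + t i) -` A i) = emeasure lborel (A i)"
        by (simp add: fun_eq_iff[of "(+) (t i)" "\<lambda>u. u + t i", THEN iffD2] add.commute)
    qed
    finally show "emeasure (distr (leb N) (leb N) (\<lambda>x. \<lambda>i\<in>{..<N}. x i + t i)) (Pi\<^sub>E {..<N} A)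
        = (\<Prod>i\<in>{..<N}. emeasure lborel (A i))" .
  qed (auto simp: leb_def)
  then show ?thesis by (simp add: leb_def)
qed

lemma leb_nn_integral_translate:
  assumes f[measurable]: "f \<in> borel_measurable (leb N)"
  shows "(\<integral>\<^sup>+x. f (\<lambda>i\<in>{..<N}. x i + t i) \<partial>leb N) = (\<integral>\<^sup>+x. f x \<partial>leb N)"
proof -
  have "(\<integral>\<^sup>+x. f x \<partial>leb N) = (\<integral>\<^sup>+x. f x \<partial>distr (leb N) (leb N) (\<lambda>x. \<lambda>i\<in>{..<N}. x i + t i))"
    by (simp add: leb_translate)
  also have "\<dots> = (\<integral>\<^sup>+x. f (\<lambda>i\<in>{..<N}. x i + t i) \<partial>leb N)"
    by (rule nn_integral_distr) measurable
  finally show ?thesis ..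
qed

lemma pvec_restrict: "pvec N A (\<lambda>i\<in>{..<N}. x i) = pvec N A x"
  by (auto simp: pvec_def fun_eq_iff intro!: sum.cong)

lemma pvec_lin: "pvec N A (lin N B x) = pvec N A (pvec N B x)"
  by (simp add: lin_def pvec_restrict)

lemma pvec_add: "pvec N A (\<lambda>i. x i + y i) i = pvec N A x i + pvec N A y i"
  by (simp add: pvec_def distrib_left sum.distrib)

lemma pvec_scale: "pvec N A (\<lambda>i. c * x i) i = c * pvec N A x i"
  by (simp add: pvec_def sum_distrib_left mult_ac)

lemma pvec_uminus: "pvec N A (\<lambda>i. - x i) i = - pvec N A x i"
  using pvec_scale[of N A "-1" x i] by simp

lemma pvec_cong: "(\<And>i. i < N \<Longrightarrow> x i = y i) \<Longrightarrow> pvec N A x i = pvec N A y i"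
  unfolding pvec_def by (intro sum.cong) auto

text \<open>Uniqueness of translation-invariant measures: the two orders of integrating
  \<open>f y * g (y - A x)\<close> give the two sides.\<close>

lemma leb_linear_exchange:
  assumes inv: "\<And>x i. i < N \<Longrightarrow> pvec N A (pvec N A' x) i = x i"
    and f[measurable]: "f \<in> borel_measurable (leb N)" and g[measurable]: "g \<in> borel_measurable (leb N)"
  shows "(\<integral>\<^sup>+x. f (lin N A x) \<partial>leb N) * (\<integral>\<^sup>+x. g x \<partial>leb N)
       = (\<integral>\<^sup>+x. f x \<partial>leb N) * (\<integral>\<^sup>+x. g (\<lambda>i\<in>{..<N}. - pvec N A x i) \<partial>leb N)"
proof -
  have [measurable]: "(\<lambda>z. pvec N A (fst z) i) \<in> borel_measurable (leb N \<Otimes>\<^sub>M leb N)" for i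
    by (rule measurable_compose[OF measurable_fst]) measurable
  have [measurable]: "(\<lambda>z. snd z i) \<in> borel_measurable (leb N \<Otimes>\<^sub>M leb N)" if "i \<in> {..<N}" for i
    using that by measurable
  have m1[measurable]: "(\<lambda>z. \<lambda>i\<in>{..<N}. snd z i - pvec N A (fst z) i) \<in> leb N \<Otimes>\<^sub>M leb N \<rightarrow>\<^sub>M PiM {..<N} (\<lambda>_. borel)"
    by (rule measurable_restrict) measurable
  have m2[measurable]: "(\<lambda>z. \<lambda>i\<in>{..<N}. snd z i + pvec N A (fst z) i) \<in> leb N \<Otimes>\<^sub>M leb N \<rightarrow>\<^sub>M PiM {..<N} (\<lambda>_. borel)"
    by (rule measurable_restrict) measurable
  have M1[measurable]: "(\<lambda>(x, y). f y * g (\<lambda>i\<in>{..<N}. y i - pvec N A x i)) \<in> borel_measurable (leb N \<Otimes>\<^sub>M leb N)"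
    unfolding split_beta' using m1 by measurable
  have M2[measurable]: "(\<lambda>(x, y). f (\<lambda>i\<in>{..<N}. y i + pvec N A x i) * g y) \<in> borel_measurable (leb N \<Otimes>\<^sub>M leb N)"
    unfolding split_beta' using m2 by measurable
  have ext: "(\<lambda>i\<in>{..<N}. y i) = y" if "y \<in> space (leb N)" for y :: "nat \<Rightarrow> real"
    using that by (auto simp: leb_def space_PiM PiE_iff extensional_def fun_eq_iff)
  have "(\<integral>\<^sup>+x. \<integral>\<^sup>+y. f y * g (\<lambda>i\<in>{..<N}. y i - pvec N A x i) \<partial>leb N \<partial>leb N)
      = (\<integral>\<^sup>+x. \<integral>\<^sup>+y. f (\<lambda>i\<in>{..<N}. y i + pvec N A x i) * g y \<partial>leb N \<partial>leb N)"
  proof (rule nn_integral_cong)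
    fix x assume x: "x \<in> space (leb N)"
    have "(\<lambda>y. f y * g (\<lambda>i\<in>{..<N}. y i - pvec N A x i)) \<in> borel_measurable (leb N)"
      using measurable_compose[OF measurable_Pair1'[OF x] M1] by simp
    from leb_nn_integral_translate[OF this, of "pvec N A x"]
    have "(\<integral>\<^sup>+y. f y * g (\<lambda>i\<in>{..<N}. y i - pvec N A x i) \<partial>leb N)
      = (\<integral>\<^sup>+y. f (\<lambda>i\<in>{..<N}. y i + pvec N A x i) *
          g (\<lambda>i\<in>{..<N}. (\<lambda>i\<in>{..<N}. y i + pvec N A x i) i - pvec N A x i) \<partial>leb N)" by simp
    also have "\<dots> = (\<integral>\<^sup>+y. f (\<lambda>i\<in>{..<N}. y i + pvec N A x i) * g y \<partial>leb N)"
    proof (rule nn_integral_cong)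
      fix y assume y: "y \<in> space (leb N)"
      have "(\<lambda>i\<in>{..<N}. (\<lambda>i\<in>{..<N}. y i + pvec N A x i) i - pvec N A x i) = y"
        by (subst (2) ext[OF y, symmetric]) (auto simp: fun_eq_iff restrict_def)
      then show "f (\<lambda>i\<in>{..<N}. y i + pvec N A x i) *
          g (\<lambda>i\<in>{..<N}. (\<lambda>i\<in>{..<N}. y i + pvec N A x i) i - pvec N A x i)
        = f (\<lambda>i\<in>{..<N}. y i + pvec N A x i) * g y" by (simp only:)
    qed
    finally show "(\<integral>\<^sup>+y. f y * g (\<lambda>i\<in>{..<N}. y i - pvec N A x i) \<partial>leb N)
      = (\<integral>\<^sup>+y. f (\<lambda>i\<in>{..<N}. y i + pvec N A x i) * g y \<partial>leb N)" .
  qed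
  also have "\<dots> = (\<integral>\<^sup>+y. \<integral>\<^sup>+x. f (\<lambda>i\<in>{..<N}. y i + pvec N A x i) * g y \<partial>leb N \<partial>leb N)"
    using leb_pair.Fubini[OF M2] by simp
  also have "\<dots> = (\<integral>\<^sup>+y. (\<integral>\<^sup>+x. f (lin N A x) \<partial>leb N) * g y \<partial>leb N)"
  proof (rule nn_integral_cong)
    fix y assume y: "y \<in> space (leb N)"
    have fl: "(\<lambda>x. f (lin N A x)) \<in> borel_measurable (leb N)" by measurable
    have "(\<integral>\<^sup>+x. f (\<lambda>i\<in>{..<N}. y i + pvec N A x i) * g y \<partial>leb N)
        = (\<integral>\<^sup>+x. f (lin N A (\<lambda>i\<in>{..<N}. x i + pvec N A' y i)) * g y \<partial>leb N)"
    proof (rule nn_integral_cong)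
      fix x
      \<comment> \<open>Here the right inverse enters: y + A x = A (x + A' y), and translation
        invariance absorbs the shift by A' y.\<close>
      have "lin N A (\<lambda>i\<in>{..<N}. x i + pvec N A' y i) = (\<lambda>i\<in>{..<N}. y i + pvec N A x i)"
        unfolding lin_def pvec_restrict by (auto simp: fun_eq_iff pvec_add inv)
      then show "f (\<lambda>i\<in>{..<N}. y i + pvec N A x i) * g y = f (lin N A (\<lambda>i\<in>{..<N}. x i + pvec N A' y i)) * g y"
        by simp
    qed
    also have "\<dots> = (\<integral>\<^sup>+x. f (lin N A x) * g y \<partial>leb N)"
      by (rule leb_nn_integral_translate[of "\<lambda>x. f (lin N A x) * g y"]) measurable
    also have "\<dots> = (\<integral>\<^sup>+x. f (lin N A x) \<partial>leb N) * g y"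
      by (rule nn_integral_multc[OF fl])
    finally show "(\<integral>\<^sup>+x. f (\<lambda>i\<in>{..<N}. y i + pvec N A x i) * g y \<partial>leb N) = (\<integral>\<^sup>+x. f (lin N A x) \<partial>leb N) * g y" .
  qed
  also have "\<dots> = (\<integral>\<^sup>+x. f (lin N A x) \<partial>leb N) * (\<integral>\<^sup>+x. g x \<partial>leb N)"
    by (rule nn_integral_cmult) measurable
  finally have 1: "(\<integral>\<^sup>+x. \<integral>\<^sup>+y. f y * g (\<lambda>i\<in>{..<N}. y i - pvec N A x i) \<partial>leb N \<partial>leb N)
     = (\<integral>\<^sup>+x. f (lin N A x) \<partial>leb N) * (\<integral>\<^sup>+x. g x \<partial>leb N)" .
  have "(\<integral>\<^sup>+x. \<integral>\<^sup>+y. f y * g (\<lambda>i\<in>{..<N}. y i - pvec N A x i) \<partial>leb N \<partial>leb N)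
      = (\<integral>\<^sup>+y. \<integral>\<^sup>+x. f y * g (\<lambda>i\<in>{..<N}. y i - pvec N A x i) \<partial>leb N \<partial>leb N)"
    using leb_pair.Fubini[OF M1] by simp
  also have "\<dots> = (\<integral>\<^sup>+y. f y * (\<integral>\<^sup>+x. g (\<lambda>i\<in>{..<N}. - pvec N A x i) \<partial>leb N) \<partial>leb N)"
  proof (rule nn_integral_cong)
    fix y assume y: "y \<in> space (leb N)"
    have gl[measurable]: "(\<lambda>x. g (\<lambda>i\<in>{..<N}. - pvec N A x i)) \<in> borel_measurable (leb N)" by measurable
    have "(\<integral>\<^sup>+x. f y * g (\<lambda>i\<in>{..<N}. - pvec N A x i) \<partial>leb N)
        = (\<integral>\<^sup>+x. f y * g (\<lambda>i\<in>{..<N}. - pvec N A (\<lambda>i\<in>{..<N}. x i + - pvec N A' y i) i) \<partial>leb N)"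
      by (rule leb_nn_integral_translate[of "\<lambda>x. f y * g (\<lambda>i\<in>{..<N}. - pvec N A x i)", symmetric]) measurable
    also have "\<dots> = (\<integral>\<^sup>+x. f y * g (\<lambda>i\<in>{..<N}. y i - pvec N A x i) \<partial>leb N)"
    proof (rule nn_integral_cong)
      fix x
      have "(\<lambda>i\<in>{..<N}. - pvec N A (\<lambda>i\<in>{..<N}. x i + - pvec N A' y i) i) = (\<lambda>i\<in>{..<N}. y i - pvec N A x i)"
        unfolding pvec_restrict by (auto simp: fun_eq_iff pvec_add pvec_uminus inv simp del: add_uminus_conv_diff)
      then show "f y * g (\<lambda>i\<in>{..<N}. - pvec N A (\<lambda>i\<in>{..<N}. x i + - pvec N A' y i) i)
        = f y * g (\<lambda>i\<in>{..<N}. y i - pvec N A x i)" by (simp only:)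
    qed
    finally show "(\<integral>\<^sup>+x. f y * g (\<lambda>i\<in>{..<N}. y i - pvec N A x i) \<partial>leb N)
      = f y * (\<integral>\<^sup>+x. g (\<lambda>i\<in>{..<N}. - pvec N A x i) \<partial>leb N)"
      by (simp add: nn_integral_cmult[OF gl])
  qed
  also have "\<dots> = (\<integral>\<^sup>+x. f x \<partial>leb N) * (\<integral>\<^sup>+x. g (\<lambda>i\<in>{..<N}. - pvec N A x i) \<partial>leb N)"
    by (rule nn_integral_multc) measurable
  finally show ?thesis using 1 by simp
qed

lemma phi_exp: "phi N x = ennreal ((1 / sqrt (2 * pi)) ^ N * exp (- (\<Sum>i<N. (x i)\<^sup>2) / 2))"
proof -
  have "phi N x = ennreal (\<Prod>i<N. std_normal_density (x i))"
    unfolding phi_def by (rule prod_ennreal) simp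
  also have "(\<Prod>i<N. std_normal_density (x i)) = (1 / sqrt (2 * pi)) ^ N * (\<Prod>i<N. exp (- (x i)\<^sup>2 / 2))"
    unfolding std_normal_density_def prod.distrib by simp
  also have "(\<Prod>i<N. exp (- (x i)\<^sup>2 / 2)) = exp (- (\<Sum>i<N. (x i)\<^sup>2) / 2)"
    by (simp add: exp_sum[symmetric] sum_negf sum_divide_distrib)
  finally show ?thesis .
qed

lemma phi_cong_norm: "(\<Sum>i<N. (x i)\<^sup>2) = (\<Sum>i<N. (y i)\<^sup>2) \<Longrightarrow> phi N x = phi N y"
  by (simp add: phi_exp)

lemma phi_integral: "(\<integral>\<^sup>+x. phi N x \<partial>leb N) = 1"
proof -
  have "(\<integral>\<^sup>+x. phi N x \<partial>leb N) = (\<integral>\<^sup>+x. phi N x * indicator (space (leb N)) x \<partial>leb N)"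
    by (rule nn_integral_cong) simp
  also have "\<dots> = emeasure (gauss {..<N}) (space (gauss {..<N}))"
    unfolding gauss_eq_density space_density by (rule emeasure_density[symmetric]) auto
  finally show ?thesis by (simp only: gauss.emeasure_space_1)
qed

text \<open>The exchange identity with g = \<open>phi N\<close>, which is even and has total mass 1.
  The integral of \<open>phi N\<close> along A stands for the Jacobian factor 1 / |det A|; it equals
  1 for orthogonal maps and is fixed by total mass in \<open>linear_sample_law\<close>.\<close>

lemma leb_linear:
  assumes inv: "\<And>x i. i < N \<Longrightarrow> pvec N A (pvec N A' x) i = x i"
    and f[measurable]: "f \<in> borel_measurable (leb N)"
  shows "(\<integral>\<^sup>+x. f (lin N A x) \<partial>leb N) = (\<integral>\<^sup>+x. phi N (pvec N A x) \<partial>leb N) * (\<integral>\<^sup>+x. f x \<partial>leb N)"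
proof -
  have "phi N (\<lambda>i\<in>{..<N}. - pvec N A x i) = phi N (pvec N A x)" for x
    by (rule phi_cong_norm) simp
  then show ?thesis
    using leb_linear_exchange[OF inv f, of "phi N"] by (simp add: phi_integral mult.commute)
qed

definition orth_mat :: "nat \<Rightarrow> real Matrix.mat \<Rightarrow> bool" where
  "orth_mat N Q \<longleftrightarrow> Q \<in> carrier_mat N N \<and> transpose_mat Q * Q = 1\<^sub>m N"

lemma pvec_mult:
  assumes "A \<in> carrier_mat N N" "B \<in> carrier_mat N N" "i < N"
  shows "pvec N (A * B) x i = pvec N A (pvec N B x) i"
proof -
  have "pvec N (A * B) x i = (\<Sum>j<N. \<Sum>k<N. A $$ (i, k) * B $$ (k, j) * x j)"
    unfolding pvec_def using assms
    by (intro sum.cong refl) (simp add: scalar_prod_def lessThan_atLeast0 sum_distrib_right)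
  also have "\<dots> = pvec N A (pvec N B x) i"
    unfolding pvec_def by (subst sum.swap) (simp add: sum_distrib_left mult_ac)
  finally show ?thesis .
qed

lemma pvec_one: "i < N \<Longrightarrow> pvec N (1\<^sub>m N) x i = x i"
  by (simp add: pvec_def if_distrib[of "\<lambda>c. c * _"] cong: if_cong)

lemma inner_transpose:
  assumes "A \<in> carrier_mat N N"
  shows "(\<Sum>i<N. x i * pvec N A y i) = (\<Sum>i<N. pvec N (transpose_mat A) x i * y i)"
proof -
  have "(\<Sum>i<N. x i * pvec N A y i) = (\<Sum>i<N. \<Sum>j<N. A $$ (i, j) * x i * y j)"
    by (simp add: pvec_def sum_distrib_left mult_ac)
  also have "\<dots> = (\<Sum>j<N. \<Sum>i<N. A $$ (i, j) * x i * y j)" by (rule sum.swap)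
  also have "\<dots> = (\<Sum>i<N. pvec N (transpose_mat A) x i * y i)"
    unfolding pvec_def sum_distrib_right using assms by (intro sum.cong refl) auto
  finally show ?thesis .
qed

context
  fixes N Q assumes Q: "orth_mat N Q"
begin

lemma orth_mat_carrier: "Q \<in> carrier_mat N N" "transpose_mat Q \<in> carrier_mat N N"
  using Q by (auto simp: orth_mat_def)

lemma orth_mat_right: "Q * transpose_mat Q = 1\<^sub>m N"
  using Q mat_mult_left_right_inverse[of "transpose_mat Q" N Q] by (simp add: orth_mat_def)

lemma orth_mat_inverse:
  "i < N \<Longrightarrow> pvec N Q (pvec N (transpose_mat Q) x) i = x i"
  "i < N \<Longrightarrow> pvec N (transpose_mat Q) (pvec N Q x) i = x i"
  using pvec_mult[OF orth_mat_carrier(1) orth_mat_carrier(2), of i x]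
    pvec_mult[OF orth_mat_carrier(2) orth_mat_carrier(1), of i x] orth_mat_right Q
  by (simp_all add: orth_mat_def pvec_one)

lemma orth_mat_inner: "(\<Sum>i<N. pvec N Q x i * pvec N Q y i) = (\<Sum>i<N. x i * y i)"
  unfolding inner_transpose[OF orth_mat_carrier(1)]
  by (intro sum.cong refl) (simp add: orth_mat_inverse)

text \<open>The density \<open>phi N\<close> depends only on the norm, hence is preserved by
  \<open>Q\<close>; for the same reason the Jacobian factor of \<open>leb_linear\<close> is the
  total mass of \<open>phi N\<close>, which is 1.\<close>

lemma gauss_orthogonal: "distr (gauss {..<N}) (gauss {..<N}) (lin N Q) = gauss {..<N}"
proof (rule measure_eqI)
  fix A assume "A \<in> sets (distr (gauss {..<N}) (gauss {..<N}) (lin N Q))"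
  then have A[measurable]: "A \<in> sets (PiM {..<N} (\<lambda>_. borel))" by (simp add: sets_gauss)
  have norm: "phi N (pvec N Q x) = phi N x" for x
    by (rule phi_cong_norm) (use orth_mat_inner[of x x] in \<open>simp add: power2_eq_square\<close>)
  have norm': "phi N (lin N Q x) = phi N x" for x
    using norm[of x] by (simp add: lin_def phi_def)
  have "emeasure (distr (gauss {..<N}) (gauss {..<N}) (lin N Q)) A = (\<integral>\<^sup>+x. indicator A (lin N Q x) \<partial>gauss {..<N})"
    using A by (subst nn_integral_indicator[symmetric], simp add: sets_gauss) (rule nn_integral_distr, measurable)
  also have "\<dots> = (\<integral>\<^sup>+x. phi N x * indicator A (lin N Q x) \<partial>leb N)"
    unfolding gauss_eq_density by (rule nn_integral_density) measurable
  also have "\<dots> = (\<integral>\<^sup>+x. phi N (lin N Q x) * indicator A (lin N Q x) \<partial>leb N)"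
    by (simp add: norm')
  also have "\<dots> = (\<integral>\<^sup>+x. phi N (pvec N Q x) \<partial>leb N) * (\<integral>\<^sup>+x. phi N x * indicator A x \<partial>leb N)"
    by (rule leb_linear[OF orth_mat_inverse(1), of "\<lambda>x. phi N x * indicator A x"]) auto
  also have "\<dots> = (\<integral>\<^sup>+x. phi N x * indicator A x \<partial>leb N)"
    by (simp add: norm phi_integral)
  also have "\<dots> = emeasure (gauss {..<N}) A"
    unfolding gauss_eq_density by (rule emeasure_density[symmetric]) (auto simp: sets_leb)
  finally show "emeasure (distr (gauss {..<N}) (gauss {..<N}) (lin N Q)) A = emeasure (gauss {..<N}) A" .
qed simp

end

section \<open>The uniform distribution on a sphere\<close>

lemma mat_range_iff:
  assumes P: "orth_proj N P"
  shows "Matrix.vec N v \<in> mat_range P \<longleftrightarrow> (\<forall>i<N. pvec N P v i = v i)"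
proof
  note Pc = orth_proj_carrier[OF P]
  show "\<forall>i<N. pvec N P v i = v i" if v: "Matrix.vec N v \<in> mat_range P"
  proof (intro allI impI)
    fix i assume i: "i < N"
    obtain u where u: "Matrix.vec N v = P *\<^sub>v u" "u \<in> carrier_vec N"
      using v Pc by (auto simp: mat_range_def)
    have uu: "u = Matrix.vec N (vec_index u)" using u(2) by (intro eq_vecI) auto
    have v: "v j = pvec N P (vec_index u) j" if "j < N" for j
    proof -
      have "v j = vec_index (Matrix.vec N v) j" using that by simp
      also have "\<dots> = vec_index (P *\<^sub>v Matrix.vec N (vec_index u)) j" using u uu by simp
      finally show ?thesis using mat_vec_index[OF Pc that] by simp
    qed
    have "pvec N P v i = pvec N P (pvec N P (vec_index u)) i" by (rule pvec_cong) (rule v)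
    then show "pvec N P v i = v i" using pvec_pvec[OF P i] v[OF i] by simp
  qed
  assume *: "\<forall>i<N. pvec N P v i = v i"
  have "Matrix.vec N v = P *\<^sub>v Matrix.vec N v"
    by (rule eq_vecI) (use * Pc mat_vec_index[OF Pc, of _ v] in auto)
  then show "Matrix.vec N v \<in> mat_range P"
    using Pc unfolding mat_range_def by (auto intro!: exI[of _ "Matrix.vec N v"])
qed

lemma mat_vec_vec:
  assumes "A \<in> carrier_mat N N" shows "A *\<^sub>v Matrix.vec N v = Matrix.vec N (pvec N A v)"
  by (rule eq_vecI) (use assms mat_vec_index[OF assms] in auto)

lemma mat_range_preserved_iff:
  assumes P: "orth_proj N P" and Q: "Q \<in> carrier_mat N N"
  shows "(\<forall>w \<in> mat_range P. Q *\<^sub>v w \<in> mat_range P) \<longleftrightarrow>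
    (\<forall>x. \<forall>i<N. pvec N P (pvec N Q (pvec N P x)) i = pvec N Q (pvec N P x) i)"
proof
  note Pc = orth_proj_carrier[OF P]
  have mem: "Matrix.vec N (pvec N P x) \<in> mat_range P" for x
    unfolding mat_range_iff[OF P] by (simp add: pvec_pvec[OF P])
  assume "\<forall>w \<in> mat_range P. Q *\<^sub>v w \<in> mat_range P"
  then have "Matrix.vec N (pvec N Q (pvec N P x)) \<in> mat_range P" for x
    using mem mat_vec_vec[OF Q] by metis
  then show "\<forall>x. \<forall>i<N. pvec N P (pvec N Q (pvec N P x)) i = pvec N Q (pvec N P x) i"
    unfolding mat_range_iff[OF P] by blast
next
  note Pc = orth_proj_carrier[OF P]
  assume *: "\<forall>x. \<forall>i<N. pvec N P (pvec N Q (pvec N P x)) i = pvec N Q (pvec N P x) i"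
  show "\<forall>w \<in> mat_range P. Q *\<^sub>v w \<in> mat_range P"
  proof
    fix w assume "w \<in> mat_range P"
    then obtain u where u: "w = P *\<^sub>v u" "u \<in> carrier_vec N" using Pc by (auto simp: mat_range_def)
    have uu: "u = Matrix.vec N (vec_index u)" using u(2) by (intro eq_vecI) auto
    have w: "w = Matrix.vec N (pvec N P (vec_index u))"
      unfolding u(1) by (subst uu) (rule mat_vec_vec[OF Pc])
    show "Q *\<^sub>v w \<in> mat_range P"
      unfolding w mat_vec_vec[OF Q] mat_range_iff[OF P] using * by blast
  qed
qed

lemma pvec_delta: "j < N \<Longrightarrow> pvec N A (delta j) i = A $$ (i, j)"
  by (simp add: pvec_def delta_def if_distrib[of "\<lambda>c. _ * c"] cong: if_cong)

lemma inner_pvec: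
  assumes "orth_proj N P"
  shows "(\<Sum>i<N. f i * pvec N P g i) = (\<Sum>i<N. pvec N P f i * g i)"
  using inner_transpose[of P N f g] assms by (simp add: orth_proj_def)

text \<open>For an orthogonal map \<open>Q\<close> preserving the range, \<open>|P Q x|\<^sup>2 - |P x|\<^sup>2\<close> is the squared norm of the
  commutator at \<open>x\<close>; its sum over the standard basis is a difference of equal traces.\<close>

lemma orth_mat_commutes:
  assumes P: "orth_proj N P" and Q: "orth_mat N Q"
    and inv: "\<forall>w \<in> mat_range P. Q *\<^sub>v w \<in> mat_range P"
    and i: "i < N"
  shows "pvec N Q (pvec N P x) i = pvec N P (pvec N Q x) i"
proof -
  note Qc = orth_mat_carrier(1)[OF Q] and Pc = orth_proj_carrier[OF P]
  have pres: "pvec N P (pvec N Q (pvec N P x)) i = pvec N Q (pvec N P x) i" if "i < N" for x i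
    using inv that unfolding mat_range_preserved_iff[OF P Qc] by blast
  define D where "D = (\<lambda>j. \<Sum>i<N. (pvec N P (pvec N Q (delta j)) i - pvec N Q (pvec N P (delta j)) i)\<^sup>2)"
  have D: "D j = bil N P (pvec N Q (delta j)) (pvec N Q (delta j)) - P $$ (j, j)" if j: "j < N" for j
  proof -
    let ?x = "delta j"
    \<comment> \<open>P is moved to the other side, where P Q P = Q P absorbs it; orthogonality of Q
      then removes Q from both factors.\<close>
    have cross: "(\<Sum>i<N. pvec N P (pvec N Q ?x) i * pvec N Q (pvec N P ?x) i) = (\<Sum>i<N. ?x i * pvec N P ?x i)"
    proof -
      have "(\<Sum>i<N. pvec N P (pvec N Q ?x) i * pvec N Q (pvec N P ?x) i)
          = (\<Sum>i<N. pvec N Q ?x i * pvec N P (pvec N Q (pvec N P ?x)) i)"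
        by (rule inner_pvec[OF P, symmetric])
      also have "\<dots> = (\<Sum>i<N. pvec N Q ?x i * pvec N Q (pvec N P ?x) i)"
        by (intro sum.cong refl) (simp add: pres)
      finally show ?thesis by (simp add: orth_mat_inner[OF Q])
    qed
    have nn: "(\<Sum>i<N. pvec N Q (pvec N P ?x) i * pvec N Q (pvec N P ?x) i) = (\<Sum>i<N. ?x i * pvec N P ?x i)"
      unfolding orth_mat_inner[OF Q] using bil_eq_inner[OF P, of ?x ?x] by (simp add: bil_eq_pvec)
    have dd: "(\<Sum>i<N. ?x i * pvec N P ?x i) = P $$ (j, j)"
      using j by (simp add: pvec_delta) (simp add: delta_def if_distrib[of "\<lambda>c. c * _"] cong: if_cong)
    have "D j = (\<Sum>i<N. pvec N P (pvec N Q ?x) i * pvec N P (pvec N Q ?x) i)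
        - 2 * (\<Sum>i<N. pvec N P (pvec N Q ?x) i * pvec N Q (pvec N P ?x) i)
        + (\<Sum>i<N. pvec N Q (pvec N P ?x) i * pvec N Q (pvec N P ?x) i)"
      unfolding D_def by (simp add: power2_eq_square algebra_simps sum.distrib sum_subtractf sum_distrib_left)
    then show ?thesis unfolding cross nn dd bil_eq_inner[OF P] by simp
  qed
  have "(\<Sum>j<N. D j) = (\<Sum>j<N. \<Sum>a<N. \<Sum>b<N. P $$ (a, b) * (Q $$ (a, j) * Q $$ (b, j))) - (\<Sum>j<N. P $$ (j, j))"
    by (simp add: D sum_subtractf bil_def pvec_delta mult_ac)
  also have "(\<Sum>j<N. \<Sum>a<N. \<Sum>b<N. P $$ (a, b) * (Q $$ (a, j) * Q $$ (b, j)))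
      = (\<Sum>a<N. \<Sum>j<N. \<Sum>b<N. P $$ (a, b) * (Q $$ (a, j) * Q $$ (b, j)))" by (rule sum.swap)
  also have "\<dots> = (\<Sum>a<N. \<Sum>b<N. P $$ (a, b) * (\<Sum>j<N. Q $$ (a, j) * Q $$ (b, j)))"
  proof (rule sum.cong[OF refl])
    fix a
    show "(\<Sum>j<N. \<Sum>b<N. P $$ (a, b) * (Q $$ (a, j) * Q $$ (b, j)))
        = (\<Sum>b<N. P $$ (a, b) * (\<Sum>j<N. Q $$ (a, j) * Q $$ (b, j)))"
      by (subst sum.swap) (simp add: sum_distrib_left)
  qed
  also have "\<dots> = (\<Sum>a<N. P $$ (a, a))"
  proof (intro sum.cong refl)
    fix a assume "a \<in> {..<N}"
    then have a: "a < N" by simp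
    have QQ: "(\<Sum>j<N. Q $$ (a, j) * Q $$ (b, j)) = (if a = b then 1 else 0)" if b: "b < N" for b
    proof -
      have "(Q * transpose_mat Q) $$ (a, b) = (\<Sum>j<N. Q $$ (a, j) * Q $$ (b, j))"
        using Qc a b by (simp add: scalar_prod_def lessThan_atLeast0)
      then show ?thesis using orth_mat_right[OF Q] a b by simp
    qed
    show "(\<Sum>b<N. P $$ (a, b) * (\<Sum>j<N. Q $$ (a, j) * Q $$ (b, j))) = P $$ (a, a)"
      using a by (simp add: QQ if_distrib[of "\<lambda>c. _ * c"] cong: if_cong)
  qed
  finally have "(\<Sum>j<N. D j) = 0" by simp
  moreover have "0 \<le> D j" for j unfolding D_def by (intro sum_nonneg) simp
  ultimately have D0: "D j = 0" if "j < N" for j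
    using that sum_nonneg_eq_0_iff[of "{..<N}" D] by auto
  have PQ: "(P * Q) $$ (i, j) = (Q * P) $$ (i, j)" if ij: "i < N" "j < N" for i j
  proof -
    have "(pvec N P (pvec N Q (delta j)) i - pvec N Q (pvec N P (delta j)) i)\<^sup>2 = 0"
      using D0[OF ij(2)] ij(1) unfolding D_def by (subst (asm) sum_nonneg_eq_0_iff) auto
    then have "pvec N P (pvec N Q (delta j)) i = pvec N Q (pvec N P (delta j)) i" by simp
    then show ?thesis
      unfolding pvec_mult[OF Pc Qc ij(1), symmetric] pvec_mult[OF Qc Pc ij(1), symmetric] pvec_delta[OF ij(2)] .
  qed
  have "pvec N (Q * P) x i = pvec N (P * Q) x i"
    unfolding pvec_def using i PQ by (intro sum.cong refl) auto
  then show ?thesis unfolding pvec_mult[OF Pc Qc i] pvec_mult[OF Qc Pc i] .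
qed

lemma bil_orth_mat:
  assumes P: "orth_proj N P" and Q: "orth_mat N Q"
    and inv: "\<forall>w \<in> mat_range P. Q *\<^sub>v w \<in> mat_range P"
  shows "bil N P (pvec N Q x) (pvec N Q y) = bil N P x y"
proof -
  have "bil N P (pvec N Q x) (pvec N Q y) = (\<Sum>i<N. pvec N Q (pvec N P x) i * pvec N Q (pvec N P y) i)"
    unfolding bil_eq_inner[OF P] by (intro sum.cong refl) (simp add: orth_mat_commutes[OF P Q inv])
  then show ?thesis by (simp add: orth_mat_inner[OF Q] bil_eq_inner[OF P])
qed

text \<open>After normalisation the combination is standard normal, a law without an atom at
  0.\<close>

lemma AE_gauss_linear_nonzero:
  assumes I: "finite I" and c: "(\<Sum>i\<in>I. (c i)\<^sup>2) > 0"
  shows "AE x in gauss I. (\<Sum>i\<in>I. c i * x i) \<noteq> 0"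
proof -
  define s where "s = sqrt (\<Sum>i\<in>I. (c i)\<^sup>2)"
  have s: "s > 0" "s\<^sup>2 = (\<Sum>i\<in>I. (c i)\<^sup>2)" using c by (auto simp: s_def)
  have "(\<Sum>i\<in>I. (c i / s)\<^sup>2) = 1"
    using s c by (simp add: power_divide sum_divide_distrib[symmetric])
  note law = gauss_linear_law[OF I this]
  have "AE y in std_normal_distribution. y \<noteq> 0"
    using AE_lborel_singleton[of "0::real"] by (subst AE_density) auto
  then have "AE y in distr (gauss I) borel (\<lambda>x. \<Sum>i\<in>I. c i / s * x i). y \<noteq> 0" unfolding law .
  then have "AE x in gauss I. (\<Sum>i\<in>I. c i / s * x i) \<noteq> 0" by (subst (asm) AE_distr_iff) auto
  then show ?thesis
  proof eventually_elim
    case (elim x)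
    have "(\<Sum>i\<in>I. c i / s * x i) = (\<Sum>i\<in>I. c i * x i) / s" by (simp add: sum_divide_distrib)
    then show ?case using elim by auto
  qed
qed

lemma measurable_bil[measurable]:
  "f \<in> M \<rightarrow>\<^sub>M PiM {..<N} (\<lambda>_. borel) \<Longrightarrow> g \<in> M \<rightarrow>\<^sub>M PiM {..<N} (\<lambda>_. borel) \<Longrightarrow>
   (\<lambda>x. bil N P (f x) (g x)) \<in> borel_measurable M"
proof -
  assume f: "f \<in> M \<rightarrow>\<^sub>M PiM {..<N} (\<lambda>_. borel)" and g: "g \<in> M \<rightarrow>\<^sub>M PiM {..<N} (\<lambda>_. borel)"
  have "(\<lambda>x. f x i) \<in> borel_measurable M" "(\<lambda>x. g x i) \<in> borel_measurable M" if "i \<in> {..<N}" for i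
    using measurable_compose[OF f measurable_component_singleton[OF that]]
      measurable_compose[OF g measurable_component_singleton[OF that]] by auto
  then show "(\<lambda>x. bil N P (f x) (g x)) \<in> borel_measurable M"
    unfolding bil_def by measurable
qed

context
  fixes N :: nat and P :: "real Matrix.mat"
  assumes P: "orth_proj N P" and P0: "\<exists>i<N. P $$ (i, i) \<noteq> 0"
begin

text \<open>A nonzero diagonal entry makes the corresponding row of \<open>P\<close> nonzero, since
  it is the squared norm of that row. The matching coordinate of P x is then almost surely
  nonzero.\<close>

lemma AE_gauss_bil_pos: "AE x in gauss {..<N}. bil N P x x > 0"
proof -
  obtain i where i: "i < N" "P $$ (i, i) \<noteq> 0" using P0 by auto
  then have "(\<Sum>j<N. (P $$ (i, j))\<^sup>2) > 0"
    using orth_proj_frob[OF P i(1)] orth_proj_diag(1)[OF P i(1)] by auto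
  from AE_gauss_linear_nonzero[OF _ this]
  have "AE x in gauss {..<N}. pvec N P x i \<noteq> 0" by (simp add: pvec_def)
  then show ?thesis
  proof eventually_elim
    case (elim x)
    then show ?case using pvec_zero[OF P _ i(1), of x] bil_nonneg[OF P, of x] by force
  qed
qed

definition unit_in :: "(nat \<Rightarrow> real) \<Rightarrow> bool" where
  "unit_in a \<longleftrightarrow> (\<forall>i<N. pvec N P a i = a i) \<and> (\<Sum>i<N. (a i)\<^sup>2) = 1"

lemma vec_unit_in:
  "Matrix.vec N v \<in> mat_range P \<and> vnorm (Matrix.vec N v) = 1 \<longleftrightarrow> unit_in v"
  unfolding unit_in_def mat_range_iff[OF P]
  by (simp add: vnorm_def scalar_prod_def power2_eq_square lessThan_atLeast0)

lemma unit_in_normalized: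
  assumes "bil N P y y > 0"
  shows "unit_in (\<lambda>i. pvec N P y i / sqrt (bil N P y y))"
proof -
  have "pvec N P (\<lambda>i. pvec N P y i / sqrt (bil N P y y)) i = pvec N P y i / sqrt (bil N P y y)" if "i < N" for i
    using pvec_scale[of N P "1 / sqrt (bil N P y y)" "pvec N P y" i] pvec_pvec[OF P that] by simp
  moreover have "(\<Sum>i<N. (pvec N P y i / sqrt (bil N P y y))\<^sup>2) = (\<Sum>i<N. pvec N P y i * pvec N P y i) / bil N P y y"
    using assms by (simp add: power_divide sum_divide_distrib power2_eq_square)
  ultimately show ?thesis using assms unfolding unit_in_def bil_eq_inner[OF P, symmetric] by simp
qed

text \<open>The direction of the projection of a standard Gaussian vector has the required law: an
  orthogonal map preserving the range commutes with \<open>P\<close> and keeps |P x|, so it commutes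
  with the normalisation \<open>T\<close>. Existence matters because \<open>uniform_sphere\<close>
  is defined by choice.\<close>

lemma uniform_sphere_exists: "\<exists>\<nu>. is_uniform_sphere N (mat_range P) \<nu>"
proof
  let ?B = "(\<Pi>\<^sub>M i\<in>{..<N}. borel) :: (nat \<Rightarrow> real) measure"
  define T where "T = (\<lambda>x. \<lambda>i\<in>{..<N}. pvec N P x i / sqrt (bil N P x x))"
  have T[measurable]: "T \<in> gauss {..<N} \<rightarrow>\<^sub>M ?B"
    unfolding T_def by (rule measurable_restrict) measurable
  let ?\<nu> = "distr (gauss {..<N}) ?B T"
  show "is_uniform_sphere N (mat_range P) ?\<nu>"
    unfolding is_uniform_sphere_def vec_unit_in
  proof (intro conjI ballI impI)
    show "prob_space ?\<nu>" by (rule gauss.prob_space_distr) measurable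
    have "Measurable.pred ?B (\<lambda>v. (\<forall>i\<in>{..<N}. pvec N P v i - v i = 0) \<and> (\<Sum>i<N. (v i)\<^sup>2) = 1)"
    proof (intro pred_intros_logic pred_intros_finite)
      show "Measurable.pred ?B (\<lambda>v. pvec N P v i - v i = 0)" if "i \<in> {..<N}" for i
        using that by measurable
      show "Measurable.pred ?B (\<lambda>v. (\<Sum>i<N. (v i)\<^sup>2) = 1)" by measurable
    qed simp
    moreover have "unit_in = (\<lambda>v. (\<forall>i\<in>{..<N}. pvec N P v i - v i = 0) \<and> (\<Sum>i<N. (v i)\<^sup>2) = 1)"
      by (auto simp: unit_in_def fun_eq_iff)
    ultimately have [measurable]: "Measurable.pred ?B unit_in" by simp
    have "AE x in gauss {..<N}. unit_in (T x)"
      using AE_gauss_bil_pos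
    proof eventually_elim
      case (elim x)
      have "unit_in (T x) \<longleftrightarrow> unit_in (\<lambda>i. pvec N P x i / sqrt (bil N P x x))"
        unfolding unit_in_def T_def pvec_restrict by simp
      then show ?case using unit_in_normalized[OF elim] by simp
    qed
    then show "AE v in ?\<nu>. unit_in v" by (subst AE_distr_iff) auto
    fix Q assume Q': "Q \<in> carrier_mat N N" and "transpose_mat Q * Q = 1\<^sub>m N \<and> (\<forall>w\<in>mat_range P. Q *\<^sub>v w \<in> mat_range P)"
    then have Q: "orth_mat N Q" and inv: "\<forall>w\<in>mat_range P. Q *\<^sub>v w \<in> mat_range P" by (auto simp: orth_mat_def)
    have L: "(\<lambda>v. \<lambda>i\<in>{..<N}. vec_index (Q *\<^sub>v Matrix.vec N v) i) = lin N Q"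
      unfolding lin_def using mat_vec_index[OF Q'] by (auto simp: fun_eq_iff)
    have "distr ?\<nu> ?B (lin N Q) = distr (gauss {..<N}) ?B (lin N Q \<circ> T)"
      by (rule distr_distr) measurable
    also have "lin N Q \<circ> T = T \<circ> lin N Q"
    proof
      fix x
      have b: "bil N P (lin N Q x) (lin N Q x) = bil N P x x"
        using bil_orth_mat[OF P Q inv, of x x] bil_cong[of N "lin N Q x" "pvec N Q x" "lin N Q x" "pvec N Q x" P]
        by (simp add: lin_def)
      have "pvec N Q (T x) i = pvec N P (lin N Q x) i / sqrt (bil N P x x)" if i: "i < N" for i
      proof -
        have "pvec N Q (T x) i = pvec N Q (\<lambda>i. (1 / sqrt (bil N P x x)) * pvec N P x i) i"
          unfolding T_def by (rule pvec_cong) simp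
        also have "\<dots> = (1 / sqrt (bil N P x x)) * pvec N P (pvec N Q x) i"
          unfolding pvec_scale by (simp only: orth_mat_commutes[OF P Q inv i])
        finally show ?thesis by (simp add: pvec_lin)
      qed
      then show "(lin N Q \<circ> T) x = (T \<circ> lin N Q) x"
        unfolding comp_def by (subst lin_def) (auto simp: T_def b fun_eq_iff)
    qed
    also have "distr (gauss {..<N}) ?B (T \<circ> lin N Q) = distr (distr (gauss {..<N}) (gauss {..<N}) (lin N Q)) ?B T"
      by (rule distr_distr[symmetric]) measurable
    also have "\<dots> = ?\<nu>" unfolding gauss_orthogonal[OF Q] ..
    finally show "distr ?\<nu> ?B (\<lambda>v. \<lambda>i\<in>{..<N}. vec_index (Q *\<^sub>v Matrix.vec N v) i) = ?\<nu>" unfolding L .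
  qed simp
qed

text \<open>Homogeneity of the sphere. The reflection along b - a carries \<open>a\<close> to
  \<open>b\<close>, and it preserves the range because it only adds multiples of b - a, which lies
  in the range.\<close>

lemma householder_unit_in:
  assumes a: "unit_in a" and b: "unit_in b"
  defines "H \<equiv> householder N (\<lambda>k. b k - a k)"
  shows "orth_mat N H" "\<forall>w\<in>mat_range P. H *\<^sub>v w \<in> mat_range P" "\<And>i. i < N \<Longrightarrow> pvec N H a i = b i"
proof -
  show H: "orth_mat N H"
    unfolding orth_mat_def H_def householder_sym by (simp add: householder_square householder_carrier)
  show "pvec N H a i = b i" if "i < N" for i
  proof -
    have "pvec N H b j = a j" if "j < N" for j
      unfolding H_def by (rule householder_maps[OF _ that]) (use a b in \<open>simp add: unit_in_def\<close>)
    then have "pvec N H a i = pvec N H (pvec N H b) i" by (intro pvec_cong) simp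
    also have "\<dots> = b i"
      using orth_mat_inverse(1)[OF H that, of b] by (simp add: H_def householder_sym)
    finally show ?thesis .
  qed
  have "pvec N P (pvec N H (pvec N P x)) i = pvec N H (pvec N P x) i" if i: "i < N" for x i
  proof -
    define t where "t = 2 / (\<Sum>k<N. (b k - a k)\<^sup>2) * (\<Sum>k<N. (b k - a k) * pvec N P x k)"
    have Hx: "pvec N H (pvec N P x) j = pvec N P x j + t * (a j + (-1) * b j)" if "j < N" for j
      unfolding H_def householder_pvec[OF that] t_def[symmetric] by (simp add: algebra_simps)
    have "pvec N P (pvec N H (pvec N P x)) i = pvec N P (\<lambda>j. pvec N P x j + t * (a j + (-1) * b j)) i"
      by (rule pvec_cong) (rule Hx)
    also have "\<dots> = pvec N P (pvec N P x) i + t * (pvec N P a i + (-1) * pvec N P b i)"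
      unfolding pvec_add pvec_scale ..
    also have "\<dots> = pvec N P x i + t * (a i + (-1) * b i)"
      using a b i pvec_pvec[OF P i] by (simp add: unit_in_def)
    finally show ?thesis using Hx[OF i] by simp
  qed
  then show "\<forall>w\<in>mat_range P. H *\<^sub>v w \<in> mat_range P"
    using mat_range_preserved_iff[OF P orth_mat_carrier(1)[OF H]] by blast
qed

text \<open>By Fubini, the direction of an independent Gaussian vector can stand for the fixed
  direction, or the sphere point for a fixed unit vector.\<close>

lemma uniform_sphere_cdf:
  assumes \<nu>: "is_uniform_sphere N (mat_range P) \<nu>" and y: "bil N P y y > 0"
  shows "measure \<nu> {v \<in> space \<nu>. (\<Sum>i<N. pvec N P y i * v i) \<le> s * sqrt (bil N P y y)}
    = measure (gauss {..<N}) {x \<in> space (gauss {..<N}). bil N P y x \<le> s * sqrt (bil N P y y) * sqrt (bil N P x x)}"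
proof -
  let ?G = "gauss {..<N}"
  interpret \<nu>: prob_space \<nu> using \<nu> by (simp add: is_uniform_sphere_def)
  have sets\<nu>[measurable_cong]: "sets \<nu> = sets (\<Pi>\<^sub>M i\<in>{..<N}. borel)" using \<nu> by (simp add: is_uniform_sphere_def)
  have AE_unit: "AE v in \<nu>. unit_in v" using \<nu> by (simp add: is_uniform_sphere_def vec_unit_in)
  have inv\<nu>: "distr \<nu> \<nu> (lin N Q) = \<nu>" if Q: "orth_mat N Q" "\<forall>w\<in>mat_range P. Q *\<^sub>v w \<in> mat_range P" for Q
  proof -
    have L: "(\<lambda>v. \<lambda>i\<in>{..<N}. vec_index (Q *\<^sub>v Matrix.vec N v) i) = lin N Q"
      unfolding lin_def using mat_vec_index[OF orth_mat_carrier(1)[OF Q(1)]] by (auto simp: fun_eq_iff)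
    have "distr \<nu> (\<Pi>\<^sub>M i\<in>{..<N}. borel) (\<lambda>v. \<lambda>i\<in>{..<N}. vec_index (Q *\<^sub>v Matrix.vec N v) i) = \<nu>"
      using \<nu> Q unfolding is_uniform_sphere_def orth_mat_def by blast
    then have "distr \<nu> (\<Pi>\<^sub>M i\<in>{..<N}. borel) (lin N Q) = \<nu>" unfolding L .
    moreover have "distr \<nu> (\<Pi>\<^sub>M i\<in>{..<N}. borel) (lin N Q) = distr \<nu> \<nu> (lin N Q)"
      by (intro distr_cong) (auto simp: sets\<nu>)
    ultimately show ?thesis by simp
  qed
  \<comment> \<open>\<open>f a\<close> is the sphere measure of the half-space with normal
    \<open>a\<close>; \<open>g v\<close> is the chance that the direction of a projected Gaussian
    vector falls in the half-space with normal \<open>v\<close>. The reflections show that both are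
    constant on unit vectors of the range.\<close>
  define f where "f = (\<lambda>a. measure \<nu> {v \<in> space \<nu>. (\<Sum>i<N. a i * v i) \<le> s})"
  define g where "g = (\<lambda>v. measure ?G {x \<in> space ?G. (\<Sum>i<N. v i * x i) \<le> s * sqrt (bil N P x x)})"
  have adj: "(\<Sum>i<N. b i * lin N H v i) = (\<Sum>i<N. a i * v i)"
    if H: "orth_mat N H" "transpose_mat H = H" "\<And>i. i < N \<Longrightarrow> pvec N H b i = a i" for a b v H
  proof -
    have "(\<Sum>i<N. b i * lin N H v i) = (\<Sum>i<N. b i * pvec N H v i)" by (simp add: lin_def)
    also have "\<dots> = (\<Sum>i<N. a i * v i)"
      unfolding inner_transpose[OF orth_mat_carrier(1)[OF H(1)]] H(2) using H(3) by simp
    finally show ?thesis .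
  qed
  have f_const: "f a = f b" if ab: "unit_in a" "unit_in b" for a b
  proof -
    note H = householder_unit_in[OF ab(2,1)]
    let ?H = "householder N (\<lambda>k. a k - b k)"
    have [measurable]: "lin N ?H \<in> \<nu> \<rightarrow>\<^sub>M \<nu>" by measurable
    have "f b = measure (distr \<nu> \<nu> (lin N ?H)) {v \<in> space \<nu>. (\<Sum>i<N. b i * v i) \<le> s}"
      unfolding inv\<nu>[OF H(1,2)] f_def ..
    also have "\<dots> = measure \<nu> (lin N ?H -` {v \<in> space \<nu>. (\<Sum>i<N. b i * v i) \<le> s} \<inter> space \<nu>)"
      by (rule measure_distr) measurable
    also have "lin N ?H -` {v \<in> space \<nu>. (\<Sum>i<N. b i * v i) \<le> s} \<inter> space \<nu> = {v \<in> space \<nu>. (\<Sum>i<N. a i * v i) \<le> s}"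
      using measurable_space[OF \<open>lin N ?H \<in> \<nu> \<rightarrow>\<^sub>M \<nu>\<close>] adj[OF H(1) householder_sym H(3)] by auto
    finally show ?thesis by (simp add: f_def)
  qed
  have g_const: "g a = g b" if ab: "unit_in a" "unit_in b" for a b
  proof -
    note H = householder_unit_in[OF ab(2,1)]
    let ?H = "householder N (\<lambda>k. a k - b k)"
    have [measurable]: "lin N ?H \<in> ?G \<rightarrow>\<^sub>M ?G" by measurable
    have b: "bil N P (lin N ?H x) (lin N ?H x) = bil N P x x" for x
      using bil_orth_mat[OF P H(1,2), of x x] bil_cong[of N "lin N ?H x" "pvec N ?H x" "lin N ?H x" "pvec N ?H x" P]
      by (simp add: lin_def)
    have "g b = measure (distr ?G ?G (lin N ?H)) {x \<in> space ?G. (\<Sum>i<N. b i * x i) \<le> s * sqrt (bil N P x x)}"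
      unfolding gauss_orthogonal[OF H(1)] g_def ..
    also have "\<dots> = measure ?G (lin N ?H -` {x \<in> space ?G. (\<Sum>i<N. b i * x i) \<le> s * sqrt (bil N P x x)} \<inter> space ?G)"
      by (rule measure_distr) measurable
    also have "lin N ?H -` {x \<in> space ?G. (\<Sum>i<N. b i * x i) \<le> s * sqrt (bil N P x x)} \<inter> space ?G
        = {x \<in> space ?G. (\<Sum>i<N. a i * x i) \<le> s * sqrt (bil N P x x)}"
      using measurable_space[OF \<open>lin N ?H \<in> ?G \<rightarrow>\<^sub>M ?G\<close>] adj[OF H(1) householder_sym H(3)] b by auto
    finally show ?thesis by (simp add: g_def)
  qed
  let ?a = "\<lambda>i. pvec N P y i / sqrt (bil N P y y)"
  have a: "unit_in ?a" by (rule unit_in_normalized[OF y])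
  interpret pair: pair_sigma_finite ?G \<nu> ..
  \<comment> \<open>One event on the product space. For fixed x its slice has mass \<open>f\<close>
    at the direction of P x; for fixed v its slice has mass \<open>g v\<close>.\<close>
  let ?E = "{z \<in> space (?G \<Otimes>\<^sub>M \<nu>). (\<Sum>i<N. pvec N P (fst z) i * snd z i) \<le> s * sqrt (bil N P (fst z) (fst z))}"
  have m1: "(\<lambda>z. snd z i) \<in> borel_measurable (?G \<Otimes>\<^sub>M \<nu>)" if "i \<in> {..<N}" for i
    using that by measurable
  have m2: "(\<lambda>z. pvec N P (fst z) i) \<in> borel_measurable (?G \<Otimes>\<^sub>M \<nu>)" for i
    by (rule measurable_compose[OF measurable_fst]) measurable
  have E: "?E \<in> sets (?G \<Otimes>\<^sub>M \<nu>)" using m1 m2 by measurable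
  have "emeasure (?G \<Otimes>\<^sub>M \<nu>) ?E = (\<integral>\<^sup>+x. emeasure \<nu> (Pair x -` ?E) \<partial>?G)"
    by (rule \<nu>.emeasure_pair_measure_alt[OF E])
  also have "\<dots> = (\<integral>\<^sup>+x. ennreal (f ?a) \<partial>?G)"
  proof (rule nn_integral_cong_AE)
    show "AE x in ?G. emeasure \<nu> (Pair x -` ?E) = ennreal (f ?a)"
      using AE_gauss_bil_pos AE_space
    proof eventually_elim
      case (elim x)
      have "Pair x -` ?E = {v \<in> space \<nu>. (\<Sum>i<N. pvec N P x i / sqrt (bil N P x x) * v i) \<le> s}"
        using elim by (auto simp: space_pair_measure sum_divide_distrib[symmetric] pos_divide_le_eq)
      then have "emeasure \<nu> (Pair x -` ?E) = ennreal (f (\<lambda>i. pvec N P x i / sqrt (bil N P x x)))"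
        by (simp add: f_def \<nu>.emeasure_eq_measure)
      then show ?case using f_const[OF unit_in_normalized[OF elim(1)] a] by simp
    qed
  qed
  also have "\<dots> = ennreal (f ?a)" by (simp add: gauss.emeasure_space_1)
  finally have 1: "emeasure (?G \<Otimes>\<^sub>M \<nu>) ?E = ennreal (f ?a)" .
  have "emeasure (?G \<Otimes>\<^sub>M \<nu>) ?E = (\<integral>\<^sup>+v. emeasure ?G ((\<lambda>x. (x, v)) -` ?E) \<partial>\<nu>)"
    by (rule pair.emeasure_pair_measure_alt2[OF E])
  also have "\<dots> = (\<integral>\<^sup>+v. ennreal (g ?a) \<partial>\<nu>)"
  proof (rule nn_integral_cong_AE)
    show "AE v in \<nu>. emeasure ?G ((\<lambda>x. (x, v)) -` ?E) = ennreal (g ?a)"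
      using AE_unit AE_space
    proof eventually_elim
      case (elim v)
      have "(\<Sum>i<N. pvec N P x i * v i) = (\<Sum>i<N. v i * x i)" for x
      proof -
        have "(\<Sum>i<N. pvec N P x i * v i) = (\<Sum>i<N. x i * pvec N P v i)" by (rule inner_pvec[OF P, symmetric])
        then show ?thesis using elim(1) by (simp add: unit_in_def mult.commute)
      qed
      then have "(\<lambda>x. (x, v)) -` ?E = {x \<in> space ?G. (\<Sum>i<N. v i * x i) \<le> s * sqrt (bil N P x x)}"
        using elim by (auto simp: space_pair_measure)
      then show ?case using g_const[OF elim(1) a] by (simp add: g_def gauss.emeasure_eq_measure)
    qed
  qed
  also have "\<dots> = ennreal (g ?a)" by (simp add: \<nu>.emeasure_space_1)
  finally have "ennreal (f ?a) = ennreal (g ?a)" using 1 by simp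
  then have fg: "f ?a = g ?a" by (simp add: f_def g_def)
  have "(\<Sum>i<N. ?a i * v i) \<le> s \<longleftrightarrow> (\<Sum>i<N. pvec N P y i * v i) \<le> s * sqrt (bil N P y y)" for v
    using y by (simp add: sum_divide_distrib[symmetric] pos_divide_le_eq)
  moreover have "(\<Sum>i<N. ?a i * x i) \<le> s * sqrt (bil N P x x) \<longleftrightarrow>
      bil N P y x \<le> s * sqrt (bil N P y y) * sqrt (bil N P x x)" for x
  proof -
    have "(\<Sum>i<N. ?a i * x i) = bil N P y x / sqrt (bil N P y y)"
      unfolding bil_eq_pvec inner_pvec[OF P, of y x] by (simp add: sum_divide_distrib)
    then show ?thesis using y by (simp add: pos_divide_le_eq mult_ac)
  qed
  ultimately show ?thesis using fg unfolding f_def g_def by simp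
qed

end

text \<open>Right continuity makes the infimum a minimum, so quantile and distribution function form
  a Galois connection. Rejection thereby becomes a condition on the distribution function at the
  observed statistic.\<close>

lemma quantile_le_iff:
  assumes \<mu>: "real_distribution \<mu>" and u: "0 < u" "u < 1"
  shows "quantile \<mu> u \<le> t \<longleftrightarrow> u \<le> cdf \<mu> t"
proof -
  interpret real_distribution \<mu> by (rule \<mu>)
  let ?S = "{t. cdf \<mu> t \<ge> u}"
  have "eventually (\<lambda>t. cdf \<mu> t > u) at_top"
    using cdf_lim_at_top_prob u(2) by (rule order_tendstoD)
  then obtain t1 where "\<And>t. t \<ge> t1 \<Longrightarrow> u < cdf \<mu> t" unfolding eventually_at_top_linorder by auto
  from this[of t1] have t1: "t1 \<in> ?S" by simp
  have "eventually (\<lambda>t. cdf \<mu> t < u) at_bot"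
    using cdf_lim_at_bot u(1) by (rule order_tendstoD)
  then obtain t0 where t0: "\<And>t. t \<le> t0 \<Longrightarrow> cdf \<mu> t < u" unfolding eventually_at_bot_linorder by auto
  have bdd: "bdd_below ?S"
    using t0 by (intro bdd_belowI[of _ t0]) (metis linorder_not_le mem_Collect_eq less_imp_le)
  let ?q = "Inf ?S"
  have ev: "cdf \<mu> s \<ge> u" if s: "s > ?q" for s
  proof -
    obtain r where r: "r \<in> ?S" "r < s" using cInf_lessD[OF _ s] t1 by blast
    then have "cdf \<mu> r \<le> cdf \<mu> s" by (intro cdf_nondecreasing) simp
    then show ?thesis using r by simp
  qed
  have "(cdf \<mu> \<longlongrightarrow> cdf \<mu> ?q) (at_right ?q)"
    using cdf_is_right_cont[of ?q] by (simp add: continuous_within)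
  then have q: "u \<le> cdf \<mu> ?q"
    by (rule tendsto_lowerbound) (auto simp: eventually_at_right_less intro!: eventually_mono[OF eventually_at_right_less] ev)
  show ?thesis
  proof
    assume "quantile \<mu> u \<le> t"
    then have "cdf \<mu> ?q \<le> cdf \<mu> t" unfolding quantile_def by (rule cdf_nondecreasing)
    then show "u \<le> cdf \<mu> t" using q by simp
  next
    assume "u \<le> cdf \<mu> t"
    then show "quantile \<mu> u \<le> t" unfolding quantile_def using bdd by (intro cInf_lower) auto
  qed
qed

text \<open>The part of \<open>x\<close> in the column space is shared by the statistic and its
  resampled copies and cancels. What remains compares |P x| <y, v> with <y, P x> for a sphere point
  v, and \<open>uniform_sphere_cdf\<close> trades v for a Gaussian vector. The criterion is stated
  without division so that P x = 0 and P y = 0 are covered.\<close>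

lemma ccrt_rejects_iff:
  fixes x Y :: "nat \<Rightarrow> real"
  assumes Z: "Z \<in> carrier_mat N d" and P0: "\<exists>i<N. resid_mat Z $$ (i, i) \<noteq> 0"
    and n: "0 < n" "n \<le> N" and \<alpha>: "0 < \<alpha>" "\<alpha> < 1"
  defines "P \<equiv> resid_mat Z"
    and "y \<equiv> \<lambda>i. if i < n then Y i else 0"
  shows "ccrt_rejects \<alpha> Z (Matrix.vec N x) (Matrix.vec n Y) \<longleftrightarrow>
    measure (gauss {..<N}) {u \<in> space (gauss {..<N}).
      sqrt (bil N P x x) * bil N P y u \<le> bil N P y x * sqrt (bil N P u u)} \<ge> 1 - \<alpha>"
proof -
  have P: "orth_proj N P" unfolding P_def by (rule resid_mat_proj[OF Z])
  note Pc = orth_proj_carrier[OF P]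
  have P0': "\<exists>i<N. P $$ (i, i) \<noteq> 0" using P0 by (simp add: P_def)
  have dZ: "dim_row Z = N" using Z by simp
  define \<nu> where "\<nu> = uniform_sphere N (mat_range P)"
  have \<nu>: "is_uniform_sphere N (mat_range P) \<nu>"
    unfolding \<nu>_def uniform_sphere_def by (rule someI_ex) (rule uniform_sphere_exists[OF P P0'])
  interpret \<nu>: prob_space \<nu> using \<nu> by (simp add: is_uniform_sphere_def)
  have sets\<nu>[measurable_cong]: "sets \<nu> = sets (\<Pi>\<^sub>M i\<in>{..<N}. borel)" using \<nu> by (simp add: is_uniform_sphere_def)
  define r where "r = vnorm (P *\<^sub>v Matrix.vec N x)"
  have r: "r = sqrt (bil N P x x)"
    unfolding r_def vnorm_def mat_vec_vec[OF Pc] bil_eq_inner[OF P]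
    by (simp add: scalar_prod_def lessThan_atLeast0)
  define b where "b = (\<lambda>i. x i - pvec N P x i)"
  have hat: "hat_mat Z *\<^sub>v Matrix.vec N x = Matrix.vec N b"
  proof (rule eq_vecI)
    fix i assume "i < dim_vec (Matrix.vec N b)"
    then have i: "i < N" by simp
    have "pvec N (resid_mat Z + hat_mat Z) x i = pvec N (resid_mat Z) x i + pvec N (hat_mat Z) x i"
      using hat_mat_carrier[OF Z] Pc i by (simp add: pvec_def P_def distrib_right sum.distrib)
    then show "vec_index (hat_mat Z *\<^sub>v Matrix.vec N x) i = vec_index (Matrix.vec N b) i"
      using i unfolding resid_hat[OF Z] pvec_one[OF i]
      by (simp add: mat_vec_index[OF hat_mat_carrier[OF Z]] b_def P_def del: index_mult_mat_vec)
  qed (use hat_mat_carrier[OF Z] in auto)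
  have T: "T_MC (Matrix.vec n Y) (vec_first (Matrix.vec N f) n) = (\<Sum>i<N. y i * f i) / real n" for f
  proof -
    have "(\<Sum>i<N. y i * f i) = (\<Sum>i<n. Y i * f i)"
      using n by (intro sum.mono_neutral_cong_right) (auto simp: y_def)
    then show ?thesis
      using n by (simp add: T_MC_def scalar_prod_def vec_first_def lessThan_atLeast0)
  qed
  define h where "h = (\<lambda>v. (\<Sum>i<N. y i * (b i + r * v i)) / real n)"
  have hm[measurable]: "h \<in> borel_measurable \<nu>" unfolding h_def by measurable
  have law: "resampled_T_law Z (Matrix.vec n Y) (hat_mat Z *\<^sub>v Matrix.vec N x) (vnorm (resid_mat Z *\<^sub>v Matrix.vec N x))
      = distr \<nu> borel h"
  proof -
    have "Matrix.vec N b + r \<cdot>\<^sub>v Matrix.vec N v = Matrix.vec N (\<lambda>i. b i + r * v i)" for v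
      by (rule eq_vecI) auto
    then show ?thesis
      unfolding resampled_T_law_def hat dZ P_def[symmetric] r_def[symmetric] \<nu>_def[symmetric]
      by (simp add: T h_def)
  qed
  have rd: "real_distribution (distr \<nu> borel h)" by (rule \<nu>.real_distribution_distr) measurable
  let ?t = "(\<Sum>i<N. y i * x i) / real n"
  have "ccrt_rejects \<alpha> Z (Matrix.vec N x) (Matrix.vec n Y) \<longleftrightarrow> 1 - \<alpha> \<le> cdf (distr \<nu> borel h) ?t"
    unfolding ccrt_rejects_def law using quantile_le_iff[OF rd, of "1 - \<alpha>" ?t] \<alpha> by (simp add: T)
  also have "cdf (distr \<nu> borel h) ?t = measure \<nu> {v \<in> space \<nu>. h v \<le> ?t}"
    unfolding cdf_def by (subst measure_distr) (auto intro!: arg_cong2[where f = measure])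
  also have "{v \<in> space \<nu>. h v \<le> ?t} = {v \<in> space \<nu>. r * (\<Sum>i<N. y i * v i) \<le> bil N P y x}"
  proof -
    have "h v \<le> ?t \<longleftrightarrow> r * (\<Sum>i<N. y i * v i) \<le> bil N P y x" for v
    proof -
      have "h v \<le> ?t \<longleftrightarrow> (\<Sum>i<N. y i * (b i + r * v i)) \<le> (\<Sum>i<N. y i * x i)"
        unfolding h_def using n by (simp add: divide_le_cancel)
      also have "(\<Sum>i<N. y i * (b i + r * v i)) = (\<Sum>i<N. y i * x i) - bil N P y x + r * (\<Sum>i<N. y i * v i)"
        unfolding bil_eq_pvec b_def by (simp add: algebra_simps sum.distrib sum_subtractf sum_distrib_left)
      finally show ?thesis by simp
    qed
    then show ?thesis by simp
  qed
  \<comment> \<open>Almost every sphere point lies in the range, so \<open>y\<close> may be replaced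
    by its projection.\<close>
  also have "measure \<nu> \<dots> = measure \<nu> {v \<in> space \<nu>. r * (\<Sum>i<N. pvec N P y i * v i) \<le> bil N P y x}"
  proof (rule measure_eq_AE)
    show "AE v in \<nu>. v \<in> {v \<in> space \<nu>. r * (\<Sum>i<N. y i * v i) \<le> bil N P y x} \<longleftrightarrow>
        v \<in> {v \<in> space \<nu>. r * (\<Sum>i<N. pvec N P y i * v i) \<le> bil N P y x}"
    proof -
      have "AE v in \<nu>. \<forall>i<N. pvec N P v i = v i"
        using \<nu> unfolding is_uniform_sphere_def mat_range_iff[OF P] by (auto elim!: eventually_mono)
      then show ?thesis
      proof eventually_elim
        case (elim v)
        have "(\<Sum>i<N. pvec N P y i * v i) = (\<Sum>i<N. y i * pvec N P v i)" by (rule inner_pvec[OF P, symmetric])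
        then have "(\<Sum>i<N. pvec N P y i * v i) = (\<Sum>i<N. y i * v i)" using elim by simp
        then show ?case by simp
      qed
    qed
  qed measurable
  also have "measure \<nu> {v \<in> space \<nu>. r * (\<Sum>i<N. pvec N P y i * v i) \<le> bil N P y x} =
    measure (gauss {..<N}) {u \<in> space (gauss {..<N}). r * bil N P y u \<le> bil N P y x * sqrt (bil N P u u)}"
  \<comment> \<open>If P y or P x vanishes, both inequalities read 0 \<le> 0 and both probabilities
    are 1.\<close>
  proof (cases "bil N P y y = 0 \<or> bil N P x x = 0")
    case True
    have yx: "bil N P y x = 0"
      using True bil_zero[OF P, of y x] bil_zero[OF P, of x y] bil_sym[OF P, of x y] by auto
    have "r * (\<Sum>i<N. pvec N P y i * v i) \<le> bil N P y x" for v
      using True pvec_zero[OF P, of y] by (auto simp: r yx)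
    moreover have "r * bil N P y u \<le> bil N P y x * sqrt (bil N P u u)" for u
      using True bil_zero[OF P, of y u] by (auto simp: r yx)
    ultimately show ?thesis by (simp add: gauss.prob_space \<nu>.prob_space)
  next
    case False
    then have pos: "bil N P y y > 0" "r > 0" using bil_nonneg[OF P, of y] bil_nonneg[OF P, of x] by (auto simp: r)
    define s where "s = bil N P y x / (r * sqrt (bil N P y y))"
    have s: "s * sqrt (bil N P y y) = bil N P y x / r" using pos by (simp add: s_def field_simps)
    have "r * (\<Sum>i<N. pvec N P y i * v i) \<le> bil N P y x \<longleftrightarrow> (\<Sum>i<N. pvec N P y i * v i) \<le> s * sqrt (bil N P y y)" for v
      unfolding s using pos by (simp add: pos_le_divide_eq mult.commute)
    moreover have "r * bil N P y u \<le> bil N P y x * sqrt (bil N P u u) \<longleftrightarrow>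
        bil N P y u \<le> s * sqrt (bil N P y y) * sqrt (bil N P u u)" for u
      unfolding s using pos by (simp add: pos_le_divide_eq mult_ac)
    ultimately show ?thesis using uniform_sphere_cdf[OF P P0' \<nu> pos(1), of s] by simp
  qed
  finally show ?thesis unfolding r .
qed

section \<open>Residual projections of a Gaussian array\<close>

text \<open>The block of \<open>d\<close> columns starting at column \<open>s\<close>. Offset 0
  gives all covariates, offset 1 leaves out the signal column.\<close>

definition blk :: "nat \<Rightarrow> nat \<Rightarrow> nat \<Rightarrow> (nat \<times> nat \<Rightarrow> real) \<Rightarrow> real Matrix.mat" where
  "blk N s d x = Matrix.mat N d (\<lambda>(i, j). x (i, s + j))"

definition gram :: "nat \<Rightarrow> nat \<Rightarrow> nat \<Rightarrow> (nat \<times> nat \<Rightarrow> real) \<Rightarrow> real Matrix.mat" where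
  "gram N s d x = Matrix.mat d d (\<lambda>(k, l). \<Sum>i<N. x (i, s + k) * x (i, s + l))"

definition res :: "nat \<Rightarrow> nat \<Rightarrow> nat \<Rightarrow> (nat \<times> nat \<Rightarrow> real) \<Rightarrow> real Matrix.mat" where
  "res N s d x = resid_mat (blk N s d x)"

lemma blk_carrier: "blk N s d x \<in> carrier_mat N d"
  by (simp add: blk_def)

lemma gram_eq: "transpose_mat (blk N s d x) * blk N s d x = gram N s d x"
  by (rule eq_matI) (auto simp: blk_def gram_def scalar_prod_def lessThan_atLeast0)

lemma res_proj: "orth_proj N (res N s d x)"
  unfolding res_def by (rule resid_mat_proj[OF blk_carrier])

section \<open>Measurability of the residual projection\<close>

lemma measurable_det:
  assumes "\<And>i j. i < n \<Longrightarrow> j < n \<Longrightarrow> (\<lambda>x. F x i j) \<in> borel_measurable M"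
  shows "(\<lambda>x. Determinant.det (Matrix.mat n n (\<lambda>(i, j). F x i j)) :: real) \<in> borel_measurable M"
proof -
  have "Determinant.det (Matrix.mat n n (\<lambda>(i, j). F x i j))
      = (\<Sum>p\<in>{p. p permutes {0..<n}}. signof p * (\<Prod>i = 0..<n. F x i (p i)))" for x
    by (subst det_def'[of _ n], simp)
      (intro sum.cong refl arg_cong2[where f = "(*)"] prod.cong, auto)
  moreover have "(\<lambda>x. \<Sum>p\<in>{p. p permutes {0..<n}}. signof p * (\<Prod>i = 0..<n. F x i (p i))) \<in> borel_measurable M"
    by (intro borel_measurable_sum borel_measurable_times borel_measurable_const borel_measurable_prod assms)
      (auto)
  ultimately show ?thesis by simp
qed

lemma measurable_adj:
  assumes F: "\<And>i j. i < n \<Longrightarrow> j < n \<Longrightarrow> (\<lambda>x. F x i j) \<in> borel_measurable M" and kl: "k < n" "l < n"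
  shows "(\<lambda>x. adj_mat (Matrix.mat n n (\<lambda>(i, j). F x i j)) $$ (k, l) :: real) \<in> borel_measurable M"
proof -
  define s where "s = (\<lambda>a i. if i < a then i else Suc i :: nat)"
  have s: "s a i < n" if "i < n - 1" for a i using that by (auto simp: s_def)
  have "mat_delete (Matrix.mat n n (\<lambda>(i, j). F x i j)) l k = Matrix.mat (n - 1) (n - 1) (\<lambda>(i, j). F x (s l i) (s k j))" for x
    unfolding mat_delete_def by (rule eq_matI) (auto simp: s_def)
  moreover have "(\<lambda>x. Determinant.det (Matrix.mat (n - 1) (n - 1) (\<lambda>(i, j). F x (s l i) (s k j)))) \<in> borel_measurable M"
    by (rule measurable_det) (intro F s)
  ultimately show ?thesis
    using kl by (simp add: adj_mat_def cofactor_def)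
qed

lemma measurable_entry:
  "i < N \<Longrightarrow> j < D \<Longrightarrow> (\<lambda>x. x (i, j)) \<in> borel_measurable (arr N D)"
  unfolding measurable_cong_sets[OF sets_arr refl] by (auto intro: measurable_component_singleton)

lemma measurable_resid_mat:
  assumes F: "\<And>i j. i < N \<Longrightarrow> j < d \<Longrightarrow> (\<lambda>x. F x i j) \<in> borel_measurable M" and ij: "i < N" "j < N"
  shows "(\<lambda>x. resid_mat (Matrix.mat N d (\<lambda>(i, j). F x i j)) $$ (i, j)) \<in> borel_measurable M"
proof -
  let ?Z = "\<lambda>x. Matrix.mat N d (\<lambda>(i, j). F x i j)"
  let ?G = "\<lambda>x. Matrix.mat d d (\<lambda>(k, l). \<Sum>i<N. F x i k * F x i l)"
  have gram: "transpose_mat (?Z x) * ?Z x = ?G x" for x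
    by (rule eq_matI) (auto simp: scalar_prod_def lessThan_atLeast0)
  have Gm: "(\<lambda>x. \<Sum>i<N. F x i k * F x i l) \<in> borel_measurable M" if "k < d" "l < d" for k l
    by (intro borel_measurable_sum borel_measurable_times F) (use that in auto)
  have inv: "(\<lambda>x. inv_mat (?G x) $$ (k, l)) \<in> borel_measurable M" if kl: "k < d" "l < d" for k l
  proof -
    have [measurable]: "(\<lambda>x. adj_mat (?G x) $$ (k, l)) \<in> borel_measurable M"
      by (rule measurable_adj[OF _ kl], rule Gm)
    have [measurable]: "(\<lambda>x. Determinant.det (?G x)) \<in> borel_measurable M"
      by (rule measurable_det, rule Gm)
    have "(\<lambda>x. if Determinant.det (?G x) = 0 then 0 else adj_mat (?G x) $$ (k, l) / Determinant.det (?G x)) \<in> borel_measurable M"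
      by measurable
    then show ?thesis using inv_mat_index[of "?G _" d k l] kl by simp
  qed
  have eq: "resid_mat (?Z x) $$ (i, j) = (if i = j then 1 else 0) -
      (\<Sum>k<d. \<Sum>l<d. F x i k * inv_mat (?G x) $$ (k, l) * F x j l)" for x
    using resid_mat_index[of "?Z x" N d i j] ij unfolding gram by simp
  show ?thesis
    unfolding eq
    by (intro borel_measurable_diff borel_measurable_const borel_measurable_sum borel_measurable_times inv F) (use ij in auto)
qed

lemma measurable_res:
  assumes D: "s + d \<le> D" and ij: "i < N" "j < N"
  shows "(\<lambda>x. res N s d x $$ (i, j)) \<in> borel_measurable (arr N D)"
  unfolding res_def blk_def
  by (rule measurable_resid_mat[OF _ ij], rule measurable_entry) (use D in auto)

lemma upd_index: "i < N \<Longrightarrow> j < D \<Longrightarrow> upd N D k x y (i, j) = (if j = k then y i else x (i, j))"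
  by (simp add: upd_def)

lemma blk_upd:
  assumes "s + d \<le> D" "k < s \<or> s + d \<le> k"
  shows "blk N s d (upd N D k x y) = blk N s d x"
  unfolding blk_def by (rule eq_matI) (use assms in \<open>auto simp: upd_index\<close>)

lemma res_upd:
  assumes "s + d \<le> D" "k < s \<or> s + d \<le> k"
  shows "res N s d (upd N D k x y) = res N s d x"
  unfolding res_def blk_upd[OF assms] ..

text \<open>Induction on the size. Laplace expansion makes the determinant linear in the last
  column, which is independent of the previous ones, and the coefficient of its bottom entry is the
  previous determinant. A linear form that is not zero vanishes with probability 0.\<close>

lemma AE_top_block:
  assumes "k \<le> N" "s + k \<le> D"
  shows "AE x in arr N D. Determinant.det (blk k s k x) \<noteq> 0"
  using assms
proof (induction k)
  case 0
  then show ?case by (simp add: blk_def)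
next
  case (Suc k)
  then have kN: "k < N" and kD: "s + k < D" by auto
  let ?B = "\<lambda>x. blk (Suc k) s (Suc k) x"
  have meas: "(\<lambda>x. Determinant.det (?B x)) \<in> borel_measurable (arr N D)"
    unfolding blk_def by (intro measurable_det measurable_entry) (use Suc.prems in auto)
  define E where "E = {x \<in> space (arr N D). Determinant.det (?B x) = 0}"
  have E: "E \<in> sets (arr N D)" unfolding E_def using meas[measurable] by measurable
  have "measure (arr N D) E = 0"
  proof (rule measure_arr_column_eq[OF kD E])
    have IH: "AE x in arr N D. Determinant.det (blk k s k x) \<noteq> 0" using Suc by simp
    then show "AE x in arr N D. measure (gauss {..<N}) {y \<in> space (gauss {..<N}). upd N D (s + k) x y \<in> E} = 0"
      using AE_space
    proof eventually_elim
      case (elim x)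
      \<comment> \<open>The cofactors along the last column see only the earlier columns and so
        survive the update. Rows below the block get coefficient 0.\<close>
      define c where "c = (\<lambda>i. if i < Suc k then cofactor (?B x) i k else 0)"
      have det: "Determinant.det (?B (upd N D (s + k) x y)) = (\<Sum>i<N. c i * y i)" for y
      proof -
        have "cofactor (?B (upd N D (s + k) x y)) i k = cofactor (?B x) i k" if "i < Suc k" for i
        proof -
          have "mat_delete (?B (upd N D (s + k) x y)) i k = mat_delete (?B x) i k"
            unfolding mat_delete_def
            by (rule eq_matI) (use Suc.prems that in \<open>auto simp: blk_def upd_index\<close>)
          then show ?thesis by (simp add: cofactor_def)
        qed
        moreover have "Determinant.det (?B (upd N D (s + k) x y))
            = (\<Sum>i<Suc k. ?B (upd N D (s + k) x y) $$ (i, k) * cofactor (?B (upd N D (s + k) x y)) i k)"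
          by (rule laplace_expansion_column[OF blk_carrier]) simp
        ultimately have "Determinant.det (?B (upd N D (s + k) x y)) = (\<Sum>i<Suc k. c i * y i)"
          using kN kD by (simp add: blk_def upd_index c_def mult.commute)
        also have "\<dots> = (\<Sum>i<N. c i * y i)"
          using kN by (intro sum.mono_neutral_left) (auto simp: c_def)
        finally show ?thesis .
      qed
      have "mat_delete (?B x) k k = blk k s k x"
        unfolding mat_delete_def by (rule eq_matI) (auto simp: blk_def)
      then have "c k \<noteq> 0" using elim by (simp add: c_def cofactor_def)
      then have "(\<Sum>i<N. (c i)\<^sup>2) > 0"
        using kN by (intro sum_pos2[of _ k]) auto
      from AE_gauss_linear_nonzero[OF _ this]
      have "AE y in gauss {..<N}. (\<Sum>i<N. c i * y i) \<noteq> 0" by simp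
      then have "AE y in gauss {..<N}. \<not> (upd N D (s + k) x y \<in> E)"
        by eventually_elim (simp add: E_def det)
      then show ?case
        using emeasure_arr_column(2)[OF kD E, of x] elim
        by (subst gauss.prob_eq_0) (auto simp: elim!: eventually_mono)
    qed
  qed
  then have "AE x in arr N D. x \<notin> E" using E by (simp add: arr.prob_eq_0)
  with AE_space show ?case by eventually_elim (simp add: E_def)
qed

text \<open>An invertible top square block already forces the kernel of the whole block to be
  trivial.\<close>

lemma AE_gram_det:
  assumes d: "d \<le> N" and D: "s + d \<le> D"
  shows "AE x in arr N D. Determinant.det (gram N s d x) \<noteq> 0"
  using AE_top_block[OF d D]
proof eventually_elim
  case (elim x)
  show ?case
    unfolding gram_eq[symmetric] gram_det_nonzero_iff[OF blk_carrier]
  proof (intro ballI impI)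
    fix v assume v: "v \<in> carrier_vec d" and 0: "blk N s d x *\<^sub>v v = 0\<^sub>v N"
    have "blk d s d x *\<^sub>v v = 0\<^sub>v d"
    proof (rule eq_vecI)
      fix i assume "i < dim_vec (0\<^sub>v d)"
      then have i: "i < d" by simp
      have "vec_index (blk d s d x *\<^sub>v v) i = vec_index (blk N s d x *\<^sub>v v) i"
        using i d v by (simp add: blk_def scalar_prod_def)
      then show "vec_index (blk d s d x *\<^sub>v v) i = vec_index (0\<^sub>v d) i"
        using 0 i d by simp
    qed (simp add: blk_def)
    then show "v = 0\<^sub>v d"
      using elim det_0_iff_vec_prod_zero[OF blk_carrier[of d s d x]] v by auto
  qed
qed

text \<open>The diagonal entries of the projection are exchangeable with an almost surely constant sum, hence
  negatively correlated.\<close>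

lemma res_diag_concentration:
  assumes d: "d \<le> N" and D: "s + d \<le> D" and n: "n \<le> N" and \<delta>: "\<delta> > 0"
  shows "measure (arr N D) {x \<in> space (arr N D).
    \<bar>(\<Sum>i<n. res N s d x $$ (i, i)) - real n * (real N - real d) / real N\<bar> \<ge> \<delta>} \<le> real n / \<delta>\<^sup>2"
proof -
  define \<mu> where "\<mu> = (real N - real d) / real N"
  \<comment> \<open>Deviations from the average diagonal entry; by the trace formula they sum to 0
    almost surely.\<close>
  define b where "b = (\<lambda>i x. res N s d x $$ (i, i) - \<mu>)"
  have \<mu>: "0 \<le> \<mu>" "\<mu> \<le> 1" using d by (auto simp: \<mu>_def divide_le_eq_1)
  have bm: "b i \<in> borel_measurable (arr N D)" if "i < N" for i
    unfolding b_def by (intro borel_measurable_diff borel_measurable_const measurable_res D that)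
  have b1: "\<bar>b i x\<bar> \<le> 1" if "i < N" for i x
    using orth_proj_diag[OF res_proj that, of s d x] \<mu> unfolding b_def by (auto simp: abs_le_iff)
  have bb_int: "integrable (arr N D) (\<lambda>x. b i x * b j x)" if "i < N" "j < N" for i j
  proof (rule arr.integrable_const_bound[of _ 1])
    show "AE x in arr N D. norm (b i x * b j x) \<le> 1"
      using b1 that by (intro AE_I2) (auto simp: abs_mult intro!: mult_le_one)
  qed (use bm that in auto)
  have sum0: "AE x in arr N D. (\<Sum>i<N. b i x) = 0"
    using AE_gram_det[OF d D]
  proof eventually_elim
    case (elim x)
    have "(\<Sum>i<N. res N s d x $$ (i, i)) = real N - real d"
      unfolding res_def by (rule resid_mat_diag_sum[OF blk_carrier]) (simp add: gram_eq elim)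
    then have "(\<Sum>i<N. b i x) = (real N - real d) - real N * \<mu>" by (simp add: b_def sum_subtractf)
    also have "\<dots> = 0" using d by (cases "N = 0") (auto simp: \<mu>_def)
    finally show ?case .
  qed
  have exch: "(\<integral>x. b i x * b j x \<partial>arr N D) = (\<integral>x. b i x * b j' x \<partial>arr N D)"
    if ij: "i < N" "j < N" "j' < N" "j \<noteq> i" "j' \<noteq> i" for i j j'
  proof -
    \<comment> \<open>The swap fixes \<open>i\<close>, so invariance of the array law exchanges
      \<open>b j\<close> with \<open>b j'\<close> while keeping \<open>b i\<close>.\<close>
    define \<pi> where "\<pi> = Transposition.transpose j j'"
    have \<pi>: "bij_betw \<pi> {..<N} {..<N}"
      unfolding \<pi>_def using ij by (intro bij_betw_byWitness[of _ "Transposition.transpose j j'"])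
        (auto simp: Transposition.transpose_def)
    define T where "T = (\<lambda>x. \<lambda>p\<in>{..<N} \<times> {..<D}. x (\<pi> (fst p), snd p) :: real)"
    have T: "distr (arr N D) (arr N D) T = arr N D"
      unfolding T_def by (rule distr_arr_permute_rows[OF \<pi>])
    have \<pi>N: "\<pi> a < N" if "a < N" for a using \<pi> that by (auto dest: bij_betwE)
    have Tm: "T \<in> arr N D \<rightarrow>\<^sub>M arr N D"
    proof -
      have "T \<in> arr N D \<rightarrow>\<^sub>M PiM ({..<N} \<times> {..<D}) (\<lambda>_. borel)"
        unfolding T_def by (rule measurable_restrict) (auto intro!: measurable_entry \<pi>N)
      then show ?thesis using measurable_cong_sets[OF refl sets_arr] by blast
    qed
    have bT: "b a (T x) = b (\<pi> a) x" if a: "a < N" for a x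
    proof -
      have "blk N s d (T x) = Matrix.mat N d (\<lambda>(i, k). x (\<pi> i, s + k))"
        unfolding blk_def by (rule eq_matI) (use D in \<open>auto simp: T_def\<close>)
      then show ?thesis
        using resid_mat_permute_rows[OF \<pi> a a, of d "\<lambda>i k. x (i, s + k)"]
        by (simp add: b_def res_def blk_def)
    qed
    have "(\<integral>x. b i x * b j' x \<partial>arr N D) = (\<integral>x. b i x * b j' x \<partial>distr (arr N D) (arr N D) T)"
      by (simp add: T)
    also have "\<dots> = (\<integral>x. b i (T x) * b j' (T x) \<partial>arr N D)"
      by (rule integral_distr[OF Tm]) (use bm ij in auto)
    also have "\<dots> = (\<integral>x. b i x * b j x \<partial>arr N D)"
      using ij by (simp add: bT \<pi>_def)
    finally show ?thesis ..
  qed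
  have neg: "(\<integral>x. b i x * b j x \<partial>arr N D) \<le> 0" if ij: "i < N" "j < N" "i \<noteq> j" for i j
  proof -
    let ?I = "\<lambda>j. \<integral>x. b i x * b j x \<partial>arr N D"
    \<comment> \<open>Multiplying the vanishing sum by \<open>b i\<close> gives 0 = E b_i^2 + (N -
      1) E b_i b_j, so the mixed moment cannot be positive.\<close>
    have "0 = (\<integral>x. b i x * (\<Sum>j<N. b j x) \<partial>arr N D)"
      by (subst integral_eq_zero_AE) (use sum0 in auto)
    also have "\<dots> = (\<Sum>j<N. ?I j)"
      unfolding sum_distrib_left using ij by (intro Bochner_Integration.integral_sum bb_int) auto
    also have "\<dots> = ?I i + (\<Sum>j'\<in>{..<N} - {i}. ?I j')"
      using ij by (intro sum.remove) auto
    also have "(\<Sum>j'\<in>{..<N} - {i}. ?I j') = (\<Sum>j'\<in>{..<N} - {i}. ?I j)"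
      by (rule sum.cong[OF refl]) (use ij in \<open>auto intro!: exch\<close>)
    also have "\<dots> = (real N - 1) * ?I j"
      using ij by (simp add: of_nat_diff)
    finally have "(real N - 1) * ?I j = - ?I i" by simp
    moreover have "?I i \<ge> 0" by (intro integral_nonneg_AE) auto
    moreover have "real N - 1 > 0" using ij by linarith
    ultimately show ?thesis using mult_pos_pos[of "real N - 1" "?I j"] by linarith
  qed
  have bd2: "(\<integral>x. b i x * b i x \<partial>arr N D) \<le> 1" if "i < N" for i
  proof -
    have "(\<integral>x. b i x * b i x \<partial>arr N D) \<le> (\<integral>x. 1 \<partial>arr N D)"
    proof (rule integral_mono[OF bb_int[OF that that]])
      show "b i x * b i x \<le> 1" for x
        using b1[OF that, of x] abs_le_square_iff[of "b i x" 1] by (simp add: power2_eq_square)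
    qed simp
    then show ?thesis by (simp add: arr.prob_space)
  qed
  have "has_bochner_integral (arr N D) (\<lambda>x. (\<Sum>i<n. b i x)\<^sup>2) (\<Sum>i<n. \<Sum>j<n. \<integral>x. b i x * b j x \<partial>arr N D)"
    unfolding power2_eq_square sum_product
    by (intro has_bochner_integral_sum has_bochner_integral_integrable bb_int) (use n in auto)
  moreover have "(\<Sum>i<n. \<Sum>j<n. \<integral>x. b i x * b j x \<partial>arr N D) \<le> (\<Sum>i<n. 1)"
  proof (rule sum_mono)
    fix i assume "i \<in> {..<n}"
    then have i: "i < n" by simp
    have "(\<Sum>j<n. \<integral>x. b i x * b j x \<partial>arr N D) \<le> (\<Sum>j<n. if j = i then 1 else 0)"
      using i n neg[of i] bd2[of i] by (intro sum_mono) auto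
    then show "(\<Sum>j<n. \<integral>x. b i x * b j x \<partial>arr N D) \<le> 1" using i by simp
  qed
  ultimately have "measure (arr N D) {x \<in> space (arr N D). \<bar>\<Sum>i<n. b i x\<bar> \<ge> \<delta>} \<le> (\<Sum>i<n. 1) / \<delta>\<^sup>2"
    by (intro chebyshev_measure[OF arr.prob_space_axioms _ _ \<delta>])
  moreover have "(\<Sum>i<n. b i x) = (\<Sum>i<n. res N s d x $$ (i, i)) - real n * (real N - real d) / real N" for x
    by (simp add: b_def sum_subtractf \<mu>_def)
  ultimately show ?thesis by simp
qed

text \<open>\<open>B\<close> ignores column \<open>k\<close>, so with the other columns fixed this
  is the bound for a constant matrix; being uniform, it integrates.\<close>

lemma column_quadratic_concentration:
  assumes k: "k < D" and Bm: "\<And>i j. i < N \<Longrightarrow> j < N \<Longrightarrow> (\<lambda>x. B x i j) \<in> borel_measurable (arr N D)"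
    and B: "\<And>x y. B (upd N D k x y) = B x"
    and b: "\<And>x. (\<Sum>i<N. \<Sum>j<N. (B x i j)\<^sup>2) \<le> b" and \<delta>: "\<delta> > 0"
  shows "measure (arr N D) {x \<in> space (arr N D).
    \<bar>(\<Sum>i<N. \<Sum>j<N. B x i j * x (i, k) * x (j, k)) - (\<Sum>i<N. B x i i)\<bar> \<ge> \<delta>} \<le> 2 * b / \<delta>\<^sup>2"
    (is "measure _ ?E \<le> _")
proof (rule measure_arr_column_le[OF k])
  have m: "(\<lambda>x. (\<Sum>i<N. \<Sum>j<N. B x i j * x (i, k) * x (j, k)) - (\<Sum>i<N. B x i i)) \<in> borel_measurable (arr N D)"
    by (intro borel_measurable_diff borel_measurable_sum borel_measurable_times Bm measurable_entry) (use k in auto)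
  show "?E \<in> sets (arr N D)" using m[measurable] by measurable
  have "0 \<le> b" using b[of undefined] by (rule order_trans[rotated]) (intro sum_nonneg, simp)
  then show "0 \<le> 2 * b / \<delta>\<^sup>2" by simp
  fix x
  have "{y \<in> space (gauss {..<N}). upd N D k x y \<in> ?E} \<subseteq> {y \<in> space (gauss {..<N}).
      \<bar>(\<Sum>i<N. \<Sum>j<N. B x i j * y i * y j) - (\<Sum>i<N. B x i i)\<bar> \<ge> \<delta>}"
    using k by (auto simp: B upd_index)
  then have "measure (gauss {..<N}) {y \<in> space (gauss {..<N}). upd N D k x y \<in> ?E} \<le>
     measure (gauss {..<N}) {y \<in> space (gauss {..<N}). \<bar>(\<Sum>i<N. \<Sum>j<N. B x i j * y i * y j) - (\<Sum>i<N. B x i i)\<bar> \<ge> \<delta>}"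
    by (rule gauss.finite_measure_mono) measurable
  also have "\<dots> \<le> 2 * b / \<delta>\<^sup>2" by (rule gauss_quadratic_concentration[OF _ b \<delta>]) simp
  finally show "measure (gauss {..<N}) {y \<in> space (gauss {..<N}). upd N D k x y \<in> ?E} \<le> 2 * b / \<delta>\<^sup>2" .
qed

text \<open>The coefficients are random and their norm is controlled only with high probability. The
  control is therefore part of the event: where it fails, the slice is empty.\<close>

lemma column_linear_concentration:
  assumes k: "k < D" and cm: "\<And>i. i < N \<Longrightarrow> (\<lambda>x. c x i) \<in> borel_measurable (arr N D)"
    and c: "\<And>x y. c (upd N D k x y) = c x" and b: "0 \<le> b" and \<delta>: "\<delta> > 0"
  shows "measure (arr N D) {x \<in> space (arr N D).
    \<bar>\<Sum>i<N. c x i * x (i, k)\<bar> \<ge> \<delta> \<and> (\<Sum>i<N. (c x i)\<^sup>2) \<le> b} \<le> b / \<delta>\<^sup>2"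
    (is "measure _ ?E \<le> _")
proof (rule measure_arr_column_le[OF k])
  have m: "(\<lambda>x. \<Sum>i<N. c x i * x (i, k)) \<in> borel_measurable (arr N D)"
    by (intro borel_measurable_sum borel_measurable_times cm measurable_entry) (use k in auto)
  have m': "(\<lambda>x. \<Sum>i<N. (c x i)\<^sup>2) \<in> borel_measurable (arr N D)"
    by (intro borel_measurable_sum borel_measurable_power cm) auto
  show "?E \<in> sets (arr N D)" using m[measurable] m'[measurable] by measurable
  show "0 \<le> b / \<delta>\<^sup>2" using b by simp
  fix x
  show "measure (gauss {..<N}) {y \<in> space (gauss {..<N}). upd N D k x y \<in> ?E} \<le> b / \<delta>\<^sup>2"
  proof (cases "(\<Sum>i<N. (c x i)\<^sup>2) \<le> b")
    case True
    have "{y \<in> space (gauss {..<N}). upd N D k x y \<in> ?E} \<subseteq> {y \<in> space (gauss {..<N}). \<bar>\<Sum>i<N. c x i * y i\<bar> \<ge> \<delta>}"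
      using k by (auto simp: c upd_index)
    then have "measure (gauss {..<N}) {y \<in> space (gauss {..<N}). upd N D k x y \<in> ?E} \<le>
       measure (gauss {..<N}) {y \<in> space (gauss {..<N}). \<bar>\<Sum>i<N. c x i * y i\<bar> \<ge> \<delta>}"
      by (rule gauss.finite_measure_mono) measurable
    also have "\<dots> \<le> b / \<delta>\<^sup>2" by (rule gauss_linear_concentration[OF _ True \<delta>]) simp
    finally show ?thesis .
  next
    case False
    then have *: "{y \<in> space (gauss {..<N}). upd N D k x y \<in> ?E} = {}" by (auto simp: c)
    show ?thesis unfolding * using b by simp
  qed
qed

text \<open>Given the other columns the normalised form is standard normal. This conditional law
  does not depend on them, so it is the unconditional law as well, with no approximation.\<close>

lemma column_normal:
  assumes k: "k < D" and cm: "\<And>i. i < N \<Longrightarrow> (\<lambda>x. c x i) \<in> borel_measurable (arr N D)"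
    and c: "\<And>x y. c (upd N D k x y) = c x" and A: "A \<in> sets borel"
    and pos: "AE x in arr N D. (\<Sum>i<N. (c x i)\<^sup>2) > 0"
  shows "measure (arr N D) {x \<in> space (arr N D). (\<Sum>i<N. c x i * x (i, k)) / sqrt (\<Sum>i<N. (c x i)\<^sup>2) \<in> A}
    = measure std_normal_distribution A"
    (is "measure _ ?E = _")
proof (rule measure_arr_column_eq[OF k])
  have "(\<lambda>x. \<Sum>i<N. c x i * x (i, k)) \<in> borel_measurable (arr N D)"
    by (intro borel_measurable_sum borel_measurable_times cm measurable_entry) (use k in auto)
  moreover have "(\<lambda>x. \<Sum>i<N. (c x i)\<^sup>2) \<in> borel_measurable (arr N D)"
    by (intro borel_measurable_sum borel_measurable_power cm) auto
  ultimately have m: "(\<lambda>x. (\<Sum>i<N. c x i * x (i, k)) / sqrt (\<Sum>i<N. (c x i)\<^sup>2)) \<in> borel_measurable (arr N D)"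
    by measurable
  show E: "?E \<in> sets (arr N D)" using m[measurable] A[measurable] by measurable
  show "AE x in arr N D. measure (gauss {..<N}) {y \<in> space (gauss {..<N}). upd N D k x y \<in> ?E} = measure std_normal_distribution A"
    using pos AE_space
  proof eventually_elim
    case (elim x)
    define q where "q = sqrt (\<Sum>i<N. (c x i)\<^sup>2)"
    have q: "q > 0" "q\<^sup>2 = (\<Sum>i<N. (c x i)\<^sup>2)" using elim(1) by (auto simp: q_def)
    have "(\<Sum>i<N. (c x i / q)\<^sup>2) = 1"
      using q elim by (simp add: power_divide sum_divide_distrib[symmetric])
    note law = gauss_linear_law[OF _ this, simplified]
    have up: "upd N D k x y \<in> space (arr N D)" for y
      by (simp add: arr_def space_gauss upd_def)
    have "{y \<in> space (gauss {..<N}). upd N D k x y \<in> ?E}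
        = (\<lambda>y. \<Sum>i<N. c x i / q * y i) -` A \<inter> space (gauss {..<N})"
      using k up by (auto simp: c upd_index q_def[symmetric] sum_divide_distrib)
    then have "measure (gauss {..<N}) {y \<in> space (gauss {..<N}). upd N D k x y \<in> ?E}
        = measure (distr (gauss {..<N}) borel (\<lambda>y. \<Sum>i<N. c x i / q * y i)) A"
      using A by (subst measure_distr) auto
    then show ?case by (simp add: law)
  qed
qed

section \<open>Convergence in probability\<close>

text \<open>Convergence in probability along a sequence of probability spaces, as a filter on pairs of an
  index and a sample point. This makes the library rules for limits available.\<close>

definition pfilter :: "(nat \<Rightarrow> 'a measure) \<Rightarrow> (nat \<times> 'a) filter" where
  "pfilter M = Abs_filter (\<lambda>P. \<exists>E. (\<forall>\<^sub>F n in sequentially. E n \<in> sets (M n) \<and> (\<forall>x\<in>E n. P (n, x))) \<and>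
     (\<lambda>n. measure (M n) (E n)) \<longlonglongrightarrow> 1)"

context
  fixes M :: "nat \<Rightarrow> 'a measure"
  assumes M: "\<And>n. prob_space (M n)"
begin

lemma eventually_pfilter:
  "eventually P (pfilter M) \<longleftrightarrow>
    (\<exists>E. (\<forall>\<^sub>F n in sequentially. E n \<in> sets (M n) \<and> (\<forall>x\<in>E n. P (n, x))) \<and> (\<lambda>n. measure (M n) (E n)) \<longlonglongrightarrow> 1)"
  unfolding pfilter_def
proof (rule eventually_Abs_filter, rule is_filter.intro)
  show "\<exists>E. (\<forall>\<^sub>F n in sequentially. E n \<in> sets (M n) \<and> (\<forall>x\<in>E n. True)) \<and> (\<lambda>n. measure (M n) (E n)) \<longlonglongrightarrow> 1"
    by (rule exI[of _ "\<lambda>n. space (M n)"]) (simp add: prob_space.prob_space[OF M])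
next
  fix P Q
  assume "\<exists>E. (\<forall>\<^sub>F n in sequentially. E n \<in> sets (M n) \<and> (\<forall>x\<in>E n. P (n, x))) \<and> (\<lambda>n. measure (M n) (E n)) \<longlonglongrightarrow> 1"
    and "\<exists>E. (\<forall>\<^sub>F n in sequentially. E n \<in> sets (M n) \<and> (\<forall>x\<in>E n. Q (n, x))) \<and> (\<lambda>n. measure (M n) (E n)) \<longlonglongrightarrow> 1"
  then obtain E F where
    E: "\<forall>\<^sub>F n in sequentially. E n \<in> sets (M n) \<and> (\<forall>x\<in>E n. P (n, x))" "(\<lambda>n. measure (M n) (E n)) \<longlonglongrightarrow> 1" and
    F: "\<forall>\<^sub>F n in sequentially. F n \<in> sets (M n) \<and> (\<forall>x\<in>F n. Q (n, x))" "(\<lambda>n. measure (M n) (F n)) \<longlonglongrightarrow> 1"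
    by blast
  have "(\<lambda>n. measure (M n) (E n \<inter> F n)) \<longlonglongrightarrow> 1"
  proof (rule tendsto_sandwich)
    have "(\<lambda>n. measure (M n) (E n) + measure (M n) (F n) - 1) \<longlonglongrightarrow> 1 + 1 - 1"
      by (intro tendsto_intros E F)
    then show "(\<lambda>n. measure (M n) (E n) + measure (M n) (F n) - 1) \<longlonglongrightarrow> 1" by simp
    show "\<forall>\<^sub>F n in sequentially. measure (M n) (E n) + measure (M n) (F n) - 1 \<le> measure (M n) (E n \<inter> F n)"
      using E(1) F(1)
    proof eventually_elim
      case (elim n)
      interpret prob_space "M n" by (rule M)
      have "measure (M n) (E n \<union> F n) = measure (M n) (E n) + measure (M n) (F n) - measure (M n) (E n \<inter> F n)"
        using elim by (intro measure_Un3) (auto simp: fmeasurable_eq_sets)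
      then show ?case using prob_le_1[of "E n \<union> F n"] by linarith
    qed
    show "\<forall>\<^sub>F n in sequentially. measure (M n) (E n \<inter> F n) \<le> 1"
      by (simp add: prob_space.prob_le_1[OF M])
  qed simp
  moreover have "\<forall>\<^sub>F n in sequentially. E n \<inter> F n \<in> sets (M n) \<and> (\<forall>x\<in>E n \<inter> F n. P (n, x) \<and> Q (n, x))"
    using E(1) F(1) by eventually_elim auto
  ultimately show "\<exists>E. (\<forall>\<^sub>F n in sequentially. E n \<in> sets (M n) \<and> (\<forall>x\<in>E n. P (n, x) \<and> Q (n, x))) \<and>
      (\<lambda>n. measure (M n) (E n)) \<longlonglongrightarrow> 1" by (intro exI[of _ "\<lambda>n. E n \<inter> F n"]) simp
next
  fix P Q :: "nat \<times> 'a \<Rightarrow> bool"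
  assume PQ: "\<forall>x. P x \<longrightarrow> Q x"
    and "\<exists>E. (\<forall>\<^sub>F n in sequentially. E n \<in> sets (M n) \<and> (\<forall>x\<in>E n. P (n, x))) \<and> (\<lambda>n. measure (M n) (E n)) \<longlonglongrightarrow> 1"
  then show "\<exists>E. (\<forall>\<^sub>F n in sequentially. E n \<in> sets (M n) \<and> (\<forall>x\<in>E n. Q (n, x))) \<and> (\<lambda>n. measure (M n) (E n)) \<longlonglongrightarrow> 1"
    by (auto elim!: eventually_mono)
qed

lemma eventually_pfilter_compl:
  assumes "\<forall>\<^sub>F n in sequentially. {x \<in> space (M n). \<not> P (n, x)} \<in> sets (M n) \<and> measure (M n) {x \<in> space (M n). \<not> P (n, x)} \<le> b n"
    and b: "b \<longlonglongrightarrow> 0"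
  shows "eventually P (pfilter M)"
  unfolding eventually_pfilter
proof (intro exI conjI)
  let ?E = "\<lambda>n. space (M n) - {x \<in> space (M n). \<not> P (n, x)}"
  show "\<forall>\<^sub>F n in sequentially. ?E n \<in> sets (M n) \<and> (\<forall>x\<in>?E n. P (n, x))"
    using assms(1) by eventually_elim auto
  show "(\<lambda>n. measure (M n) (?E n)) \<longlonglongrightarrow> 1"
  proof (rule tendsto_sandwich[of "\<lambda>n. 1 - b n" _ _ "\<lambda>_. 1"])
    show "\<forall>\<^sub>F n in sequentially. 1 - b n \<le> measure (M n) (?E n)"
      using assms(1) by eventually_elim (simp add: prob_space.prob_compl[OF M])
    show "(\<lambda>n. 1 - b n) \<longlonglongrightarrow> 1" using tendsto_diff[OF tendsto_const[of 1] b] by simp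
  qed (simp_all add: prob_space.prob_le_1[OF M])
qed

lemma tendsto_pfilterI:
  fixes f :: "nat \<times> 'a \<Rightarrow> real"
  assumes m: "\<forall>\<^sub>F n in sequentially. (\<lambda>x. f (n, x)) \<in> borel_measurable (M n)"
    and b: "\<And>\<delta>. \<delta> > 0 \<Longrightarrow> \<forall>\<^sub>F n in sequentially. measure (M n) {x \<in> space (M n). \<bar>f (n, x) - c\<bar> \<ge> \<delta>} \<le> b \<delta> n"
      "\<And>\<delta>. \<delta> > 0 \<Longrightarrow> b \<delta> \<longlonglongrightarrow> 0"
  shows "(f \<longlongrightarrow> c) (pfilter M)"
proof (rule tendstoI)
  fix \<delta> :: real assume \<delta>: "\<delta> > 0"
  show "\<forall>\<^sub>F z in pfilter M. dist (f z) c < \<delta>"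
  proof (rule eventually_pfilter_compl[OF _ b(2)[OF \<delta>]])
    show "\<forall>\<^sub>F n in sequentially. {x \<in> space (M n). \<not> dist (f (n, x)) c < \<delta>} \<in> sets (M n) \<and>
        measure (M n) {x \<in> space (M n). \<not> dist (f (n, x)) c < \<delta>} \<le> b \<delta> n"
      using m b(1)[OF \<delta>]
    proof eventually_elim
      case (elim n)
      note elim(1)[measurable]
      have "{x \<in> space (M n). \<not> dist (f (n, x)) c < \<delta>} = {x \<in> space (M n). \<bar>f (n, x) - c\<bar> \<ge> \<delta>}"
        by (auto simp: dist_real_def)
      moreover have "{x \<in> space (M n). \<bar>f (n, x) - c\<bar> \<ge> \<delta>} \<in> sets (M n)" by measurable
      ultimately show ?case using elim(2) by simp
    qed
  qed
qed

lemma eventually_pfilter_fst: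
  assumes "eventually P sequentially" shows "\<forall>\<^sub>F z in pfilter M. P (fst z)"
  unfolding eventually_pfilter
  using assms by (intro exI[of _ "\<lambda>n. space (M n)"]) (auto simp: prob_space.prob_space[OF M] elim: eventually_mono)

lemma tendsto_pfilter_fst:
  assumes "(a \<longlongrightarrow> l) sequentially" shows "((\<lambda>z. a (fst z)) \<longlongrightarrow> l) (pfilter M)"
  using assms unfolding tendsto_def by (auto intro: eventually_pfilter_fst)

lemma eventually_pfilter_AE:
  assumes "\<forall>\<^sub>F n in sequentially. AE x in M n. P (n, x)"
  shows "eventually P (pfilter M)"
proof -
  have "\<forall>n. \<exists>E. (AE x in M n. P (n, x)) \<longrightarrow> E \<in> sets (M n) \<and> (\<forall>x\<in>E. P (n, x)) \<and> measure (M n) E = 1"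
  proof
    fix n
    interpret prob_space "M n" by (rule M)
    show "\<exists>E. (AE x in M n. P (n, x)) \<longrightarrow> E \<in> sets (M n) \<and> (\<forall>x\<in>E. P (n, x)) \<and> measure (M n) E = 1"
    proof (cases "AE x in M n. P (n, x)")
      case True
      then obtain K where K: "{x \<in> space (M n). \<not> P (n, x)} \<subseteq> K" "emeasure (M n) K = 0" "K \<in> sets (M n)"
        by (rule AE_E)
      then have "measure (M n) (space (M n) - K) = 1"
        by (subst prob_compl) (auto simp: measure_def)
      then show ?thesis using K by (intro exI[of _ "space (M n) - K"]) auto
    qed auto
  qed
  then obtain E where E: "\<And>n. (AE x in M n. P (n, x)) \<Longrightarrow> E n \<in> sets (M n) \<and> (\<forall>x\<in>E n. P (n, x)) \<and> measure (M n) (E n) = 1"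
    by metis
  show ?thesis
    unfolding eventually_pfilter
  proof (intro exI conjI)
    show "\<forall>\<^sub>F n in sequentially. E n \<in> sets (M n) \<and> (\<forall>x\<in>E n. P (n, x))"
      by (rule eventually_mono[OF assms]) (use E in blast)
    show "(\<lambda>n. measure (M n) (E n)) \<longlonglongrightarrow> 1"
      by (rule tendsto_eventually, rule eventually_mono[OF assms]) (use E in blast)
  qed
qed

text \<open>The way back from the filter to probabilities: an inclusion that holds with probability
  tending to 1 compares the probabilities up to any fixed error.\<close>

lemma pfilter_measure_le:
  assumes imp: "\<forall>\<^sub>F z in pfilter M. snd z \<in> A (fst z) \<longrightarrow> snd z \<in> B (fst z)"
    and A: "\<forall>\<^sub>F n in sequentially. A n \<in> sets (M n)" and B: "\<forall>\<^sub>F n in sequentially. B n \<in> sets (M n)"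
    and e: "e > (0::real)"
  shows "\<forall>\<^sub>F n in sequentially. measure (M n) (A n) \<le> measure (M n) (B n) + e"
proof -
  obtain E where E: "\<forall>\<^sub>F n in sequentially. E n \<in> sets (M n) \<and> (\<forall>x\<in>E n. x \<in> A n \<longrightarrow> x \<in> B n)"
    "(\<lambda>n. measure (M n) (E n)) \<longlonglongrightarrow> 1"
    using imp unfolding eventually_pfilter by auto
  have "\<forall>\<^sub>F n in sequentially. measure (M n) (E n) > 1 - e"
    using E(2) e by (intro order_tendstoD) auto
  with E(1) A B show ?thesis
  proof eventually_elim
    case (elim n)
    interpret prob_space "M n" by (rule M)
    have "A n \<subseteq> B n \<union> (space (M n) - E n)"
      using elim sets.sets_into_space[of "A n" "M n"] by auto
    then have "measure (M n) (A n) \<le> measure (M n) (B n \<union> (space (M n) - E n))"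
      using elim by (intro finite_measure_mono) auto
    also have "\<dots> \<le> measure (M n) (B n) + measure (M n) (space (M n) - E n)"
      using elim by (intro measure_Un_le) auto
    also have "measure (M n) (space (M n) - E n) = 1 - measure (M n) (E n)"
      using elim by (intro prob_compl) auto
    finally show ?case using elim by linarith
  qed
qed

end

section \<open>The normal distribution function\<close>

lemma real_dist_std_normal: "real_distribution std_normal_distribution"
  unfolding real_distribution_def real_distribution_axioms_def
  by (simp add: prob_space_std_normal)

lemma Phi_eq: "Phi x = measure std_normal_distribution {..x}"
  by (simp add: Phi_def cdf_def)

lemma isCont_Phi: "isCont Phi x"
proof -
  have "emeasure std_normal_distribution {x} = (\<integral>\<^sup>+u. ennreal (std_normal_density u) * indicator {x} u \<partial>lborel)"
    by (rule emeasure_density) auto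
  also have "\<dots> = integral\<^sup>N lborel (\<lambda>u::real. 0)"
  proof (rule nn_integral_cong_AE)
    show "AE u in lborel. ennreal (std_normal_density u) * indicator {x} u = 0"
      using AE_lborel_singleton[of x] by eventually_elim simp
  qed
  finally have "emeasure std_normal_distribution {x} = 0" by simp
  then have "measure std_normal_distribution {x} = 0" by (simp add: measure_def)
  then show ?thesis
    unfolding Phi_def
    using finite_borel_measure.isCont_cdf[OF real_distribution.finite_borel_measure_M[OF real_dist_std_normal], of x]
    by blast
qed

text \<open>The density is positive, so no interval of positive length is a null set. Strictness
  makes the normal quantile unique and the gap in \<open>sphere_critical_value\<close>
  positive.\<close>

lemma Phi_less: assumes "x < y" shows "Phi x < Phi y"
proof -
  interpret N: real_distribution std_normal_distribution by (rule real_dist_std_normal)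
  have "Phi y - Phi x = measure std_normal_distribution {x<..y}"
    unfolding Phi_def using assms by (simp add: N.cdf_diff_eq)
  moreover have "measure std_normal_distribution {x<..y} \<noteq> 0"
  proof
    assume "measure std_normal_distribution {x<..y} = 0"
    then have "emeasure std_normal_distribution {x<..y} = 0" by (simp add: std_normal.emeasure_eq_measure)
    then have "(\<integral>\<^sup>+u. ennreal (std_normal_density u) * indicator {x<..y} u \<partial>lborel) = 0"
      by (simp add: emeasure_density)
    then have "AE u in lborel. ennreal (std_normal_density u) * indicator {x<..y} u = 0"
      by (subst (asm) nn_integral_0_iff_AE) auto
    then have "AE u in lborel. u \<notin> {x<..y}"
    proof eventually_elim
      case (elim u)
      have "std_normal_density u > 0" by (rule normal_density_pos) simp
      then show ?case using elim by (auto simp: indicator_def split: if_splits)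
    qed
    then have "{x<..y} \<in> null_sets lborel" by (subst AE_iff_null_sets) auto
    then have "emeasure lborel {x<..y} = 0" by auto
    then show False using assms by simp
  qed
  moreover have "measure std_normal_distribution {x<..y} \<ge> 0" by simp
  ultimately show ?thesis by linarith
qed

lemma Phi_mono: "x \<le> y \<Longrightarrow> Phi x \<le> Phi y"
  using Phi_less[of x y] by (cases "x = y") auto

lemma Phi_z_quantile:
  assumes a: "0 < a" "a < 1" shows "Phi (z_quantile a) = a"
proof -
  interpret N: real_distribution std_normal_distribution by (rule real_dist_std_normal)
  obtain l where l: "Phi l < a"
    using order_tendstoD(2)[OF N.cdf_lim_at_bot a(1)] unfolding eventually_at_bot_linorder Phi_def by auto
  obtain u where u: "Phi u > a"
    using order_tendstoD(1)[OF N.cdf_lim_at_top_prob a(2)] unfolding eventually_at_top_linorder Phi_def by auto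
  have "l \<le> u" using l u Phi_mono[of u l] by linarith
  then obtain x where x: "Phi x = a"
    using IVT[of Phi l a u] l u isCont_Phi by auto
  show ?thesis unfolding z_quantile_def
  proof (rule theI[of "\<lambda>z. Phi z = a"])
    show "y = x" if "Phi y = a" for y
      using that x Phi_less[of x y] Phi_less[of y x] by (cases x y rule: linorder_cases) auto
  qed (rule x)
qed

lemma std_normal_uminus: "measure std_normal_distribution {x..} = Phi (- x)"
proof -
  have "emeasure std_normal_distribution {x..} = (\<integral>\<^sup>+u. ennreal (std_normal_density u) * indicator {x..} u \<partial>lborel)"
    by (simp add: emeasure_density)
  also have "\<dots> = (\<integral>\<^sup>+u. ennreal (std_normal_density (- u)) * indicator {x..} (- u) \<partial>lborel)"
    using nn_integral_real_affine[of "\<lambda>u. ennreal (std_normal_density u) * indicator {x..} u" "-1" 0] by simp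
  also have "\<dots> = (\<integral>\<^sup>+u. ennreal (std_normal_density u) * indicator {..-x} u \<partial>lborel)"
    by (intro nn_integral_cong arg_cong2[where f = "(*)"]) (auto simp: std_normal_density_def indicator_def)
  also have "\<dots> = emeasure std_normal_distribution {..-x}" by (simp add: emeasure_density)
  finally show ?thesis by (simp add: Phi_eq measure_def)
qed

section \<open>Normal approximation for a coordinate on a high-dimensional sphere\<close>

lemma measurable_bil_right[measurable]: "(\<lambda>u. bil N P y u) \<in> borel_measurable (PiM {..<N} (\<lambda>_. borel))"
  unfolding bil_def by measurable

lemma gauss_bil_law:
  assumes P: "orth_proj N P" and y: "bil N P y y > 0"
  shows "measure (gauss {..<N}) {u \<in> space (gauss {..<N}). bil N P y u \<le> s * sqrt (bil N P y y)} = Phi s"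
proof -
  define q where "q = sqrt (bil N P y y)"
  have q: "q > 0" "q\<^sup>2 = bil N P y y" using y by (auto simp: q_def)
  define c where "c = (\<lambda>i. pvec N P y i / q)"
  have "(\<Sum>i\<in>{..<N}. (c i)\<^sup>2) = 1"
    using q y bil_eq_inner[OF P, of y y]
    by (simp add: c_def power_divide sum_divide_distrib[symmetric] power2_eq_square)
  note law = gauss_linear_law[OF _ this, simplified]
  have "bil N P y u \<le> s * sqrt (bil N P y y) \<longleftrightarrow> (\<Sum>i<N. c i * u i) \<le> s" for u
  proof -
    have "(\<Sum>i<N. c i * u i) = bil N P y u / q"
      unfolding bil_eq_pvec inner_pvec[OF P, of y u] by (simp add: c_def sum_divide_distrib)
    then show ?thesis using q by (simp add: pos_divide_le_eq q_def[symmetric])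
  qed
  then have "measure (gauss {..<N}) {u \<in> space (gauss {..<N}). bil N P y u \<le> s * sqrt (bil N P y y)}
      = measure (distr (gauss {..<N}) borel (\<lambda>u. \<Sum>i<N. c i * u i)) {..s}"
    by (subst measure_distr) (auto intro!: arg_cong2[where f = measure])
  then show ?thesis by (simp add: law Phi_eq)
qed

text \<open>For a projection the squared Frobenius norm is the trace, so the relative deviation of
  |P u|^2 is governed by the rank alone.\<close>

lemma gauss_bil_concentration:
  assumes P: "orth_proj N P" and \<delta>: "\<delta> > 0"
  shows "measure (gauss {..<N}) {u \<in> space (gauss {..<N}). \<bar>bil N P u u - (\<Sum>i<N. P $$ (i, i))\<bar> \<ge> \<delta>}
    \<le> 2 * (\<Sum>i<N. P $$ (i, i)) / \<delta>\<^sup>2"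
  unfolding bil_def
  by (rule gauss_quadratic_concentration[OF _ _ \<delta>]) (auto simp: orth_proj_frob[OF P])

text \<open>For Q \<ge> 0 one has |Q - 1| \<le> |Q - 1| (Q + 1) = |Q^2 - 1|.\<close>

lemma sqrt_ratio_close:
  fixes r b e :: real
  assumes r: "r > 0" and b: "b \<ge> 0"
  shows "sqrt (b / r) \<ge> 0" "\<bar>b - r\<bar> < e * r \<Longrightarrow> \<bar>sqrt (b / r) - 1\<bar> < e" "sqrt r * sqrt (b / r) = sqrt b"
proof -
  define Q where "Q = sqrt (b / r)"
  have Q: "Q \<ge> 0" "Q\<^sup>2 = b / r" using r b by (auto simp: Q_def)
  show "sqrt (b / r) \<ge> 0" "sqrt r * sqrt (b / r) = sqrt b" using r b by (auto simp: real_sqrt_divide)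
  show "\<bar>sqrt (b / r) - 1\<bar> < e" if "\<bar>b - r\<bar> < e * r"
  proof -
    have "\<bar>Q - 1\<bar> * 1 \<le> \<bar>Q - 1\<bar> * \<bar>Q + 1\<bar>" using Q by (intro mult_left_mono) auto
    also have "\<dots> = \<bar>Q\<^sup>2 - 1\<bar>" by (simp add: abs_mult[symmetric] power2_eq_square algebra_simps)
    also have "Q\<^sup>2 - 1 = (b - r) / r" using r by (simp add: Q(2) diff_divide_distrib)
    also have "\<bar>(b - r) / r\<bar> < e" using that r by (simp add: abs_divide pos_divide_less_eq)
    finally show ?thesis by (simp add: Q_def)
  qed
qed

text \<open><y, P u> / |P y| is exactly standard normal and |P u| is close to the square root of the
  trace. Both facts are uniform over projections of large trace, and uniformity is essential because
  the bound is later applied to a random projection and a random \<open>y\<close>.\<close>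

lemma sphere_critical_value:
  assumes z: "Phi z = a" and \<delta>: "\<delta> > 0"
  obtains r0 where "r0 > 0"
    "\<And>N P y t. orth_proj N P \<Longrightarrow> (\<Sum>i<N. P $$ (i, i)) \<ge> r0 \<Longrightarrow> bil N P y y > 0 \<Longrightarrow> t \<ge> z + \<delta> \<Longrightarrow>
      a \<le> measure (gauss {..<N}) {u \<in> space (gauss {..<N}).
        sqrt (\<Sum>i<N. P $$ (i, i)) * bil N P y u \<le> t * sqrt (bil N P y y) * sqrt (bil N P u u)}"
    "\<And>N P y t. orth_proj N P \<Longrightarrow> (\<Sum>i<N. P $$ (i, i)) \<ge> r0 \<Longrightarrow> bil N P y y > 0 \<Longrightarrow> t \<le> z - \<delta> \<Longrightarrow>
      measure (gauss {..<N}) {u \<in> space (gauss {..<N}).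
        sqrt (\<Sum>i<N. P $$ (i, i)) * bil N P y u \<le> t * sqrt (bil N P y y) * sqrt (bil N P u u)} < a"
proof -
  \<comment> \<open>Chosen so that a relative error \<open>e\<close> in |P u| moves a threshold
    \<open>z + \<delta>\<close> or \<open>z - \<delta>\<close> by at most \<delta> / 2.\<close>
  define e where "e = \<delta> / (2 * (\<bar>z\<bar> + \<delta>))"
  have "\<bar>z\<bar> + \<delta> > 0" using \<delta> by linarith
  then have e: "e > 0" "e * (\<bar>z\<bar> + \<delta>) = \<delta> / 2" using \<delta> by (auto simp: e_def field_simps)
  define gap where "gap = min (Phi (z + \<delta> / 2) - a) (a - Phi (z - \<delta> / 2))"
  have gap: "gap > 0" using Phi_less[of z "z + \<delta> / 2"] Phi_less[of "z - \<delta> / 2" z] z \<delta> by (simp add: gap_def)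
  \<comment> \<open>Chebyshev's inequality bounds the probability of a relative error
    \<open>e\<close> by 2 / (e^2 r), which is at most half of \<open>gap\<close> once r \<ge>
    \<open>r0\<close>.\<close>
  define r0 where "r0 = 4 / (e\<^sup>2 * gap)"
  have r0: "r0 > 0" using e gap by (simp add: r0_def)
  have main: "a \<le> measure (gauss {..<N}) {u \<in> space (gauss {..<N}).
        sqrt (\<Sum>i<N. P $$ (i, i)) * bil N P y u \<le> t * sqrt (bil N P y y) * sqrt (bil N P u u)}"
    if "t \<ge> z + \<delta>"
    and P: "orth_proj N P" and r: "(\<Sum>i<N. P $$ (i, i)) \<ge> r0" and y: "bil N P y y > 0" for N P y t
  proof -
    let ?G = "gauss {..<N}"
    define r where "r = (\<Sum>i<N. P $$ (i, i))"
    have rpos: "r > 0" using r r0 by (simp add: r_def)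
    let ?T = "{u \<in> space ?G. sqrt r * bil N P y u \<le> t * sqrt (bil N P y y) * sqrt (bil N P u u)}"
    let ?B = "{u \<in> space ?G. \<bar>bil N P u u - r\<bar> \<ge> e * r}"
    let ?A = "{u \<in> space ?G. bil N P y u \<le> (z + \<delta> / 2) * sqrt (bil N P y y)}"
    have sub: "?A \<subseteq> ?T \<union> ?B"
    proof
      fix u assume u: "u \<in> ?A"
      show "u \<in> ?T \<union> ?B"
      proof (cases "\<bar>bil N P u u - r\<bar> \<ge> e * r")
        case False
        define Q where "Q = sqrt (bil N P u u / r)"
        note close = sqrt_ratio_close[OF rpos bil_nonneg[OF P, of u], folded Q_def]
        have Q0: "Q \<ge> 0" and Qe: "\<bar>Q - 1\<bar> < e" and rQ: "sqrt r * Q = sqrt (bil N P u u)"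
          using close(1,3) close(2)[of e] False by auto
        have "\<bar>(z + \<delta>) * (Q - 1)\<bar> \<le> (\<bar>z\<bar> + \<delta>) * e"
          unfolding abs_mult using Qe \<delta> by (intro mult_mono) auto
        then have "(z + \<delta>) * Q \<ge> z + \<delta> / 2" using e by (simp add: algebra_simps abs_le_iff)
        moreover have "t * Q \<ge> (z + \<delta>) * Q" using that(1) Q0 by (intro mult_right_mono)
        ultimately have "z + \<delta> / 2 \<le> t * Q" by linarith
        then have "(z + \<delta> / 2) * sqrt (bil N P y y) \<le> t * Q * sqrt (bil N P y y)" using y by (intro mult_right_mono) auto
        then have "bil N P y u \<le> t * Q * sqrt (bil N P y y)" using u by simp
        then have "sqrt r * bil N P y u \<le> sqrt r * (t * Q * sqrt (bil N P y y))" using rpos by (intro mult_left_mono) auto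
        also have "\<dots> = t * sqrt (bil N P y y) * (sqrt r * Q)" by (simp add: mult_ac)
        also note rQ
        finally show ?thesis using u by simp
      qed (use u in simp)
    qed
    have "Phi (z + \<delta> / 2) = measure ?G ?A" by (rule gauss_bil_law[OF P y, symmetric])
    also have "\<dots> \<le> measure ?G (?T \<union> ?B)" by (rule gauss.finite_measure_mono[OF sub]) measurable
    also have "\<dots> \<le> measure ?G ?T + measure ?G ?B" by (rule measure_Un_le) measurable
    also have "measure ?G ?B \<le> 2 * r / (e * r)\<^sup>2"
      unfolding r_def by (rule gauss_bil_concentration[OF P]) (use e rpos in \<open>simp add: r_def[symmetric]\<close>)
    also have "2 * r / (e * r)\<^sup>2 = 2 / (e\<^sup>2 * r)" using rpos by (simp add: power2_eq_square field_simps)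
    also have "\<dots> \<le> 2 / (e\<^sup>2 * r0)" using r r0 e by (intro divide_left_mono mult_left_mono mult_pos_pos) (auto simp: r_def)
    also have "\<dots> = gap / 2" using e gap by (simp add: r0_def)
    finally have "measure ?G ?T \<ge> Phi (z + \<delta> / 2) - gap / 2" by simp
    moreover have "gap \<le> Phi (z + \<delta> / 2) - a" by (simp add: gap_def)
    ultimately show ?thesis using gap unfolding r_def by linarith
  qed
  have main': "measure (gauss {..<N}) {u \<in> space (gauss {..<N}).
        sqrt (\<Sum>i<N. P $$ (i, i)) * bil N P y u \<le> t * sqrt (bil N P y y) * sqrt (bil N P u u)} < a"
    if "t \<le> z - \<delta>"
    and P: "orth_proj N P" and r: "(\<Sum>i<N. P $$ (i, i)) \<ge> r0" and y: "bil N P y y > 0" for N P y t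
  proof -
    let ?G = "gauss {..<N}"
    define r where "r = (\<Sum>i<N. P $$ (i, i))"
    have rpos: "r > 0" using r r0 by (simp add: r_def)
    let ?T = "{u \<in> space ?G. sqrt r * bil N P y u \<le> t * sqrt (bil N P y y) * sqrt (bil N P u u)}"
    let ?B = "{u \<in> space ?G. \<bar>bil N P u u - r\<bar> \<ge> e * r}"
    let ?A = "{u \<in> space ?G. bil N P y u \<le> (z - \<delta> / 2) * sqrt (bil N P y y)}"
    have sub: "?T \<subseteq> ?A \<union> ?B"
    proof
      fix u assume u: "u \<in> ?T"
      show "u \<in> ?A \<union> ?B"
      proof (cases "\<bar>bil N P u u - r\<bar> \<ge> e * r")
        case False
        define Q where "Q = sqrt (bil N P u u / r)"
        note close = sqrt_ratio_close[OF rpos bil_nonneg[OF P, of u], folded Q_def]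
        have Q0: "Q \<ge> 0" and Qe: "\<bar>Q - 1\<bar> < e" and rQ: "sqrt r * Q = sqrt (bil N P u u)"
          using close(1,3) close(2)[of e] False by auto
        have "\<bar>(z - \<delta>) * (Q - 1)\<bar> \<le> (\<bar>z\<bar> + \<delta>) * e"
          unfolding abs_mult using Qe \<delta> by (intro mult_mono) auto
        then have "(z - \<delta>) * Q \<le> z - \<delta> / 2" using e by (simp add: algebra_simps abs_le_iff)
        moreover have "t * Q \<le> (z - \<delta>) * Q" using that(1) Q0 by (intro mult_right_mono)
        ultimately have "t * Q \<le> z - \<delta> / 2" by linarith
        then have le: "t * Q * sqrt (bil N P y y) \<le> (z - \<delta> / 2) * sqrt (bil N P y y)" using y by (intro mult_right_mono) auto
        have "sqrt r * bil N P y u \<le> sqrt r * (t * Q * sqrt (bil N P y y))"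
          using u by (simp add: rQ[symmetric] mult_ac)
        then have "bil N P y u \<le> t * Q * sqrt (bil N P y y)" using rpos by simp
        with le show ?thesis using u by simp
      qed (use u in simp)
    qed
    have "measure ?G ?T \<le> measure ?G (?A \<union> ?B)" by (rule gauss.finite_measure_mono[OF sub]) measurable
    also have "\<dots> \<le> measure ?G ?A + measure ?G ?B" by (rule measure_Un_le) measurable
    also have "measure ?G ?A = Phi (z - \<delta> / 2)" by (rule gauss_bil_law[OF P y])
    also have "measure ?G ?B \<le> 2 * r / (e * r)\<^sup>2"
      unfolding r_def by (rule gauss_bil_concentration[OF P]) (use e rpos in \<open>simp add: r_def[symmetric]\<close>)
    also have "2 * r / (e * r)\<^sup>2 = 2 / (e\<^sup>2 * r)" using rpos by (simp add: power2_eq_square field_simps)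
    also have "\<dots> \<le> 2 / (e\<^sup>2 * r0)" using r r0 e by (intro divide_left_mono mult_left_mono mult_pos_pos) (auto simp: r_def)
    also have "\<dots> = gap / 2" using e gap by (simp add: r0_def)
    finally have "measure ?G ?T \<le> Phi (z - \<delta> / 2) + gap / 2" by simp
    moreover have "gap \<le> a - Phi (z - \<delta> / 2)" by (simp add: gap_def)
    ultimately show ?thesis using gap unfolding r_def by linarith
  qed
  show ?thesis by (rule that[OF r0]) (rule main main'; assumption)+
qed

section \<open>Limits of quadratic forms\<close>

text \<open>Zero extension of the labeled part. Truncation at the full length leaves a vector
  unchanged, so one family of limits serves truncated and full vectors alike.\<close>

definition truncate :: "nat \<Rightarrow> (nat \<Rightarrow> real) \<Rightarrow> nat \<Rightarrow> real" where
  "truncate a v i = (if i < a then v i else 0)"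

definition column :: "nat \<Rightarrow> (nat \<times> nat \<Rightarrow> real) \<Rightarrow> nat \<Rightarrow> real" where
  "column k x i = x (i, k)"

lemma measurable_res_bil:
  assumes "s + e \<le> D" "\<And>i. i < N \<Longrightarrow> (\<lambda>x. f x i) \<in> borel_measurable (arr N D)"
    "\<And>i. i < N \<Longrightarrow> (\<lambda>x. g x i) \<in> borel_measurable (arr N D)"
  shows "(\<lambda>x. bil N (res N s e x) (f x) (g x)) \<in> borel_measurable (arr N D)"
  unfolding bil_def
  by (intro borel_measurable_sum borel_measurable_times measurable_res assms) auto

lemma measurable_truncate_column: "k < D \<Longrightarrow> i < N \<Longrightarrow> (\<lambda>x. truncate a (column k x) i) \<in> borel_measurable (arr N D)"
  unfolding truncate_def column_def by (cases "i < a") (auto intro: measurable_entry)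

text \<open>A quadratic form of column \<open>k\<close> in the matrix J_a R J_b, where J_a keeps the
  leading \<open>a\<close> coordinates. Its Frobenius norm is at most that of R, and its trace is
  the sum of the leading min(a, b) diagonal entries of R.\<close>

lemma quadratic_concentration:
  assumes D: "s + e \<le> D" "k < D" "k < s \<or> s + e \<le> k" and ab: "a \<le> N" "b \<le> N" and \<delta>: "\<delta> > 0"
  shows "measure (arr N D) {x \<in> space (arr N D).
    \<bar>bil N (res N s e x) (truncate a (column k x)) (truncate b (column k x)) - (\<Sum>i<min a b. res N s e x $$ (i, i))\<bar> \<ge> \<delta>}
    \<le> 2 * real N / \<delta>\<^sup>2"
proof -
  define B where "B = (\<lambda>x i j. if i < a \<and> j < b then res N s e x $$ (i, j) else 0)"
  have 1: "bil N (res N s e x) (truncate a (column k x)) (truncate b (column k x)) = (\<Sum>i<N. \<Sum>j<N. B x i j * x (i, k) * x (j, k))" for x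
    unfolding bil_def by (intro sum.cong refl) (auto simp: B_def truncate_def column_def)
  have 2: "(\<Sum>i<min a b. res N s e x $$ (i, i)) = (\<Sum>i<N. B x i i)" for x
    using ab by (intro sum.mono_neutral_cong_left) (auto simp: B_def)
  show ?thesis
    unfolding 1 2
  proof (rule column_quadratic_concentration[OF D(2) _ _ _ \<delta>])
    show "(\<lambda>x. B x i j) \<in> borel_measurable (arr N D)" if "i < N" "j < N" for i j
      unfolding B_def using measurable_res[OF D(1) that] by (cases "i < a \<and> j < b") auto
    show "B (upd N D k x y) = B x" for x y unfolding B_def res_upd[OF D(1,3)] ..
    have "(\<Sum>i<N. \<Sum>j<N. (B x i j)\<^sup>2) \<le> (\<Sum>i<N. \<Sum>j<N. (res N s e x $$ (i, j))\<^sup>2)" for x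
      by (intro sum_mono) (auto simp: B_def)
    then show "(\<Sum>i<N. \<Sum>j<N. (B x i j)\<^sup>2) \<le> real N" for x
      using orth_proj_frob_le[OF res_proj, of N s e x] by (rule order_trans)
  qed
qed

lemma column_norm_concentration:
  assumes l: "l < D" and N: "N > 0"
  shows "measure (arr N D) {x \<in> space (arr N D). (\<Sum>i<N. (x (i, l))\<^sup>2) \<ge> 2 * real N} \<le> 2 / real N"
proof -
  have "{x \<in> space (arr N D). (\<Sum>i<N. (x (i, l))\<^sup>2) \<ge> 2 * real N} \<subseteq>
    {x \<in> space (arr N D). \<bar>(\<Sum>i<N. \<Sum>j<N. delta i j * x (i, l) * x (j, l)) - (\<Sum>i<N. delta i i)\<bar> \<ge> real N}" (is "?A \<subseteq> ?B")
    by (auto simp: delta_def if_distrib[of "\<lambda>c. c * _"] power2_eq_square cong: if_cong)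
  then have "measure (arr N D) ?A \<le> measure (arr N D) ?B"
  proof (rule arr.finite_measure_mono)
    have "(\<lambda>x. (\<Sum>i<N. \<Sum>j<N. delta i j * x (i, l) * x (j, l)) - (\<Sum>i<N. delta i i)) \<in> borel_measurable (arr N D)"
      by (intro borel_measurable_diff borel_measurable_sum borel_measurable_times borel_measurable_const measurable_entry) (use l in auto)
    from this[measurable] show "?B \<in> sets (arr N D)" by measurable
  qed
  also have "\<dots> \<le> 2 * real N / (real N)\<^sup>2"
    using N by (intro column_quadratic_concentration[OF l])
      (auto simp: delta_def if_distrib[of "\<lambda>c. c\<^sup>2"] cong: if_cong)
  finally show ?thesis using N by (simp add: power2_eq_square)
qed

text \<open>Linear in column \<open>k\<close>, with coefficients built from the projection and
  column \<open>l\<close>. Only column \<open>k\<close> has to lie outside the projected block;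
  column \<open>l\<close> may belong to it, as the signal column will.\<close>

lemma cross_concentration:
  assumes D: "s + e \<le> D" "k < D" "l < D" "k \<noteq> l" "k < s \<or> s + e \<le> k" and N: "N > 0" and \<delta>: "\<delta> > 0"
  shows "measure (arr N D) {x \<in> space (arr N D).
    \<bar>bil N (res N s e x) (truncate a (column k x)) (truncate b (column l x))\<bar> \<ge> \<delta>} \<le> 2 * real N / \<delta>\<^sup>2 + 2 / real N"
    (is "measure _ ?E \<le> _")
proof -
  define c where "c = (\<lambda>x i. if i < a then pvec N (res N s e x) (truncate b (column l x)) i else 0)"
  have cm: "(\<lambda>x. c x i) \<in> borel_measurable (arr N D)" if "i < N" for i
  proof -
    have "(\<lambda>x. pvec N (res N s e x) (truncate b (column l x)) i) \<in> borel_measurable (arr N D)"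
      unfolding pvec_def by (intro borel_measurable_sum borel_measurable_times measurable_res measurable_truncate_column) (use D that in auto)
    then show ?thesis unfolding c_def by (cases "i < a") auto
  qed
  have cu: "c (upd N D k x y) = c x" for x y
  proof -
    have "pvec N R (truncate b (column l (upd N D k x y))) i = pvec N R (truncate b (column l x)) i" for R i
      using D by (intro pvec_cong) (auto simp: truncate_def column_def upd_index)
    then show ?thesis unfolding c_def res_upd[OF D(1,5)] by (auto simp: fun_eq_iff)
  qed
  have form: "bil N (res N s e x) (truncate a (column k x)) (truncate b (column l x)) = (\<Sum>i<N. c x i * x (i, k))" for x
    unfolding bil_eq_pvec by (intro sum.cong refl) (auto simp: c_def truncate_def column_def)
  \<comment> \<open>Truncating and projecting only shrink the norm, so the coefficients are
    controlled by column \<open>l\<close>.\<close>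
  have cb: "(\<Sum>i<N. (c x i)\<^sup>2) \<le> (\<Sum>i<N. (x (i, l))\<^sup>2)" for x
  proof -
    have "(\<Sum>i<N. (c x i)\<^sup>2) \<le> (\<Sum>i<N. pvec N (res N s e x) (truncate b (column l x)) i * pvec N (res N s e x) (truncate b (column l x)) i)"
      by (intro sum_mono) (auto simp: c_def power2_eq_square)
    also have "\<dots> = bil N (res N s e x) (truncate b (column l x)) (truncate b (column l x))" by (rule bil_eq_inner[OF res_proj, symmetric])
    also have "\<dots> \<le> (\<Sum>i<N. (truncate b (column l x) i)\<^sup>2)" by (rule bil_le[OF res_proj])
    also have "\<dots> \<le> (\<Sum>i<N. (x (i, l))\<^sup>2)" by (intro sum_mono) (auto simp: truncate_def column_def)
    finally show ?thesis .
  qed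
  let ?A = "{x \<in> space (arr N D). \<bar>\<Sum>i<N. c x i * x (i, k)\<bar> \<ge> \<delta> \<and> (\<Sum>i<N. (c x i)\<^sup>2) \<le> 2 * real N}"
  let ?B = "{x \<in> space (arr N D). (\<Sum>i<N. (x (i, l))\<^sup>2) \<ge> 2 * real N}"
  have m1: "(\<lambda>x. \<Sum>i<N. c x i * x (i, k)) \<in> borel_measurable (arr N D)"
    by (intro borel_measurable_sum borel_measurable_times cm measurable_entry) (use D in auto)
  have m2: "(\<lambda>x. \<Sum>i<N. (c x i)\<^sup>2) \<in> borel_measurable (arr N D)"
    by (intro borel_measurable_sum borel_measurable_power cm) auto
  have m3: "(\<lambda>x. \<Sum>i<N. (x (i, l))\<^sup>2) \<in> borel_measurable (arr N D)"
    by (intro borel_measurable_sum borel_measurable_power measurable_entry) (use D in auto)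
  note m1[measurable] m2[measurable] m3[measurable]
  have AB: "?A \<in> sets (arr N D)" "?B \<in> sets (arr N D)" by measurable
  have "?E \<subseteq> ?A \<union> ?B"
  proof
    fix x assume "x \<in> ?E"
    then show "x \<in> ?A \<union> ?B"
      using cb[of x] unfolding form by (cases "(\<Sum>i<N. (x (i, l))\<^sup>2) \<ge> 2 * real N") auto
  qed
  then have "measure (arr N D) ?E \<le> measure (arr N D) (?A \<union> ?B)"
    by (rule arr.finite_measure_mono) (use AB in auto)
  also have "\<dots> \<le> measure (arr N D) ?A + measure (arr N D) ?B"
    by (rule measure_Un_le) (use AB in auto)
  also have "measure (arr N D) ?A \<le> 2 * real N / \<delta>\<^sup>2"
    by (rule column_linear_concentration[OF D(2) cm cu _ \<delta>]) auto
  also have "measure (arr N D) ?B \<le> 2 / real N" by (rule column_norm_concentration[OF D(3) N])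
  finally show ?thesis by simp
qed

section \<open>The power of the test on a Gaussian array\<close>

locale proportional_regime =
  fixes N d :: "nat \<Rightarrow> nat" and \<kappa> \<kappa>s :: real
  assumes n_le_N: "\<And>n. n \<le> N n"
    and d_lim: "(\<lambda>n. real (d n) / real n) \<longlonglongrightarrow> \<kappa>"
    and N_lim: "(\<lambda>n. real n / real (N n)) \<longlonglongrightarrow> \<kappa>s"
    and \<kappa>: "\<kappa> > 0" and \<kappa>s: "\<kappa>s > 0" and \<kappa>\<kappa>s: "\<kappa> * \<kappa>s < 1"
begin

text \<open>The limit of (N - d) / N, the share of residual degrees of freedom.\<close>

definition "\<rho> = 1 - \<kappa> * \<kappa>s"

abbreviation "A \<equiv> \<lambda>n. arr (N n) (d n + 2)"

abbreviation "F \<equiv> pfilter A"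

lemma A_prob: "prob_space (A n)"
  by (rule arr.prob_space_axioms)

lemma \<rho>_pos: "\<rho> > 0"
  using \<kappa>\<kappa>s by (simp add: \<rho>_def)

lemma \<kappa>s_le_1: "\<kappa>s \<le> 1"
proof (rule tendsto_upperbound[OF N_lim])
  have "real n / real (N n) \<le> 1" for n using n_le_N[of n] by (cases "N n = 0") (auto simp: divide_le_eq)
  then show "\<forall>\<^sub>F n in sequentially. real n / real (N n) \<le> 1" by simp
qed simp

lemma N_over_n: "(\<lambda>n. real (N n) / real n) \<longlonglongrightarrow> 1 / \<kappa>s"
  using tendsto_inverse[OF N_lim] \<kappa>s by (simp add: inverse_eq_divide)

lemma inverse_n: "(\<lambda>n. 1 / real n) \<longlonglongrightarrow> 0"
  by (rule lim_1_over_n)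

lemma d_over_N: "(\<lambda>n. real (d n) / real (N n)) \<longlonglongrightarrow> \<kappa> * \<kappa>s"
proof -
  have "\<forall>\<^sub>F n in sequentially. real (d n) / real n * (real n / real (N n)) = real (d n) / real (N n)"
    using eventually_gt_at_top[of 0] by eventually_elim simp
  then show ?thesis by (rule Lim_transform_eventually[OF tendsto_mult[OF d_lim N_lim]])
qed

lemma d_less_N: "\<forall>\<^sub>F n in sequentially. d n < N n"
proof -
  have "\<forall>\<^sub>F n in sequentially. real (d n) / real (N n) < 1"
    using order_tendstoD(2)[OF d_over_N] \<kappa>\<kappa>s by auto
  with eventually_gt_at_top[of 0] show ?thesis
  proof eventually_elim
    case (elim n)
    then have "N n > 0" using n_le_N[of n] by linarith
    then show ?case using elim by (simp add: divide_less_eq_1)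
  qed
qed

lemma d_pos: "\<forall>\<^sub>F n in sequentially. d n > 0"
  using order_tendstoD(1)[OF d_lim \<kappa>] by eventually_elim (auto intro: ccontr)

text \<open>Conditionally on the projected block the quadratic form concentrates at the trace of
  \<open>J\<^sub>a R J\<^sub>b\<close>, where \<open>J\<^sub>a\<close> is the truncation to the first \<open>a\<close> coordinates; exchangeability turns
  that trace into the stated constant.\<close>

lemma quadratic_limit:
  assumes ev: "\<forall>\<^sub>F n in sequentially. s + e n \<le> d n + 2 \<and> k n < d n + 2 \<and> (k n < s \<or> s + e n \<le> k n) \<and> e n \<le> N n"
    and ab: "\<And>n. a n \<le> N n" "\<And>n. b n \<le> N n"
    and e: "(\<lambda>n. real (e n) / real n) \<longlonglongrightarrow> \<kappa>"
    and \<gamma>: "(\<lambda>n. real (min (a n) (b n)) / real n) \<longlonglongrightarrow> \<gamma>"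
  shows "((\<lambda>(n, x). bil (N n) (res (N n) s (e n) x) (truncate (a n) (column (k n) x)) (truncate (b n) (column (k n) x)) / real n)
    \<longlongrightarrow> \<gamma> * \<rho>) F"
proof -
  let ?q = "\<lambda>n x. bil (N n) (res (N n) s (e n) x) (truncate (a n) (column (k n) x)) (truncate (b n) (column (k n) x))"
  let ?c = "\<lambda>n. min (a n) (b n)"
  let ?tr = "\<lambda>n x. \<Sum>i<?c n. res (N n) s (e n) x $$ (i, i)"
  have qm: "(\<lambda>x. ?q n x) \<in> borel_measurable (A n)" if "s + e n \<le> d n + 2" "k n < d n + 2" for n
    by (rule measurable_res_bil[OF that(1)]) (use that in \<open>auto intro: measurable_truncate_column\<close>)
  have trm: "(\<lambda>x. ?tr n x) \<in> borel_measurable (A n)" if "s + e n \<le> d n + 2" for n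
    by (intro borel_measurable_sum measurable_res that) (use ab[of n] in auto)
  \<comment> \<open>Both Chebyshev bounds below have this form; since N / n converges, it is of
    order 1 / n.\<close>
  have Nn2: "(\<lambda>n. c * real (N n) / (\<delta> * real n)\<^sup>2) \<longlonglongrightarrow> 0" for c \<delta> :: real
  proof -
    have "(\<lambda>n. c / \<delta>\<^sup>2 * (real (N n) / real n) * (1 / real n)) \<longlonglongrightarrow> c / \<delta>\<^sup>2 * (1 / \<kappa>s) * 0"
      by (intro tendsto_intros N_over_n inverse_n)
    then show ?thesis by (simp add: power2_eq_square mult_ac)
  qed
  have 1: "((\<lambda>(n, x). (?q n x - ?tr n x) / real n) \<longlongrightarrow> 0) F"
  proof (rule tendsto_pfilterI[OF A_prob, where b = "\<lambda>\<delta> n. 2 * real (N n) / (\<delta> * real n)\<^sup>2"])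
    show "\<forall>\<^sub>F n in sequentially. (\<lambda>x. case (n, x) of (n, x) \<Rightarrow> (?q n x - ?tr n x) / real n) \<in> borel_measurable (A n)"
      using ev
    proof eventually_elim
      case (elim n)
      then show ?case using qm[of n] trm[of n] by simp
    qed
    fix \<delta> :: real assume \<delta>: "\<delta> > 0"
    show "\<forall>\<^sub>F n in sequentially. measure (A n) {x \<in> space (A n). \<delta> \<le> \<bar>(case (n, x) of (n, x) \<Rightarrow> (?q n x - ?tr n x) / real n) - 0\<bar>}
        \<le> 2 * real (N n) / (\<delta> * real n)\<^sup>2"
      using ev eventually_gt_at_top[of 0]
    proof eventually_elim
      case (elim n)
      have "{x \<in> space (A n). \<delta> \<le> \<bar>(case (n, x) of (n, x) \<Rightarrow> (?q n x - ?tr n x) / real n) - 0\<bar>}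
          = {x \<in> space (A n). \<bar>?q n x - ?tr n x\<bar> \<ge> \<delta> * real n}"
        using elim by (auto simp: abs_divide pos_le_divide_eq)
      then show ?case
        using quadratic_concentration[of s "e n" "d n + 2" "k n" "a n" "N n" "b n" "\<delta> * real n"] elim ab \<delta> by simp
    qed
  qed (rule Nn2)
  \<comment> \<open>The block in the trace has length min(a, b), so
    \<open>res_diag_concentration\<close> centres it at the corresponding share of the full trace N
    - e.\<close>
  have 2: "((\<lambda>(n, x). (?tr n x - real (?c n) * (real (N n) - real (e n)) / real (N n)) / real n) \<longlongrightarrow> 0) F"
  proof (rule tendsto_pfilterI[OF A_prob, where b = "\<lambda>\<delta> n. 1 * real (N n) / (\<delta> * real n)\<^sup>2"])
    show "\<forall>\<^sub>F n in sequentially. (\<lambda>x. case (n, x) of (n, x) \<Rightarrow>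
        (?tr n x - real (?c n) * (real (N n) - real (e n)) / real (N n)) / real n) \<in> borel_measurable (A n)"
      using ev
    proof eventually_elim
      case (elim n)
      then show ?case using trm[of n] by simp
    qed
    fix \<delta> :: real assume \<delta>: "\<delta> > 0"
    show "\<forall>\<^sub>F n in sequentially. measure (A n) {x \<in> space (A n). \<delta> \<le> \<bar>(case (n, x) of (n, x) \<Rightarrow>
        (?tr n x - real (?c n) * (real (N n) - real (e n)) / real (N n)) / real n) - 0\<bar>}
        \<le> 1 * real (N n) / (\<delta> * real n)\<^sup>2"
      using ev eventually_gt_at_top[of 0]
    proof eventually_elim
      case (elim n)
      have "{x \<in> space (A n). \<delta> \<le> \<bar>(case (n, x) of (n, x) \<Rightarrow>
          (?tr n x - real (?c n) * (real (N n) - real (e n)) / real (N n)) / real n) - 0\<bar>}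
          = {x \<in> space (A n). \<bar>?tr n x - real (?c n) * (real (N n) - real (e n)) / real (N n)\<bar> \<ge> \<delta> * real n}"
        using elim by (auto simp: abs_divide pos_le_divide_eq)
      also have "measure (A n) \<dots> \<le> real (?c n) / (\<delta> * real n)\<^sup>2"
        using elim ab[of n] \<delta> by (intro res_diag_concentration) auto
      also have "\<dots> \<le> 1 * real (N n) / (\<delta> * real n)\<^sup>2"
        using ab[of n] by (intro divide_right_mono) auto
      finally show ?case .
    qed
  qed (rule Nn2)
  have "(\<lambda>n. real (?c n) / real n * (1 - real (e n) / real n * (real n / real (N n)))) \<longlonglongrightarrow> \<gamma> * (1 - \<kappa> * \<kappa>s)"
    by (intro tendsto_intros \<gamma> e N_lim)
  note 3 = tendsto_pfilter_fst[of A, OF A_prob this]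
  have "((\<lambda>z. (case z of (n, x) \<Rightarrow> (?q n x - ?tr n x) / real n)
      + (case z of (n, x) \<Rightarrow> (?tr n x - real (?c n) * (real (N n) - real (e n)) / real (N n)) / real n)
      + real (?c (fst z)) / real (fst z) * (1 - real (e (fst z)) / real (fst z) * (real (fst z) / real (N (fst z)))))
      \<longlongrightarrow> 0 + 0 + \<gamma> * (1 - \<kappa> * \<kappa>s)) F"
    by (intro tendsto_add 1 2 3)
  moreover have "0 + 0 + \<gamma> * (1 - \<kappa> * \<kappa>s) = \<gamma> * \<rho>" by (simp add: \<rho>_def)
  ultimately have "((\<lambda>z. (case z of (n, x) \<Rightarrow> (?q n x - ?tr n x) / real n)
      + (case z of (n, x) \<Rightarrow> (?tr n x - real (?c n) * (real (N n) - real (e n)) / real (N n)) / real n)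
      + real (?c (fst z)) / real (fst z) * (1 - real (e (fst z)) / real (fst z) * (real (fst z) / real (N (fst z)))))
      \<longlongrightarrow> \<gamma> * \<rho>) F" by (simp only:)
  then show ?thesis
  proof (rule Lim_transform_eventually)
    show "\<forall>\<^sub>F z in F. (case z of (n, x) \<Rightarrow> (?q n x - ?tr n x) / real n)
      + (case z of (n, x) \<Rightarrow> (?tr n x - real (?c n) * (real (N n) - real (e n)) / real (N n)) / real n)
      + real (?c (fst z)) / real (fst z) * (1 - real (e (fst z)) / real (fst z) * (real (fst z) / real (N (fst z))))
      = (case z of (n, x) \<Rightarrow> ?q n x / real n)"
      using eventually_pfilter_fst[of A, OF A_prob eventually_gt_at_top[of 0]]
    proof eventually_elim
      case (elim z)
      obtain n x where z: "z = (n, x)" by (cases z)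
      have n: "n > 0" "N n > 0" using elim n_le_N[of n] by (auto simp: z)
      have "real (?c n) * (real (N n) - real (e n)) / real (N n) / real n
          = real (?c n) / real n * (1 - real (e n) / real n * (real n / real (N n)))"
        using n by (simp add: field_simps)
      then show ?case unfolding z by (simp add: diff_divide_distrib)
    qed
  qed
qed

text \<open>Covers the pairs residual and signal, noise and signal, noise and residual. Column
  \<open>k n\<close> always lies outside the covariates, and \<open>d n > 0\<close> keeps column
  \<open>d n\<close> apart from column 0.\<close>

lemma cross_limit:
  assumes k: "k = d \<and> l = (\<lambda>_. 0) \<or> k = (\<lambda>n. d n + 1) \<and> (l = (\<lambda>_. 0) \<or> l = d)"
  shows "((\<lambda>(n, x). bil (N n) (res (N n) 0 (d n) x) (truncate n (column (k n) x)) (truncate n (column (l n) x)) / real n)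
    \<longlongrightarrow> 0) F"
proof (rule tendsto_pfilterI[OF A_prob, where b = "\<lambda>\<delta> n. 2 * real (N n) / (\<delta> * real n)\<^sup>2 + 2 / real (N n)"])
  let ?q = "\<lambda>n x. bil (N n) (res (N n) 0 (d n) x) (truncate n (column (k n) x)) (truncate n (column (l n) x))"
  have kl: "k n < d n + 2" "l n < d n + 2" "d n \<le> k n" for n
    using k by auto
  show "\<forall>\<^sub>F n in sequentially. (\<lambda>x. case (n, x) of (n, x) \<Rightarrow> ?q n x / real n) \<in> borel_measurable (A n)"
  proof (rule always_eventually, intro allI)
    fix n
    have "(\<lambda>x. ?q n x) \<in> borel_measurable (A n)"
      by (rule measurable_res_bil) (use kl in \<open>auto intro: measurable_truncate_column\<close>)
    then show "(\<lambda>x. case (n, x) of (n, x) \<Rightarrow> ?q n x / real n) \<in> borel_measurable (A n)" by simp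
  qed
  fix \<delta> :: real assume \<delta>: "\<delta> > 0"
  show "\<forall>\<^sub>F n in sequentially. measure (A n) {x \<in> space (A n). \<delta> \<le> \<bar>(case (n, x) of (n, x) \<Rightarrow> ?q n x / real n) - 0\<bar>}
      \<le> 2 * real (N n) / (\<delta> * real n)\<^sup>2 + 2 / real (N n)"
    using d_pos eventually_gt_at_top[of 0]
  proof eventually_elim
    case (elim n)
    have "{x \<in> space (A n). \<delta> \<le> \<bar>(case (n, x) of (n, x) \<Rightarrow> ?q n x / real n) - 0\<bar>} = {x \<in> space (A n). \<bar>?q n x\<bar> \<ge> \<delta> * real n}"
      using elim by (auto simp: abs_divide pos_le_divide_eq)
    moreover have "k n \<noteq> l n" using k elim by auto
    moreover have "N n > 0" using n_le_N[of n] elim by linarith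
    ultimately show ?case
      using cross_concentration[of 0 "d n" "d n + 2" "k n" "l n" "N n" "\<delta> * real n" n n] kl[of n] elim \<delta> by simp
  qed
  have "(\<lambda>n. 2 / \<delta>\<^sup>2 * (real (N n) / real n) * (1 / real n) + 2 * ((real n / real (N n)) * (1 / real n))) \<longlonglongrightarrow>
      2 / \<delta>\<^sup>2 * (1 / \<kappa>s) * 0 + 2 * (\<kappa>s * 0)"
    by (intro tendsto_intros N_over_n inverse_n N_lim)
  moreover have "\<forall>\<^sub>F n in sequentially. 2 / \<delta>\<^sup>2 * (real (N n) / real n) * (1 / real n) + 2 * ((real n / real (N n)) * (1 / real n))
      = 2 * real (N n) / (\<delta> * real n)\<^sup>2 + 2 / real (N n)"
    using eventually_gt_at_top[of 0] by eventually_elim (simp add: power2_eq_square)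
  ultimately show "(\<lambda>n. 2 * real (N n) / (\<delta> * real n)\<^sup>2 + 2 / real (N n)) \<longlonglongrightarrow> 0"
    using Lim_transform_eventually by force
qed

end

text \<open>\<open>\<tau>\<close> is the length of the whitened covariate signal. \<open>a\<close>
  will be 1 - \<alpha>, and \<open>z\<close> the corresponding normal quantile.\<close>

locale array_test = proportional_regime +
  fixes \<tau> \<beta> :: "nat \<Rightarrow> real" and \<tau>0 \<sigma> h a z :: real
  assumes \<tau>_lim: "\<tau> \<longlonglongrightarrow> \<tau>0" and \<sigma>: "\<sigma> > 0" and \<beta>: "\<And>n. \<beta> n = h / sqrt (real n)"
    and z: "Phi z = a"
begin

text \<open>Columns \<open>0, \<dots>, d n - 1\<close> of the array are the whitened covariates, rotated so that column 0 carries
  the whole signal of the covariates; column \<open>d n\<close> is the residual of \<open>X\<close> and column \<open>d n + 1\<close> the noise.\<close>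

definition "\<eta> n x = column (d n) x"
definition "P n x = res (N n) 0 (d n) x"
definition "u n x = (\<lambda>i. \<tau> n * truncate n (column 0 x) i + \<sigma> * truncate n (column (d n + 1) x) i)"
definition "y n x = (\<lambda>i. \<beta> n * truncate n (\<eta> n x) i + u n x i)"

text \<open>The criterion of \<open>ccrt_rejects_iff\<close> with level \<open>a\<close>, written
  for the residual \<open>\<eta>\<close> in the place of X and the whitened response
  \<open>y\<close>.\<close>

definition crit :: "nat \<Rightarrow> (nat \<times> nat \<Rightarrow> real) \<Rightarrow> bool" where
  "crit n x \<longleftrightarrow> a \<le> measure (gauss {..<N n}) {v \<in> space (gauss {..<N n}).
      sqrt (bil (N n) (P n x) (\<eta> n x) (\<eta> n x)) * bil (N n) (P n x) (y n x) v
      \<le> bil (N n) (P n x) (y n x) (\<eta> n x) * sqrt (bil (N n) (P n x) v v)}"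

text \<open>The limit of |P u|^2 / n, and also of |P y|^2 / n. The ratio \<open>\<mu>\<close> below
  is the limiting drift h \<rho> over the limiting standard deviation.\<close>

definition "s2 = \<rho> * (\<tau>0\<^sup>2 * (1 - \<kappa>s) + \<sigma>\<^sup>2)"
definition "\<mu> = h * \<rho> / sqrt s2"

lemma P_proj: "orth_proj (N n) (P n x)"
  unfolding P_def by (rule res_proj)

lemma s2_pos: "s2 > 0"
  unfolding s2_def using \<rho>_pos \<sigma> \<kappa>s_le_1 by (intro mult_pos_pos add_nonneg_pos) auto

text \<open>The block split off here consists of column 0; the projection onto the complement of the other
  columns is independent of it.\<close>

lemma signal_limit:
  "((\<lambda>(n, x). bil (N n) (P n x) (truncate n (column 0 x)) (truncate n (column 0 x)) / real n) \<longlongrightarrow> \<rho> * (1 - \<kappa>s)) F"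
proof -
  let ?V = "\<lambda>n x. res (N n) 1 (d n - 1) x"
  let ?w = "\<lambda>b x. truncate b (column 0 x)"
  have ev: "\<forall>\<^sub>F n in sequentially. 1 + (d n - 1) \<le> d n + 2 \<and> 0 < d n + 2 \<and> ((0::nat) < 1 \<or> 1 + (d n - 1) \<le> 0) \<and> d n - 1 \<le> N n"
    using d_less_N by eventually_elim auto
  have e: "(\<lambda>n. real (d n - 1) / real n) \<longlonglongrightarrow> \<kappa>"
  proof (rule Lim_transform_eventually)
    show "(\<lambda>n. real (d n) / real n - 1 / real n) \<longlonglongrightarrow> \<kappa>" using tendsto_diff[OF d_lim inverse_n] by simp
    show "\<forall>\<^sub>F n in sequentially. real (d n) / real n - 1 / real n = real (d n - 1) / real n"
      using d_pos by eventually_elim (simp add: of_nat_diff diff_divide_distrib)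
  qed
  have one: "(\<lambda>n. real (min n n) / real n) \<longlonglongrightarrow> 1"
    by (rule tendsto_eventually, rule eventually_mono[OF eventually_gt_at_top[of 0]]) simp
  have one': "(\<lambda>n. real (min n (N n)) / real n) \<longlonglongrightarrow> 1" using one n_le_N by (simp add: min_absorb1)
  have NN: "(\<lambda>n. real (min (N n) (N n)) / real n) \<longlonglongrightarrow> 1 / \<kappa>s" using N_over_n by simp
  have V1: "((\<lambda>(n, x). bil (N n) (?V n x) (?w n x) (?w n x) / real n) \<longlongrightarrow> 1 * \<rho>) F"
    by (rule quadratic_limit[OF ev n_le_N n_le_N e one])
  have V2: "((\<lambda>(n, x). bil (N n) (?V n x) (?w n x) (?w (N n) x) / real n) \<longlongrightarrow> 1 * \<rho>) F"
    by (rule quadratic_limit[OF ev n_le_N order_refl e one'])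
  have V3: "((\<lambda>(n, x). bil (N n) (?V n x) (?w (N n) x) (?w (N n) x) / real n) \<longlongrightarrow> (1 / \<kappa>s) * \<rho>) F"
    by (rule quadratic_limit[OF ev order_refl order_refl e NN])
  let ?f1 = "\<lambda>(n, x). bil (N n) (?V n x) (?w n x) (?w n x) / real n"
  let ?f2 = "\<lambda>(n, x). bil (N n) (?V n x) (?w n x) (?w (N n) x) / real n"
  let ?f3 = "\<lambda>(n, x). bil (N n) (?V n x) (?w (N n) x) (?w (N n) x) / real n"
  \<comment> \<open>The downdate formula for column 0. The mixed form involves a truncated and a
    full copy of the column, so its trace runs over n entries, while |R w|^2 involves all N; hence
    \<rho> - \<rho>^2 / (\<rho> / \<kappa>s).\<close>
  have "((\<lambda>z. ?f1 z - (?f2 z * ?f2 z) / ?f3 z) \<longlongrightarrow> 1 * \<rho> - (1 * \<rho> * (1 * \<rho>)) / ((1 / \<kappa>s) * \<rho>)) F"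
    using \<rho>_pos \<kappa>s by (intro tendsto_intros V1 V2 V3) auto
  moreover have "1 * \<rho> - (1 * \<rho> * (1 * \<rho>)) / ((1 / \<kappa>s) * \<rho>) = \<rho> * (1 - \<kappa>s)"
    using \<rho>_pos \<kappa>s by (simp add: field_simps)
  moreover have "\<forall>\<^sub>F z in F. ?f1 z - (?f2 z * ?f2 z) / ?f3 z =
      (case z of (n, x) \<Rightarrow> bil (N n) (P n x) (?w n x) (?w n x) / real n)"
  proof -
    have "\<forall>\<^sub>F n in sequentially. AE x in A n. Determinant.det (gram (N n) 0 (d n) x) \<noteq> 0"
      using d_less_N by eventually_elim (rule AE_gram_det, auto)
    then have "\<forall>\<^sub>F z in F. Determinant.det (gram (N (fst z)) 0 (d (fst z)) (snd z)) \<noteq> 0"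
      by (intro eventually_pfilter_AE[OF A_prob]) simp
    then show ?thesis
      using eventually_pfilter_fst[of A, OF A_prob d_pos] eventually_pfilter_fst[of A, OF A_prob eventually_gt_at_top[of 0]]
    proof eventually_elim
      case (elim zz)
      obtain n x where zz: "zz = (n, x)" by (cases zz)
      obtain k where k: "d n = Suc k" using elim zz by (cases "d n") auto
      have n: "n > 0" using elim zz by simp
      let ?W = "blk (N n) 0 (Suc k) x"
      have V: "Matrix.mat (N n) k (\<lambda>(i, j). ?W $$ (i, Suc j)) = blk (N n) 1 k x"
        unfolding blk_def by (rule eq_matI) auto
      have det: "Determinant.det (transpose_mat ?W * ?W) \<noteq> 0" using elim zz k by (simp add: gram_eq)
      note split = bil_resid_unique(3)[OF blk_carrier det, unfolded V]
      have w: "bil (N n) R f (\<lambda>i. ?W $$ (i, 0)) = bil (N n) R f (?w (N n) x)"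
        "bil (N n) R (\<lambda>i. ?W $$ (i, 0)) f = bil (N n) R (?w (N n) x) f" for R f
        by (intro bil_cong; simp add: blk_def truncate_def column_def)+
      have "bil (N n) (P n x) (?w n x) (?w n x) = bil (N n) (?V n x) (?w n x) (?w n x)
        - bil (N n) (?V n x) (?w n x) (?w (N n) x) * bil (N n) (?V n x) (?w n x) (?w (N n) x)
          / bil (N n) (?V n x) (?w (N n) x) (?w (N n) x)"
        unfolding P_def res_def k diff_Suc_1 using split[of "?w n x" "?w n x"] unfolding w .
      then show ?case unfolding zz using n by (simp add: field_simps)
    qed
  qed
  ultimately show ?thesis using Lim_transform_eventually by force
qed

lemma outside_limit:
  assumes k: "k = d \<or> k = (\<lambda>n. d n + 1)" and ab: "\<And>n. f n \<le> N n" "\<And>n. g n \<le> N n"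
    and \<gamma>: "(\<lambda>n. real (min (f n) (g n)) / real n) \<longlonglongrightarrow> \<gamma>"
  shows "((\<lambda>(n, x). bil (N n) (P n x) (truncate (f n) (column (k n) x)) (truncate (g n) (column (k n) x)) / real n)
    \<longlongrightarrow> \<gamma> * \<rho>) F"
  unfolding P_def
proof (rule quadratic_limit[OF _ ab d_lim \<gamma>])
  show "\<forall>\<^sub>F n in sequentially. 0 + d n \<le> d n + 2 \<and> k n < d n + 2 \<and> (k n < 0 \<or> 0 + d n \<le> k n) \<and> d n \<le> N n"
    using d_less_N by eventually_elim (use k in auto)
qed

lemma min_lims:
  "(\<lambda>n. real (min n n) / real n) \<longlonglongrightarrow> 1" "(\<lambda>n. real (min n (N n)) / real n) \<longlonglongrightarrow> 1"
  "(\<lambda>n. real (min (N n) (N n)) / real n) \<longlonglongrightarrow> 1 / \<kappa>s"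
proof -
  show "(\<lambda>n. real (min n n) / real n) \<longlonglongrightarrow> 1"
    by (rule tendsto_eventually, rule eventually_mono[OF eventually_gt_at_top[of 0]]) simp
  then show "(\<lambda>n. real (min n (N n)) / real n) \<longlonglongrightarrow> 1" using n_le_N by (simp add: min_absorb1)
  show "(\<lambda>n. real (min (N n) (N n)) / real n) \<longlonglongrightarrow> 1 / \<kappa>s" using N_over_n by simp
qed

lemma noise_limit: "((\<lambda>(n, x). bil (N n) (P n x) (u n x) (u n x) / real n) \<longlongrightarrow> s2) F"
proof -
  let ?w = "\<lambda>n x. truncate n (column 0 x)" and ?e = "\<lambda>n x. truncate n (column (d n + 1) x)"
  have ee: "((\<lambda>(n, x). bil (N n) (P n x) (?e n x) (?e n x) / real n) \<longlongrightarrow> 1 * \<rho>) F"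
    by (rule outside_limit[where f = "\<lambda>n. n" and g = "\<lambda>n. n" and k = "\<lambda>n. d n + 1"]) (auto simp: n_le_N min_lims(1)[simplified])
  have ew: "((\<lambda>(n, x). bil (N n) (P n x) (?e n x) (?w n x) / real n) \<longlongrightarrow> 0) F"
    unfolding P_def by (rule cross_limit[where k = "\<lambda>n. d n + 1" and l = "\<lambda>_. 0"]) simp
  have t: "((\<lambda>z. \<tau> (fst z)) \<longlongrightarrow> \<tau>0) F" by (rule tendsto_pfilter_fst[OF A_prob \<tau>_lim])
  let ?f1 = "\<lambda>(n, x). bil (N n) (P n x) (?w n x) (?w n x) / real n"
  let ?f2 = "\<lambda>(n, x). bil (N n) (P n x) (?e n x) (?e n x) / real n"
  let ?f3 = "\<lambda>(n, x). bil (N n) (P n x) (?e n x) (?w n x) / real n"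
  have "((\<lambda>z. (\<tau> (fst z))\<^sup>2 * ?f1 z + \<sigma>\<^sup>2 * ?f2 z + 2 * (\<tau> (fst z) * (\<sigma> * ?f3 z))) \<longlongrightarrow>
      \<tau>0\<^sup>2 * (\<rho> * (1 - \<kappa>s)) + \<sigma>\<^sup>2 * (1 * \<rho>) + 2 * (\<tau>0 * (\<sigma> * 0))) F"
    by (intro tendsto_intros t signal_limit ee ew)
  moreover have "\<tau>0\<^sup>2 * (\<rho> * (1 - \<kappa>s)) + \<sigma>\<^sup>2 * (1 * \<rho>) + 2 * (\<tau>0 * (\<sigma> * 0)) = s2"
    by (simp add: s2_def algebra_simps)
  moreover have "(\<tau> (fst z))\<^sup>2 * ?f1 z + \<sigma>\<^sup>2 * ?f2 z + 2 * (\<tau> (fst z) * (\<sigma> * ?f3 z)) =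
      (case z of (n, x) \<Rightarrow> bil (N n) (P n x) (u n x) (u n x) / real n)" for z
  proof -
    obtain n x where z: "z = (n, x)" by (cases z)
    have "bil (N n) (P n x) (u n x) (u n x) = (\<tau> n)\<^sup>2 * bil (N n) (P n x) (?w n x) (?w n x)
      + \<sigma>\<^sup>2 * bil (N n) (P n x) (?e n x) (?e n x) + 2 * (\<tau> n * (\<sigma> * bil (N n) (P n x) (?e n x) (?w n x)))"
      unfolding u_def bil_add_left bil_add_right bil_scale_left bil_scale_right
      using bil_sym[OF P_proj, of n x "?w n x" "?e n x"] by (simp add: power2_eq_square algebra_simps)
    then show ?thesis unfolding z by (simp add: add_divide_distrib)
  qed
  ultimately show ?thesis by simp
qed

text \<open>At the scale n every term containing \<beta> vanishes, since \<beta> tends to 0 and the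
  forms it multiplies stay bounded after division by n. The effect is visible in the drift of the
  statistic but not in the norm of P y.\<close>

lemma response_limit: "((\<lambda>(n, x). bil (N n) (P n x) (y n x) (y n x) / real n) \<longlongrightarrow> s2) F"
proof -
  let ?w = "\<lambda>n x. truncate n (column 0 x)" and ?e = "\<lambda>n x. truncate n (column (d n + 1) x)"
    and ?h = "\<lambda>n x. truncate n (\<eta> n x)"
  have hh: "((\<lambda>(n, x). bil (N n) (P n x) (?h n x) (?h n x) / real n) \<longlongrightarrow> 1 * \<rho>) F"
    unfolding \<eta>_def by (rule outside_limit[where f = "\<lambda>n. n" and g = "\<lambda>n. n" and k = d]) (auto simp: n_le_N min_lims(1)[simplified])
  have hw: "((\<lambda>(n, x). bil (N n) (P n x) (?h n x) (?w n x) / real n) \<longlongrightarrow> 0) F"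
    unfolding P_def \<eta>_def by (rule cross_limit[where k = d and l = "\<lambda>_. 0"]) simp
  have eh: "((\<lambda>(n, x). bil (N n) (P n x) (?e n x) (?h n x) / real n) \<longlongrightarrow> 0) F"
    unfolding P_def \<eta>_def by (rule cross_limit[where k = "\<lambda>n. d n + 1" and l = d]) simp
  have t: "((\<lambda>z. \<tau> (fst z)) \<longlongrightarrow> \<tau>0) F" by (rule tendsto_pfilter_fst[OF A_prob \<tau>_lim])
  have "\<beta> \<longlonglongrightarrow> h * 0"
    unfolding \<beta> divide_inverse
    by (intro tendsto_intros tendsto_inverse_0_at_top filterlim_compose[OF sqrt_at_top filterlim_real_sequentially])
  then have b: "((\<lambda>z. \<beta> (fst z)) \<longlongrightarrow> 0) F" using tendsto_pfilter_fst[of A \<beta> 0, OF A_prob] by simp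
  let ?f0 = "\<lambda>(n, x). bil (N n) (P n x) (u n x) (u n x) / real n"
  let ?f1 = "\<lambda>(n, x). bil (N n) (P n x) (?h n x) (?h n x) / real n"
  let ?f2 = "\<lambda>(n, x). bil (N n) (P n x) (?h n x) (?w n x) / real n"
  let ?f3 = "\<lambda>(n, x). bil (N n) (P n x) (?e n x) (?h n x) / real n"
  have "((\<lambda>z. ?f0 z + (\<beta> (fst z))\<^sup>2 * ?f1 z + 2 * (\<beta> (fst z) * (\<tau> (fst z) * ?f2 z + \<sigma> * ?f3 z))) \<longlongrightarrow>
      s2 + 0\<^sup>2 * (1 * \<rho>) + 2 * (0 * (\<tau>0 * 0 + \<sigma> * 0))) F"
    by (intro tendsto_intros t b hh hw eh noise_limit)
  moreover have "?f0 z + (\<beta> (fst z))\<^sup>2 * ?f1 z + 2 * (\<beta> (fst z) * (\<tau> (fst z) * ?f2 z + \<sigma> * ?f3 z)) =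
      (case z of (n, x) \<Rightarrow> bil (N n) (P n x) (y n x) (y n x) / real n)" for z
  proof -
    obtain n x where z: "z = (n, x)" by (cases z)
    let ?b = "bil (N n) (P n x)"
    have uh: "?b (u n x) (?h n x) = \<tau> n * ?b (?h n x) (?w n x) + \<sigma> * ?b (?e n x) (?h n x)"
      unfolding u_def bil_add_left bil_scale_left using bil_sym[OF P_proj, of n x "?w n x" "?h n x"] by simp
    have "?b (y n x) (y n x) = ?b (u n x) (u n x) + (\<beta> n)\<^sup>2 * ?b (?h n x) (?h n x) + 2 * (\<beta> n * ?b (u n x) (?h n x))"
      unfolding y_def bil_add_left bil_add_right bil_scale_left bil_scale_right
      using bil_sym[OF P_proj, of n x "?h n x" "u n x"] by (simp add: power2_eq_square algebra_simps)
    then have F: "?b (y n x) (y n x) = ?b (u n x) (u n x) + (\<beta> n)\<^sup>2 * ?b (?h n x) (?h n x)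
        + 2 * (\<beta> n * (\<tau> n * ?b (?h n x) (?w n x) + \<sigma> * ?b (?e n x) (?h n x)))"
      by (simp only: uh)
    have "A0 / c + p\<^sup>2 * (A1 / c) + 2 * (p * (q * (A2 / c) + r * (A3 / c))) = (A0 + p\<^sup>2 * A1 + 2 * (p * (q * A2 + r * A3))) / c"
      for A0 A1 A2 A3 c p q r :: real
      by (cases "c = 0") (auto simp: field_simps)
    then show ?thesis unfolding z prod.case fst_conv F .
  qed
  ultimately show ?thesis by simp
qed

lemma \<eta>_limit: "((\<lambda>(n, x). bil (N n) (P n x) (\<eta> n x) (\<eta> n x) / real n) \<longlongrightarrow> \<rho> / \<kappa>s) F"
proof -
  have "bil (N n) (P n x) (\<eta> n x) (\<eta> n x) = bil (N n) (P n x) (truncate (N n) (column (d n) x)) (truncate (N n) (column (d n) x))" for n x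
    by (rule bil_cong) (auto simp: \<eta>_def truncate_def)
  then show ?thesis
    using outside_limit[where f = N and g = N and k = d and \<gamma> = "1 / \<kappa>s"] min_lims(3) by simp
qed

text \<open>Only the labeled part of \<open>\<eta>\<close> enters the response but all of it is
  tested, so the trace runs over n entries and no factor 1 / \<kappa>s appears.\<close>

lemma drift_limit: "((\<lambda>(n, x). bil (N n) (P n x) (truncate n (\<eta> n x)) (\<eta> n x) / real n) \<longlongrightarrow> \<rho>) F"
proof -
  have "bil (N n) (P n x) (truncate n (\<eta> n x)) (\<eta> n x) = bil (N n) (P n x) (truncate n (column (d n) x)) (truncate (N n) (column (d n) x))" for n x
    by (rule bil_cong) (auto simp: \<eta>_def truncate_def)
  then show ?thesis
    using outside_limit[where f = "\<lambda>n. n" and g = N and k = d and \<gamma> = 1] min_lims(2) n_le_N by simp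
qed

lemma trace_eventually: "\<forall>\<^sub>F z in F. (\<Sum>i<N (fst z). P (fst z) (snd z) $$ (i, i)) = real (N (fst z)) - real (d (fst z))"
proof -
  have "\<forall>\<^sub>F n in sequentially. AE x in A n. (\<Sum>i<N n. P n x $$ (i, i)) = real (N n) - real (d n)"
    using d_less_N
  proof eventually_elim
    case (elim n)
    have "AE x in A n. Determinant.det (gram (N n) 0 (d n) x) \<noteq> 0" using elim by (intro AE_gram_det) auto
    then show ?case
      by eventually_elim (simp add: P_def res_def resid_mat_diag_sum[OF blk_carrier] gram_eq)
  qed
  then show ?thesis by (intro eventually_pfilter_AE[OF A_prob]) simp
qed

text \<open>The fallback direction makes the normal law of \<open>G\<close> exact; it is irrelevant in the limit.\<close>

definition dir :: "nat \<Rightarrow> (nat \<times> nat \<Rightarrow> real) \<Rightarrow> nat \<Rightarrow> real" where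
  "dir n x = (if bil (N n) (P n x) (u n x) (u n x) > 0 then pvec (N n) (P n x) (u n x) else delta 0)"

definition G :: "nat \<Rightarrow> (nat \<times> nat \<Rightarrow> real) \<Rightarrow> real" where
  "G n x = (\<Sum>i<N n. dir n x i * x (i, d n)) / sqrt (\<Sum>i<N n. (dir n x i)\<^sup>2)"

lemma measurable_u: "i < N n \<Longrightarrow> (\<lambda>x. u n x i) \<in> borel_measurable (A n)"
  unfolding u_def
  by (intro borel_measurable_add borel_measurable_times borel_measurable_const measurable_truncate_column) auto

lemma measurable_dir: assumes i: "i < N n" shows "(\<lambda>x. dir n x i) \<in> borel_measurable (A n)"
proof -
  have [measurable]: "(\<lambda>x. bil (N n) (P n x) (u n x) (u n x)) \<in> borel_measurable (A n)"
    unfolding P_def by (rule measurable_res_bil, simp; rule measurable_u)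
  have [measurable]: "(\<lambda>x. pvec (N n) (P n x) (u n x) i) \<in> borel_measurable (A n)"
    unfolding pvec_def P_def
    by (intro borel_measurable_sum borel_measurable_times measurable_res measurable_u) (use i in auto)
  have "(\<lambda>x. if bil (N n) (P n x) (u n x) (u n x) > 0 then pvec (N n) (P n x) (u n x) i else delta 0 i) \<in> borel_measurable (A n)"
    by measurable
  then show ?thesis unfolding dir_def by (simp add: if_distrib[of "\<lambda>f. f i"] cong: if_cong)
qed

lemma G_law:
  assumes n: "n > 0" and d0: "d n > 0"
  shows "measure (A n) {x \<in> space (A n). G n x \<ge> g} = Phi (- g)"
    and "{x \<in> space (A n). G n x \<ge> g} \<in> sets (A n)"
proof -
  have N0: "N n > 0" using n n_le_N[of n] by linarith
  have pos: "(\<Sum>i<N n. (dir n x i)\<^sup>2) > 0" for x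
  proof (cases "bil (N n) (P n x) (u n x) (u n x) > 0")
    case True
    then show ?thesis using bil_eq_inner[OF P_proj, of n x "u n x" "u n x"] by (simp add: dir_def power2_eq_square)
  next
    case False
    then show ?thesis using N0 by (simp add: dir_def delta_def if_distrib[of "\<lambda>c. c\<^sup>2"] cong: if_cong)
  qed
  \<comment> \<open>The direction uses the covariates through P, column 0 and the noise column, but
    not column \<open>d n\<close>; \<open>d n > 0\<close> separates the latter from column
    0.\<close>
  have du: "dir n (upd (N n) (d n + 2) (d n) x v) = dir n x" for x v
  proof -
    have Pu: "P n (upd (N n) (d n + 2) (d n) x v) = P n x"
      unfolding P_def by (rule res_upd) auto
    have uu: "u n (upd (N n) (d n + 2) (d n) x v) i = u n x i" if "i < N n" for i
      using that d0 by (simp add: u_def truncate_def column_def upd_index)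
    have "bil (N n) (P n x) (u n (upd (N n) (d n + 2) (d n) x v)) (u n (upd (N n) (d n + 2) (d n) x v)) = bil (N n) (P n x) (u n x) (u n x)"
      by (rule bil_cong; rule uu)
    moreover have "pvec (N n) (P n x) (u n (upd (N n) (d n + 2) (d n) x v)) = pvec (N n) (P n x) (u n x)"
      by (rule ext, rule pvec_cong, rule uu)
    ultimately show ?thesis unfolding dir_def Pu by simp
  qed
  have "measure (A n) {x \<in> space (A n). G n x \<in> {g..}} = measure std_normal_distribution {g..}"
    unfolding G_def using du measurable_dir pos by (intro column_normal) auto
  then show "measure (A n) {x \<in> space (A n). G n x \<ge> g} = Phi (- g)" by (simp add: std_normal_uminus)
  have "G n \<in> borel_measurable (A n)"
  proof -
    have "(\<lambda>x. \<Sum>i<N n. dir n x i * x (i, d n)) \<in> borel_measurable (A n)"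
      by (intro borel_measurable_sum borel_measurable_times measurable_dir measurable_entry) auto
    moreover have "(\<lambda>x. \<Sum>i<N n. (dir n x i)\<^sup>2) \<in> borel_measurable (A n)"
      by (intro borel_measurable_sum borel_measurable_power measurable_dir) auto
    ultimately show ?thesis unfolding G_def by measurable
  qed
  from this[measurable] show "{x \<in> space (A n). G n x \<ge> g} \<in> sets (A n)" by measurable
qed

text \<open>The statistic sqrt(tr P) <P y, \<eta>> / (|P y| |P \<eta>|), with tr P = N - d, is split
  along y = \<beta> J \<eta> + u. \<open>Lz\<close> is the contribution of \<beta> J \<eta>, using
  \<beta> = h / sqrt n, and \<open>Mz\<close> is the factor in front of \<open>G\<close>. The
  divisions by n make each factor converge.\<close>

definition "Lz zz = (case zz of (n, x) \<Rightarrow>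
  sqrt ((real (N n) - real (d n)) / real n) * (h * (bil (N n) (P n x) (truncate n (\<eta> n x)) (\<eta> n x) / real n))
   / (sqrt (bil (N n) (P n x) (y n x) (y n x) / real n) * sqrt (bil (N n) (P n x) (\<eta> n x) (\<eta> n x) / real n)))"

definition "Mz zz = (case zz of (n, x) \<Rightarrow>
  sqrt ((real (N n) - real (d n)) / real n) * sqrt (bil (N n) (P n x) (u n x) (u n x) / real n)
   / (sqrt (bil (N n) (P n x) (y n x) (y n x) / real n) * sqrt (bil (N n) (P n x) (\<eta> n x) (\<eta> n x) / real n)))"

lemma dof_limit: "(\<lambda>n. (real (N n) - real (d n)) / real n) \<longlonglongrightarrow> \<rho> / \<kappa>s"
  using tendsto_diff[OF N_over_n d_lim] \<kappa>s by (simp add: diff_divide_distrib \<rho>_def)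

lemma Lz_limit: "(Lz \<longlongrightarrow> \<mu>) F" and Mz_limit: "(Mz \<longlongrightarrow> 1) F"
proof -
  have r: "\<rho> / \<kappa>s > 0" using \<rho>_pos \<kappa>s by simp
  have nz: "sqrt s2 * sqrt (\<rho> / \<kappa>s) \<noteq> 0" 
    using mult_pos_pos[OF real_sqrt_gt_zero[OF s2_pos] real_sqrt_gt_zero[OF r]] by (rule less_imp_neq[THEN not_sym])
  have t: "((\<lambda>z. (real (N (fst z)) - real (d (fst z))) / real (fst z)) \<longlongrightarrow> \<rho> / \<kappa>s) F"
    by (rule tendsto_pfilter_fst[OF A_prob dof_limit])
  let ?y = "\<lambda>(n, x). bil (N n) (P n x) (y n x) (y n x) / real n"
  let ?u = "\<lambda>(n, x). bil (N n) (P n x) (u n x) (u n x) / real n"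
  let ?e = "\<lambda>(n, x). bil (N n) (P n x) (\<eta> n x) (\<eta> n x) / real n"
  let ?f = "\<lambda>(n, x). bil (N n) (P n x) (truncate n (\<eta> n x)) (\<eta> n x) / real n"
  have "((\<lambda>z. sqrt ((real (N (fst z)) - real (d (fst z))) / real (fst z)) * (h * ?f z) / (sqrt (?y z) * sqrt (?e z)))
      \<longlongrightarrow> sqrt (\<rho> / \<kappa>s) * (h * \<rho>) / (sqrt s2 * sqrt (\<rho> / \<kappa>s))) F"
    by (intro tendsto_intros t response_limit \<eta>_limit drift_limit nz)
  \<comment> \<open>The degrees of freedom and |P \<eta>|^2 have the same limit \<rho> / \<kappa>s
    after division by n, so they cancel; the effect size depends on \<kappa>s only through
    \<open>s2\<close> and \<rho>.\<close>
  moreover have "sqrt (\<rho> / \<kappa>s) * (h * \<rho>) / (sqrt s2 * sqrt (\<rho> / \<kappa>s)) = \<mu>"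
  proof -
    have "R * p / (q * R) = p / q" if "R > 0" for R p q :: real using that by simp
    from this[OF real_sqrt_gt_zero[OF r]] show ?thesis unfolding \<mu>_def .
  qed
  ultimately show "(Lz \<longlongrightarrow> \<mu>) F" unfolding Lz_def by (simp add: split_beta')
  have "((\<lambda>z. sqrt ((real (N (fst z)) - real (d (fst z))) / real (fst z)) * sqrt (?u z) / (sqrt (?y z) * sqrt (?e z)))
      \<longlongrightarrow> sqrt (\<rho> / \<kappa>s) * sqrt s2 / (sqrt s2 * sqrt (\<rho> / \<kappa>s))) F"
    by (intro tendsto_intros t response_limit \<eta>_limit noise_limit nz)
  moreover have "sqrt (\<rho> / \<kappa>s) * sqrt s2 / (sqrt s2 * sqrt (\<rho> / \<kappa>s)) = 1"
  proof -
    have "R * q / (q * R) = 1" if "R > 0" "q > 0" for R q :: real using that by simp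
    from this[OF real_sqrt_gt_zero[OF r] real_sqrt_gt_zero[OF s2_pos]] show ?thesis .
  qed
  ultimately show "(Mz \<longlongrightarrow> 1) F" unfolding Mz_def by (simp add: split_beta')
qed

text \<open>The test compares \<open>Lz + Mz * G\<close> with a critical value that converges to \<open>z\<close>.\<close>

lemma crit_eventually:
  assumes \<delta>: "\<delta> > 0"
  shows "\<forall>\<^sub>F zz in F. (Lz zz + Mz zz * G (fst zz) (snd zz) \<ge> z + \<delta> \<longrightarrow> crit (fst zz) (snd zz)) \<and>
    (Lz zz + Mz zz * G (fst zz) (snd zz) \<le> z - \<delta> \<longrightarrow> \<not> crit (fst zz) (snd zz))"
proof -
  obtain r0 where r0: "r0 > 0"
    "\<And>N P y t. orth_proj N P \<Longrightarrow> (\<Sum>i<N. P $$ (i, i)) \<ge> r0 \<Longrightarrow> bil N P y y > 0 \<Longrightarrow> t \<ge> z + \<delta> \<Longrightarrow>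
      a \<le> measure (gauss {..<N}) {u \<in> space (gauss {..<N}).
        sqrt (\<Sum>i<N. P $$ (i, i)) * bil N P y u \<le> t * sqrt (bil N P y y) * sqrt (bil N P u u)}"
    "\<And>N P y t. orth_proj N P \<Longrightarrow> (\<Sum>i<N. P $$ (i, i)) \<ge> r0 \<Longrightarrow> bil N P y y > 0 \<Longrightarrow> t \<le> z - \<delta> \<Longrightarrow>
      measure (gauss {..<N}) {u \<in> space (gauss {..<N}).
        sqrt (\<Sum>i<N. P $$ (i, i)) * bil N P y u \<le> t * sqrt (bil N P y y) * sqrt (bil N P u u)} < a"
    using sphere_critical_value[OF z \<delta>] by blast
  have r: "\<rho> / \<kappa>s > 0" using \<rho>_pos \<kappa>s by simp
  \<comment> \<open>The degrees of freedom diverge, so the trace eventually passes the threshold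
    \<open>r0\<close>.\<close>
  have "filterlim (\<lambda>n. (real (N n) - real (d n)) / real n * real n) at_top sequentially"
    by (rule filterlim_tendsto_pos_mult_at_top[OF dof_limit r filterlim_real_sequentially])
  then have "\<forall>\<^sub>F n in sequentially. (real (N n) - real (d n)) / real n * real n \<ge> r0"
    unfolding filterlim_at_top by blast
  then have dof: "\<forall>\<^sub>F n in sequentially. real (N n) - real (d n) \<ge> r0"
    using eventually_gt_at_top[of 0] by eventually_elim simp
  show ?thesis
    using trace_eventually eventually_pfilter_fst[of A, OF A_prob dof]
      eventually_pfilter_fst[of A, OF A_prob eventually_gt_at_top[of 0]]
      order_tendstoD(1)[OF response_limit s2_pos] order_tendstoD(1)[OF noise_limit s2_pos] order_tendstoD(1)[OF \<eta>_limit r]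
  proof eventually_elim
    case (elim zz)
    obtain n x where zz: "zz = (n, x)" by (cases zz)
    let ?b = "bil (N n) (P n x)"
    let ?r = "\<Sum>i<N n. P n x $$ (i, i)"
    have n: "n > 0" and tr: "?r = real (N n) - real (d n)" and rr: "?r \<ge> r0"
      and yy: "?b (y n x) (y n x) > 0" and uu: "?b (u n x) (u n x) > 0" and ee: "?b (\<eta> n x) (\<eta> n x) > 0"
      using elim by (auto simp: zz zero_less_divide_iff)
    \<comment> \<open>The observed value on the scale of \<open>sphere_critical_value\<close>: this
      choice turns the criterion into the event considered there.\<close>
    define t where "t = sqrt ?r * ?b (y n x) (\<eta> n x) / (sqrt (?b (y n x) (y n x)) * sqrt (?b (\<eta> n x) (\<eta> n x)))"
    have crit_iff: "crit n x \<longleftrightarrow> a \<le> measure (gauss {..<N n}) {v \<in> space (gauss {..<N n}).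
        sqrt ?r * ?b (y n x) v \<le> t * sqrt (?b (y n x) (y n x)) * sqrt (?b v v)}"
    proof -
      have "sqrt ?r * ?b (y n x) v \<le> t * sqrt (?b (y n x) (y n x)) * sqrt (?b v v) \<longleftrightarrow>
          sqrt (?b (\<eta> n x) (\<eta> n x)) * ?b (y n x) v \<le> ?b (y n x) (\<eta> n x) * sqrt (?b v v)" for v
      proof -
        have rp: "sqrt ?r > 0" using rr r0(1) by simp
        have "t * sqrt (?b (y n x) (y n x)) * sqrt (?b v v) = sqrt ?r * (?b (y n x) (\<eta> n x) * sqrt (?b v v) / sqrt (?b (\<eta> n x) (\<eta> n x)))"
          using yy ee by (simp add: t_def)
        then have "sqrt ?r * ?b (y n x) v \<le> t * sqrt (?b (y n x) (y n x)) * sqrt (?b v v) \<longleftrightarrow>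
          ?b (y n x) v \<le> ?b (y n x) (\<eta> n x) * sqrt (?b v v) / sqrt (?b (\<eta> n x) (\<eta> n x))"
          using rp by (simp only: mult_le_cancel_left_pos)
        then show ?thesis using ee by (simp add: pos_le_divide_eq mult.commute)
      qed
      then show ?thesis unfolding crit_def by simp
    qed
    have "t = Lz zz + Mz zz * G n x"
    proof -
      have G: "?b (u n x) (\<eta> n x) = sqrt (?b (u n x) (u n x)) * G n x"
      proof -
        have dir: "dir n x = pvec (N n) (P n x) (u n x)" using uu by (simp add: dir_def)
        have "(\<Sum>i<N n. dir n x i * x (i, d n)) = ?b (u n x) (\<eta> n x)"
          unfolding dir bil_eq_pvec inner_pvec[OF P_proj[of n x], of "u n x" "\<eta> n x"] by (simp add: \<eta>_def column_def)
        moreover have "(\<Sum>i<N n. (dir n x i)\<^sup>2) = ?b (u n x) (u n x)"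
          unfolding dir bil_eq_inner[OF P_proj] by (simp add: power2_eq_square)
        ultimately show ?thesis unfolding G_def using uu by simp
      qed
      have yb: "?b (y n x) (\<eta> n x) = h / sqrt (real n) * ?b (truncate n (\<eta> n x)) (\<eta> n x) + sqrt (?b (u n x) (u n x)) * G n x"
        unfolding y_def bil_add_left bil_scale_left G \<beta> ..
      have sn: "sqrt (real n) * sqrt (real n) = real n" "sqrt (real n) > 0" using n by auto
      show ?thesis
        unfolding t_def Lz_def Mz_def zz prod.case yb tr real_sqrt_divide
        using sn n yy ee by (simp add: field_simps)
    qed
    then show ?case
      unfolding zz fst_conv snd_conv crit_iff
      using r0(2)[OF P_proj rr yy, of t] r0(3)[OF P_proj rr yy, of t] by (auto simp: zz not_le)
  qed
qed

text \<open>A sandwich in the manner of Slutsky: with probability tending to 1, \<open>G\<close>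
  \<ge> \<open>g0\<close> implies rejection and rejection implies \<open>G\<close> \<ge>
  \<open>g1\<close>, and the probabilities of these two events are exact values of
  \<open>Phi\<close>.\<close>

theorem power_limit:
  assumes R: "\<forall>\<^sub>F n in sequentially. R n \<in> sets (A n)"
    and crit: "\<forall>\<^sub>F zz in F. snd zz \<in> R (fst zz) \<longleftrightarrow> crit (fst zz) (snd zz)"
  shows "(\<lambda>n. measure (A n) (R n)) \<longlonglongrightarrow> Phi (\<mu> - z)"
proof (rule tendstoI)
  fix \<epsilon> :: real assume \<epsilon>: "\<epsilon> > 0"
  have "Phi \<midarrow>\<mu> - z\<rightarrow> Phi (\<mu> - z)" using isCont_Phi by (simp add: isCont_def)
  then obtain s where s: "s > 0" "\<And>x. x \<noteq> \<mu> - z \<Longrightarrow> dist x (\<mu> - z) < s \<Longrightarrow> dist (Phi x) (Phi (\<mu> - z)) < \<epsilon> / 2"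
    unfolding tendsto_iff eventually_at using \<epsilon> by (metis UNIV_I half_gt_zero zero_less_dist_iff)
  define \<delta> where "\<delta> = s / 4"
  have \<delta>: "\<delta> > 0" using s by (simp add: \<delta>_def)
  \<comment> \<open>Of the margin 2 \<delta>, one \<delta> pays for the critical value and the other
    for the convergence of \<open>Lz\<close> and \<open>Mz\<close>. As 2 \<delta> = s / 2, both
    levels stay within the continuity radius \<open>s\<close>.\<close>
  define g0 where "g0 = z + 2 * \<delta> - \<mu>"
  define g1 where "g1 = z - 2 * \<delta> - \<mu>"
  have Phi0: "Phi (- g0) > Phi (\<mu> - z) - \<epsilon> / 2" and Phi1: "Phi (- g1) < Phi (\<mu> - z) + \<epsilon> / 2"
  proof -
    have "dist (Phi (- g0)) (Phi (\<mu> - z)) < \<epsilon> / 2" "dist (Phi (- g1)) (Phi (\<mu> - z)) < \<epsilon> / 2"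
      using s(1) by (intro s(2); simp add: g0_def g1_def \<delta>_def dist_real_def)+
    then show "Phi (- g0) > Phi (\<mu> - z) - \<epsilon> / 2" "Phi (- g1) < Phi (\<mu> - z) + \<epsilon> / 2"
      unfolding dist_real_def by linarith+
  qed
  have "((\<lambda>zz. Lz zz + Mz zz * g0) \<longlongrightarrow> \<mu> + 1 * g0) F" "((\<lambda>zz. Lz zz + Mz zz * g1) \<longlongrightarrow> \<mu> + 1 * g1) F"
    by (intro tendsto_intros Lz_limit Mz_limit)+
  then have ev0: "\<forall>\<^sub>F zz in F. Lz zz + Mz zz * g0 > z + \<delta>" and ev1: "\<forall>\<^sub>F zz in F. Lz zz + Mz zz * g1 < z - \<delta>"
    using \<delta> by (auto intro!: order_tendstoD simp: g0_def g1_def)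
  have evM: "\<forall>\<^sub>F zz in F. Mz zz > 0" by (rule order_tendstoD(1)[OF Mz_limit]) simp
  have i0: "\<forall>\<^sub>F zz in F. snd zz \<in> {x \<in> space (A (fst zz)). G (fst zz) x \<ge> g0} \<longrightarrow> snd zz \<in> R (fst zz)"
    using crit crit_eventually[OF \<delta>] ev0 evM
  proof eventually_elim
    case (elim zz)
    show ?case
    proof
      assume "snd zz \<in> {x \<in> space (A (fst zz)). G (fst zz) x \<ge> g0}"
      then have "Mz zz * G (fst zz) (snd zz) \<ge> Mz zz * g0" using elim by (intro mult_left_mono) auto
      then have "Lz zz + Mz zz * G (fst zz) (snd zz) \<ge> z + \<delta>" using elim by linarith
      then show "snd zz \<in> R (fst zz)" using elim by blast
    qed
  qed
  have i1: "\<forall>\<^sub>F zz in F. snd zz \<in> R (fst zz) \<inter> space (A (fst zz)) \<longrightarrow> snd zz \<in> {x \<in> space (A (fst zz)). G (fst zz) x \<ge> g1}"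
    using crit crit_eventually[OF \<delta>] ev1 evM
  proof eventually_elim
    case (elim zz)
    show ?case
    proof
      assume inR: "snd zz \<in> R (fst zz) \<inter> space (A (fst zz))"
      have "G (fst zz) (snd zz) \<ge> g1"
      proof (rule ccontr)
        assume "\<not> G (fst zz) (snd zz) \<ge> g1"
        then have "Mz zz * G (fst zz) (snd zz) \<le> Mz zz * g1" using elim by (intro mult_left_mono) auto
        then have "Lz zz + Mz zz * G (fst zz) (snd zz) \<le> z - \<delta>" using elim by linarith
        then show False using elim inR by blast
      qed
      then show "snd zz \<in> {x \<in> space (A (fst zz)). G (fst zz) x \<ge> g1}" using inR by simp
    qed
  qed
  have n0: "\<forall>\<^sub>F n in sequentially. n > (0::nat)" by (rule eventually_gt_at_top)
  have sets: "\<forall>\<^sub>F n in sequentially. {x \<in> space (A n). G n x \<ge> g} \<in> sets (A n)" for g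
    using n0 d_pos by eventually_elim (rule G_law(2))
  have half: "\<epsilon> / 2 > 0" using \<epsilon> by simp
  have R': "\<forall>\<^sub>F n in sequentially. R n \<inter> space (A n) \<in> sets (A n)"
    using R by eventually_elim auto
  show "\<forall>\<^sub>F n in sequentially. dist (measure (A n) (R n)) (Phi (\<mu> - z)) < \<epsilon>"
    using pfilter_measure_le[of A, OF A_prob i0 sets R half] pfilter_measure_le[of A, OF A_prob i1 R' sets half] n0 d_pos R
  proof eventually_elim
    case (elim n)
    have "R n \<inter> space (A n) = R n" using elim sets.sets_into_space[of "R n" "A n"] by auto
    then show ?case using elim G_law(1)[of n g0] G_law(1)[of n g1] Phi0 Phi1 by (simp add: dist_real_def abs_less_iff)
  qed
qed

end

section \<open>From the linear model to the Gaussian array\<close>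

text \<open>Builds the pair (Z_i, X_i) from row \<open>i\<close> of the array: the leading
  \<open>d\<close> entries are coloured by \<open>A\<close>, and entry \<open>d\<close> is the
  residual of X given Z.\<close>

definition sample :: "nat \<Rightarrow> real Matrix.mat \<Rightarrow> real Matrix.vec \<Rightarrow> nat \<Rightarrow> (nat \<times> nat \<Rightarrow> real) \<Rightarrow> (nat \<Rightarrow> real) \<times> real" where
  "sample d A \<xi> i x = (lin d A (\<lambda>k. x (i, k)), (\<Sum>j<d. lin d A (\<lambda>k. x (i, k)) j * vec_index \<xi> j) + x (i, d))"

abbreviation sample_space :: "nat \<Rightarrow> ((nat \<Rightarrow> real) \<times> real) measure" where
  "sample_space d \<equiv> (\<Pi>\<^sub>M j\<in>{..<d}. borel) \<Otimes>\<^sub>M borel"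

lemma sample_cong: "(\<And>k. k \<le> d \<Longrightarrow> x (i, k) = x' (i, k)) \<Longrightarrow> sample d A \<xi> i x = sample d A \<xi> i x'"
proof -
  assume *: "\<And>k. k \<le> d \<Longrightarrow> x (i, k) = x' (i, k)"
  have "lin d A (\<lambda>k. x (i, k)) = lin d A (\<lambda>k. x' (i, k))"
    unfolding lin_def using * by (intro restrict_ext pvec_cong) auto
  then show ?thesis unfolding sample_def using *[of d] by simp
qed

lemma measurable_sample:
  assumes "\<And>k. k \<le> d \<Longrightarrow> (\<lambda>x. x (i, k)) \<in> borel_measurable M"
  shows "sample d A \<xi> i \<in> M \<rightarrow>\<^sub>M sample_space d"
proof -
  have p: "(\<lambda>x. pvec d A (\<lambda>k. x (i, k)) j) \<in> borel_measurable M" for j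
    unfolding pvec_def by (intro borel_measurable_sum borel_measurable_times borel_measurable_const assms) auto
  have 1: "(\<lambda>x. lin d A (\<lambda>k. x (i, k))) \<in> M \<rightarrow>\<^sub>M (\<Pi>\<^sub>M j\<in>{..<d}. borel)"
    unfolding lin_def by (rule measurable_restrict) (rule p)
  have "(\<lambda>x. (\<Sum>j<d. lin d A (\<lambda>k. x (i, k)) j * vec_index \<xi> j) + x (i, d))
      = (\<lambda>x. (\<Sum>j<d. pvec d A (\<lambda>k. x (i, k)) j * vec_index \<xi> j) + x (i, d))"
    by (simp add: lin_def)
  also have "\<dots> \<in> borel_measurable M"
    by (intro borel_measurable_add borel_measurable_sum borel_measurable_times borel_measurable_const assms p) auto
  finally show ?thesis unfolding sample_def[abs_def] using 1 by (intro measurable_Pair)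
qed

lemma (in prob_space) distr_indep_vars:
  assumes "I \<noteq> {}" and X: "indep_vars (\<lambda>_. S) X I"
  shows "distr M (PiM I (\<lambda>_. S)) (\<lambda>\<omega>. \<lambda>i\<in>I. X i \<omega>) = PiM I (\<lambda>i. distr M S (X i))"
  using X by (subst indep_vars_iff_distr_eq_PiM'[symmetric]) (auto simp: assms(1) indep_vars_def)

lemma (in prob_space) distr_indep_set:
  assumes X: "X \<in> M \<rightarrow>\<^sub>M S" and Y: "Y \<in> M \<rightarrow>\<^sub>M T"
    and ind: "indep_set {X -` A \<inter> space M | A. A \<in> sets S} {Y -` B \<inter> space M | B. B \<in> sets T}"
  shows "distr M (S \<Otimes>\<^sub>M T) (\<lambda>\<omega>. (X \<omega>, Y \<omega>)) = distr M S X \<Otimes>\<^sub>M distr M T Y"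
proof (rule pair_measure_eqI[symmetric])
  interpret X: prob_space "distr M S X" by (rule prob_space_distr[OF X])
  interpret Y: prob_space "distr M T Y" by (rule prob_space_distr[OF Y])
  show "sigma_finite_measure (distr M S X)" "sigma_finite_measure (distr M T Y)" by unfold_locales
  fix A B assume "A \<in> sets (distr M S X)" "B \<in> sets (distr M T Y)"
  then have AB: "A \<in> sets S" "B \<in> sets T" by auto
  have "emeasure (distr M (S \<Otimes>\<^sub>M T) (\<lambda>\<omega>. (X \<omega>, Y \<omega>))) (A \<times> B) = emeasure M ((\<lambda>\<omega>. (X \<omega>, Y \<omega>)) -` (A \<times> B) \<inter> space M)"
    using AB X Y by (intro emeasure_distr) auto
  also have "(\<lambda>\<omega>. (X \<omega>, Y \<omega>)) -` (A \<times> B) \<inter> space M = (X -` A \<inter> space M) \<inter> (Y -` B \<inter> space M)" by auto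
  also have "emeasure M \<dots> = emeasure M (X -` A \<inter> space M) * emeasure M (Y -` B \<inter> space M)"
  proof -
    have "prob ((X -` A \<inter> space M) \<inter> (Y -` B \<inter> space M)) = prob (X -` A \<inter> space M) * prob (Y -` B \<inter> space M)"
      by (rule indep_setD[OF ind]) (use AB in auto)
    then show ?thesis by (simp only: emeasure_eq_measure ennreal_mult[OF measure_nonneg measure_nonneg])
  qed
  finally show "emeasure (distr M S X) A * emeasure (distr M T Y) B = emeasure (distr M (S \<Otimes>\<^sub>M T) (\<lambda>\<omega>. (X \<omega>, Y \<omega>))) (A \<times> B)"
    using AB X Y by (simp add: emeasure_distr)
qed simp

lemma arr_indep_coordinates:
  assumes "N > 0" "D > 0"
  shows "arr.indep_vars N D (\<lambda>_. borel) (\<lambda>p x. x p) ({..<N} \<times> {..<D})"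
  unfolding arr_def by (rule gauss_indep_coordinates) (use assms in auto)

text \<open>Functions of disjoint sets of entries are independent; the equations with
  \<open>restrict\<close> say that \<open>f\<close> and \<open>g\<close> look only at
  \<open>K\<close> and \<open>L\<close>.\<close>

lemma arr_pair_law:
  assumes AB: "K \<inter> L = {}" "K \<subseteq> {..<N} \<times> {..<D}" "L \<subseteq> {..<N} \<times> {..<D}" and N: "N > 0" "D > 0"
    and f: "f \<in> PiM K (\<lambda>_. borel) \<rightarrow>\<^sub>M S" "\<And>x. f (restrict x K) = f x"
    and g: "g \<in> PiM L (\<lambda>_. borel) \<rightarrow>\<^sub>M T" "\<And>x. g (restrict x L) = g x"
  shows "distr (arr N D) (S \<Otimes>\<^sub>M T) (\<lambda>x. (f x, g x)) = distr (arr N D) S f \<Otimes>\<^sub>M distr (arr N D) T g"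
proof -
  let ?P = "\<lambda>K. PiM K (\<lambda>_. borel) :: (nat \<times> nat \<Rightarrow> real) measure"
  have "arr.indep_var N D (?P K) (\<lambda>x. restrict (\<lambda>p. x p) K) (?P L) (\<lambda>x. restrict (\<lambda>p. x p) L)"
    by (rule arr.indep_var_restrict[OF arr_indep_coordinates[OF N] AB])
  then have law: "arr.random_variable N D (?P K) (\<lambda>x. restrict x K)" "arr.random_variable N D (?P L) (\<lambda>x. restrict x L)"
     "distr (arr N D) (?P K) (\<lambda>x. restrict x K) \<Otimes>\<^sub>M distr (arr N D) (?P L) (\<lambda>x. restrict x L)
      = distr (arr N D) (?P K \<Otimes>\<^sub>M ?P L) (\<lambda>x. (restrict x K, restrict x L))"
    unfolding arr.indep_var_distribution_eq by auto
  have K: "distr (distr (arr N D) (?P K) (\<lambda>x. restrict x K)) S f = distr (arr N D) S f"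
    using distr_distr[OF f(1) law(1)] by (simp add: comp_def f(2))
  have L: "distr (distr (arr N D) (?P L) (\<lambda>x. restrict x L)) T g = distr (arr N D) T g"
    using distr_distr[OF g(1) law(2)] by (simp add: comp_def g(2))
  have f': "f \<in> distr (arr N D) (?P K) (\<lambda>x. restrict x K) \<rightarrow>\<^sub>M S" and g': "g \<in> distr (arr N D) (?P L) (\<lambda>x. restrict x L) \<rightarrow>\<^sub>M T"
    using f(1) g(1) by auto
  have fg: "(\<lambda>(x, y). (f x, g y)) \<in> ?P K \<Otimes>\<^sub>M ?P L \<rightarrow>\<^sub>M S \<Otimes>\<^sub>M T"
    using measurable_Pair[OF measurable_compose[OF measurable_fst f(1)] measurable_compose[OF measurable_snd g(1)]]
    by (simp add: split_beta')
  have "prob_space (distr (arr N D) T g)"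
    unfolding L[symmetric] by (intro prob_space.prob_space_distr[OF arr.prob_space_distr] law(2) g')
  then have "distr (arr N D) S f \<Otimes>\<^sub>M distr (arr N D) T g
    = distr (distr (arr N D) (?P K) (\<lambda>x. restrict x K) \<Otimes>\<^sub>M distr (arr N D) (?P L) (\<lambda>x. restrict x L)) (S \<Otimes>\<^sub>M T) (\<lambda>(x, y). (f x, g y))"
    unfolding K[symmetric] L[symmetric]
    by (intro pair_measure_distr f' g') (auto simp: L intro: prob_space_imp_sigma_finite)
  also have "\<dots> = distr (arr N D) (S \<Otimes>\<^sub>M T) (\<lambda>x. (f x, g x))"
    unfolding law(3) using distr_distr[OF fg, of "\<lambda>x. (restrict x K, restrict x L)" "arr N D"] law(1,2)
    by (simp add: comp_def f(2) g(2))
  finally show ?thesis ..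
qed

lemma distr_arr_row:
  assumes i: "i < N"
  shows "distr (arr N (d + 2)) (gauss {..<d} \<Otimes>\<^sub>M std_normal_distribution) (\<lambda>x. (\<lambda>k\<in>{..<d}. x (i, k), x (i, d)))
    = gauss {..<d} \<Otimes>\<^sub>M std_normal_distribution"
proof -
  let ?A = "{i} \<times> {..<d}" and ?B = "{(i, d)}"
  let ?f = "\<lambda>w :: nat \<times> nat \<Rightarrow> real. \<lambda>k\<in>{..<d}. w (i, k)" and ?g = "\<lambda>w :: nat \<times> nat \<Rightarrow> real. w (i, d)"
  have "distr (arr N (d + 2)) (gauss {..<d} \<Otimes>\<^sub>M std_normal_distribution) (\<lambda>x. (?f x, ?g x))
    = distr (arr N (d + 2)) (gauss {..<d}) ?f \<Otimes>\<^sub>M distr (arr N (d + 2)) std_normal_distribution ?g"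
  proof (rule arr_pair_law[of ?A ?B])
    have "?f \<in> PiM ?A (\<lambda>_. borel) \<rightarrow>\<^sub>M PiM {..<d} (\<lambda>_. borel)"
      by (rule measurable_restrict) (rule measurable_component_singleton, simp)
    then show "?f \<in> PiM ?A (\<lambda>_. borel) \<rightarrow>\<^sub>M gauss {..<d}" using measurable_cong_sets[OF refl sets_gauss] by blast
    have "?g \<in> PiM ?B (\<lambda>_. borel) \<rightarrow>\<^sub>M borel" by (rule measurable_component_singleton) simp
    then show "?g \<in> PiM ?B (\<lambda>_. borel) \<rightarrow>\<^sub>M std_normal_distribution" by simp
  qed (use i in \<open>auto simp: fun_eq_iff\<close>)
  moreover have "distr (arr N (d + 2)) (gauss {..<d}) ?f = gauss {..<d}"
    unfolding arr_def gauss_def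
    by (rule distr_PiM_reindex[of "{..<N} \<times> {..<d + 2}" "\<lambda>_. std_normal_distribution" "\<lambda>k. (i, k)" "{..<d}"])
      (use i prob_space_std_normal in \<open>auto simp: inj_on_def\<close>)
  moreover have "distr (arr N (d + 2)) std_normal_distribution ?g = std_normal_distribution"
    using distr_PiM_component[of "{..<N} \<times> {..<d + 2}" "\<lambda>_. std_normal_distribution" "(i, d)"] i prob_space_std_normal
    unfolding arr_def gauss_def by auto
  ultimately show ?thesis by simp
qed

text \<open>The normalising constants need not be computed: both measures are probability measures with
  proportional densities.\<close>

lemma linear_sample_law:
  assumes A: "A \<in> carrier_mat d d" and det: "Determinant.det A \<noteq> 0" and S: "A * transpose_mat A = \<Sigma>"
    and \<xi>: "\<xi> \<in> carrier_vec d"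
  defines "h \<equiv> \<lambda>(z, x). ennreal (mvn_density d \<Sigma> z * normal_density (scalar_prod (Matrix.vec d z) \<xi>) 1 x)"
  assumes prob: "prob_space (density (leb d \<Otimes>\<^sub>M lborel) h)"
    and meas: "h \<in> borel_measurable (leb d \<Otimes>\<^sub>M lborel)"
  shows "distr (gauss {..<d} \<Otimes>\<^sub>M std_normal_distribution) (leb d \<Otimes>\<^sub>M lborel)
    (\<lambda>(g, t). (lin d A g, (\<Sum>j<d. lin d A g j * vec_index \<xi> j) + t)) = density (leb d \<Otimes>\<^sub>M lborel) h"
proof -
  define B where "B = inv_mat A"
  note inv = inv_mat_nonsingular[OF A det, folded B_def]
  note B = inv(3)
  have AB: "pvec d A (pvec d B x) i = x i" and BA: "pvec d B (pvec d A x) i = x i" if "i < d" for x i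
    using pvec_mult[OF A B that, of x] pvec_mult[OF B A that, of x] inv pvec_one[OF that] by auto
  \<comment> \<open>With B the inverse of A, the inverse covariance is B^T B, so the exponent of the
    density is -|B x|^2 / 2 and the density is a multiple of \<open>phi d\<close> along B.\<close>
  have iS: "inv_mat \<Sigma> = transpose_mat B * B"
  proof (rule inv_mat_unique)
    show Sc: "\<Sigma> \<in> carrier_mat d d" using S A by auto
    have AtBt: "transpose_mat A * transpose_mat B = 1\<^sub>m d"
      using transpose_mult[OF B A] inv(2) by simp
    have "\<Sigma> * (transpose_mat B * B) = A * transpose_mat A * (transpose_mat B * B)" by (simp add: S)
    also have "\<dots> = A * (transpose_mat A * (transpose_mat B * B))" by (rule assoc_mult_mat) (use A B in auto)
    also have "transpose_mat A * (transpose_mat B * B) = transpose_mat A * transpose_mat B * B"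
      by (rule assoc_mult_mat[symmetric]) (use A B in auto)
    finally show "\<Sigma> * (transpose_mat B * B) = 1\<^sub>m d" using AtBt B inv by simp
  qed (use B in auto)
  have q: "quad_form (inv_mat \<Sigma>) (Matrix.vec d x) = (\<Sum>i<d. (pvec d B x i)\<^sup>2)" for x
  proof -
    have "transpose_mat B * B *\<^sub>v Matrix.vec d x = transpose_mat B *\<^sub>v (B *\<^sub>v Matrix.vec d x)"
      by (rule assoc_mult_mat_vec) (use B in auto)
    then have "quad_form (inv_mat \<Sigma>) (Matrix.vec d x) = (\<Sum>i<d. x i * pvec d (transpose_mat B) (pvec d B x) i)"
      unfolding quad_form_def iS using B mat_vec_vec[OF B] mat_vec_vec[of "transpose_mat B" d]
      by (simp add: scalar_prod_def lessThan_atLeast0)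
    also have "\<dots> = (\<Sum>i<d. (pvec d B x i)\<^sup>2)"
      using inner_transpose[of "transpose_mat B" d x "pvec d B x"] B by (simp add: power2_eq_square)
    finally show ?thesis .
  qed
  define K where "K = ennreal (1 / sqrt ((2 * pi) ^ d * Determinant.det \<Sigma>) / (1 / sqrt (2 * pi)) ^ d)"
  have mvn: "ennreal (mvn_density d \<Sigma> x) = K * phi d (pvec d B x)" for x
  proof -
    have "mvn_density d \<Sigma> x = (1 / sqrt ((2 * pi) ^ d * Determinant.det \<Sigma>) / (1 / sqrt (2 * pi)) ^ d)
      * ((1 / sqrt (2 * pi)) ^ d * exp (- (\<Sum>i<d. (pvec d B x i)\<^sup>2) / 2))"
      unfolding mvn_density_def q by simp
    then show ?thesis unfolding K_def phi_exp by (simp only: ennreal_mult'')  (subst ennreal_mult'', auto)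
  qed
  define ip where "ip = (\<lambda>x. \<Sum>j<d. x j * vec_index \<xi> j)"
  have sp: "scalar_prod (Matrix.vec d x) \<xi> = ip x" for x
    using \<xi> by (simp add: scalar_prod_def ip_def lessThan_atLeast0)
  have ipm[measurable]: "ip \<in> borel_measurable (leb d)" unfolding ip_def by measurable
  \<comment> \<open>Each of the two measures gives \<open>E\<close> the mass \<open>J E\<close>
    times a constant, which is \<open>c\<close> for the image measure and \<open>K\<close> for the
    density.\<close>
  define J where "J = (\<lambda>E. \<integral>\<^sup>+x. phi d (pvec d B x) * (\<integral>\<^sup>+t. indicator E (x, t) * ennreal (std_normal_density (t - ip x)) \<partial>lborel) \<partial>leb d)"
  define c where "c = (\<integral>\<^sup>+x. phi d (pvec d A x) \<partial>leb d)"
  have phiB[measurable]: "(\<lambda>x. phi d (pvec d B x)) \<in> borel_measurable (leb d)"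
    unfolding phi_def by measurable
  let ?T = "\<lambda>(g, t). (lin d A g, (\<Sum>j<d. lin d A g j * vec_index \<xi> j) + t)"
  have T: "?T \<in> gauss {..<d} \<Otimes>\<^sub>M std_normal_distribution \<rightarrow>\<^sub>M leb d \<Otimes>\<^sub>M lborel"
  proof -
    have 1: "(\<lambda>p. lin d A (fst p)) \<in> gauss {..<d} \<Otimes>\<^sub>M std_normal_distribution \<rightarrow>\<^sub>M leb d"
      by (rule measurable_compose[OF measurable_fst]) measurable
    have 2: "(\<lambda>p. ip (lin d A (fst p)) + snd p) \<in> gauss {..<d} \<Otimes>\<^sub>M std_normal_distribution \<rightarrow>\<^sub>M lborel"
      using measurable_compose[OF 1 ipm] by measurable
    show ?thesis using measurable_Pair[OF 1 2] by (simp add: split_beta' ip_def)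
  qed
  have left: "emeasure (distr (gauss {..<d} \<Otimes>\<^sub>M std_normal_distribution) (leb d \<Otimes>\<^sub>M lborel) ?T) E = c * J E"
    if E[measurable]: "E \<in> sets (leb d \<Otimes>\<^sub>M lborel)" for E
  proof -
    have H[measurable]: "(\<lambda>x. \<integral>\<^sup>+t. indicator E (x, t) * ennreal (std_normal_density (t - ip x)) \<partial>lborel) \<in> borel_measurable (leb d)"
      by measurable
    have "emeasure (distr (gauss {..<d} \<Otimes>\<^sub>M std_normal_distribution) (leb d \<Otimes>\<^sub>M lborel) ?T) E
        = (\<integral>\<^sup>+p. indicator E (?T p) \<partial>(gauss {..<d} \<Otimes>\<^sub>M std_normal_distribution))"
      using E by (subst nn_integral_indicator[symmetric], simp) (rule nn_integral_distr[OF T], measurable)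
    also have "\<dots> = (\<integral>\<^sup>+g. \<integral>\<^sup>+t. indicator E (?T (g, t)) \<partial>std_normal_distribution \<partial>gauss {..<d})"
      by (rule std_normal.nn_integral_fst[symmetric]) (rule measurable_compose[OF T], measurable)
    also have "\<dots> = (\<integral>\<^sup>+g. \<integral>\<^sup>+t. indicator E (lin d A g, t) * ennreal (std_normal_density (t - ip (lin d A g))) \<partial>lborel \<partial>gauss {..<d})"
    proof (rule nn_integral_cong)
      fix g assume g: "g \<in> space (gauss {..<d})"
      let ?z = "lin d A g"
      have z: "?z \<in> space (leb d)" by (simp add: leb_def space_PiM lin_def)
      have Ez[measurable]: "(\<lambda>t. indicator E (?z, t) :: ennreal) \<in> borel_measurable borel"
        using measurable_compose[OF measurable_Pair1'[OF z, of lborel] borel_measurable_indicator[OF E]] by simp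
      have "(\<integral>\<^sup>+t. indicator E (?T (g, t)) \<partial>std_normal_distribution) = (\<integral>\<^sup>+t. indicator E (?z, ip ?z + t) \<partial>std_normal_distribution)"
        by (simp add: ip_def)
      also have "\<dots> = (\<integral>\<^sup>+t. ennreal (std_normal_density t) * indicator E (?z, ip ?z + t) \<partial>lborel)"
        by (rule nn_integral_density) (auto intro!: measurable_compose[OF _ Ez])
      also have "\<dots> = (\<integral>\<^sup>+t. indicator E (?z, t) * ennreal (std_normal_density (t - ip ?z)) \<partial>lborel)"
        using nn_integral_real_affine[of "\<lambda>t. indicator E (?z, t) * ennreal (std_normal_density (t - ip ?z))" 1 "ip ?z"]
        by (simp add: mult.commute)
      finally show "(\<integral>\<^sup>+t. indicator E (?T (g, t)) \<partial>std_normal_distribution)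
        = (\<integral>\<^sup>+t. indicator E (?z, t) * ennreal (std_normal_density (t - ip ?z)) \<partial>lborel)" .
    qed
    also have "\<dots> = (\<integral>\<^sup>+g. phi d g * (\<integral>\<^sup>+t. indicator E (lin d A g, t) * ennreal (std_normal_density (t - ip (lin d A g))) \<partial>lborel) \<partial>leb d)"
      unfolding gauss_eq_density
    proof (rule nn_integral_density)
      show "phi d \<in> borel_measurable (leb d)" by measurable
      have "lin d A \<in> leb d \<rightarrow>\<^sub>M leb d" by measurable
      from measurable_compose[OF this H]
      show "(\<lambda>g. \<integral>\<^sup>+t. indicator E (lin d A g, t) * ennreal (std_normal_density (t - ip (lin d A g))) \<partial>lborel) \<in> borel_measurable (leb d)" .
    qed
    also have "\<dots> = (\<integral>\<^sup>+g. phi d (pvec d B (lin d A g)) * (\<integral>\<^sup>+t. indicator E (lin d A g, t) * ennreal (std_normal_density (t - ip (lin d A g))) \<partial>lborel) \<partial>leb d)"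
    proof (rule nn_integral_cong)
      fix g
      have "phi d (pvec d B (lin d A g)) = phi d g"
        unfolding pvec_lin by (rule phi_cong_norm) (simp add: BA)
      then show "phi d g * (\<integral>\<^sup>+t. indicator E (lin d A g, t) * ennreal (std_normal_density (t - ip (lin d A g))) \<partial>lborel)
        = phi d (pvec d B (lin d A g)) * (\<integral>\<^sup>+t. indicator E (lin d A g, t) * ennreal (std_normal_density (t - ip (lin d A g))) \<partial>lborel)"
        by simp
    qed
    also have "\<dots> = c * J E"
      unfolding c_def J_def
      by (rule leb_linear[of d A B "\<lambda>x. phi d (pvec d B x) * (\<integral>\<^sup>+t. indicator E (x, t) * ennreal (std_normal_density (t - ip x)) \<partial>lborel)"])
        (rule AB, assumption, measurable)
    finally show ?thesis .
  qed
  have right: "emeasure (density (leb d \<Otimes>\<^sub>M lborel) h) E = K * J E"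
    if E[measurable]: "E \<in> sets (leb d \<Otimes>\<^sub>M lborel)" for E
  proof -
    have H[measurable]: "(\<lambda>x. \<integral>\<^sup>+t. indicator E (x, t) * ennreal (std_normal_density (t - ip x)) \<partial>lborel) \<in> borel_measurable (leb d)"
      by measurable
    have "emeasure (density (leb d \<Otimes>\<^sub>M lborel) h) E = (\<integral>\<^sup>+p. h p * indicator E p \<partial>(leb d \<Otimes>\<^sub>M lborel))"
      by (rule emeasure_density[OF meas E])
    also have "\<dots> = (\<integral>\<^sup>+x. \<integral>\<^sup>+t. h (x, t) * indicator E (x, t) \<partial>lborel \<partial>leb d)"
      by (rule lborel.nn_integral_fst[symmetric]) (use meas in measurable)
    also have "\<dots> = (\<integral>\<^sup>+x. K * (phi d (pvec d B x) * (\<integral>\<^sup>+t. indicator E (x, t) * ennreal (std_normal_density (t - ip x)) \<partial>lborel)) \<partial>leb d)"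
    proof (rule nn_integral_cong)
      fix x assume x: "x \<in> space (leb d)"
      have Ex[measurable]: "(\<lambda>t. indicator E (x, t) :: ennreal) \<in> borel_measurable borel"
        using measurable_compose[OF measurable_Pair1'[OF x, of lborel] borel_measurable_indicator[OF E]] by simp
      have "h (x, t) = K * phi d (pvec d B x) * ennreal (std_normal_density (t - ip x))" for t
      proof -
        have "h (x, t) = ennreal (mvn_density d \<Sigma> x) * ennreal (normal_density (ip x) 1 t)"
          unfolding h_def sp prod.case by (rule ennreal_mult'') simp
        also have "normal_density (ip x) 1 t = std_normal_density (t - ip x)" by (simp add: normal_density_def)
        finally show ?thesis by (simp only: mvn)
      qed
      then have "(\<integral>\<^sup>+t. h (x, t) * indicator E (x, t) \<partial>lborel)
        = (\<integral>\<^sup>+t. (K * phi d (pvec d B x)) * (indicator E (x, t) * ennreal (std_normal_density (t - ip x))) \<partial>lborel)"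
        by (simp add: mult_ac)
      also have "\<dots> = (K * phi d (pvec d B x)) * (\<integral>\<^sup>+t. indicator E (x, t) * ennreal (std_normal_density (t - ip x)) \<partial>lborel)"
        by (rule nn_integral_cmult) measurable
      finally show "(\<integral>\<^sup>+t. h (x, t) * indicator E (x, t) \<partial>lborel)
        = K * (phi d (pvec d B x) * (\<integral>\<^sup>+t. indicator E (x, t) * ennreal (std_normal_density (t - ip x)) \<partial>lborel))"
        by (simp add: mult.assoc)
    qed
    also have "\<dots> = K * J E"
      unfolding J_def by (rule nn_integral_cmult) measurable
    finally show ?thesis .
  qed
  let ?\<Omega> = "space (leb d \<Otimes>\<^sub>M lborel)"
  interpret pair: pair_prob_space "gauss {..<d}" std_normal_distribution ..
  have "prob_space (distr (gauss {..<d} \<Otimes>\<^sub>M std_normal_distribution) (leb d \<Otimes>\<^sub>M lborel) ?T)"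
    by (rule pair.prob_space_distr[OF T])
  from prob_space.emeasure_space_1[OF this] have c1: "c * J ?\<Omega> = 1" using left[OF sets.top] by simp
  from prob_space.emeasure_space_1[OF prob] have K1: "K * J ?\<Omega> = 1" using right[OF sets.top] by simp
  have "K = K * (c * J ?\<Omega>)" by (simp add: c1)
  also have "\<dots> = c * (K * J ?\<Omega>)" by (simp add: mult_ac)
  finally have "K = c" by (simp add: K1)
  then show ?thesis by (intro measure_eqI) (use left right in auto)
qed

text \<open>The test is defined through a quantile of a measure obtained by choice, which hides its
  dependence on the data. The equivalent criterion compares a constant with the Gaussian measure of
  a jointly measurable slice.\<close>

lemma measurable_ccrt_rejects:
  assumes Z: "\<And>i j. i < N \<Longrightarrow> j < d \<Longrightarrow> (\<lambda>w. FZ w i j) \<in> borel_measurable Q"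
    and X: "\<And>i. i < N \<Longrightarrow> (\<lambda>w. FX w i) \<in> borel_measurable Q"
    and Y: "\<And>i. i < n \<Longrightarrow> (\<lambda>w. FY w i) \<in> borel_measurable Q"
    and n: "0 < n" "n \<le> N" "d < N" and \<alpha>: "0 < \<alpha>" "\<alpha> < 1"
  shows "{w \<in> space Q. ccrt_rejects \<alpha> (Matrix.mat N d (\<lambda>(i, j). FZ w i j)) (Matrix.vec N (FX w)) (Matrix.vec n (FY w))} \<in> sets Q"
proof -
  define P where "P = (\<lambda>w. resid_mat (Matrix.mat N d (\<lambda>(i, j). FZ w i j)))"
  define y where "y = (\<lambda>w i. if i < n then FY w i else 0)"
  have Pm: "(\<lambda>w. P w $$ (i, j)) \<in> borel_measurable Q" if "i < N" "j < N" for i j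
    unfolding P_def by (rule measurable_resid_mat[OF Z that])
  have ym: "(\<lambda>w. y w i) \<in> borel_measurable Q" if "i < N" for i
    unfolding y_def using Y by (cases "i < n") auto
  \<comment> \<open>For a singular Gram matrix the default inverse 0 turns the residual matrix into
    the identity; otherwise its trace is N - d > 0.\<close>
  have P0: "\<exists>i<N. P w $$ (i, i) \<noteq> 0" for w
  proof (cases "Determinant.det (transpose_mat (Matrix.mat N d (\<lambda>(i, j). FZ w i j)) * Matrix.mat N d (\<lambda>(i, j). FZ w i j)) = 0")
    case True
    let ?Z = "Matrix.mat N d (\<lambda>(i, j). FZ w i j)"
    have inv: "inv_mat (transpose_mat ?Z * ?Z) = 0\<^sub>m d d" by (rule inv_mat_singular[OF _ True]) auto
    have "P w $$ (0, 0) = 1"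
      unfolding P_def using resid_mat_index[of ?Z N d 0 0] n unfolding inv by simp
    then show ?thesis using n by (intro exI[of _ 0]) simp
  next
    case False
    have "(\<Sum>i<N. P w $$ (i, i)) = real N - real d"
      unfolding P_def by (rule resid_mat_diag_sum[OF _ False]) simp
    then have "(\<Sum>i<N. P w $$ (i, i)) \<noteq> 0" using n by simp
    then show ?thesis by (metis (no_types, lifting) lessThan_iff sum.neutral)
  qed
  let ?G = "gauss {..<N}"
  have bm: "(\<lambda>p. bil N (P (fst p)) (f p) (g p)) \<in> borel_measurable (Q \<Otimes>\<^sub>M ?G)"
    if "\<And>i. i < N \<Longrightarrow> (\<lambda>p. f p i) \<in> borel_measurable (Q \<Otimes>\<^sub>M ?G)" "\<And>i. i < N \<Longrightarrow> (\<lambda>p. g p i) \<in> borel_measurable (Q \<Otimes>\<^sub>M ?G)" for f g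
    unfolding bil_def
    by (intro borel_measurable_sum borel_measurable_times that measurable_compose[OF measurable_fst Pm]) auto
  have ux: "(\<lambda>p. FX (fst p) i) \<in> borel_measurable (Q \<Otimes>\<^sub>M ?G)" and uy: "(\<lambda>p. y (fst p) i) \<in> borel_measurable (Q \<Otimes>\<^sub>M ?G)"
    if "i < N" for i
    using measurable_compose[OF measurable_fst X[OF that]] measurable_compose[OF measurable_fst ym[OF that]] by auto
  have uu: "(\<lambda>p. snd p i) \<in> borel_measurable (Q \<Otimes>\<^sub>M ?G)" if "i < N" for i
    using that by (intro measurable_compose[OF measurable_snd]) measurable
  let ?A = "\<lambda>w. {u \<in> space ?G. sqrt (bil N (P w) (FX w) (FX w)) * bil N (P w) (y w) u \<le> bil N (P w) (y w) (FX w) * sqrt (bil N (P w) u u)}"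
  have [measurable]: "(\<lambda>p. bil N (P (fst p)) (FX (fst p)) (FX (fst p))) \<in> borel_measurable (Q \<Otimes>\<^sub>M ?G)"
    "(\<lambda>p. bil N (P (fst p)) (y (fst p)) (snd p)) \<in> borel_measurable (Q \<Otimes>\<^sub>M ?G)"
    "(\<lambda>p. bil N (P (fst p)) (y (fst p)) (FX (fst p))) \<in> borel_measurable (Q \<Otimes>\<^sub>M ?G)"
    "(\<lambda>p. bil N (P (fst p)) (snd p) (snd p)) \<in> borel_measurable (Q \<Otimes>\<^sub>M ?G)"
    by (intro bm ux uy uu; assumption)+
  have m: "(\<lambda>w. measure ?G (?A w)) \<in> borel_measurable Q"
  proof (rule gauss.measurable_measure)
    have "{p \<in> space (Q \<Otimes>\<^sub>M ?G). sqrt (bil N (P (fst p)) (FX (fst p)) (FX (fst p))) * bil N (P (fst p)) (y (fst p)) (snd p)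
        \<le> bil N (P (fst p)) (y (fst p)) (FX (fst p)) * sqrt (bil N (P (fst p)) (snd p) (snd p))} \<in> sets (Q \<Otimes>\<^sub>M ?G)"
      by measurable
    also have "{p \<in> space (Q \<Otimes>\<^sub>M ?G). sqrt (bil N (P (fst p)) (FX (fst p)) (FX (fst p))) * bil N (P (fst p)) (y (fst p)) (snd p)
        \<le> bil N (P (fst p)) (y (fst p)) (FX (fst p)) * sqrt (bil N (P (fst p)) (snd p) (snd p))} = {p \<in> space (Q \<Otimes>\<^sub>M ?G). snd p \<in> ?A (fst p)}"
      by (auto simp: space_pair_measure)
    finally show "{p \<in> space (Q \<Otimes>\<^sub>M ?G). snd p \<in> ?A (fst p)} \<in> sets (Q \<Otimes>\<^sub>M ?G)" .
  qed auto
  have "ccrt_rejects \<alpha> (Matrix.mat N d (\<lambda>(i, j). FZ w i j)) (Matrix.vec N (FX w)) (Matrix.vec n (FY w)) \<longleftrightarrow> 1 - \<alpha> \<le> measure ?G (?A w)" for w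
    using ccrt_rejects_iff[OF _ P0[of w, unfolded P_def] n(1,2) \<alpha>, of d "FX w" "FY w"]
    unfolding P_def y_def by simp
  then show ?thesis using m[measurable] by simp
qed

section \<open>The law of the observed data and its reproduction on a Gaussian array\<close>

context unlabeled_linear_model
begin

text \<open>Noise and samples together determine the response, so the rejection event depends on
  \<omega> only through this pair.\<close>

definition "observed \<omega> = (\<lambda>i\<in>{..<n}. \<epsilon> i \<omega>, \<lambda>i\<in>{..<n + m}. (Z i \<omega>, X i \<omega>))"

definition "observed_space = (\<Pi>\<^sub>M i\<in>{..<n}. borel) \<Otimes>\<^sub>M (\<Pi>\<^sub>M i\<in>{..<n + m}. sample_space d)"

definition "noise_law_product = (\<Pi>\<^sub>M i\<in>{..<n}. density lborel (\<lambda>e. ennreal (normal_density 0 \<sigma> e)))"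

lemma sets_sample_space: "sets ((\<Pi>\<^sub>M j\<in>{..<d}. lborel) \<Otimes>\<^sub>M lborel) = sets (sample_space d)"
  by (intro sets_pair_measure_cong sets_PiM_cong) auto

definition "sample_density = (\<lambda>(z, x). ennreal (mvn_density d \<Sigma> z * normal_density (scalar_prod (Matrix.vec d z) \<xi>) 1 x))"

text \<open>The push-forward along the identity restates the law over \<open>sample_space d\<close>,
  which has the same measurable sets.\<close>

definition "sample_measure = distr (density (leb d \<Otimes>\<^sub>M lborel) sample_density) (sample_space d) (\<lambda>p. p)"

lemma sample_measure_eq: assumes i: "i < n + m" shows "distr M (sample_space d) (\<lambda>\<omega>. (Z i \<omega>, X i \<omega>)) = sample_measure"
proof -
  have D: "distributed M (leb d \<Otimes>\<^sub>M lborel) (\<lambda>\<omega>. (Z i \<omega>, X i \<omega>)) sample_density"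
    using sample_law[OF i] by (simp add: leb_def sample_density_def)
  have S: "sets (leb d \<Otimes>\<^sub>M lborel) = sets (sample_space d)" using sets_sample_space by (simp add: leb_def)
  have "sample_measure = distr (distr M (leb d \<Otimes>\<^sub>M lborel) (\<lambda>\<omega>. (Z i \<omega>, X i \<omega>))) (sample_space d) (\<lambda>p. p)"
    using D by (simp add: sample_measure_def distributed_def)
  also have "\<dots> = distr M (sample_space d) (\<lambda>\<omega>. (Z i \<omega>, X i \<omega>))"
    using D S by (subst distr_distr) (auto simp: distributed_def comp_def measurable_ident_sets)
  finally show ?thesis ..
qed

lemma observed_measurable:
  "(\<lambda>\<omega>. \<lambda>i\<in>{..<n}. \<epsilon> i \<omega>) \<in> M \<rightarrow>\<^sub>M (\<Pi>\<^sub>M i\<in>{..<n}. borel)"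
  "(\<lambda>\<omega>. \<lambda>i\<in>{..<n + m}. (Z i \<omega>, X i \<omega>)) \<in> M \<rightarrow>\<^sub>M (\<Pi>\<^sub>M i\<in>{..<n + m}. sample_space d)"
  using indep_noise indep_samples unfolding indep_vars_def by (auto intro!: measurable_restrict)

lemma observed_measurable': "observed \<in> M \<rightarrow>\<^sub>M observed_space"
  using measurable_Pair[OF observed_measurable] by (simp add: observed_def[abs_def] observed_space_def)

lemma observed_law:
  assumes n: "n > 0"
  shows "distr M observed_space observed = noise_law_product \<Otimes>\<^sub>M (\<Pi>\<^sub>M i\<in>{..<n + m}. sample_measure)"
proof -
  have ne: "{..<n} \<noteq> {}" "{..<n + m} \<noteq> {}" using n by auto
  have "distr M (\<Pi>\<^sub>M i\<in>{..<n}. borel) (\<lambda>\<omega>. \<lambda>i\<in>{..<n}. \<epsilon> i \<omega>) = (\<Pi>\<^sub>M i\<in>{..<n}. distr M borel (\<epsilon> i))"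
    by (rule distr_indep_vars[OF ne(1) indep_noise])
  also have "\<dots> = noise_law_product"
    unfolding noise_law_product_def
  proof (intro PiM_cong refl)
    fix i assume "i \<in> {..<n}"
    then have "distr M lborel (\<epsilon> i) = density lborel (\<lambda>e. ennreal (normal_density 0 \<sigma> e))"
      using noise_law[of i] by (simp add: distributed_def)
    moreover have "distr M lborel (\<epsilon> i) = distr M borel (\<epsilon> i)" by (intro distr_cong) auto
    ultimately show "distr M borel (\<epsilon> i) = density lborel (\<lambda>e. ennreal (normal_density 0 \<sigma> e))" by simp
  qed
  finally have 1: "distr M (\<Pi>\<^sub>M i\<in>{..<n}. borel) (\<lambda>\<omega>. \<lambda>i\<in>{..<n}. \<epsilon> i \<omega>) = noise_law_product" .
  have "distr M (\<Pi>\<^sub>M i\<in>{..<n + m}. sample_space d) (\<lambda>\<omega>. \<lambda>i\<in>{..<n + m}. (Z i \<omega>, X i \<omega>))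
      = (\<Pi>\<^sub>M i\<in>{..<n + m}. distr M (sample_space d) (\<lambda>\<omega>. (Z i \<omega>, X i \<omega>)))"
    by (rule distr_indep_vars[OF ne(2) indep_samples])
  also have "\<dots> = (\<Pi>\<^sub>M i\<in>{..<n + m}. sample_measure)"
    by (intro PiM_cong refl sample_measure_eq) auto
  finally have 2: "distr M (\<Pi>\<^sub>M i\<in>{..<n + m}. sample_space d) (\<lambda>\<omega>. \<lambda>i\<in>{..<n + m}. (Z i \<omega>, X i \<omega>))
      = (\<Pi>\<^sub>M i\<in>{..<n + m}. sample_measure)" .
  show ?thesis
    unfolding observed_def[abs_def] observed_space_def
    using distr_indep_set[OF observed_measurable noise_indep_samples] by (simp add: 1 2)
qed

definition "array_observed A x = (\<lambda>i\<in>{..<n}. \<sigma> * x (i, d + 1), \<lambda>i\<in>{..<n + m}. sample d A \<xi> i x)"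

lemma array_observed_measurable:
  "(\<lambda>x. \<lambda>i\<in>{..<n}. \<sigma> * x (i, d + 1)) \<in> PiM ({..<n} \<times> {d + 1}) (\<lambda>_. borel) \<rightarrow>\<^sub>M (\<Pi>\<^sub>M i\<in>{..<n}. borel)"
  "(\<lambda>x. \<lambda>i\<in>{..<n + m}. sample d A \<xi> i x) \<in> PiM ({..<n + m} \<times> {..d}) (\<lambda>_. borel) \<rightarrow>\<^sub>M (\<Pi>\<^sub>M i\<in>{..<n + m}. sample_space d)"
  by (rule measurable_restrict, intro borel_measurable_times borel_measurable_const measurable_component_singleton, simp)
    (rule measurable_restrict, rule measurable_sample, rule measurable_component_singleton, simp)

lemma array_observed_measurable':
  "array_observed A \<in> arr (n + m) (d + 2) \<rightarrow>\<^sub>M observed_space"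
proof -
  have "(\<lambda>x. \<lambda>i\<in>{..<n}. \<sigma> * x (i, d + 1)) \<in> arr (n + m) (d + 2) \<rightarrow>\<^sub>M (\<Pi>\<^sub>M i\<in>{..<n}. borel)"
    by (rule measurable_restrict, intro borel_measurable_times borel_measurable_const measurable_entry) auto
  moreover have "(\<lambda>x. \<lambda>i\<in>{..<n + m}. sample d A \<xi> i x) \<in> arr (n + m) (d + 2) \<rightarrow>\<^sub>M (\<Pi>\<^sub>M i\<in>{..<n + m}. sample_space d)"
    by (rule measurable_restrict, rule measurable_sample, rule measurable_entry) auto
  ultimately show ?thesis
    unfolding array_observed_def[abs_def] observed_space_def by (rule measurable_Pair)
qed

text \<open>The noise uses column d + 1 and sample i uses the leading d + 1 entries of row i. These
  sets of entries are disjoint, so the product form agrees with that of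
  \<open>observed_law\<close>.\<close>

lemma array_observed_law:
  assumes n: "n > 0" and A: "A \<in> carrier_mat d d" "Determinant.det A \<noteq> 0" "A * transpose_mat A = \<Sigma>"
  shows "distr (arr (n + m) (d + 2)) observed_space (array_observed A)
    = noise_law_product \<Otimes>\<^sub>M (\<Pi>\<^sub>M i\<in>{..<n + m}. sample_measure)"
proof -
  let ?N = "n + m" and ?D = "d + 2"
  let ?R = "arr ?N ?D"
  let ?K = "{..<n} \<times> {d + 1}" and ?L = "{..<?N} \<times> {..d}"
  let ?f = "\<lambda>x. \<lambda>i\<in>{..<n}. \<sigma> * x (i, d + 1)" and ?g = "\<lambda>x. \<lambda>i\<in>{..<?N}. sample d A \<xi> i x"
  have N: "?N > 0" "?D > 0" using n by auto
  have ne: "{..<n} \<noteq> {}" "{..<?N} \<noteq> {}" using n by auto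
  have pair: "distr ?R ((\<Pi>\<^sub>M i\<in>{..<n}. borel) \<Otimes>\<^sub>M (\<Pi>\<^sub>M i\<in>{..<?N}. sample_space d)) (\<lambda>x. (?f x, ?g x))
      = distr ?R (\<Pi>\<^sub>M i\<in>{..<n}. borel) ?f \<Otimes>\<^sub>M distr ?R (\<Pi>\<^sub>M i\<in>{..<?N}. sample_space d) ?g"
  proof (rule arr_pair_law[of ?K ?L, OF _ _ _ N])
    show "?f (restrict x ?K) = ?f x" for x by (auto simp: fun_eq_iff)
    show "?g (restrict x ?L) = ?g x" for x by (intro restrict_ext sample_cong) auto
  qed (use array_observed_measurable in auto)
  have coords: "arr.indep_vars ?N ?D (\<lambda>i. PiM (K i) (\<lambda>_. borel)) (\<lambda>i x. restrict (\<lambda>p. x p) (K i)) L"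
    if "\<And>i. i \<in> L \<Longrightarrow> K i \<subseteq> {..<?N} \<times> {..<?D}" "disjoint_family_on K L" for K and L :: "nat set"
    by (rule arr.indep_vars_restrict[OF arr_indep_coordinates[OF N] that])
  have "arr.indep_vars ?N ?D (\<lambda>_. borel) (\<lambda>i x. \<sigma> * restrict (\<lambda>p. x p) {(i, d + 1)} (i, d + 1)) {..<n}"
    by (rule arr.indep_vars_compose2[OF coords[of "{..<n}" "\<lambda>i. {(i, d + 1)}"]])
      (auto simp: disjoint_family_on_def)
  then have "distr ?R (\<Pi>\<^sub>M i\<in>{..<n}. borel) ?f = (\<Pi>\<^sub>M i\<in>{..<n}. distr ?R borel (\<lambda>x. \<sigma> * x (i, d + 1)))"
    by (intro arr.distr_indep_vars[OF ne(1)]) simp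
  also have "\<dots> = noise_law_product"
    unfolding noise_law_product_def
  proof (intro PiM_cong refl)
    fix i assume i: "i \<in> {..<n}"
    have "distr ?R lborel (\<lambda>x. x (i, d + 1)) = distr ?R borel (\<lambda>x. x (i, d + 1))" by (intro distr_cong) auto
    also have "\<dots> = std_normal_distribution" unfolding arr_def by (rule gauss_coordinate) (use i in auto)
    finally have "distributed ?R lborel (\<lambda>x. x (i, d + 1)) (\<lambda>x. ennreal (normal_density 0 1 x))"
      unfolding distributed_def using i measurable_entry[of i ?N "d + 1" ?D] by auto
    from arr.normal_density_affine[OF this, of \<sigma> 0] sigma_pos
    have "distr ?R lborel (\<lambda>x. \<sigma> * x (i, d + 1)) = density lborel (\<lambda>e. ennreal (normal_density 0 \<sigma> e))"
      by (simp add: distributed_def)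
    moreover have "distr ?R lborel (\<lambda>x. \<sigma> * x (i, d + 1)) = distr ?R borel (\<lambda>x. \<sigma> * x (i, d + 1))" by (intro distr_cong) auto
    ultimately show "distr ?R borel (\<lambda>x. \<sigma> * x (i, d + 1)) = density lborel (\<lambda>e. ennreal (normal_density 0 \<sigma> e))" by simp
  qed
  finally have 1: "distr ?R (\<Pi>\<^sub>M i\<in>{..<n}. borel) ?f = noise_law_product" .
  have "arr.indep_vars ?N ?D (\<lambda>_. sample_space d) (\<lambda>i x. sample d A \<xi> i (restrict (\<lambda>p. x p) ({i} \<times> {..d}))) {..<?N}"
  proof (rule arr.indep_vars_compose2[OF coords[of "{..<?N}" "\<lambda>i. {i} \<times> {..d}"]])
    show "sample d A \<xi> i \<in> PiM ({i} \<times> {..d}) (\<lambda>_. borel) \<rightarrow>\<^sub>M sample_space d" for i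
      by (rule measurable_sample) (auto intro: measurable_component_singleton)
  qed (auto simp: disjoint_family_on_def)
  moreover have "sample d A \<xi> i (restrict (\<lambda>p. x p) ({i} \<times> {..d})) = sample d A \<xi> i x" for i x
    by (rule sample_cong) simp
  ultimately have "distr ?R (\<Pi>\<^sub>M i\<in>{..<?N}. sample_space d) ?g = (\<Pi>\<^sub>M i\<in>{..<?N}. distr ?R (sample_space d) (sample d A \<xi> i))"
    by (intro arr.distr_indep_vars[OF ne(2)]) simp
  also have "\<dots> = (\<Pi>\<^sub>M i\<in>{..<?N}. sample_measure)"
  proof (intro PiM_cong refl)
    fix i assume "i \<in> {..<?N}"
    then have i: "i < ?N" by simp
    let ?T = "\<lambda>(g, t). (lin d A g, (\<Sum>j<d. lin d A g j * vec_index \<xi> j) + t)"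
    let ?r = "\<lambda>x :: nat \<times> nat \<Rightarrow> real. (\<lambda>k\<in>{..<d}. x (i, k), x (i, d))"
    have D: "distributed M (leb d \<Otimes>\<^sub>M lborel) (\<lambda>\<omega>. (Z i \<omega>, X i \<omega>)) sample_density"
      using sample_law[OF i] by (simp add: leb_def sample_density_def)
    have pm: "prob_space (density (leb d \<Otimes>\<^sub>M lborel) sample_density)" "sample_density \<in> borel_measurable (leb d \<Otimes>\<^sub>M lborel)"
      using D prob_space_distr[of "\<lambda>\<omega>. (Z i \<omega>, X i \<omega>)" "leb d \<Otimes>\<^sub>M lborel"] by (auto simp: distributed_def)
    have law: "distr (gauss {..<d} \<Otimes>\<^sub>M std_normal_distribution) (leb d \<Otimes>\<^sub>M lborel) ?T = density (leb d \<Otimes>\<^sub>M lborel) sample_density"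
      using linear_sample_law[OF A(1,2,3) coef(2)] pm unfolding sample_density_def by blast
    have sr: "sample d A \<xi> i = ?T \<circ> ?r"
      by (auto simp: fun_eq_iff sample_def lin_def pvec_restrict)
    have S: "sets (leb d \<Otimes>\<^sub>M lborel) = sets (sample_space d)" using sets_sample_space by (simp add: leb_def)
    have rm: "?r \<in> ?R \<rightarrow>\<^sub>M gauss {..<d} \<Otimes>\<^sub>M std_normal_distribution"
    proof -
      have "(\<lambda>x. \<lambda>k\<in>{..<d}. x (i, k)) \<in> ?R \<rightarrow>\<^sub>M PiM {..<d} (\<lambda>_. borel)"
        by (rule measurable_restrict, rule measurable_entry) (use i in auto)
      then have 1: "(\<lambda>x. \<lambda>k\<in>{..<d}. x (i, k)) \<in> ?R \<rightarrow>\<^sub>M gauss {..<d}"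
        using measurable_cong_sets[OF refl sets_gauss] by blast
      have 2: "(\<lambda>x. x (i, d)) \<in> ?R \<rightarrow>\<^sub>M std_normal_distribution"
        using measurable_entry[OF i, of d ?D] by simp
      show ?thesis by (rule measurable_Pair[OF 1 2])
    qed
    have Tm: "?T \<in> gauss {..<d} \<Otimes>\<^sub>M std_normal_distribution \<rightarrow>\<^sub>M sample_space d"
    proof -
      have 1: "(\<lambda>p. lin d A (fst p)) \<in> gauss {..<d} \<Otimes>\<^sub>M std_normal_distribution \<rightarrow>\<^sub>M PiM {..<d} (\<lambda>_. borel)"
        by (rule measurable_compose[OF measurable_fst]) measurable
      have 3: "(\<lambda>z. \<Sum>j<d. z j * vec_index \<xi> j) \<in> borel_measurable (PiM {..<d} (\<lambda>_. borel))" by measurable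
      have 2: "(\<lambda>p. (\<Sum>j<d. lin d A (fst p) j * vec_index \<xi> j) + snd p) \<in> borel_measurable (gauss {..<d} \<Otimes>\<^sub>M std_normal_distribution)"
        using measurable_compose[OF 1 3] by measurable
      show ?thesis using measurable_Pair[OF 1 2] by (simp add: split_beta')
    qed
    have "distr ?R (sample_space d) (sample d A \<xi> i) = distr (distr ?R (gauss {..<d} \<Otimes>\<^sub>M std_normal_distribution) ?r) (sample_space d) ?T"
      unfolding sr by (rule distr_distr[OF Tm rm, symmetric])
    also have "\<dots> = distr (gauss {..<d} \<Otimes>\<^sub>M std_normal_distribution) (sample_space d) ?T"
      by (simp only: distr_arr_row[OF i])
    also have "\<dots> = distr (distr (gauss {..<d} \<Otimes>\<^sub>M std_normal_distribution) (leb d \<Otimes>\<^sub>M lborel) ?T) (sample_space d) (\<lambda>p. p)"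
      using Tm S by (subst distr_distr) (auto simp: comp_def measurable_ident_sets cong: measurable_cong_sets)
    finally show "distr ?R (sample_space d) (sample d A \<xi> i) = sample_measure"
      unfolding law sample_measure_def .
  qed
  finally have 2: "distr ?R (\<Pi>\<^sub>M i\<in>{..<?N}. sample_space d) ?g = (\<Pi>\<^sub>M i\<in>{..<?N}. sample_measure)" .
  show ?thesis
    unfolding array_observed_def[abs_def] observed_space_def pair 1 2 ..
qed

text \<open>The rejection region in the space of observations has the same probability under both
  laws; \<open>R\<close> is its preimage in the array. Outside the null set of singular designs,
  whitening and P Z = 0 bring membership in \<open>R\<close> into the form of
  \<open>crit\<close>.\<close>

lemma power_on_array:
  assumes n: "n > 0" and d: "d > 0" "d < n + m" and \<alpha>: "0 < \<alpha>" "\<alpha> < 1"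
  defines "\<tau> \<equiv> sqrt (quad_form \<Sigma> (\<theta> + \<beta> \<cdot>\<^sub>v \<xi>))"
  shows "\<exists>R. R \<in> sets (arr (n + m) (d + 2)) \<and> ccrt_power M n m d X Z Y \<alpha> = measure (arr (n + m) (d + 2)) R \<and>
    (\<forall>x \<in> space (arr (n + m) (d + 2)). Determinant.det (gram (n + m) 0 d x) \<noteq> 0 \<longrightarrow>
      (x \<in> R \<longleftrightarrow> 1 - \<alpha> \<le> measure (gauss {..<n + m}) {v \<in> space (gauss {..<n + m}).
        sqrt (bil (n + m) (res (n + m) 0 d x) (column d x) (column d x)) *
          bil (n + m) (res (n + m) 0 d x) (\<lambda>i. \<beta> * truncate n (column d x) i +
            (\<tau> * truncate n (column 0 x) i + \<sigma> * truncate n (column (d + 1) x) i)) v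
        \<le> bil (n + m) (res (n + m) 0 d x) (\<lambda>i. \<beta> * truncate n (column d x) i +
            (\<tau> * truncate n (column 0 x) i + \<sigma> * truncate n (column (d + 1) x) i)) (column d x) *
          sqrt (bil (n + m) (res (n + m) 0 d x) v v)}))"
proof -
  let ?N = "n + m"
  \<comment> \<open>Substituting X = Z \<xi> + \<eta> into the response collects the coefficient
    \<theta> + \<beta> \<xi> on Z and leaves \<beta> \<eta> plus noise.\<close>
  define \<theta>' where "\<theta>' = \<theta> + \<beta> \<cdot>\<^sub>v \<xi>"
  have \<theta>': "\<theta>' \<in> carrier_vec d" using coef by (simp add: \<theta>'_def)
  obtain A where A: "A \<in> carrier_mat d d" "A * transpose_mat A = \<Sigma>" "Determinant.det A \<noteq> 0"
    "transpose_mat A *\<^sub>v \<theta>' = Matrix.vec d (\<lambda>i. if i = 0 then sqrt (quad_form \<Sigma> \<theta>') else 0)"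
    using aligned_square_root[OF cov \<theta>' d(1)] by blast
  define rej where "rej = (\<lambda>p :: (nat \<Rightarrow> real) \<times> (nat \<Rightarrow> (nat \<Rightarrow> real) \<times> real).
    ccrt_rejects \<alpha> (Matrix.mat ?N d (\<lambda>(i, j). fst (snd p i) j)) (Matrix.vec ?N (\<lambda>i. snd (snd p i)))
      (Matrix.vec n (\<lambda>i. snd (snd p i) * \<beta> + (\<Sum>j<d. fst (snd p i) j * vec_index \<theta> j) + fst p i)))"
  define S where "S = {p \<in> space observed_space. rej p}"
  have comp: "(\<lambda>p. snd p i) \<in> observed_space \<rightarrow>\<^sub>M sample_space d" if "i < ?N" for i
    unfolding observed_space_def using that
    by (intro measurable_compose[OF measurable_snd] measurable_component_singleton) simp
  have mZ: "(\<lambda>p. fst (snd p i) j) \<in> borel_measurable observed_space" if "i < ?N" "j < d" for i j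
    using measurable_compose[OF measurable_compose[OF comp[OF that(1)] measurable_fst] measurable_component_singleton[of j]] that by simp
  have mX: "(\<lambda>p. snd (snd p i)) \<in> borel_measurable observed_space" if "i < ?N" for i
    by (rule measurable_compose[OF comp[OF that] measurable_snd])
  have me: "(\<lambda>p. fst p i) \<in> borel_measurable observed_space" if "i < n" for i
    unfolding observed_space_def using that
    by (intro measurable_compose[OF measurable_fst] measurable_component_singleton) simp
  have S: "S \<in> sets observed_space"
    unfolding S_def rej_def
    by (rule measurable_ccrt_rejects)
      (use n d \<alpha> in \<open>auto intro!: mZ mX me borel_measurable_add borel_measurable_times borel_measurable_sum\<close>)
  define R where "R = array_observed A -` S \<inter> space (arr ?N (d + 2))"
  have R: "R \<in> sets (arr ?N (d + 2))"
    unfolding R_def by (rule measurable_sets[OF array_observed_measurable' S])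
  have obs: "rej (observed \<omega>) \<longleftrightarrow> ccrt_rejects \<alpha> (Matrix.mat ?N d (\<lambda>(i, j). Z i \<omega> j))
      (Matrix.vec ?N (\<lambda>i. X i \<omega>)) (Matrix.vec n (\<lambda>i. Y i \<omega>))" if \<omega>: "\<omega> \<in> space M" for \<omega>
  proof -
    have "Matrix.mat ?N d (\<lambda>(i, j). fst (snd (observed \<omega>) i) j) = Matrix.mat ?N d (\<lambda>(i, j). Z i \<omega> j)"
      by (rule eq_matI) (auto simp: observed_def)
    moreover have "Matrix.vec ?N (\<lambda>i. snd (snd (observed \<omega>) i)) = Matrix.vec ?N (\<lambda>i. X i \<omega>)"
      by (rule eq_vecI) (auto simp: observed_def)
    moreover have "Matrix.vec n (\<lambda>i. snd (snd (observed \<omega>) i) * \<beta> + (\<Sum>j<d. fst (snd (observed \<omega>) i) j * vec_index \<theta> j) + fst (observed \<omega>) i)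
        = Matrix.vec n (\<lambda>i. Y i \<omega>)"
      using \<omega> coef(1) by (intro eq_vecI) (auto simp: observed_def response scalar_prod_def lessThan_atLeast0)
    ultimately show ?thesis unfolding rej_def by simp
  qed
  have "ccrt_power M n m d X Z Y \<alpha> = measure M (observed -` S \<inter> space M)"
    unfolding ccrt_power_def S_def using obs measurable_space[OF observed_measurable']
    by (intro arg_cong2[where f = measure]) auto
  also have "\<dots> = measure (distr M observed_space observed) S"
    by (rule measure_distr[OF observed_measurable' S, symmetric])
  also have "\<dots> = measure (distr (arr ?N (d + 2)) observed_space (array_observed A)) S"
    by (simp only: observed_law[OF n] array_observed_law[OF n A(1) A(3) A(2)])
  also have "\<dots> = measure (arr ?N (d + 2)) R"
    unfolding R_def by (rule measure_distr[OF array_observed_measurable' S])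
  finally have power: "ccrt_power M n m d X Z Y \<alpha> = measure (arr ?N (d + 2)) R" .
  have crit: "x \<in> R \<longleftrightarrow> 1 - \<alpha> \<le> measure (gauss {..<?N}) {v \<in> space (gauss {..<?N}).
        sqrt (bil ?N (res ?N 0 d x) (column d x) (column d x)) *
          bil ?N (res ?N 0 d x) (\<lambda>i. \<beta> * truncate n (column d x) i +
            (\<tau> * truncate n (column 0 x) i + \<sigma> * truncate n (column (d + 1) x) i)) v
        \<le> bil ?N (res ?N 0 d x) (\<lambda>i. \<beta> * truncate n (column d x) i +
            (\<tau> * truncate n (column 0 x) i + \<sigma> * truncate n (column (d + 1) x) i)) (column d x) *
          sqrt (bil ?N (res ?N 0 d x) v v)}"
    if x: "x \<in> space (arr ?N (d + 2))" and det: "Determinant.det (gram ?N 0 d x) \<noteq> 0" for x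
  proof -
    define z where "z = (\<lambda>i. lin d A (\<lambda>k. x (i, k)))"
    define Zm where "Zm = Matrix.mat ?N d (\<lambda>(i, j). z i j)"
    define X' where "X' = (\<lambda>i. (\<Sum>j<d. z i j * vec_index \<xi> j) + x (i, d))"
    define Y' where "Y' = (\<lambda>i. X' i * \<beta> + (\<Sum>j<d. z i j * vec_index \<theta> j) + \<sigma> * x (i, d + 1))"
    let ?P = "res ?N 0 d x"
    have Zm: "Zm \<in> carrier_mat ?N d" by (simp add: Zm_def)
    have zj: "z i j = (\<Sum>k<d. A $$ (j, k) * x (i, k))" if "j < d" for i j
      using that by (simp add: z_def lin_def pvec_def)
    have ZW: "Zm = blk ?N 0 d x * transpose_mat A"
    proof (rule eq_matI)
      fix i j assume "i < dim_row (blk ?N 0 d x * transpose_mat A)" "j < dim_col (blk ?N 0 d x * transpose_mat A)"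
      then have ij: "i < ?N" "j < d" using A(1) by (auto simp: blk_def)
      show "Zm $$ (i, j) = (blk ?N 0 d x * transpose_mat A) $$ (i, j)"
        using ij A(1) by (simp add: Zm_def zj blk_def scalar_prod_def lessThan_atLeast0 mult.commute)
    qed (use A(1) in \<open>auto simp: Zm_def blk_def\<close>)
    note inv = inv_mat_nonsingular[OF A(1,3)]
    have AA: "transpose_mat A * transpose_mat (inv_mat A) = 1\<^sub>m d"
      using transpose_mult[OF inv(3) A(1)] inv by simp
    \<comment> \<open>The design is the Gaussian block times the invertible A^T, so both have the
      same residual projection.\<close>
    note change = resid_mat_basis_change[OF blk_carrier _ _ AA, of ?N 0 x, folded ZW]
    have detZ: "Determinant.det (transpose_mat Zm * Zm) \<noteq> 0" and res: "resid_mat Zm = ?P"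
      using change A(1) inv(3) det unfolding gram_eq res_def by auto
    have P: "orth_proj ?N ?P" by (rule res_proj)
    have "(\<Sum>i<?N. resid_mat Zm $$ (i, i)) = real ?N - real d" by (rule resid_mat_diag_sum[OF Zm detZ])
    then have "(\<Sum>i<?N. resid_mat Zm $$ (i, i)) \<noteq> 0" using d by simp
    then have P0: "\<exists>i<?N. resid_mat Zm $$ (i, i) \<noteq> 0" by (metis (no_types, lifting) lessThan_iff sum.neutral)
    have PZ: "pvec ?N ?P X' i = pvec ?N ?P (column d x) i" if i: "i < ?N" for i
    proof -
      have "pvec ?N ?P (\<lambda>i. \<Sum>j<d. z i j * vec_index \<xi> j) i = (\<Sum>l<?N. \<Sum>j<d. ?P $$ (i, l) * z l j * vec_index \<xi> j)"
        by (simp add: pvec_def sum_distrib_left mult.assoc)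
      also have "\<dots> = (\<Sum>j<d. (\<Sum>l<?N. ?P $$ (i, l) * z l j) * vec_index \<xi> j)"
        by (subst sum.swap) (simp add: sum_distrib_right)
      also have "\<dots> = (\<Sum>j<d. (?P * Zm) $$ (i, j) * vec_index \<xi> j)"
        using i orth_proj_carrier[OF P] by (intro sum.cong refl) (simp add: Zm_def scalar_prod_def lessThan_atLeast0)
      also have "\<dots> = 0" using resid_mat_mult[OF Zm detZ] i by (simp add: res)
      finally show ?thesis
        unfolding X'_def pvec_add by (simp add: column_def[abs_def])
    qed
    have bX: "bil ?N ?P f X' = bil ?N ?P f (column d x)" for f
      unfolding bil_eq_pvec by (intro sum.cong refl) (simp add: PZ)
    have bX': "bil ?N ?P X' f = bil ?N ?P (column d x) f" for f
      by (metis bX bil_sym[OF P])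
    have y: "(if i < n then Y' i else 0) = \<beta> * truncate n (column d x) i +
            (\<tau> * truncate n (column 0 x) i + \<sigma> * truncate n (column (d + 1) x) i)" for i
    proof -
      have "(\<Sum>j<d. z i j * vec_index \<theta>' j) = (\<Sum>j<d. \<Sum>k<d. A $$ (j, k) * x (i, k) * vec_index \<theta>' j)"
        by (intro sum.cong refl) (simp add: zj sum_distrib_right)
      also have "\<dots> = (\<Sum>k<d. x (i, k) * (\<Sum>j<d. A $$ (j, k) * vec_index \<theta>' j))"
        by (subst sum.swap) (simp add: sum_distrib_left mult_ac)
      also have "\<dots> = (\<Sum>k<d. x (i, k) * vec_index (transpose_mat A *\<^sub>v \<theta>') k)"
        using A(1) \<theta>' by (intro sum.cong refl) (simp add: scalar_prod_def lessThan_atLeast0)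
      also have "\<dots> = \<tau> * x (i, 0)"
        unfolding A(4) \<tau>_def \<theta>'_def[symmetric] using d
        by (simp add: if_distrib[of "\<lambda>c. _ * c"] cong: if_cong)
      finally have 1: "(\<Sum>j<d. z i j * vec_index \<theta>' j) = \<tau> * x (i, 0)" .
      have 2: "(\<Sum>j<d. z i j * vec_index \<theta>' j) = (\<Sum>j<d. z i j * vec_index \<theta> j) + \<beta> * (\<Sum>j<d. z i j * vec_index \<xi> j)"
        unfolding sum_distrib_left sum.distrib[symmetric]
        using coef by (intro sum.cong refl) (simp add: \<theta>'_def algebra_simps)
      have "Y' i = \<beta> * x (i, d) + (\<tau> * x (i, 0) + \<sigma> * x (i, d + 1))"
        unfolding Y'_def X'_def using 1 2 by (simp add: algebra_simps)
      then show ?thesis by (simp add: truncate_def column_def)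
    qed
    have mem: "array_observed A x \<in> space observed_space"
      by (rule measurable_space[OF array_observed_measurable' x])
    have "rej (array_observed A x) \<longleftrightarrow> ccrt_rejects \<alpha> Zm (Matrix.vec ?N X') (Matrix.vec n Y')"
    proof -
      have "Matrix.mat ?N d (\<lambda>(i, j). fst (snd (array_observed A x) i) j) = Zm"
        unfolding Zm_def by (rule eq_matI) (auto simp: array_observed_def sample_def z_def)
      moreover have "Matrix.vec ?N (\<lambda>i. snd (snd (array_observed A x) i)) = Matrix.vec ?N X'"
        by (rule eq_vecI) (auto simp: array_observed_def sample_def z_def X'_def)
      moreover have "Matrix.vec n (\<lambda>i. snd (snd (array_observed A x) i) * \<beta> + (\<Sum>j<d. fst (snd (array_observed A x) i) j * vec_index \<theta> j) + fst (array_observed A x) i)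
          = Matrix.vec n Y'"
        by (rule eq_vecI) (auto simp: array_observed_def sample_def z_def X'_def Y'_def)
      ultimately show ?thesis unfolding rej_def by simp
    qed
    moreover have "x \<in> R \<longleftrightarrow> rej (array_observed A x)" using x mem by (simp add: R_def S_def)
    ultimately show ?thesis
      unfolding ccrt_rejects_iff[OF Zm P0 n le_add1 \<alpha>] res bX bX' y by simp
  qed
  show ?thesis using R power crit by blast
qed

end

section \<open>The limiting power\<close>

text \<open>The cross term is controlled by a weighted arithmetic-geometric mean inequality; the
  weight \<open>s\<close> balances it between the two quadratic forms.\<close>

lemma quad_form_perturbation:
  assumes S: "pos_def_mat d S" and t: "t \<in> carrier_vec d" and x: "x \<in> carrier_vec d" and s: "s > 0"
  shows "\<bar>quad_form S (t + b \<cdot>\<^sub>v x) - quad_form S t\<bar> \<le> s * quad_form S t + b\<^sup>2 / s * quad_form S x + b\<^sup>2 * quad_form S x"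
    and "quad_form S x \<ge> 0"
proof -
  have Sc: "S \<in> carrier_mat d d" and sym: "\<And>i j. i < d \<Longrightarrow> j < d \<Longrightarrow> S $$ (i, j) = S $$ (j, i)"
    and pos: "\<And>v. v \<in> carrier_vec d \<Longrightarrow> v \<noteq> 0\<^sub>v d \<Longrightarrow> quad_form S v > 0"
    using S unfolding pos_def_mat_def by (auto, metis carrier_matD index_transpose_mat(1))
  have nn: "quad_form S v \<ge> 0" if "v \<in> carrier_vec d" for v
    using pos[OF that] by (cases "v = 0\<^sub>v d") (auto simp: quad_form_sum[OF Sc] less_imp_le)
  define B where "B = (\<Sum>i<d. \<Sum>j<d. S $$ (i, j) * vec_index t i * vec_index x j)"
  have B': "(\<Sum>i<d. \<Sum>j<d. S $$ (i, j) * vec_index x i * vec_index t j) = B"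
    unfolding B_def by (subst sum.swap) (intro sum.cong refl, simp add: sym mult_ac)
  have expand: "quad_form S (p \<cdot>\<^sub>v t + q \<cdot>\<^sub>v x) = p\<^sup>2 * quad_form S t + 2 * (p * q * B) + q\<^sup>2 * quad_form S x" for p q
  proof -
    have c: "p \<cdot>\<^sub>v t + q \<cdot>\<^sub>v x \<in> carrier_vec d" using t x by simp
    have "quad_form S (p \<cdot>\<^sub>v t + q \<cdot>\<^sub>v x) = (\<Sum>i<d. \<Sum>j<d. S $$ (i, j) * (p * vec_index t i + q * vec_index x i) * (p * vec_index t j + q * vec_index x j))"
      unfolding quad_form_sum[OF Sc c] using t x by (intro sum.cong refl) simp
    also have "\<dots> = (\<Sum>i<d. \<Sum>j<d. p\<^sup>2 * (S $$ (i, j) * vec_index t i * vec_index t j) + p * q * (S $$ (i, j) * vec_index t i * vec_index x j)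
       + p * q * (S $$ (i, j) * vec_index x i * vec_index t j) + q\<^sup>2 * (S $$ (i, j) * vec_index x i * vec_index x j))"
      by (intro sum.cong refl) (simp add: power2_eq_square algebra_simps)
    also have "\<dots> = p\<^sup>2 * quad_form S t + p * q * B + p * q * B + q\<^sup>2 * quad_form S x"
      unfolding quad_form_sum[OF Sc t] quad_form_sum[OF Sc x] sum.distrib sum_distrib_left[symmetric] B' B_def ..
    finally show ?thesis by simp
  qed
  \<comment> \<open>\<open>r\<close> takes the values 1 and -1, which bounds the cross term from
    both sides.\<close>
  have "0 \<le> quad_form S (sqrt s \<cdot>\<^sub>v t + (r * b / sqrt s) \<cdot>\<^sub>v x)" for r using t x by (intro nn) simp
  then have *: "0 \<le> s * quad_form S t + 2 * (r * b * B) + r\<^sup>2 * b\<^sup>2 / s * quad_form S x" for r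
    unfolding expand using s by (simp add: power_divide power_mult_distrib)
  have "quad_form S (t + b \<cdot>\<^sub>v x) = quad_form S t + 2 * (b * B) + b\<^sup>2 * quad_form S x"
    using expand[of 1 b] t by simp
  moreover have "0 \<le> b\<^sup>2 * quad_form S x" using nn[OF x] by simp
  moreover have "0 \<le> s * quad_form S t + 2 * (b * B) + b\<^sup>2 / s * quad_form S x" using *[of 1] by simp
  moreover have "0 \<le> s * quad_form S t - 2 * (b * B) + b\<^sup>2 / s * quad_form S x" using *[of "-1"] by simp
  ultimately show "\<bar>quad_form S (t + b \<cdot>\<^sub>v x) - quad_form S t\<bar> \<le> s * quad_form S t + b\<^sup>2 / s * quad_form S x + b\<^sup>2 * quad_form S x"
    unfolding abs_le_iff by (intro conjI) linarith+
  show "quad_form S x \<ge> 0" by (rule nn[OF x])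
qed

text \<open>All three effect sizes have the shape h sqrt(\<rho>) / sqrt(\<sigma>^2 + v^2 f), which
  decreases in f, so only the factors f are compared. On one side 1 - \<kappa>s \<le> 1 \<le> 1 /
  \<rho>.\<close>

lemma effect_size_bounds:
  fixes \<kappa> \<kappa>s h \<sigma> v :: real
  assumes \<kappa>: "\<kappa> > 0" "\<kappa>s > 0" "\<kappa>s \<le> 1" "\<kappa> * \<kappa>s < 1" and h: "h > 0" and \<sigma>: "\<sigma> > 0"
  defines "\<rho> \<equiv> 1 - \<kappa> * \<kappa>s"
  defines "\<mu> \<equiv> h * \<rho> / sqrt (\<rho> * (v\<^sup>2 * (1 - \<kappa>s) + \<sigma>\<^sup>2))"
  shows "h * sqrt \<rho> / sqrt (\<sigma>\<^sup>2 + v\<^sup>2 * (1 / \<rho>)) \<le> \<mu>"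
    and "\<mu> \<le> h * sqrt \<rho> / sqrt (\<sigma>\<^sup>2 + v\<^sup>2 *
      max 0 ((1 - (1 + sqrt (1 / \<kappa>))\<^sup>2 / (1 - sqrt (\<kappa> * \<kappa>s))\<^sup>2 * (\<kappa> * \<kappa>s)) / \<rho>))"
proof -
  have \<rho>: "0 < \<rho>" "\<rho> \<le> 1" using \<kappa> by (auto simp: \<rho>_def)
  have \<mu>: "\<mu> = h * sqrt \<rho> / sqrt (\<sigma>\<^sup>2 + v\<^sup>2 * (1 - \<kappa>s))"
  proof -
    have "h * \<rho> / (sqrt \<rho> * w) = h * (\<rho> / sqrt \<rho>) / w" for w by simp
    then show ?thesis unfolding \<mu>_def real_sqrt_mult using \<rho> by (simp add: add.commute real_div_sqrt)
  qed
  have mono: "h * sqrt \<rho> / sqrt (\<sigma>\<^sup>2 + v\<^sup>2 * b) \<le> h * sqrt \<rho> / sqrt (\<sigma>\<^sup>2 + v\<^sup>2 * a)" if "0 \<le> a" "a \<le> b" for a b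
  proof (rule divide_left_mono)
    have pos: "0 < \<sigma>\<^sup>2 + v\<^sup>2 * a" using that \<sigma> by (intro add_pos_nonneg) auto
    show le: "sqrt (\<sigma>\<^sup>2 + v\<^sup>2 * a) \<le> sqrt (\<sigma>\<^sup>2 + v\<^sup>2 * b)" using that by (simp add: mult_left_mono)
    show "0 \<le> h * sqrt \<rho>" using h \<rho> by simp
    have "0 < sqrt (\<sigma>\<^sup>2 + v\<^sup>2 * a)" using pos by simp
    then show "0 < sqrt (\<sigma>\<^sup>2 + v\<^sup>2 * b) * sqrt (\<sigma>\<^sup>2 + v\<^sup>2 * a)" using le by (intro mult_pos_pos) auto
  qed
  have "1 - \<kappa>s \<le> 1 / \<rho>" using \<rho> \<kappa> by (simp add: pos_le_divide_eq mult_le_one)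
  then show "h * sqrt \<rho> / sqrt (\<sigma>\<^sup>2 + v\<^sup>2 * (1 / \<rho>)) \<le> \<mu>" unfolding \<mu> using \<kappa> by (intro mono) auto
  define r where "r = (1 + sqrt (1 / \<kappa>))\<^sup>2 / (1 - sqrt (\<kappa> * \<kappa>s))\<^sup>2 * (\<kappa> * \<kappa>s)"
  have "sqrt (\<kappa> * \<kappa>s) < 1" "0 \<le> sqrt (\<kappa> * \<kappa>s)" using \<kappa> by auto
  then have den: "0 < (1 - sqrt (\<kappa> * \<kappa>s))\<^sup>2" "(1 - sqrt (\<kappa> * \<kappa>s))\<^sup>2 \<le> 1"
    by (auto simp: power_le_one)
  \<comment> \<open>Dropping the mixed term of the square and a denominator at most 1 gives r \<ge>
    \<kappa> \<kappa>s + \<kappa>s. Hence 1 - r \<le> (1 - \<kappa>s) \<rho>, with slack \<kappa>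
    \<kappa>s^2.\<close>
  have "(1 + 1 / \<kappa>) \<le> (1 + sqrt (1 / \<kappa>))\<^sup>2" using \<kappa> by (simp add: power2_sum)
  also have "\<dots> \<le> (1 + sqrt (1 / \<kappa>))\<^sup>2 / (1 - sqrt (\<kappa> * \<kappa>s))\<^sup>2"
    using den by (simp add: pos_le_divide_eq mult_left_le)
  finally have "(1 + 1 / \<kappa>) * (\<kappa> * \<kappa>s) \<le> r" unfolding r_def using \<kappa> by (intro mult_right_mono) auto
  moreover have "(1 + 1 / \<kappa>) * (\<kappa> * \<kappa>s) = \<kappa> * \<kappa>s + \<kappa>s" using \<kappa> by (simp add: distrib_right)
  moreover have "(1 - \<kappa>s) * \<rho> = 1 - (\<kappa> * \<kappa>s + \<kappa>s) + \<kappa> * \<kappa>s * \<kappa>s" by (simp add: \<rho>_def algebra_simps)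
  moreover have "0 \<le> \<kappa> * \<kappa>s * \<kappa>s" using \<kappa> by simp
  ultimately have "1 - r \<le> (1 - \<kappa>s) * \<rho>" by linarith
  then have "(1 - r) / \<rho> \<le> 1 - \<kappa>s" using \<rho> by (simp add: pos_divide_le_eq)
  then have "max 0 ((1 - r) / \<rho>) \<le> 1 - \<kappa>s" using \<kappa> by simp
  then show "\<mu> \<le> h * sqrt \<rho> / sqrt (\<sigma>\<^sup>2 + v\<^sup>2 *
      max 0 ((1 - (1 + sqrt (1 / \<kappa>))\<^sup>2 / (1 - sqrt (\<kappa> * \<kappa>s))\<^sup>2 * (\<kappa> * \<kappa>s)) / \<rho>))"
    unfolding \<mu> r_def[symmetric] by (intro mono) auto
qed

text \<open>The weight 1 / sqrt n in \<open>quad_form_perturbation\<close> balances the terms: with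
  b = h / sqrt n, both the weight and b^2 divided by it are of order 1 / sqrt n. The limsup
  condition keeps the form at \<open>x n\<close> eventually below a constant.\<close>

lemma perturbed_signal_limit:
  fixes h v :: real
  assumes S: "\<And>n. n > 0 \<Longrightarrow> pos_def_mat (d n) (S n)"
    and t: "\<And>n. n > 0 \<Longrightarrow> t n \<in> carrier_vec (d n)" and x: "\<And>n. n > 0 \<Longrightarrow> x n \<in> carrier_vec (d n)"
    and t_lim: "(\<lambda>n. quad_form (S n) (t n)) \<longlonglongrightarrow> v\<^sup>2"
    and x_bound: "limsup (\<lambda>n. ereal (quad_form (S n) (x n))) < \<infinity>"
  shows "(\<lambda>n. sqrt (quad_form (S n) (t n + (h / sqrt (real n)) \<cdot>\<^sub>v x n))) \<longlonglongrightarrow> \<bar>v\<bar>"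
proof -
  let ?q = "\<lambda>n w. quad_form (S n) w" and ?b = "\<lambda>n. h / sqrt (real n)"
  obtain C where "limsup (\<lambda>n. ereal (?q n (x n))) < ereal C" using ereal_dense2[OF x_bound] by auto
  then have C: "\<forall>\<^sub>F n in sequentially. ?q n (x n) < C" using Limsup_lessD by fastforce
  have r: "(\<lambda>n. 1 / sqrt (real n)) \<longlonglongrightarrow> 0"
    using tendsto_real_sqrt[OF lim_1_over_n] by (simp add: real_sqrt_divide)
  let ?g = "\<lambda>n. 1 / sqrt (real n) * ?q n (t n) + h\<^sup>2 * (1 / sqrt (real n)) * C + h\<^sup>2 * (1 / real n) * C"
  have "?g \<longlonglongrightarrow> 0 * v\<^sup>2 + h\<^sup>2 * 0 * C + h\<^sup>2 * 0 * C"
    by (intro tendsto_intros r t_lim lim_1_over_n)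
  then have g: "?g \<longlonglongrightarrow> 0" by simp
  have "\<forall>\<^sub>F n in sequentially. norm (?q n (t n + ?b n \<cdot>\<^sub>v x n) - ?q n (t n)) \<le> ?g n"
    using C eventually_gt_at_top[of 0]
  proof eventually_elim
    case (elim n)
    have n: "real n > 0" using elim by simp
    have e: "(?b n)\<^sup>2 = h\<^sup>2 * (1 / real n)" using n by (simp add: power_divide)
    have e': "(?b n)\<^sup>2 / (1 / sqrt (real n)) = h\<^sup>2 * (1 / sqrt (real n))"
    proof -
      have "1 / real n / (1 / sqrt (real n)) = 1 / sqrt (real n)"
        using sqrt_divide_self_eq[of "real n"] by (simp add: inverse_eq_divide)
      then show ?thesis unfolding e times_divide_eq_right[of "h\<^sup>2" "1 / real n" "1 / sqrt (real n)", symmetric] by (rule arg_cong)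
    qed
    have "\<bar>?q n (t n + ?b n \<cdot>\<^sub>v x n) - ?q n (t n)\<bar>
        \<le> 1 / sqrt (real n) * ?q n (t n) + (?b n)\<^sup>2 / (1 / sqrt (real n)) * ?q n (x n) + (?b n)\<^sup>2 * ?q n (x n)"
      using elim n by (intro quad_form_perturbation(1)[OF S t x]) auto
    also have "\<dots> \<le> ?g n"
      unfolding e' unfolding e by (intro add_mono mult_left_mono order_refl) (use elim in simp_all)
    finally show ?case by simp
  qed
  then have "(\<lambda>n. ?q n (t n + ?b n \<cdot>\<^sub>v x n) - ?q n (t n)) \<longlonglongrightarrow> 0" by (rule Lim_null_comparison[OF _ g])
  from tendsto_real_sqrt[OF tendsto_add[OF this t_lim]] show ?thesis by simp
qed

theorem theorem4:
  fixes M :: "nat \<Rightarrow> 'a measure"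
    and p m :: "nat \<Rightarrow> nat"
    and \<Sigma> :: "nat \<Rightarrow> real Matrix.mat"
    and \<theta> \<xi> :: "nat \<Rightarrow> real Matrix.vec"
    and X \<epsilon> Y :: "nat \<Rightarrow> nat \<Rightarrow> 'a \<Rightarrow> real"
    and Z :: "nat \<Rightarrow> nat \<Rightarrow> 'a \<Rightarrow> nat \<Rightarrow> real"
    and h \<sigma> \<kappa> \<kappa>s c v\<^sub>Z \<alpha> :: real
  assumes p_pos: "\<And>n. n > 0 \<Longrightarrow> p n \<ge> 1"
    and model: "\<And>n. n > 0 \<Longrightarrow>
      unlabeled_linear_model (M n) n (m n) (p n - 1) (\<Sigma> n) (\<theta> n) (\<xi> n) (h / sqrt (real n)) \<sigma>
        (X n) (Z n) (\<epsilon> n) (Y n)"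
    and h: "h > 0"
    and \<sigma>: "\<sigma> > 0"
    and \<kappa>: "\<kappa> > 0" "(\<lambda>n. real (p n) / real n) \<longlonglongrightarrow> \<kappa>"
    and m: "c > 0" "(\<lambda>n. real (m n) / real (p n)) \<longlonglongrightarrow> c"
    and \<kappa>s: "(\<lambda>n. real n / real (n + m n)) \<longlonglongrightarrow> \<kappa>s" "\<kappa> * \<kappa>s < 1"
    and \<theta>: "(\<lambda>n. quad_form (\<Sigma> n) (\<theta> n)) \<longlonglongrightarrow> v\<^sub>Z\<^sup>2"
    and \<xi>: "limsup (\<lambda>n. ereal (quad_form (\<Sigma> n) (\<xi> n))) < \<infinity>"
    and \<alpha>: "0 < \<alpha>" "\<alpha> < 1"
  shows "liminf (\<lambda>n. ereal (ccrt_power (M n) n (m n) (p n - 1) (X n) (Z n) (Y n) \<alpha>))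
           \<ge> ereal (z_test_power \<alpha>
               (h * sqrt (1 - \<kappa> * \<kappa>s) / sqrt (\<sigma>\<^sup>2 + v\<^sub>Z\<^sup>2 * (1 / (1 - \<kappa> * \<kappa>s)))))
         \<and> limsup (\<lambda>n. ereal (ccrt_power (M n) n (m n) (p n - 1) (X n) (Z n) (Y n) \<alpha>))
           \<le> ereal (z_test_power \<alpha>
               (h * sqrt (1 - \<kappa> * \<kappa>s) /
                sqrt (\<sigma>\<^sup>2 + v\<^sub>Z\<^sup>2 *
                  max 0 ((1 - (1 + sqrt (1 / \<kappa>))\<^sup>2 / (1 - sqrt (\<kappa> * \<kappa>s))\<^sup>2 * (\<kappa> * \<kappa>s)) /
                         (1 - \<kappa> * \<kappa>s)))))"
proof -
  define N where "N = (\<lambda>n. n + m n)"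
  define d where "d = (\<lambda>n. p n - 1)"
  define \<tau> where "\<tau> = (\<lambda>n. sqrt (quad_form (\<Sigma> n) (\<theta> n + (h / sqrt (real n)) \<cdot>\<^sub>v \<xi> n)))"
  define z where "z = z_quantile (1 - \<alpha>)"
  have d_lim: "(\<lambda>n. real (d n) / real n) \<longlonglongrightarrow> \<kappa>"
  proof (rule Lim_transform_eventually)
    show "(\<lambda>n. real (p n) / real n - 1 / real n) \<longlonglongrightarrow> \<kappa>"
      using tendsto_diff[OF \<kappa>(2) lim_1_over_n] by simp
    show "\<forall>\<^sub>F n in sequentially. real (p n) / real n - 1 / real n = real (d n) / real n"
      using eventually_gt_at_top[of 0]
    proof eventually_elim
      case (elim n)
      then show ?case using p_pos[of n] by (simp add: d_def of_nat_diff diff_divide_distrib)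
    qed
  qed
  have p_ev: "\<forall>\<^sub>F n in sequentially. p n > 0"
    using eventually_gt_at_top[of 0] by eventually_elim (use p_pos in \<open>auto simp: Suc_le_eq\<close>)
  have pos: "1 + c * \<kappa> > 0" using \<kappa>(1) m(1) by (simp add: add_pos_pos)
  \<comment> \<open>The limits of m / p and p / n force \<kappa>s = 1 / (1 + c \<kappa>), and from
    this its positivity is read off.\<close>
  have "(\<lambda>n. 1 / (1 + real (m n) / real (p n) * (real (p n) / real n))) \<longlonglongrightarrow> 1 / (1 + c * \<kappa>)"
    using pos by (intro tendsto_intros m(2) \<kappa>(2)) simp
  moreover have "\<forall>\<^sub>F n in sequentially. 1 / (1 + real (m n) / real (p n) * (real (p n) / real n)) = real n / real (n + m n)"
    using p_ev eventually_gt_at_top[of 0] by eventually_elim (simp add: field_simps)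
  ultimately have "(\<lambda>n. real n / real (n + m n)) \<longlonglongrightarrow> 1 / (1 + c * \<kappa>)" by (rule Lim_transform_eventually)
  then have "\<kappa>s = 1 / (1 + c * \<kappa>)" by (rule LIMSEQ_unique[OF \<kappa>s(1)])
  then have \<kappa>s_pos: "\<kappa>s > 0" using pos by simp
  have \<tau>_lim: "\<tau> \<longlonglongrightarrow> \<bar>v\<^sub>Z\<bar>"
  proof -
    have "pos_def_mat (d n) (\<Sigma> n) \<and> \<theta> n \<in> carrier_vec (d n) \<and> \<xi> n \<in> carrier_vec (d n)" if "n > 0" for n
    proof -
      interpret unlabeled_linear_model "M n" n "m n" "p n - 1" "\<Sigma> n" "\<theta> n" "\<xi> n" "h / sqrt (real n)" \<sigma>
        "X n" "Z n" "\<epsilon> n" "Y n" by (rule model[OF that])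
      show ?thesis using cov coef by (simp add: d_def)
    qed
    then show ?thesis
      using perturbed_signal_limit[OF _ _ _ \<theta> \<xi>, where d = d and h = h] unfolding \<tau>_def by simp
  qed
  \<comment> \<open>\<open>\<tau>\<close> is a nonnegative root, so its limit is the absolute value
    of \<open>v\<^sub>Z\<close>; in \<open>s2\<close> only the square appears.\<close>
  interpret T: array_test N d \<kappa> \<kappa>s \<tau> "\<lambda>n. h / sqrt (real n)" "\<bar>v\<^sub>Z\<bar>" \<sigma> h "1 - \<alpha>" z
  proof unfold_locales
    show "n \<le> N n" for n by (simp add: N_def)
    show "(\<lambda>n. real n / real (N n)) \<longlonglongrightarrow> \<kappa>s" unfolding N_def by (rule \<kappa>s(1))
    show "Phi z = 1 - \<alpha>" unfolding z_def using \<alpha> by (intro Phi_z_quantile) auto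
  qed (rule d_lim \<kappa>s \<kappa> \<kappa>s_pos \<tau>_lim \<sigma> refl)+
  let ?pow = "\<lambda>n. ccrt_power (M n) n (m n) (p n - 1) (X n) (Z n) (Y n) \<alpha>"
  define good where "good = (\<lambda>n R. R \<in> sets (arr (N n) (d n + 2)) \<and> ?pow n = measure (arr (N n) (d n + 2)) R \<and>
      (\<forall>x \<in> space (arr (N n) (d n + 2)). Determinant.det (gram (N n) 0 (d n) x) \<noteq> 0 \<longrightarrow> (x \<in> R \<longleftrightarrow> T.crit n x)))"
  \<comment> \<open>The guard makes the statement total, so that a rejection region can be chosen
    for every \<open>n\<close>; the guard holds eventually.\<close>
  have "\<forall>n. \<exists>R. n > 0 \<and> d n > 0 \<and> d n < N n \<longrightarrow> good n R"
  proof
    fix n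
    show "\<exists>R. n > 0 \<and> d n > 0 \<and> d n < N n \<longrightarrow> good n R"
    proof (cases "n > 0 \<and> d n > 0 \<and> d n < N n")
      case True
      interpret unlabeled_linear_model "M n" n "m n" "p n - 1" "\<Sigma> n" "\<theta> n" "\<xi> n" "h / sqrt (real n)" \<sigma>
        "X n" "Z n" "\<epsilon> n" "Y n" by (rule model) (use True in blast)
      have "\<exists>R. good n R"
        unfolding good_def T.crit_def T.y_def T.u_def T.P_def T.\<eta>_def unfolding \<tau>_def N_def d_def
        by (rule power_on_array[OF _ _ _ \<alpha>]) (use True in \<open>simp_all add: d_def N_def\<close>)
      then show ?thesis by blast
    qed blast
  qed
  from choice[OF this] obtain R where R: "\<And>n. n > 0 \<Longrightarrow> d n > 0 \<Longrightarrow> d n < N n \<Longrightarrow> good n (R n)" by blast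
  have ev: "\<forall>\<^sub>F n in sequentially. n > 0 \<and> d n > 0 \<and> d n < N n"
    using eventually_gt_at_top[of 0] T.d_pos T.d_less_N by eventually_elim blast
  have "\<forall>\<^sub>F n in sequentially. AE x in arr (N n) (d n + 2). x \<in> R n \<longleftrightarrow> T.crit n x"
    using ev
  proof eventually_elim
    case (elim n)
    have "AE x in arr (N n) (d n + 2). Determinant.det (gram (N n) 0 (d n) x) \<noteq> 0"
      using elim by (intro AE_gram_det) auto
    then show ?case using AE_space by eventually_elim (use R[unfolded good_def] elim in blast)
  qed
  then have crit: "\<forall>\<^sub>F zz in T.F. snd zz \<in> R (fst zz) \<longleftrightarrow> T.crit (fst zz) (snd zz)"
    by (intro eventually_pfilter_AE[OF T.A_prob]) simp
  have sets: "\<forall>\<^sub>F n in sequentially. R n \<in> sets (arr (N n) (d n + 2))"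
    using ev by eventually_elim (use R[unfolded good_def] in blast)
  have "\<forall>\<^sub>F n in sequentially. measure (arr (N n) (d n + 2)) (R n) = ?pow n"
    using ev by eventually_elim (use R[unfolded good_def] in simp)
  then have "?pow \<longlonglongrightarrow> Phi (T.\<mu> - z)"
    by (rule Lim_transform_eventually[OF T.power_limit[OF sets crit]])
  then have "(\<lambda>n. ereal (?pow n)) \<longlonglongrightarrow> ereal (Phi (T.\<mu> - z))" by simp
  \<comment> \<open>The power converges, so both bounds concern one and the same number.\<close>
  then have lims: "liminf (\<lambda>n. ereal (?pow n)) = ereal (Phi (T.\<mu> - z))"
    "limsup (\<lambda>n. ereal (?pow n)) = ereal (Phi (T.\<mu> - z))"
    by (auto intro: lim_imp_Liminf lim_imp_Limsup)
  have \<mu>: "T.\<mu> = h * (1 - \<kappa> * \<kappa>s) / sqrt ((1 - \<kappa> * \<kappa>s) * (v\<^sub>Z\<^sup>2 * (1 - \<kappa>s) + \<sigma>\<^sup>2))"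
    unfolding T.\<mu>_def T.s2_def T.\<rho>_def by simp
  show ?thesis
    unfolding lims z_test_power_def z_def[symmetric] \<mu>
    using effect_size_bounds[OF \<kappa>(1) \<kappa>s_pos T.\<kappa>s_le_1 \<kappa>s(2) h \<sigma>, of v\<^sub>Z] by (auto intro!: Phi_mono)
qed

end
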